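(* Let $\ell\ge2$, $D>0$, $\nu\in(0,1)$, $f\in L^2(\Omega)$, and set $$\gamma:=\Big[D^2\Big(1+\tfrac1{D^2(1-\nu)^2}\Big)^2+1\Big]^{-1/2}.$$ The bilinear form $A_h$ satisfies the inf-sup condition: for all $(\underline{\sigma}_h,u_h)\in\underline{\Sigma}_h^\ell\times\mathcal{P}^{\ell-1}(\mathcal{T}_h)$, $$\gamma\,\|(\underline{\sigma}_h,u_h)\|_{\Sigma\times L,h}\lesssim\sup_{(\underline{\tau}_h,v_h)\in(\underline{\Sigma}_h^\ell\times\mathcal{P}^{\ell-1}(\mathcal{T}_h))\setminus\{(0,0)\}}\frac{A_h((\underline{\sigma}_h,u_h),(\underline{\tau}_h,v_h))}{\|(\underline{\tau}_h,v_h)\|_{\Sigma\times L,h}}.$$ As a consequence, there exists a unique $(\underline{\sigma}_h,u_h)\in\underline{\Sigma}_h^\ell\times\mathcal{P}^{\ell-1}(\mathcal{T}_h)$ such that $$a_h(\underline{\sigma}_h,\underline{\tau}_h)+b_h(\underline{\tau}_h,u_h)=0\quad\forall\underline{\tau}_h\in\underline{\Sigma}_h^\ell,\qquad -b_h(\underline{\sigma}_h,v_h)=\int_\Omega f v_h\quad\forall v_h\in\mathcal{P}^{\ell-1}(\mathcal{T}_h)$$ (equivalently, $A_h((\underline{\sigma}_h,u_h),(\underline{\tau}_h,v_h))=\int_\Omega fv_h$ for all $(\underline{\tau}_h,v_h)\in\underline{\Sigma}_h^\ell\times\mathcal{P}^{\ell-1}(\mathcal{T}_h)$), and it satisfies the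 a priori bound $$\|(\underline{\sigma}_h,u_h)\|_{\Sigma\times L,h}\lesssim\gamma^{-1}\|f\|_{L^2(\Omega)}.$$
   Context: **Mesh.** $\Omega\subset\mathbb{R}^2$ is a contractible polygonal domain. $\mathcal{M}_h=(\mathcal{T}_h,\mathcal{E}_h)$ is a polygonal mesh: $\mathcal{T}_h$ is a finite collection of disjoint open contractible polygons $T$ (diameter $h_T$) with $\overline\Omega=\bigcup_T\overline T$ and $h=\max_Th_T$; $\mathcal{E}_h$ is a finite collection of disjoint open segments (edges) partitioning the skeleton ($\bigcup_T\partial T=\bigcup_E\overline E$), each edge $E$ being either contained in $\partial T_1\cap\partial T_2$ for two distinct elements or in $\partial T\cap\partial\Omega$ for one element (hanging nodes are allowed: a straight side of an element may consist of several edges). $\mathcal{E}_T$ is the set of edges contained in $\partial T$, $\mathcal{V}_h$ the set of edge endpoints, $\mathcal{V}_T$ those of the edges in $\mathcal{E}_T$, $\mathcal{V}_E$ the two endpoints of $E$. The mesh has regularity parameter $\rho\in(0,1)$ if there is a conforming triangulation of $\Omega$, with each triangle contained in one element and each triangle edge either contained in a mesh edge or disjoint from all mesh edges, such that each triangle $\mathfrak t$ with diameter $h_{\mathfrak t}$ and inradius $r_{\mathfrak t}$ satisfies $\rho h_{\mathfrak t}\le r_{\mathfrak t}$ and, if $\mathfrak t\subset T$, $\rho h_T\le h_{\mathfrak t}$. $a\lesssim b$ means $a\le Cb$ with $C$ depending only on $\Omega$, the mesh regularity parameter and the fixed degree $\ell$; in particular $C$ is independent of $h$, of $D$ and $\nu$.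 **Geometry.** For each edge $E$, $t_E$ is a fixed unit tangent, $\omega_{EV}=+1$ if $t_E$ points towards $V\in\mathcal{V}_E$ and $-1$ otherwise; $n_E$ is the unit normal with $(t_E,n_E)$ right-handed; $\omega_{TE}\in\{\pm1\}$ is such that $\omega_{TE}n_E$ points out of $T$. $x_V$ is the coordinate vector of $V$. For each $T$, $x_T\in T$ is a fixed point such that some disk centered at $x_T$ is contained in $T$. $\partial_{t_E},\partial_{n_E}$ are derivatives in directions $t_E,n_E$. **Polynomials.** $\mathbb{S}$: symmetric $2\times2$ real matrices; $A:B$ Frobenius product. $\mathbf{div}\,\tau$ is the row-wise divergence, $\mathbf{hess}$ the Hessian, $\mathrm{sym}\,\tau=\frac12(\tau+\tau^\top)$. For $Y$ an element or edge, $\mathcal{P}^m(Y)$ is the space of restrictions to $Y$ of bivariate polynomials of total degree $\le m$ ($\mathcal{P}^{-1}=\{0\}$), $\pi_{\mathcal{P},Y}^m$ its $L^2$-orthogonal projector; $\mathcal{P}^m(T;\mathbb{R}^2)$, $\mathcal{P}^m(T;\mathbb{S})$ vector/matrix versions. $\mathcal{P}^m(\mathcal{T}_h)=\{q\in L^2(\Omega):q_{|T}\in\mathcal{P}^m(T)\ \forall T\in\mathcal{T}_h\}$. With $y^\perp$ the rotation of $y$ by $\pi/2$, $\mathcal{H}^m(T)=\mathbf{hess}\,\mathcal{P}^{m+2}(T)$ and $\mathcal{H}^{\mathrm c,m}(T)=\mathrm{sym}((x-x_T)^\perp\otimes\mathcal{P}^{m-1}(T;\mathbb{R}^2))$; one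 has $\mathcal{P}^m(T;\mathbb{S})=\mathcal{H}^m(T)\oplus\mathcal{H}^{\mathrm c,m}(T)$. **Discrete spaces.** $\underline{\Sigma}_h^\ell$ is the space of $\underline{\tau}_h=((\tau_{\mathcal{H},T},\tau_{\mathcal{H},T}^{\mathrm c})_{T\in\mathcal{T}_h},(\tau_E,D_{\tau,E})_{E\in\mathcal{E}_h},(\tau_V)_{V\in\mathcal{V}_h})$ with $\tau_{\mathcal{H},T}\in\mathcal{H}^{\ell-3}(T)$, $\tau^{\mathrm c}_{\mathcal{H},T}\in\mathcal{H}^{\mathrm c,\ell}(T)$, $\tau_E\in\mathcal{P}^{\ell-2}(E)$, $D_{\tau,E}\in\mathcal{P}^{\ell-1}(E)$, $\tau_V\in\mathbb{S}$. $\underline{\tau}_T\in\underline{\Sigma}_T^\ell$ denotes the restriction of $\underline{\tau}_h$ to $T$ (components attached to $T$, $E\in\mathcal{E}_T$, $V\in\mathcal{V}_T$), $\underline{\tau}_E=(\tau_E,D_{\tau,E},(\tau_V)_{V\in\mathcal{V}_E})$. **Discrete operators.** $\mathsf{DD}_T^{\ell-1}\underline{\tau}_T\in\mathcal{P}^{\ell-1}(T)$: for all $q\in\mathcal{P}^{\ell-1}(T)$, $$\int_T\mathsf{DD}_T^{\ell-1}\underline{\tau}_T\,q=\int_T\tau_{\mathcal{H},T}:\mathbf{hess}\,q-\sum_{E\in\mathcal{E}_T}\omega_{TE}\sum_{V\in\mathcal{V}_E}\omega_{EV}(\tau_Vn_E\cdot t_E)q(x_V)-\sum_{E\in\mathcal{E}_T}\omega_{TE}\Big(\int_E\tau_E\partial_{n_E}q-\int_ED_{\tau,E}q\Big).$$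 $P_{\Sigma,E}^\ell\underline{\tau}_E\in\mathcal{P}^\ell(E)$ is the unique polynomial with $P_{\Sigma,E}^\ell\underline{\tau}_E(x_V)=\tau_Vn_E\cdot n_E$ for $V\in\mathcal{V}_E$ and $\pi_{\mathcal{P},E}^{\ell-2}(P_{\Sigma,E}^\ell\underline{\tau}_E)=\tau_E$. $P_{\Sigma,T}^\ell\underline{\tau}_T\in\mathcal{P}^\ell(T;\mathbb{S})$ is the unique element such that for all $(q,\upsilon)\in\mathcal{P}^{\ell+2}(T)\times\mathcal{H}^{\mathrm c,\ell}(T)$, $$\int_TP_{\Sigma,T}^\ell\underline{\tau}_T:(\mathbf{hess}\,q+\upsilon)=\int_T\mathsf{DD}_T^{\ell-1}\underline{\tau}_T\,q+\sum_{E\in\mathcal{E}_T}\omega_{TE}\sum_{V\in\mathcal{V}_E}\omega_{EV}(\tau_Vn_E\cdot t_E)q(x_V)+\sum_{E\in\mathcal{E}_T}\omega_{TE}\Big(\int_EP_{\Sigma,E}^\ell\underline{\tau}_E\,\partial_{n_E}q-\int_ED_{\tau,E}q\Big)+\int_T\tau_{\mathcal{H},T}^{\mathrm c}:\upsilon.$$ **Norms and forms.** For $\underline{\tau}_T$ put $\delta^1_{E}(\underline{\tau}_T)=P_{\Sigma,T}^\ell\underline{\tau}_Tn_E\cdot n_E-P_{\Sigma,E}^\ell\underline{\tau}_E$, $\delta^2_E(\underline{\tau}_T)=\partial_{t_E}(P_{\Sigma,T}^\ell\underline{\tau}_Tn_E\cdot t_E)+\mathbf{div}P_{\Sigma,T}^\ell\underline{\tau}_T\cdot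 n_E-D_{\tau,E}$, $\delta_V(\underline{\tau}_T)=P_{\Sigma,T}^\ell\underline{\tau}_T(x_V)-\tau_V$, and $$s_{\Sigma,T}(\underline{\upsilon}_T,\underline{\tau}_T)=\sum_{E\in\mathcal{E}_T}\int_E\big(h_T\delta_E^1(\underline{\upsilon}_T)\delta_E^1(\underline{\tau}_T)+h_T^3\delta_E^2(\underline{\upsilon}_T)\delta_E^2(\underline{\tau}_T)\big)+\sum_{V\in\mathcal{V}_T}h_T^2\,\delta_V(\underline{\upsilon}_T):\delta_V(\underline{\tau}_T).$$ $\|\underline{\tau}_h\|_{\Sigma,h}^2=\sum_T\big(\int_T|P_{\Sigma,T}^\ell\underline{\tau}_T|^2+s_{\Sigma,T}(\underline{\tau}_T,\underline{\tau}_T)\big)$ and $\|(\underline{\tau}_h,v_h)\|_{\Sigma\times L,h}=(\|\underline{\tau}_h\|_{\Sigma,h}^2+\|v_h\|_{L^2(\Omega)}^2)^{1/2}$. With $\mathbb{A}\tau=D[(1-\nu)\tau+\nu\,\mathrm{tr}(\tau)I_2]$ for $\tau\in\mathbb{S}$ (invertible), $$a_h(\underline{\sigma}_h,\underline{\tau}_h)=\sum_{T}\Big(\int_T\mathbb{A}^{-1}P_{\Sigma,T}^\ell\underline{\sigma}_T:P_{\Sigma,T}^\ell\underline{\tau}_T+\tfrac1{D(1+\nu)}s_{\Sigma,T}(\underline{\sigma}_T,\underline{\tau}_T)\Big),\quad b_h(\underline{\tau}_h,v_h)=\sum_T\int_T\mathsf{DD}_T^{\ell-1}\underline{\tau}_T\,v_h,$$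 $$A_h((\underline{\sigma}_h,u_h),(\underline{\tau}_h,v_h))=a_h(\underline{\sigma}_h,\underline{\tau}_h)+b_h(\underline{\tau}_h,u_h)-b_h(\underline{\sigma}_h,v_h).$$ *)

theory Defs
  imports "HOL-Analysis.Analysis"
begin

type_synonym point = "real^2"
type_synonym tensor = "real^2^2"
type_synonym region = "point set"

section \<open>Meshes\<close>

text \<open>
  Bounded open sets whose boundary consists of finitely many segments.  Regular openness
  (\<open>interior (closure S) = S\<close>) excludes slits.
\<close>

definition polygonal :: "region \<Rightarrow> bool" where
  "polygonal S \<longleftrightarrow> S \<noteq> {} \<and> open S \<and> bounded S \<and> interior (closure S) = S \<and>
     (\<exists>P. finite P \<and> frontier S = (\<Union>(a, b)\<in>P. closed_segment a b))"

definition rot90 :: "point \<Rightarrow> point" where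
  "rot90 y = vector [- y$2, y$1]"

text \<open>
  A mesh comes with its fixed choices: the unit tangent of each edge, the sign
  \<open>sign_TE T E\<close> for which the signed edge normal points out of \<open>T\<close>, and the point
  \<open>center T\<close> of each element \<open>T\<close>.
\<close>

record mesh =
  elems :: "region set"
  edges :: "region set"
  tangent :: "region \<Rightarrow> point"
  sign_TE :: "region \<Rightarrow> region \<Rightarrow> real"
  center :: "region \<Rightarrow> point"

definition normal :: "mesh \<Rightarrow> region \<Rightarrow> point" where
  "normal M E = rot90 (tangent M E)"

definition edge_verts :: "region \<Rightarrow> point set" where
  "edge_verts E = {a. \<exists>b. a \<noteq> b \<and> E = open_segment a b}"

definition elem_edges :: "mesh \<Rightarrow> region \<Rightarrow> region set" where
  "elem_edges M T = {E \<in> edges M. E \<subseteq> frontier T}"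

definition elem_verts :: "mesh \<Rightarrow> region \<Rightarrow> point set" where
  "elem_verts M T = (\<Union>E\<in>elem_edges M T. edge_verts E)"

definition mesh_verts :: "mesh \<Rightarrow> point set" where
  "mesh_verts M = (\<Union>E\<in>edges M. edge_verts E)"

text \<open>For \<open>V\<close> an endpoint of \<open>E\<close>, the condition below does not depend on \<open>x \<in> E\<close>.\<close>

definition sign_EV :: "mesh \<Rightarrow> region \<Rightarrow> point \<Rightarrow> real" where
  "sign_EV M E V = (if \<exists>x\<in>E. (V - x) \<bullet> tangent M E > 0 then 1 else -1)"

definition points_out :: "point \<Rightarrow> region \<Rightarrow> region \<Rightarrow> bool" where
  "points_out n E T \<longleftrightarrow>
     (\<forall>x\<in>E. \<exists>d>0. \<forall>s. 0 < s \<and> s < d \<longrightarrow> x + s *\<^sub>R n \<notin> T \<and> x - s *\<^sub>R n \<in> T)"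

definition polygonal_mesh :: "region \<Rightarrow> mesh \<Rightarrow> bool" where
  "polygonal_mesh \<Omega> M \<longleftrightarrow>
     finite (elems M) \<and>
     (\<forall>T\<in>elems M. polygonal T \<and> contractible T) \<and>
     pairwise disjnt (elems M) \<and>
     closure \<Omega> = (\<Union>T\<in>elems M. closure T) \<and>
     finite (edges M) \<and>
     (\<forall>E\<in>edges M. \<exists>a b. a \<noteq> b \<and> E = open_segment a b) \<and>
     pairwise disjnt (edges M) \<and>
     (\<Union>T\<in>elems M. frontier T) = (\<Union>E\<in>edges M. closure E) \<and>
     (\<forall>E\<in>edges M.
        (\<exists>T1\<in>elems M. \<exists>T2\<in>elems M. T1 \<noteq> T2 \<and> E \<subseteq> frontier T1 \<inter> frontier T2) \<or>
        (\<exists>T\<in>elems M. E \<subseteq> frontier T \<inter> frontier \<Omega>)) \<and>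
     (\<forall>E\<in>edges M. \<exists>a b. a \<noteq> b \<and> E = open_segment a b \<and>
        tangent M E = (b - a) /\<^sub>R norm (b - a)) \<and>
     (\<forall>T\<in>elems M. \<forall>E\<in>elem_edges M T. sign_TE M T E \<in> {1, -1} \<and>
        points_out (sign_TE M T E *\<^sub>R normal M E) E T) \<and>
     (\<forall>T\<in>elems M. center M T \<in> T \<and> (\<exists>r>0. ball (center M T) r \<subseteq> T))"

definition inradius :: "region \<Rightarrow> real" where
  "inradius t = Sup {r. 0 \<le> r \<and> (\<exists>x. cball x r \<subseteq> t)}"

text \<open>
  The triangles \<open>t\<close> of the library notion \<^const>\<open>triangulation\<close> are closed; open triangles
  are their interiors, open triangle edges the relative interiors of their one-dimensional faces.
\<close>

definition regular_mesh :: "real \<Rightarrow> region \<Rightarrow> mesh \<Rightarrow> bool" where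
  "regular_mesh \<rho> \<Omega> M \<longleftrightarrow> (\<exists>S.
     triangulation S \<and> (\<forall>t\<in>S. 2 simplex t) \<and> \<Union>S = closure \<Omega> \<and>
     (\<forall>t\<in>S. \<exists>T\<in>elems M. interior t \<subseteq> T) \<and>
     (\<forall>t\<in>S. \<forall>F. F face_of t \<and> aff_dim F = 1 \<longrightarrow>
        (\<exists>E\<in>edges M. rel_interior F \<subseteq> E) \<or> (\<forall>E\<in>edges M. rel_interior F \<inter> E = {})) \<and>
     (\<forall>t\<in>S. \<rho> * diameter t \<le> inradius t) \<and>
     (\<forall>t\<in>S. \<forall>T\<in>elems M. interior t \<subseteq> T \<longrightarrow> \<rho> * diameter T \<le> diameter t))"

section \<open>Integration and differentiation\<close>

definition square_integrable :: "region \<Rightarrow> (point \<Rightarrow> real) \<Rightarrow> bool" where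
  "square_integrable S f \<longleftrightarrow>
     f \<in> borel_measurable (lebesgue_on S) \<and> integrable (lebesgue_on S) (\<lambda>x. (f x)\<^sup>2)"

definition L2_norm_on :: "region \<Rightarrow> (point \<Rightarrow> real) \<Rightarrow> real" where
  "L2_norm_on S f = sqrt (LINT x:S|lebesgue. (f x)\<^sup>2)"

text \<open>Integral with respect to arc length; it does not depend on the order of the endpoints.\<close>

definition edge_integral :: "region \<Rightarrow> (point \<Rightarrow> real) \<Rightarrow> real" where
  "edge_integral E g =
     (let (a, b) = (SOME (a, b). a \<noteq> b \<and> E = open_segment a b)
      in dist a b * (LINT s:{0..1}|lborel. g (a + s *\<^sub>R (b - a))))"

definition dir_deriv :: "point \<Rightarrow> (point \<Rightarrow> real) \<Rightarrow> point \<Rightarrow> real" where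
  "dir_deriv d q x = frechet_derivative q (at x) d"

definition hess :: "(point \<Rightarrow> real) \<Rightarrow> point \<Rightarrow> tensor" where
  "hess q x = (\<chi> i j. dir_deriv (axis i 1) (dir_deriv (axis j 1) q) x)"

definition row_div :: "(point \<Rightarrow> tensor) \<Rightarrow> point \<Rightarrow> point" where
  "row_div \<tau> x = (\<chi> i. \<Sum>j\<in>UNIV. dir_deriv (axis j 1) (\<lambda>y. \<tau> y $ i $ j) x)"

section \<open>Polynomial spaces\<close>

text \<open>
  Degrees are integers, so that degree \<open>-1\<close> gives the zero space.  A polynomial on an element
  (a nonempty open set) is identified with its unique polynomial extension to the plane;
  this also provides its values and derivatives on the boundary of the element.
\<close>

definition Poly :: "int \<Rightarrow> (point \<Rightarrow> real) set" where
  "Poly m = {p. \<exists>c :: nat \<Rightarrow> nat \<Rightarrow> real.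
     p = (\<lambda>x. \<Sum>(i, j)\<in>{(i, j). int i + int j \<le> m}. c i j * (x$1) ^ i * (x$2) ^ j)}"

definition Poly_vec :: "int \<Rightarrow> (point \<Rightarrow> point) set" where
  "Poly_vec m = {v. \<forall>i. (\<lambda>x. v x $ i) \<in> Poly m}"

definition sym_tensors :: "tensor set" where
  "sym_tensors = {A. transpose A = A}"

definition Poly_sym :: "int \<Rightarrow> (point \<Rightarrow> tensor) set" where
  "Poly_sym m = {\<tau>. (\<forall>x. \<tau> x \<in> sym_tensors) \<and> (\<forall>i j. (\<lambda>x. \<tau> x $ i $ j) \<in> Poly m)}"

text \<open>
  On an edge, restrictions are taken to the closed edge (and set to zero elsewhere): this makes
  the representative unique and gives access to the values at the endpoints.
\<close>

definition Poly_edge :: "int \<Rightarrow> region \<Rightarrow> (point \<Rightarrow> real) set" where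
  "Poly_edge m E = {(\<lambda>x. if x \<in> closure E then p x else 0) | p. p \<in> Poly m}"

definition edge_proj :: "int \<Rightarrow> region \<Rightarrow> (point \<Rightarrow> real) \<Rightarrow> point \<Rightarrow> real" where
  "edge_proj m E g = (THE p. p \<in> Poly_edge m E \<and>
     (\<forall>q\<in>Poly_edge m E. edge_integral E (\<lambda>x. p x * q x) = edge_integral E (\<lambda>x. g x * q x)))"

text \<open>
  Broken polynomials, each class of almost everywhere equal functions being represented by its
  member that vanishes off the (open) elements.
\<close>

definition Poly_broken :: "int \<Rightarrow> mesh \<Rightarrow> (point \<Rightarrow> real) set" where
  "Poly_broken m M = {v. (\<forall>T\<in>elems M. \<exists>p\<in>Poly m. \<forall>x\<in>T. v x = p x) \<and>
     (\<forall>x. x \<notin> \<Union>(elems M) \<longrightarrow> v x = 0)}"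

definition sym_part :: "tensor \<Rightarrow> tensor" where
  "sym_part A = (1/2) *\<^sub>R (A + transpose A)"

definition tensor_prod :: "point \<Rightarrow> point \<Rightarrow> tensor" where
  "tensor_prod a b = (\<chi> i j. a$i * b$j)"

definition Hess_space :: "int \<Rightarrow> (point \<Rightarrow> tensor) set" where
  "Hess_space m = hess ` Poly (m + 2)"

definition Hess_compl :: "int \<Rightarrow> point \<Rightarrow> (point \<Rightarrow> tensor) set" where
  "Hess_compl m c = (\<lambda>v x. sym_part (tensor_prod (rot90 (x - c)) (v x))) ` Poly_vec (m - 1)"

section \<open>Discrete spaces\<close>

record dofs =
  cell_H :: "region \<Rightarrow> point \<Rightarrow> tensor"
  cell_Hc :: "region \<Rightarrow> point \<Rightarrow> tensor"
  edge_nn :: "region \<Rightarrow> point \<Rightarrow> real"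
  edge_D :: "region \<Rightarrow> point \<Rightarrow> real"
  vert :: "point \<Rightarrow> tensor"

text \<open>Components not attached to the mesh are set to zero, so that equality of records is
  equality of the families indexed by the elements, edges and vertices of the mesh.\<close>

definition Sigma_space :: "int \<Rightarrow> mesh \<Rightarrow> dofs set" where
  "Sigma_space l M = {\<tau>.
     (\<forall>T\<in>elems M. cell_H \<tau> T \<in> Hess_space (l - 3) \<and> cell_Hc \<tau> T \<in> Hess_compl l (center M T)) \<and>
     (\<forall>E\<in>edges M. edge_nn \<tau> E \<in> Poly_edge (l - 2) E \<and> edge_D \<tau> E \<in> Poly_edge (l - 1) E) \<and>
     (\<forall>V\<in>mesh_verts M. vert \<tau> V \<in> sym_tensors) \<and>
     (\<forall>T. T \<notin> elems M \<longrightarrow> cell_H \<tau> T = (\<lambda>x. 0) \<and> cell_Hc \<tau> T = (\<lambda>x. 0)) \<and>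
     (\<forall>E. E \<notin> edges M \<longrightarrow> edge_nn \<tau> E = (\<lambda>x. 0) \<and> edge_D \<tau> E = (\<lambda>x. 0)) \<and>
     (\<forall>V. V \<notin> mesh_verts M \<longrightarrow> vert \<tau> V = 0)}"

definition zero_dofs :: dofs where
  "zero_dofs = \<lparr>cell_H = (\<lambda>T x. 0), cell_Hc = (\<lambda>T x. 0),
     edge_nn = (\<lambda>E x. 0), edge_D = (\<lambda>E x. 0), vert = (\<lambda>V. 0)\<rparr>"

definition pair_space :: "int \<Rightarrow> mesh \<Rightarrow> (dofs \<times> (point \<Rightarrow> real)) set" where
  "pair_space l M = Sigma_space l M \<times> Poly_broken (l - 1) M"

section \<open>Discrete operators\<close>

text \<open>
  The local operators take the whole vector of unknowns, but only involve its components
  attached to \<open>T\<close> (respectively \<open>E\<close>), its edges and vertices.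
  On tensors, the inner product \<open>\<bullet>\<close> is the Frobenius product.
\<close>

definition vert_terms ::
    "mesh \<Rightarrow> region \<Rightarrow> dofs \<Rightarrow> (point \<Rightarrow> real) \<Rightarrow> real" where
  "vert_terms M T \<tau> q = (\<Sum>E\<in>elem_edges M T. sign_TE M T E *
     (\<Sum>V\<in>edge_verts E. sign_EV M E V * ((vert \<tau> V *v normal M E) \<bullet> tangent M E) * q V))"

definition DD :: "int \<Rightarrow> mesh \<Rightarrow> region \<Rightarrow> dofs \<Rightarrow> point \<Rightarrow> real" where
  "DD l M T \<tau> = (THE p. p \<in> Poly (l - 1) \<and> (\<forall>q\<in>Poly (l - 1).
     (LINT x:T|lebesgue. p x * q x) =
       (LINT x:T|lebesgue. cell_H \<tau> T x \<bullet> hess q x)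
       - vert_terms M T \<tau> q
       - (\<Sum>E\<in>elem_edges M T. sign_TE M T E *
           (edge_integral E (\<lambda>x. edge_nn \<tau> E x * dir_deriv (normal M E) q x)
            - edge_integral E (\<lambda>x. edge_D \<tau> E x * q x)))))"

definition P_edge :: "int \<Rightarrow> mesh \<Rightarrow> region \<Rightarrow> dofs \<Rightarrow> point \<Rightarrow> real" where
  "P_edge l M E \<tau> = (THE p. p \<in> Poly_edge l E \<and>
     (\<forall>V\<in>edge_verts E. p V = (vert \<tau> V *v normal M E) \<bullet> normal M E) \<and>
     edge_proj (l - 2) E p = edge_nn \<tau> E)"

definition P_cell :: "int \<Rightarrow> mesh \<Rightarrow> region \<Rightarrow> dofs \<Rightarrow> point \<Rightarrow> tensor" where
  "P_cell l M T \<tau> = (THE P. P \<in> Poly_sym l \<and>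
     (\<forall>q\<in>Poly (l + 2). \<forall>\<upsilon>\<in>Hess_compl l (center M T).
       (LINT x:T|lebesgue. P x \<bullet> (hess q x + \<upsilon> x)) =
         (LINT x:T|lebesgue. DD l M T \<tau> x * q x)
         + vert_terms M T \<tau> q
         + (\<Sum>E\<in>elem_edges M T. sign_TE M T E *
             (edge_integral E (\<lambda>x. P_edge l M E \<tau> x * dir_deriv (normal M E) q x)
              - edge_integral E (\<lambda>x. edge_D \<tau> E x * q x)))
         + (LINT x:T|lebesgue. cell_Hc \<tau> T x \<bullet> \<upsilon> x)))"

section \<open>Norms and bilinear forms\<close>

definition delta1 :: "int \<Rightarrow> mesh \<Rightarrow> region \<Rightarrow> region \<Rightarrow> dofs \<Rightarrow> point \<Rightarrow> real" where
  "delta1 l M T E \<tau> x =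
     (P_cell l M T \<tau> x *v normal M E) \<bullet> normal M E - P_edge l M E \<tau> x"

definition delta2 :: "int \<Rightarrow> mesh \<Rightarrow> region \<Rightarrow> region \<Rightarrow> dofs \<Rightarrow> point \<Rightarrow> real" where
  "delta2 l M T E \<tau> x =
     dir_deriv (tangent M E) (\<lambda>y. (P_cell l M T \<tau> y *v normal M E) \<bullet> tangent M E) x
     + row_div (P_cell l M T \<tau>) x \<bullet> normal M E - edge_D \<tau> E x"

definition deltaV :: "int \<Rightarrow> mesh \<Rightarrow> region \<Rightarrow> dofs \<Rightarrow> point \<Rightarrow> tensor" where
  "deltaV l M T \<tau> V = P_cell l M T \<tau> V - vert \<tau> V"

definition stab :: "int \<Rightarrow> mesh \<Rightarrow> region \<Rightarrow> dofs \<Rightarrow> dofs \<Rightarrow> real" where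
  "stab l M T \<upsilon> \<tau> =
     (\<Sum>E\<in>elem_edges M T. edge_integral E (\<lambda>x.
        diameter T * delta1 l M T E \<upsilon> x * delta1 l M T E \<tau> x
        + diameter T ^ 3 * delta2 l M T E \<upsilon> x * delta2 l M T E \<tau> x))
     + (\<Sum>V\<in>elem_verts M T. (diameter T)\<^sup>2 * (deltaV l M T \<upsilon> V \<bullet> deltaV l M T \<tau> V))"

definition norm_Sigma :: "int \<Rightarrow> mesh \<Rightarrow> dofs \<Rightarrow> real" where
  "norm_Sigma l M \<tau> = sqrt (\<Sum>T\<in>elems M.
     (LINT x:T|lebesgue. (norm (P_cell l M T \<tau> x))\<^sup>2) + stab l M T \<tau> \<tau>)"

definition norm_pair :: "int \<Rightarrow> region \<Rightarrow> mesh \<Rightarrow> dofs \<times> (point \<Rightarrow> real) \<Rightarrow> real" where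
  "norm_pair l \<Omega> M = (\<lambda>(\<tau>, v). sqrt ((norm_Sigma l M \<tau>)\<^sup>2 + (L2_norm_on \<Omega> v)\<^sup>2))"

definition stiffness :: "real \<Rightarrow> real \<Rightarrow> tensor \<Rightarrow> tensor" where
  "stiffness D \<nu> \<tau> = D *\<^sub>R ((1 - \<nu>) *\<^sub>R \<tau> + (\<nu> * trace \<tau>) *\<^sub>R mat 1)"

definition compliance :: "real \<Rightarrow> real \<Rightarrow> tensor \<Rightarrow> tensor" where
  "compliance D \<nu> = inv_into sym_tensors (stiffness D \<nu>)"

definition form_a :: "int \<Rightarrow> mesh \<Rightarrow> real \<Rightarrow> real \<Rightarrow> dofs \<Rightarrow> dofs \<Rightarrow> real" where
  "form_a l M D \<nu> \<sigma> \<tau> = (\<Sum>T\<in>elems M.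
     (LINT x:T|lebesgue. compliance D \<nu> (P_cell l M T \<sigma> x) \<bullet> P_cell l M T \<tau> x)
     + 1 / (D * (1 + \<nu>)) * stab l M T \<sigma> \<tau>)"

definition form_b :: "int \<Rightarrow> mesh \<Rightarrow> dofs \<Rightarrow> (point \<Rightarrow> real) \<Rightarrow> real" where
  "form_b l M \<tau> v = (\<Sum>T\<in>elems M. LINT x:T|lebesgue. DD l M T \<tau> x * v x)"

definition form_A :: "int \<Rightarrow> mesh \<Rightarrow> real \<Rightarrow> real \<Rightarrow>
    dofs \<times> (point \<Rightarrow> real) \<Rightarrow> dofs \<times> (point \<Rightarrow> real) \<Rightarrow> real" where
  "form_A l M D \<nu> = (\<lambda>(\<sigma>, u) (\<tau>, v).
     form_a l M D \<nu> \<sigma> \<tau> + form_b l M \<tau> u - form_b l M \<sigma> v)"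

definition discrete_solution :: "int \<Rightarrow> region \<Rightarrow> mesh \<Rightarrow> real \<Rightarrow> real \<Rightarrow> (point \<Rightarrow> real) \<Rightarrow>
    dofs \<times> (point \<Rightarrow> real) \<Rightarrow> bool" where
  "discrete_solution l \<Omega> M D \<nu> f = (\<lambda>(\<sigma>, u).
     (\<forall>\<tau>\<in>Sigma_space l M. form_a l M D \<nu> \<sigma> \<tau> + form_b l M \<tau> u = 0) \<and>
     (\<forall>v\<in>Poly_broken (l - 1) M. - form_b l M \<sigma> v = (LINT x:\<Omega>|lebesgue. f x * v x)))"

definition gamma_const :: "real \<Rightarrow> real \<Rightarrow> real" where
  "gamma_const D \<nu> =
     (D\<^sup>2 * (1 + 1 / (D\<^sup>2 * (1 - \<nu>)\<^sup>2))\<^sup>2 + 1) powr (- 1 / 2)"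

end

theory Submission
  imports Defs "HOL-Library.Function_Algebras"
begin

text \<open>
  The form \<open>form_a\<close> is coercive and bounded for the norm of the tensor unknowns, so everything rests
  on the inf-sup condition for \<open>form_b\<close>.  For a broken polynomial \<open>u\<close> take the test vector whose element
  components are \<open>hess u\<close> and whose edge components are the scaled jumps of \<open>u\<close> and of its normal
  derivative, all other components being zero.  It pairs with \<open>u\<close> to the broken energy (Hessians in the
  elements plus scaled jumps on the edges), which controls \<open>u\<close> in \<open>L\<^sup>2\<close> by two applications of a discrete
  Poincare inequality, proved by applying the divergence theorem to \<open>x\<^sub>1 w\<^sup>2\<close> on each element.  The norm of
  the test vector is bounded by the energy by means of inverse estimates: each element contains a disk of
  comparable radius, and all norms on the finite-dimensional space of polynomials are equivalent on a
  reference disk.  The existence of a unique solution follows in finite dimension.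
\<close>

text \<open>The obstacle is that every constant has to be fixed before the mesh is given. An element
  of a polygonal mesh has no reference shape, so it enters the estimates only through its diameter,
  a disk inside it, the number of its edges and a lower bound for their lengths. These four data are
  all that is extracted from the triangulation.

  The energy has no affine kernel because the signed jump on an edge with a single adjacent element
  is the trace itself: boundary values and boundary normal derivatives are penalized too. The powers
  -1 and -3 of the edge length, for the normal derivative and for the value, let the squared jumps
  scale like the squared L2 norm of a Hessian. This is what frees the bound of the test vector from
  the mesh size.

  The parameters D and \<nu> stay outside all of this. They enter through the coercivity constant
  1/(D (1 + \<nu>)) and the continuity constant 1/(D (1 - \<nu>)) of \<open>form_a\<close>, and
  \<open>gamma_const\<close> results from combining two tests only: the pair itself, which controls
  its tensor part, and the special vector, which controls u.\<close>

section \<open>Linear algebra on subspaces of function spaces\<close>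

instantiation "fun" :: (type, real_vector) real_vector
begin

definition "r *\<^sub>R f = (\<lambda>x. r *\<^sub>R f x)"

instance
  by standard (simp_all add: scaleR_fun_def fun_eq_iff algebra_simps)

end

lemma scaleR_fun_apply [simp]: "(r *\<^sub>R f) x = r *\<^sub>R f x"
  by (simp add: scaleR_fun_def)

lemma sum_fun_apply: "(\<Sum>i\<in>I. f i) x = (\<Sum>i\<in>I. f i x)"
  by (induction I rule: infinite_finite_induct) auto

text \<open>Containment in a finite span instead of equality with one: the property passes to
  arbitrary subsets, and no generators inside the space have to be exhibited.\<close>

definition findim :: "'a::real_vector set \<Rightarrow> bool" where
  "findim V \<longleftrightarrow> (\<exists>B. finite B \<and> V \<subseteq> span B)"

text \<open>Linearity is relative to carrier sets because the forms are integrals, which are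
  additive only on integrable arguments.\<close>

definition bilinear_on :: "'a::real_vector set \<Rightarrow> 'b::real_vector set \<Rightarrow> ('a \<Rightarrow> 'b \<Rightarrow> real) \<Rightarrow> bool" where
  "bilinear_on V W Q \<longleftrightarrow>
     (\<forall>x\<in>V. \<forall>y\<in>V. \<forall>z\<in>W. Q (x + y) z = Q x z + Q y z) \<and>
     (\<forall>r. \<forall>x\<in>V. \<forall>z\<in>W. Q (r *\<^sub>R x) z = r * Q x z) \<and>
     (\<forall>x\<in>V. \<forall>y\<in>W. \<forall>z\<in>W. Q x (y + z) = Q x y + Q x z) \<and>
     (\<forall>r. \<forall>x\<in>V. \<forall>z\<in>W. Q x (r *\<^sub>R z) = r * Q x z)"

definition linear_on' :: "'a::real_vector set \<Rightarrow> ('a \<Rightarrow> 'b::real_vector) \<Rightarrow> bool" where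
  "linear_on' V f \<longleftrightarrow> (\<forall>x\<in>V. \<forall>y\<in>V. f (x + y) = f x + f y) \<and> (\<forall>r. \<forall>x\<in>V. f (r *\<^sub>R x) = r *\<^sub>R f x)"

definition semi_inner :: "'a::real_vector set \<Rightarrow> ('a \<Rightarrow> 'a \<Rightarrow> real) \<Rightarrow> bool" where
  "semi_inner V Q \<longleftrightarrow> subspace V \<and> bilinear_on V V Q \<and>
     (\<forall>x\<in>V. \<forall>y\<in>V. Q x y = Q y x) \<and> (\<forall>x\<in>V. 0 \<le> Q x x)"

definition inner_on :: "'a::real_vector set \<Rightarrow> ('a \<Rightarrow> 'a \<Rightarrow> real) \<Rightarrow> bool" where
  "inner_on V Q \<longleftrightarrow> semi_inner V Q \<and> (\<forall>x\<in>V. Q x x = 0 \<longrightarrow> x = 0)"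

lemma linear_on'_0: "linear_on' V f \<Longrightarrow> subspace V \<Longrightarrow> f 0 = 0"
  unfolding linear_on'_def by (metis scaleR_zero_left subspace_0)

lemma linear_on'_sum:
  assumes "linear_on' V f" "subspace V" "\<And>i. i \<in> I \<Longrightarrow> g i \<in> V"
  shows "f (\<Sum>i\<in>I. c i *\<^sub>R g i) = (\<Sum>i\<in>I. c i *\<^sub>R f (g i))"
  using assms(3)
proof (induction I rule: infinite_finite_induct)
  case (insert x F)
  have "(\<Sum>i\<in>F. c i *\<^sub>R g i) \<in> V"
    using insert.prems assms(2) by (intro subspace_sum) (auto intro: subspace_scale)
  moreover have "c x *\<^sub>R g x \<in> V"
    using insert.prems assms(2) by (auto intro: subspace_scale)
  ultimately show ?case
    using insert assms(1) by (simp add: linear_on'_def)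
qed (use assms linear_on'_0 in auto)

lemma span_image_linear_on':
  assumes "linear_on' (span B) f" "x \<in> span B"
  shows "f x \<in> span (f ` B)"
proof -
  have "x \<in> span B \<and> f x \<in> span (f ` B)"
    using assms(2)
  proof (induction rule: span_induct_alt)
    case base then show ?case using linear_on'_0[OF assms(1)] by (simp add: span_zero)
  next
    case (step c x y)
    then have "x \<in> span B" "c *\<^sub>R x \<in> span B" by (auto intro: span_base span_scale)
    moreover have "f (c *\<^sub>R x + y) = c *\<^sub>R f x + f y"
      using assms(1) step calculation by (simp add: linear_on'_def)
    ultimately show ?case using step by (auto intro: span_add span_scale span_base)
  qed
  then show ?thesis ..
qed

lemma linear_on'_zero_span:
  assumes "linear_on' (span B) f" "\<And>b. b \<in> B \<Longrightarrow> f b = 0" "x \<in> span B"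
  shows "f x = 0"
proof -
  have "span (f ` B) \<subseteq> {0}" using assms(2) by (intro span_minimal) auto
  then show ?thesis using span_image_linear_on'[OF assms(1,3)] by auto
qed

lemma semi_innerD:
  assumes "semi_inner V Q"
  shows "subspace V" "bilinear_on V V Q"
    "x \<in> V \<Longrightarrow> y \<in> V \<Longrightarrow> z \<in> V \<Longrightarrow> Q (x + y) z = Q x z + Q y z"
    "x \<in> V \<Longrightarrow> y \<in> V \<Longrightarrow> z \<in> V \<Longrightarrow> Q x (y + z) = Q x y + Q x z"
    "x \<in> V \<Longrightarrow> z \<in> V \<Longrightarrow> Q (r *\<^sub>R x) z = r * Q x z"
    "x \<in> V \<Longrightarrow> z \<in> V \<Longrightarrow> Q x (r *\<^sub>R z) = r * Q x z"
    "x \<in> V \<Longrightarrow> y \<in> V \<Longrightarrow> Q x y = Q y x"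
    "x \<in> V \<Longrightarrow> 0 \<le> Q x x"
  using assms by (auto simp: semi_inner_def bilinear_on_def)

lemma bilinear_on_subset:
  assumes "bilinear_on V W Q" "V' \<subseteq> V" "W' \<subseteq> W"
  shows "bilinear_on V' W' Q"
proof -
  have "\<And>x. x \<in> V' \<Longrightarrow> x \<in> V" "\<And>x. x \<in> W' \<Longrightarrow> x \<in> W" using assms by auto
  with assms(1) show ?thesis unfolding bilinear_on_def by simp
qed

lemma semi_inner_subset:
  assumes "semi_inner V Q" "W \<subseteq> V" "subspace W"
  shows "semi_inner W Q"
proof -
  have "\<And>x. x \<in> W \<Longrightarrow> x \<in> V" using assms by auto
  with assms bilinear_on_subset[of V V Q W W] show ?thesis unfolding semi_inner_def by simp
qed

lemma bilinear_on_linear: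
  assumes "bilinear_on V W Q"
  shows "z \<in> W \<Longrightarrow> linear_on' V (\<lambda>x. Q x z)" "x \<in> V \<Longrightarrow> linear_on' W (Q x)"
  using assms by (auto simp: bilinear_on_def linear_on'_def)

text \<open>The quadratic polynomial t \<mapsto> Q (t x + y) (t x + y) is nonnegative. If its
  leading coefficient \<open>Q x x\<close> vanishes it is affine, and a nonzero slope would let it
  reach the value -1; otherwise it is evaluated at its minimizer.\<close>

lemma semi_inner_CS:
  assumes "semi_inner V Q" "x \<in> V" "y \<in> V"
  shows "(Q x y)\<^sup>2 \<le> Q x x * Q y y"
proof -
  note D = semi_innerD[OF assms(1)]
  have *: "0 \<le> Q x x * t\<^sup>2 + 2 * Q x y * t + Q y y" for t
  proof -
    have "t *\<^sub>R x \<in> V" "t *\<^sub>R x + y \<in> V"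
      using assms D(1) by (auto intro: subspace_scale subspace_add)
    with assms have "Q (t *\<^sub>R x + y) (t *\<^sub>R x + y) = Q x x * t\<^sup>2 + 2 * Q x y * t + Q y y"
      by (simp add: D(3-6) D(7)[of y x] power2_eq_square algebra_simps)
    then show ?thesis using D(8)[OF \<open>t *\<^sub>R x + y \<in> V\<close>] by simp
  qed
  have nn: "0 \<le> Q x x" "0 \<le> Q y y" using D(8) assms by auto
  show ?thesis
  proof (cases "Q x x = 0")
    case True
    have "Q x y = 0"
    proof (rule ccontr)
      assume n: "Q x y \<noteq> 0"
      have "2 * Q x y * (- (Q y y + 1) / (2 * Q x y)) + Q y y = -1" using n by (simp add: field_simps)
      with *[of "- (Q y y + 1) / (2 * Q x y)"] True show False by simp
    qed
    then show ?thesis using True by simp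
  next
    case False
    with nn have p: "Q x x > 0" by simp
    have "Q x x * (- Q x y / Q x x)\<^sup>2 + 2 * Q x y * (- Q x y / Q x x) + Q y y
        = Q y y - (Q x y)\<^sup>2 / Q x x"
      using p by (simp add: power2_eq_square field_simps)
    with *[of "- Q x y / Q x x"] have "(Q x y)\<^sup>2 / Q x x \<le> Q y y" by simp
    then show ?thesis using p by (simp add: field_simps)
  qed
qed

lemma semi_inner_CS_abs:
  assumes "semi_inner V Q" "x \<in> V" "y \<in> V"
  shows "\<bar>Q x y\<bar> \<le> sqrt (Q x x) * sqrt (Q y y)"
  using real_sqrt_le_mono[OF semi_inner_CS[OF assms]] by (simp add: real_sqrt_mult)

lemma findim_mono: "findim W \<Longrightarrow> V \<subseteq> W \<Longrightarrow> findim V"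
  unfolding findim_def by blast

lemma findim_basis:
  assumes "subspace V" "findim V"
  obtains B where "finite B" "B \<subseteq> V" "V = span B"
proof -
  obtain S where S: "finite S" "V \<subseteq> span S" using assms by (auto simp: findim_def)
  obtain B where B: "B \<subseteq> V" "independent B" "V \<subseteq> span B"
    using maximal_independent_subset[of V] by blast
  have "finite B"
    using independent_span_bound[OF S(1) B(2)] B S by blast
  moreover have "span B = V" using B assms(1) by (simp add: span_minimal subset_antisym)
  ultimately show ?thesis using that B by blast
qed

text \<open>Gram-Schmidt along the generators. The part d of a new generator b that is orthogonal to
  the earlier span is either zero, and the span does not grow, or it is normalized and added to the
  basis.\<close>

lemma orthonormal_basis_span:
  assumes "finite B" "semi_inner (span B) Q" "\<And>x. x \<in> span B \<Longrightarrow> Q x x = 0 \<Longrightarrow> x = 0"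
  shows "\<exists>E. finite E \<and> E \<subseteq> span B \<and> (\<forall>e\<in>E. \<forall>f\<in>E. Q e f = (if e = f then 1 else 0)) \<and>
           (\<forall>v\<in>span B. v = (\<Sum>e\<in>E. Q v e *\<^sub>R e))"
  using assms
proof (induction B rule: finite_induct)
  case empty
  then show ?case by (auto intro!: exI[of _ "{}"])
next
  case (insert b B)
  note D = semi_innerD[OF insert.prems(1)]
  let ?V = "span (insert b B)"
  have sub: "span B \<subseteq> ?V" by (intro span_mono) auto
  have "semi_inner (span B) Q"
    using semi_inner_subset[OF insert.prems(1) sub] by simp
  from insert.IH[OF this] insert.prems(2) sub have "\<exists>E. finite E \<and> E \<subseteq> span B \<and>
    (\<forall>e\<in>E. \<forall>f\<in>E. Q e f = (if e = f then 1 else 0)) \<and> (\<forall>v\<in>span B. v = (\<Sum>e\<in>E. Q v e *\<^sub>R e))"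
    by (simp add: subset_eq)
  then obtain E where E': "finite E" "E \<subseteq> span B"
    "\<forall>e\<in>E. \<forall>f\<in>E. Q e f = (if e = f then 1 else 0)" "\<forall>v\<in>span B. v = (\<Sum>e\<in>E. Q v e *\<^sub>R e)"
    by (elim exE conjE) (rule that)
  note E = E'(1,2) bspec[OF bspec[OF E'(3)]] bspec[OF E'(4)]
  define s where "s = (\<Sum>e\<in>E. Q b e *\<^sub>R e)"
  define d where "d = b - s"
  have EV: "e \<in> ?V" if "e \<in> E" for e using that E sub by auto
  have bV: "b \<in> ?V" by (simp add: span_base)
  have sB: "s \<in> span B" unfolding s_def using E by (auto intro!: span_sum span_scale)
  have sV: "s \<in> ?V" using sB sub by auto
  have dV: "d \<in> ?V" unfolding d_def using bV sV by (rule span_diff)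
  have bds: "b = d + s" by (simp add: d_def)
  have Qse: "Q s e = Q b e" if "e \<in> E" for e
  proof -
    have "Q s e = (\<Sum>f\<in>E. Q b f *\<^sub>R Q f e)"
      unfolding s_def
      using linear_on'_sum[OF bilinear_on_linear(1)[OF D(2) EV[OF that]] D(1), of E "\<lambda>x. x" "Q b"] EV by auto
    also have "\<dots> = (\<Sum>f\<in>E. if f = e then Q b e else 0)"
      by (rule sum.cong) (use E that in auto)
    finally show ?thesis using E that by simp
  qed
  have Qde: "Q d e = 0" if "e \<in> E" for e
    using Qse[OF that] D(3)[OF dV sV EV[OF that]] bds by simp
  have Qdspan: "Q d v = 0" "Q v d = 0" if "v \<in> span B" for v
  proof -
    have "Q d v = Q d (\<Sum>e\<in>E. Q v e *\<^sub>R e)" using E(4)[OF that] by simp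
    also have "\<dots> = (\<Sum>e\<in>E. Q v e *\<^sub>R Q d e)"
      using linear_on'_sum[OF bilinear_on_linear(2)[OF D(2) dV] D(1), of E "\<lambda>x. x" "Q v"] EV by auto
    also have "\<dots> = 0" using Qde by simp
    finally show "Q d v = 0" .
    then show "Q v d = 0" using D(7)[OF dV] that sub by auto
  qed
  have dec: "\<exists>k. v - k *\<^sub>R d \<in> span B" if v: "v \<in> ?V" for v
  proof -
    obtain k where "v - k *\<^sub>R b \<in> span B" using v span_breakdown_eq by blast
    then have "v - k *\<^sub>R b + k *\<^sub>R s \<in> span B" using sB by (intro span_add span_scale)
    then show ?thesis by (intro exI[of _ k]) (simp add: d_def algebra_simps)
  qed
  show ?case
  proof (cases "d = 0")
    case True
    have "?V = span B" using dec True sub by auto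
    then show ?thesis using E by (intro exI[of _ E]) auto
  next
    case False
    then have pos: "Q d d > 0"
      using D(8)[OF dV] insert.prems(2)[OF dV] by fastforce
    define n where "n = (1 / sqrt (Q d d)) *\<^sub>R d"
    have nV: "n \<in> ?V" unfolding n_def using dV by (rule span_scale)
    have Qnn: "Q n n = 1" unfolding n_def using dV pos span_scale[OF dV, of "1 / sqrt (Q d d)"]
      by (simp add: D(5,6))
    have Qne: "Q n e = 0" "Q e n = 0" if "e \<in> E" for e
      using that dV EV Qde D(7)[OF dV EV] unfolding n_def by (auto simp: D(5,6))
    have nE: "n \<notin> E" using Qnn Qne by force
    have dn: "d = sqrt (Q d d) *\<^sub>R n" using pos by (simp add: n_def)
    show ?thesis
    proof (intro exI[of _ "insert n E"] conjI ballI)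
      fix v assume v: "v \<in> ?V"
      obtain k where k: "v - k *\<^sub>R d \<in> span B" using dec[OF v] by blast
      define w where "w = v - k *\<^sub>R d"
      have vw: "v = w + k *\<^sub>R d" by (simp add: w_def)
      have wB: "w \<in> span B" using k w_def by simp
      have wV: "w \<in> ?V" using wB sub by auto
      have kd: "k *\<^sub>R d \<in> ?V" using dV span_scale by blast
      have "Q v e = Q w e" if "e \<in> E" for e
        unfolding vw using D(3)[OF wV kd EV[OF that]] D(5)[OF dV EV[OF that]] Qde[OF that] by simp
      then have 1: "(\<Sum>e\<in>E. Q v e *\<^sub>R e) = w" using E(4)[OF wB] by simp
      have "Q v n = (1 / sqrt (Q d d)) * Q v d" unfolding n_def using D(6)[OF v dV] by simp
      also have "Q v d = k * Q d d"
        unfolding vw using D(3)[OF wV kd dV] D(5)[OF dV dV] Qdspan(2)[OF wB] by simp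
      finally have "Q v n = k * (Q d d / sqrt (Q d d))" by simp
      then have "Q v n = k * sqrt (Q d d)" using pos by (simp add: real_div_sqrt)
      then have "Q v n *\<^sub>R n = k *\<^sub>R d" by (metis dn scaleR_scaleR)
      then show "v = (\<Sum>e\<in>insert n E. Q v e *\<^sub>R e)"
        using E(1) nE 1 vw by simp
    qed (use E nV EV Qnn Qne in auto)
  qed
qed

lemma orthonormal_basis:
  assumes "inner_on V Q" "findim V"
  obtains E where "finite E" "E \<subseteq> V" "\<And>e f. e \<in> E \<Longrightarrow> f \<in> E \<Longrightarrow> Q e f = (if e = f then 1 else 0)"
    "\<And>v. v \<in> V \<Longrightarrow> v = (\<Sum>e\<in>E. Q v e *\<^sub>R e)"
proof -
  have s: "semi_inner V Q" "subspace V" using assms by (auto simp: inner_on_def semi_inner_def)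
  obtain B where B: "finite B" "B \<subseteq> V" "V = span B" using findim_basis[OF s(2) assms(2)] .
  have d: "\<And>x. x \<in> V \<Longrightarrow> Q x x = 0 \<Longrightarrow> x = 0" using assms(1) by (simp add: inner_on_def)
  have "\<exists>E. finite E \<and> E \<subseteq> V \<and> (\<forall>e\<in>E. \<forall>f\<in>E. Q e f = (if e = f then 1 else 0)) \<and>
           (\<forall>v\<in>V. v = (\<Sum>e\<in>E. Q v e *\<^sub>R e))"
    by (rule orthonormal_basis_span[OF B(1), folded B(3), OF s(1)]) (rule d)
  then
  obtain E where E: "finite E" "E \<subseteq> V" "\<forall>e\<in>E. \<forall>f\<in>E. Q e f = (if e = f then 1 else 0)"
    "\<forall>v\<in>V. v = (\<Sum>e\<in>E. Q v e *\<^sub>R e)" by (elim exE conjE) (rule that)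
  show ?thesis by (rule that[OF E(1,2) bspec[OF bspec[OF E(3)]] bspec[OF E(4)]])
qed

text \<open>The representative has the coefficients \<open>L e\<close> in an orthonormal basis. The
  unique existence is what gives a meaning to the definite descriptions by which the discrete
  operators are defined.\<close>

lemma riesz:
  assumes "inner_on V Q" "findim V" "linear_on' V L"
  shows "\<exists>!w. w \<in> V \<and> (\<forall>z\<in>V. Q w z = L z)"
proof -
  obtain E where E: "finite E" "E \<subseteq> V" "\<And>v. v \<in> V \<Longrightarrow> v = (\<Sum>e\<in>E. Q v e *\<^sub>R e)"
    by (rule orthonormal_basis[OF assms(1,2)]) (rule that)
  have s: "semi_inner V Q" "subspace V" using assms by (auto simp: inner_on_def semi_inner_def)
  note D = semi_innerD[OF s(1)]
  define w where "w = (\<Sum>e\<in>E. L e *\<^sub>R e)"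
  have wV: "w \<in> V" unfolding w_def using E s(2) by (auto intro!: subspace_sum subspace_scale)
  have "Q w z = L z" if z: "z \<in> V" for z
  proof -
    have "Q w z = (\<Sum>e\<in>E. L e *\<^sub>R Q e z)"
      unfolding w_def using E z
      by (intro linear_on'_sum[OF bilinear_on_linear(1)[OF D(2) z] D(1)]) auto
    also have "\<dots> = (\<Sum>e\<in>E. Q z e *\<^sub>R L e)"
      using E z D(7) by (intro sum.cong) auto
    also have "\<dots> = L (\<Sum>e\<in>E. Q z e *\<^sub>R e)"
      using linear_on'_sum[OF assms(3) s(2), of E "\<lambda>x. x" "Q z"] E(2) by (simp add: subset_eq)
    also have "\<dots> = L z" using E(3)[OF z] by simp
    finally show ?thesis .
  qed
  moreover have "w' = w" if "w' \<in> V" "\<forall>z\<in>V. Q w' z = L z" for w'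
  proof -
    have n: "-1 *\<^sub>R w \<in> V" using wV s(2) subspace_scale by blast
    have d: "w' + -1 *\<^sub>R w \<in> V" using that n s(2) by (blast intro: subspace_add)
    have "Q (w' + -1 *\<^sub>R w) (w' + -1 *\<^sub>R w) = 0"
      using D(3)[OF that(1) n d] D(5)[OF wV d, of "-1"] that d calculation[OF d] by simp
    then have "w' + -1 *\<^sub>R w = 0" using assms(1) d by (auto simp: inner_on_def)
    then show ?thesis by simp
  qed
  ultimately show ?thesis using wV by blast
qed

text \<open>Nondegeneracy in the second argument makes \<open>\<Sum>b. A b z * A b z'\<close> an inner product; its
  Riesz representatives give solutions, without counting dimensions.\<close>

lemma nondegenerate_solvable:
  assumes V: "subspace V" "findim V" and A: "bilinear_on V V A"
    and left: "\<And>w. w \<in> V \<Longrightarrow> (\<And>z. z \<in> V \<Longrightarrow> A w z = 0) \<Longrightarrow> w = 0"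
    and right: "\<And>z. z \<in> V \<Longrightarrow> (\<And>w. w \<in> V \<Longrightarrow> A w z = 0) \<Longrightarrow> z = 0"
    and L: "linear_on' V L"
  shows "\<exists>!w. w \<in> V \<and> (\<forall>z\<in>V. A w z = L z)"
proof -
  obtain B where B: "finite B" "B \<subseteq> V" "V = span B" using findim_basis[OF V] .
  define R where "R z z' = (\<Sum>b\<in>B. A b z * A b z')" for z z'
  have "semi_inner V R"
    using A B V(1) unfolding semi_inner_def bilinear_on_def R_def
    by (auto simp: subset_iff sum.distrib sum_distrib_left algebra_simps intro!: sum.cong sum_nonneg)
  moreover have "z = 0" if z: "z \<in> V" "R z z = 0" for z
  proof -
    have 0: "A b z = 0" if "b \<in> B" for b
    proof -
      have "\<forall>b\<in>B. A b z * A b z = 0" using z(2) B(1) unfolding R_def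
        by (subst (asm) sum_nonneg_eq_0_iff) auto
      then show ?thesis using that by auto
    qed
    show ?thesis
    proof (rule right[OF z(1)])
      fix w assume w: "w \<in> V"
      show "A w z = 0"
        using linear_on'_zero_span[of B "\<lambda>w. A w z" w] bilinear_on_linear(1)[OF A z(1)] 0 w B(3) by simp
    qed
  qed
  ultimately have "inner_on V R" by (auto simp: inner_on_def)
  from riesz[OF this V(2) L] obtain z0 where z0: "z0 \<in> V" "\<And>z. z \<in> V \<Longrightarrow> R z0 z = L z" by blast
  define w where "w = (\<Sum>b\<in>B. A b z0 *\<^sub>R b)"
  have wV: "w \<in> V" unfolding w_def using B V by (auto intro!: subspace_sum subspace_scale)
  have "A w z = L z" if "z \<in> V" for z
    unfolding w_def z0(2)[OF that, symmetric] R_def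
    using linear_on'_sum[OF bilinear_on_linear(1)[OF A that] V(1), of B "\<lambda>x. x" "\<lambda>b. A b z0"] B by auto
  moreover have "w' = w" if "w' \<in> V" "\<forall>z\<in>V. A w' z = L z" for w'
  proof -
    have n: "-1 *\<^sub>R w \<in> V" using wV V subspace_scale by blast
    have d: "w' + -1 *\<^sub>R w \<in> V" using that n V by (blast intro: subspace_add)
    have "A (w' + -1 *\<^sub>R w) z = 0" if z: "z \<in> V" for z
      using A n z calculation[OF z] that \<open>w' \<in> V\<close> \<open>\<forall>z\<in>V. A w' z = L z\<close> wV
      unfolding bilinear_on_def by (metis mult_minus1 add.right_inverse)
    then have "w' + -1 *\<^sub>R w = 0" by (rule left[OF d])
    then show ?thesis by simp
  qed
  ultimately show ?thesis using wV by blast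
qed

text \<open>Equivalence of norms in finite dimension, for a whole family of seminorms at once: in an
  orthonormal basis the coefficients of x are at most \<open>sqrt (Q x x)\<close>, and the values of
  all seminorms on the basis are bounded by assumption. With the points of a compact set as indices
  this yields one constant for all point evaluations.\<close>

lemma inner_on_seminorm_bound:
  assumes "inner_on V Q" "findim V"
    and N: "\<And>i x y. i \<in> I \<Longrightarrow> x \<in> V \<Longrightarrow> y \<in> V \<Longrightarrow> N i (x + y) \<le> N i x + (N i y :: real)"
      "\<And>i r x. i \<in> I \<Longrightarrow> x \<in> V \<Longrightarrow> N i (r *\<^sub>R x) \<le> \<bar>r\<bar> * N i x"
      "\<And>x. x \<in> V \<Longrightarrow> \<exists>K. \<forall>i\<in>I. N i x \<le> K"
  shows "\<exists>C>0. \<forall>i\<in>I. \<forall>x\<in>V. N i x \<le> C * sqrt (Q x x)"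
proof -
  obtain E where E: "finite E" "E \<subseteq> V" "\<And>e f. e \<in> E \<Longrightarrow> f \<in> E \<Longrightarrow> Q e f = (if e = f then 1 else 0)" "\<And>v. v \<in> V \<Longrightarrow> v = (\<Sum>e\<in>E. Q v e *\<^sub>R e)"
    by (rule orthonormal_basis[OF assms(1,2)]) (rule that)
  have s: "semi_inner V Q" "subspace V" using assms by (auto simp: inner_on_def semi_inner_def)
  obtain K where K: "\<And>e i. e \<in> E \<Longrightarrow> i \<in> I \<Longrightarrow> N i e \<le> K e" using N(3) E(2) by (metis subsetD)
  \<comment> \<open>The summand 1 keeps C positive when the basis is empty.\<close>
  define C where "C = (\<Sum>e\<in>E. \<bar>K e\<bar>) + 1"
  have C0: "C > 0" unfolding C_def by (simp add: add_nonneg_pos sum_nonneg)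
  have sums: "N i (\<Sum>e\<in>F. c e *\<^sub>R e) \<le> (\<Sum>e\<in>F. \<bar>c e\<bar> * \<bar>K e\<bar>)" if "F \<subseteq> E" "i \<in> I" for F c i
    using finite_subset[OF that(1) E(1)] that(1)
  proof (induction F rule: finite_induct)
    case empty
    have "N i (0 *\<^sub>R 0) \<le> \<bar>0\<bar> * N i 0" using N(2)[OF that(2) subspace_0[OF s(2)], of 0] .
    then show ?case by simp
  next
    case (insert e F)
    have e: "e \<in> E" "e \<in> V" "F \<subseteq> V" using insert(4) E(2) by auto
    have "N i (\<Sum>e\<in>insert e F. c e *\<^sub>R e) = N i (c e *\<^sub>R e + (\<Sum>e\<in>F. c e *\<^sub>R e))" using insert by simp
    also have "\<dots> \<le> N i (c e *\<^sub>R e) + N i (\<Sum>e\<in>F. c e *\<^sub>R e)"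
      using e s(2) by (intro N(1)[OF that(2)]) (auto intro!: subspace_scale subspace_sum)
    also have "N i (c e *\<^sub>R e) \<le> \<bar>c e\<bar> * N i e" using N(2)[OF that(2) e(2)] .
    also have "\<dots> \<le> \<bar>c e\<bar> * \<bar>K e\<bar>" using K[OF e(1) that(2)] by (intro mult_left_mono) auto
    finally show ?case using insert by simp
  qed
  have "N i x \<le> C * sqrt (Q x x)" if "i \<in> I" "x \<in> V" for i x
  proof -
    have "N i x = N i (\<Sum>e\<in>E. Q x e *\<^sub>R e)" by (rule arg_cong[OF E(4)[OF that(2)]])
    also have "\<dots> \<le> (\<Sum>e\<in>E. \<bar>Q x e\<bar> * \<bar>K e\<bar>)" using sums[OF _ that(1)] by simp
    also have "\<dots> \<le> (\<Sum>e\<in>E. sqrt (Q x x) * \<bar>K e\<bar>)"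
    proof (intro sum_mono mult_right_mono)
      fix e assume "e \<in> E"
      then show "\<bar>Q x e\<bar> \<le> sqrt (Q x x)"
        using semi_inner_CS_abs[OF s(1) that(2), of e] E(2,3) by auto
    qed simp
    also have "\<dots> = sqrt (Q x x) * (\<Sum>e\<in>E. \<bar>K e\<bar>)" by (simp add: sum_distrib_left)
    also have "\<dots> \<le> sqrt (Q x x) * C"
      using semi_innerD(8)[OF s(1) that(2)] by (intro mult_left_mono) (auto simp: C_def)
    finally show ?thesis by (simp add: mult.commute)
  qed
  then show ?thesis using C0 by blast
qed

lemma linear_on'_subset: "linear_on' V f \<Longrightarrow> W \<subseteq> V \<Longrightarrow> linear_on' W f"
  unfolding linear_on'_def by (blast dest: subsetD)

lemma findim_image:
  assumes "subspace V" "findim V" "linear_on' V f"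
  shows "findim (f ` V)"
proof -
  obtain B where B: "finite B" "B \<subseteq> V" "V = span B" using findim_basis[OF assms(1,2)] .
  then have "f ` V \<subseteq> span (f ` B)" using span_image_linear_on'[of B f] assms(3) by auto
  then show ?thesis using B(1) by (auto simp: findim_def)
qed

lemma findim_span: "finite B \<Longrightarrow> findim (span B)"
  by (auto simp: findim_def)

lemma findim_Times:
  assumes "findim V" "findim W"
  shows "findim (V \<times> W)"
proof -
  obtain B C where BC: "finite B" "V \<subseteq> span B" "finite C" "W \<subseteq> span C"
    using assms by (auto simp: findim_def)
  let ?S = "(\<lambda>b. (b, 0)) ` B \<union> (\<lambda>c. (0, c)) ` C"
  have "(v, w) \<in> span ?S" if "v \<in> V" "w \<in> W" for v w
  proof -
    have l: "linear_on' (span B) (\<lambda>b. (b, 0::'b))" "linear_on' (span C) (\<lambda>b. (0::'a, b))"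
      by (auto simp: linear_on'_def)
    have "v \<in> span B" "w \<in> span C" using that BC by auto
    then have "(v, 0) \<in> span ((\<lambda>b. (b, 0::'b)) ` B)" "(0, w) \<in> span ((\<lambda>c. (0::'a, c)) ` C)"
      by (auto intro: span_image_linear_on'[OF l(1)] span_image_linear_on'[OF l(2)])
    then have "(v, 0) \<in> span ?S" "(0, w) \<in> span ?S"
      using span_mono[of "(\<lambda>b. (b, 0)) ` B" ?S] span_mono[of "(\<lambda>c. (0, c)) ` C" ?S] by auto
    from span_add[OF this] show ?thesis by simp
  qed
  then show ?thesis unfolding findim_def using BC by (intro exI[of _ ?S]) auto
qed

text \<open>A family that vanishes off the finite index set is the sum of its entries, each placed
  alone in its slot by \<open>s i\<close>; the generators are those of the factors, placed in the
  same way.\<close>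

lemma findim_fun:
  fixes V :: "'a \<Rightarrow> 'b::real_vector set"
  assumes "finite I" "\<And>i. i \<in> I \<Longrightarrow> findim (V i)"
  shows "findim {f. (\<forall>i\<in>I. f i \<in> V i) \<and> (\<forall>i. i \<notin> I \<longrightarrow> f i = 0)}"
proof -
  obtain B where B: "\<And>i. i \<in> I \<Longrightarrow> finite (B i) \<and> V i \<subseteq> span (B i)"
    using assms(2) unfolding findim_def by metis
  define s :: "'a \<Rightarrow> 'b \<Rightarrow> 'a \<Rightarrow> 'b" where "s i v = (\<lambda>j. if j = i then v else 0)" for i v
  let ?S = "\<Union>i\<in>I. s i ` B i"
  have "f \<in> span ?S" if f: "\<And>i. i \<in> I \<Longrightarrow> f i \<in> V i" "\<And>i. i \<notin> I \<Longrightarrow> f i = 0" for f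
  proof -
    have "f = (\<Sum>i\<in>I. s i (f i))"
      by (rule ext) (use assms(1) f(2) in \<open>auto simp: sum_fun_apply s_def if_distrib cong: if_cong\<close>)
    moreover have "s i (f i) \<in> span ?S" if "i \<in> I" for i
    proof -
      have "linear_on' (span (B i)) (s i)" by (auto simp: linear_on'_def s_def fun_eq_iff)
      from span_image_linear_on'[OF this, of "f i"] have "s i (f i) \<in> span (s i ` B i)"
        using f(1)[OF that] B[OF that] by blast
      then show ?thesis using span_mono[of "s i ` B i" ?S] that by blast
    qed
    ultimately show ?thesis using span_sum[of I "\<lambda>i. s i (f i)" ?S] by metis
  qed
  then show ?thesis unfolding findim_def using B assms(1) by (intro exI[of _ ?S]) auto
qed

section \<open>Polynomials in two variables\<close>

lemma finite_degrees [simp]: "finite {(i, j). int i + int j \<le> m}"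
proof (rule finite_subset)
  show "{(i, j). int i + int j \<le> m} \<subseteq> {..nat m} \<times> {..nat m}" by auto
qed auto

lemma Poly_zero [simp]: "(\<lambda>x. 0) \<in> Poly m"
  unfolding Poly_def by (auto intro!: exI[of _ "\<lambda>i j. 0"])

lemma Poly_add: "p \<in> Poly m \<Longrightarrow> q \<in> Poly m \<Longrightarrow> (\<lambda>x. p x + q x) \<in> Poly m"
  unfolding Poly_def
proof safe
  fix c d :: "nat \<Rightarrow> nat \<Rightarrow> real"
  show "\<exists>e. (\<lambda>x. (\<Sum>(i, j)\<in>{(i, j). int i + int j \<le> m}. c i j * (x$1)^i * (x$2)^j) +
          (\<Sum>(i, j)\<in>{(i, j). int i + int j \<le> m}. d i j * (x$1)^i * (x$2)^j))
      = (\<lambda>x::point. \<Sum>(i, j)\<in>{(i, j). int i + int j \<le> m}. e i j * (x$1)^i * (x$2)^j)"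
    by (rule exI[of _ "\<lambda>i j. c i j + d i j"])
      (auto simp: fun_eq_iff sum.distrib[symmetric] algebra_simps intro!: sum.cong)
qed

lemma Poly_cmult: "p \<in> Poly m \<Longrightarrow> (\<lambda>x. r * p x) \<in> Poly m"
  unfolding Poly_def
proof safe
  fix c :: "nat \<Rightarrow> nat \<Rightarrow> real"
  show "\<exists>e. (\<lambda>x. r * (\<Sum>(i, j)\<in>{(i, j). int i + int j \<le> m}. c i j * (x$1)^i * (x$2)^j))
      = (\<lambda>x::point. \<Sum>(i, j)\<in>{(i, j). int i + int j \<le> m}. e i j * (x$1)^i * (x$2)^j)"
    by (rule exI[of _ "\<lambda>i j. r * c i j"])
      (auto simp: fun_eq_iff sum_distrib_left algebra_simps intro!: sum.cong)
qed

lemma subspace_Poly: "subspace (Poly m)"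
  by (rule subspaceI)
    (use Poly_add Poly_cmult Poly_zero in \<open>auto simp: plus_fun_def scaleR_fun_def zero_fun_def\<close>)

lemma Poly_diff: "p \<in> Poly m \<Longrightarrow> q \<in> Poly m \<Longrightarrow> (\<lambda>x. p x - q x) \<in> Poly m"
  using Poly_add[of p m "\<lambda>x. -1 * q x"] Poly_cmult[of q m "-1"] by simp

lemma Poly_minus: "p \<in> Poly m \<Longrightarrow> (\<lambda>x. - p x) \<in> Poly m"
  using Poly_cmult[of p m "-1"] by simp

lemma Poly_sum: "(\<And>i. i \<in> I \<Longrightarrow> p i \<in> Poly m) \<Longrightarrow> (\<lambda>x. \<Sum>i\<in>I. p i x) \<in> Poly m"
  by (induction I rule: infinite_finite_induct) (auto intro: Poly_add)

lemma Poly_monomial: "int i + int j \<le> m \<Longrightarrow> (\<lambda>x. (x$1)^i * (x$2)^j) \<in> Poly m"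
  unfolding Poly_def
proof (safe, intro exI)
  assume a: "int i + int j \<le> m"
  show "(\<lambda>x::point. (x$1)^i * (x$2)^j)
      = (\<lambda>x::point. \<Sum>(k, l)\<in>{(i, j). int i + int j \<le> m}. (if (k, l) = (i, j) then 1 else 0) * (x$1)^k * (x$2)^l)"
  proof
    fix x :: point
    have "(\<Sum>(k, l)\<in>{(i, j). int i + int j \<le> m}. (if (k, l) = (i, j) then 1 else 0) * (x$1)^k * (x$2)^l)
       = (\<Sum>kl\<in>{(i, j). int i + int j \<le> m}. (if kl = (i, j) then (x$1)^i * (x$2)^j else 0))"
      by (rule sum.cong) (auto split: if_splits)
    also have "\<dots> = (x$1)^i * (x$2)^j" using a by simp
    finally show "(x$1)^i * (x$2)^j = (\<Sum>(k, l)\<in>{(i, j). int i + int j \<le> m}. (if (k, l) = (i, j) then 1 else 0) * (x$1)^k * (x$2)^l)" ..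
  qed
qed

text \<open>The terms of the defining sum are added one at a time; membership of the partial sums in
  \<open>Poly m\<close> is carried along so that the induction step may use it. Closure properties
  are thereby reduced to monomials and linearity.\<close>

lemma Poly_induct [consumes 1, case_names zero step]:
  assumes "p \<in> Poly m" "P (\<lambda>x. 0)"
    "\<And>c i j q. int i + int j \<le> m \<Longrightarrow> q \<in> Poly m \<Longrightarrow> P q \<Longrightarrow> P (\<lambda>x. c * ((x$1)^i * (x$2)^j) + q x)"
  shows "P p"
proof -
  obtain c where p: "p = (\<lambda>x. \<Sum>(i, j)\<in>{(i, j). int i + int j \<le> m}. c i j * (x$1)^i * (x$2)^j)"
    using assms(1) by (auto simp: Poly_def)
  have "P (\<lambda>x. \<Sum>(i, j)\<in>S. c i j * (x$1)^i * (x$2)^j) \<and> (\<lambda>x. \<Sum>(i, j)\<in>S. c i j * (x$1)^i * (x$2)^j) \<in> Poly m"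
    if "finite S" "S \<subseteq> {(i, j). int i + int j \<le> m}" for S
    using that
  proof (induction S rule: finite_induct)
    case (insert ij S)
    obtain i j where ij: "ij = (i, j)" by (cases ij)
    let ?q = "\<lambda>x::point. \<Sum>(i, j)\<in>S. c i j * (x$1)^i * (x$2)^j"
    have eq: "(\<lambda>x::point. \<Sum>(i, j)\<in>insert ij S. c i j * (x$1)^i * (x$2)^j) = (\<lambda>x. c i j * ((x$1)^i * (x$2)^j) + ?q x)"
      using insert by (auto simp: ij fun_eq_iff algebra_simps)
    have d: "int i + int j \<le> m" using insert ij by auto
    show ?case unfolding eq
      using insert assms(3)[OF d, of ?q "c i j"] Poly_add[OF Poly_cmult[OF Poly_monomial[OF d]], of ?q "c i j"] by simp
  qed (use assms(2) in auto)
  from this[OF finite_degrees order_refl] show ?thesis unfolding p by blast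
qed

lemma findim_Poly: "findim (Poly m)"
proof -
  let ?B = "(\<lambda>(i, j) x. (x$1)^i * (x$2)^j) ` {(i, j). int i + int j \<le> m} :: (point \<Rightarrow> real) set"
  have "p \<in> span ?B" if "p \<in> Poly m" for p
    using that
  proof (induction rule: Poly_induct)
    case zero
    then show ?case using span_zero[of ?B] by (simp add: zero_fun_def)
  next
    case (step c i j q)
    have "(\<lambda>x. (x$1)^i * (x$2)^j) \<in> span ?B" using step by (intro span_base image_eqI[of _ _ "(i, j)"]) auto
    from span_add[OF span_scale[OF this, of c] step(3)] show ?case by (simp add: plus_fun_def scaleR_fun_def)
  qed
  then show ?thesis unfolding findim_def by (intro exI[of _ ?B]) auto
qed

lemma Poly_const [simp]: "0 \<le> m \<Longrightarrow> (\<lambda>x. c) \<in> Poly m"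
  using Poly_cmult[OF Poly_monomial[of 0 0 m], of c] by simp

lemma Poly_coord: "1 \<le> m \<Longrightarrow> (\<lambda>x. x $ i) \<in> Poly m"
proof -
  assume m: "1 \<le> m"
  have "i = 1 \<or> i = 2" using exhaust_2 by blast
  then show ?thesis using Poly_monomial[of 1 0 m] Poly_monomial[of 0 1 m] m by auto
qed

lemma Poly_mono: "p \<in> Poly m \<Longrightarrow> m \<le> n \<Longrightarrow> p \<in> Poly n"
proof (induction rule: Poly_induct)
  case (step c i j q)
  then show ?case using Poly_add[OF Poly_cmult[OF Poly_monomial[of i j n]], of q c] by auto
qed auto

lemma Poly_neg: "p \<in> Poly m \<Longrightarrow> m < 0 \<Longrightarrow> p = (\<lambda>x. 0)"
  by (induction rule: Poly_induct) auto

lemma Poly_mult_monomial: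
  assumes "q \<in> Poly n" "int i + int j \<le> m"
  shows "(\<lambda>x. ((x$1)^i * (x$2)^j) * q x) \<in> Poly (m + n)"
  using assms(1)
proof (induction rule: Poly_induct)
  case (step c k l q)
  have "(\<lambda>x. c * ((x$1)^(i+k) * (x$2)^(j+l)) + ((x$1)^i * (x$2)^j) * q x) \<in> Poly (m + n)"
    using step assms(2) by (intro Poly_add Poly_cmult Poly_monomial) auto
  then show ?case by (simp add: power_add algebra_simps)
qed auto

lemma Poly_mult:
  assumes "p \<in> Poly m" "q \<in> Poly n"
  shows "(\<lambda>x. p x * q x) \<in> Poly (m + n)"
  using assms(1)
proof (induction rule: Poly_induct)
  case (step c i j p)
  have "(\<lambda>x. c * (((x$1)^i * (x$2)^j) * q x) + p x * q x) \<in> Poly (m + n)"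
    using step assms(2) by (intro Poly_add Poly_cmult Poly_mult_monomial) auto
  then show ?case by (simp add: algebra_simps)
qed auto

lemma Poly_power: "p \<in> Poly 1 \<Longrightarrow> (\<lambda>x. p x ^ k) \<in> Poly (int k)"
proof (induction k)
  case (Suc k)
  then show ?case using Poly_mult[of p 1 "\<lambda>x. p x ^ k" "int k"] by (simp add: algebra_simps)
qed auto

lemma Poly_compose_affine:
  assumes "p \<in> Poly m" "(\<lambda>x. f x $ 1) \<in> Poly 1" "(\<lambda>x. f x $ 2) \<in> Poly 1"
  shows "(\<lambda>x. p (f x)) \<in> Poly m"
  using assms(1)
proof (induction rule: Poly_induct)
  case (step c i j q)
  have "(\<lambda>x. (f x $ 1)^i * (f x $ 2)^j) \<in> Poly (int i + int j)"
    by (intro Poly_mult Poly_power assms)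
  then have "(\<lambda>x. (f x $ 1)^i * (f x $ 2)^j) \<in> Poly m" using Poly_mono step(1) by blast
  then show ?case using step by (intro Poly_add Poly_cmult)
qed auto

lemma Poly_shift: "p \<in> Poly m \<Longrightarrow> (\<lambda>x. p (z + h *\<^sub>R x)) \<in> Poly m"
  by (rule Poly_compose_affine) (auto intro!: Poly_add Poly_cmult Poly_coord)

lemma Poly_has_derivative:
  assumes "p \<in> Poly m"
  shows "(p has_derivative (\<lambda>d. dir_deriv d p x)) (at x)"
proof -
  have "p differentiable at x"
    using assms
  proof (induction rule: Poly_induct)
    case (step c i j q)
    then show ?case
      by (intro differentiable_add differentiable_mult differentiable_power)
         (auto intro!: differentiable_const bounded_linear_imp_differentiable bounded_linear_vec_nth)
  qed auto
  then show ?thesis by (simp add: frechet_derivative_works dir_deriv_def)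
qed

lemma dir_deriv_eqI: "(p has_derivative f) (at x) \<Longrightarrow> dir_deriv d p x = f d"
  by (metis dir_deriv_def frechet_derivative_at)

lemma dir_deriv_const [simp]: "dir_deriv d (\<lambda>x. c) x = 0"
  by (rule dir_deriv_eqI[of _ "\<lambda>_. 0"]) simp

lemma dir_deriv_add:
  "p \<in> Poly m \<Longrightarrow> q \<in> Poly n \<Longrightarrow> dir_deriv d (\<lambda>x. p x + q x) x = dir_deriv d p x + dir_deriv d q x"
  by (rule dir_deriv_eqI[OF has_derivative_add[OF Poly_has_derivative Poly_has_derivative]])

lemma dir_deriv_diff:
  "p \<in> Poly m \<Longrightarrow> q \<in> Poly n \<Longrightarrow> dir_deriv d (\<lambda>x. p x - q x) x = dir_deriv d p x - dir_deriv d q x"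
  by (rule dir_deriv_eqI[OF has_derivative_diff[OF Poly_has_derivative Poly_has_derivative]])

lemma dir_deriv_cmult:
  "p \<in> Poly m \<Longrightarrow> dir_deriv d (\<lambda>x. r * p x) x = r * dir_deriv d p x"
  by (rule dir_deriv_eqI[OF has_derivative_mult_right[OF Poly_has_derivative]])

lemma dir_deriv_mult:
  "p \<in> Poly m \<Longrightarrow> q \<in> Poly n \<Longrightarrow> dir_deriv d (\<lambda>x. p x * q x) x = p x * dir_deriv d q x + dir_deriv d p x * q x"
  by (rule dir_deriv_eqI[OF has_derivative_mult[OF Poly_has_derivative Poly_has_derivative]])

lemma dir_deriv_sum:
  assumes "\<And>i. i \<in> I \<Longrightarrow> p i \<in> Poly m"
  shows "dir_deriv d (\<lambda>x. \<Sum>i\<in>I. p i x) x = (\<Sum>i\<in>I. dir_deriv d (p i) x)"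
  by (rule dir_deriv_eqI[OF has_derivative_sum]) (rule Poly_has_derivative[OF assms])

lemma dir_deriv_monomial:
  "dir_deriv d (\<lambda>x. (x$1)^i * (x$2)^j) x =
     d$1 * (of_nat i * (x$1)^(i-1) * (x$2)^j) + d$2 * (of_nat j * (x$1)^i * (x$2)^(j-1))"
proof -
  have n: "((\<lambda>x. x $ k) has_derivative (\<lambda>h. h $ k)) (at x)" for k and x :: point
    by (intro bounded_linear_imp_has_derivative bounded_linear_vec_nth)
  have "((\<lambda>x. (x$1)^i * (x$2)^j) has_derivative
    (\<lambda>d. (x$1)^i * (of_nat j * d$2 * (x$2)^(j-1)) + (of_nat i * d$1 * (x$1)^(i-1)) * (x$2)^j)) (at x)"
    by (intro has_derivative_mult has_derivative_power n)
  from dir_deriv_eqI[OF this] show ?thesis by (simp add: algebra_simps)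
qed

lemma dir_deriv_linear:
  assumes "p \<in> Poly m"
  shows "linear (\<lambda>d. dir_deriv d p x)"
  using Poly_has_derivative[OF assms] by (rule has_derivative_linear)

lemma dir_deriv_coords:
  assumes "p \<in> Poly m"
  shows "dir_deriv d p x = d$1 * dir_deriv (axis 1 1) p x + d$2 * dir_deriv (axis 2 1) p x"
proof -
  have "d = d$1 *\<^sub>R axis 1 1 + d$2 *\<^sub>R axis 2 1"
    by (simp add: vec_eq_iff forall_2 axis_def)
  then show ?thesis
    using linear_add[OF dir_deriv_linear[OF assms]] linear_cmul[OF dir_deriv_linear[OF assms]]
    by (metis real_scaleR_def)
qed

lemma dir_deriv_Poly: "p \<in> Poly m \<Longrightarrow> dir_deriv d p \<in> Poly (m - 1)"
proof (induction rule: Poly_induct)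
  case zero
  have "dir_deriv d (\<lambda>x. 0) = (\<lambda>x. 0)" by auto
  then show ?case by simp
next
  case (step c i j q)
  have m: "(\<lambda>x. (x$1)^i * (x$2)^j) \<in> Poly m" using step by (intro Poly_monomial)
  have "dir_deriv d (\<lambda>x. c * ((x$1)^i * (x$2)^j) + q x) =
    (\<lambda>x. c * (d$1 * (of_nat i * ((x$1)^(i-1) * (x$2)^j)) + d$2 * (of_nat j * ((x$1)^i * (x$2)^(j-1)))) + dir_deriv d q x)"
    by (rule ext, subst dir_deriv_add[OF Poly_cmult[OF m] step(2)], subst dir_deriv_cmult[OF m])
      (simp add: dir_deriv_monomial algebra_simps)
  moreover have "(\<lambda>x. of_nat i * ((x$1)^(i-1) * (x$2)^j)) \<in> Poly (m - 1)"
    using step(1) Poly_monomial[of "i-1" j "m-1"] by (cases i) (auto intro!: Poly_cmult)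
  moreover have "(\<lambda>x. of_nat j * ((x$1)^i * (x$2)^(j-1))) \<in> Poly (m - 1)"
    using step(1) Poly_monomial[of i "j-1" "m-1"] by (cases j) (auto intro!: Poly_cmult)
  ultimately show ?case using step by (auto intro!: Poly_add Poly_cmult)
qed

lemma dir_deriv_shift:
  assumes "p \<in> Poly m"
  shows "dir_deriv d (\<lambda>x. p (z + h *\<^sub>R x)) x = h * dir_deriv d p (z + h *\<^sub>R x)"
proof -
  have "((\<lambda>x. p (z + h *\<^sub>R x)) has_derivative (\<lambda>d. dir_deriv (h *\<^sub>R d) p (z + h *\<^sub>R x))) (at x)"
    by (rule has_derivative_compose[of "\<lambda>x. z + h *\<^sub>R x" _ x UNIV p, OF _ Poly_has_derivative[OF assms]])
       (auto intro!: derivative_eq_intros)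
  from dir_deriv_eqI[OF this] show ?thesis
    using linear_cmul[OF dir_deriv_linear[OF assms]] by simp
qed

lemma Poly_line_deriv:
  assumes "p \<in> Poly m"
  shows "((\<lambda>s. p (a + s *\<^sub>R d)) has_real_derivative dir_deriv d p (a + s *\<^sub>R d)) (at s within S)"
proof -
  have "((\<lambda>s. p (a + s *\<^sub>R d)) has_derivative (\<lambda>r. dir_deriv (r *\<^sub>R d) p (a + s *\<^sub>R d))) (at s within S)"
    by (rule has_derivative_compose[of "\<lambda>s. a + s *\<^sub>R d" _ s S p, OF _ Poly_has_derivative[OF assms]])
       (auto intro!: derivative_eq_intros)
  then show ?thesis
    using linear_cmul[OF dir_deriv_linear[OF assms]]
    by (auto simp: has_field_derivative_def mult.commute elim!: has_derivative_eq_rhs)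
qed

lemma Poly_continuous_on: "p \<in> Poly m \<Longrightarrow> continuous_on S p"
  by (meson Poly_has_derivative continuous_at_imp_continuous_on has_derivative_continuous)

section \<open>Polynomials of one variable\<close>

text \<open>These are the traces of \<open>Poly m\<close> on parametrized lines. The definition as a
  span makes subspace properties and finite dimension immediate, which coefficients would
  not.\<close>

definition Poly1 :: "int \<Rightarrow> (real \<Rightarrow> real) set" where
  "Poly1 m = span ((\<lambda>k s. s ^ k) ` {k. int k \<le> m})"

lemma subspace_Poly1: "subspace (Poly1 m)"
  by (simp add: Poly1_def)

lemma findim_Poly1: "findim (Poly1 m)"
proof -
  have "finite {k. int k \<le> m}" by (rule finite_subset[of _ "{..nat m}"]) auto
  then show ?thesis unfolding Poly1_def by (intro findim_span) auto
qed

lemma Poly1_monomial: "int k \<le> m \<Longrightarrow> (\<lambda>s. s ^ k) \<in> Poly1 m"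
  unfolding Poly1_def by (intro span_base) auto

lemma Poly1_add: "f \<in> Poly1 m \<Longrightarrow> g \<in> Poly1 m \<Longrightarrow> (\<lambda>s. f s + g s) \<in> Poly1 m"
  using subspace_add[OF subspace_Poly1, of f m g] by (simp add: plus_fun_def)

lemma Poly1_cmult: "f \<in> Poly1 m \<Longrightarrow> (\<lambda>s. r * f s) \<in> Poly1 m"
  using subspace_scale[OF subspace_Poly1, of f m r] by (simp add: scaleR_fun_def)

lemma Poly1_zero [simp]: "(\<lambda>s. 0) \<in> Poly1 m"
  using subspace_0[OF subspace_Poly1, of m] by (simp add: zero_fun_def)

lemma Poly1_induct [consumes 1, case_names zero step]:
  assumes "p \<in> Poly1 m" "P (\<lambda>s. 0)"
    "\<And>c k q. int k \<le> m \<Longrightarrow> q \<in> Poly1 m \<Longrightarrow> P q \<Longrightarrow> P (\<lambda>s. c * s ^ k + q s)"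
  shows "P p"
proof -
  have "p \<in> Poly1 m \<and> P p"
    using assms(1) unfolding Poly1_def
  proof (induction rule: span_induct_alt)
    case base
    show ?case using assms(2) Poly1_zero[of m, unfolded Poly1_def] by (simp add: zero_fun_def)
  next
    case (step c x y)
    then obtain k where k: "int k \<le> m" "x = (\<lambda>s. s ^ k)" by auto
    have "c *\<^sub>R x + y = (\<lambda>s. c * s ^ k + y s)" by (simp add: k plus_fun_def scaleR_fun_def)
    moreover have "(\<lambda>s. c * s ^ k + y s) \<in> Poly1 m" "P (\<lambda>s. c * s ^ k + y s)"
      using step k assms(3)[of k y c]
      by (auto intro!: Poly1_add Poly1_cmult Poly1_monomial simp: Poly1_def[symmetric])
    ultimately show ?case by (simp add: Poly1_def[symmetric])
  qed
  then show ?thesis ..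
qed

lemma Poly1_const [simp]: "0 \<le> m \<Longrightarrow> (\<lambda>s. c) \<in> Poly1 m"
  using Poly1_cmult[OF Poly1_monomial[of 0 m], of c] by simp

lemma Poly1_mono: "p \<in> Poly1 m \<Longrightarrow> m \<le> n \<Longrightarrow> p \<in> Poly1 n"
  by (induction rule: Poly1_induct) (auto intro!: Poly1_add Poly1_cmult Poly1_monomial)

lemma Poly1_mult:
  assumes "p \<in> Poly1 m" "q \<in> Poly1 n"
  shows "(\<lambda>s. p s * q s) \<in> Poly1 (m + n)"
proof -
  have *: "(\<lambda>s. s ^ k * q s) \<in> Poly1 (m + n)" if "int k \<le> m" for k
    using assms(2)
  proof (induction rule: Poly1_induct)
    case (step c l q)
    have "(\<lambda>s. c * s ^ (k + l) + s ^ k * q s) \<in> Poly1 (m + n)"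
      using step that by (intro Poly1_add Poly1_cmult Poly1_monomial) auto
    then show ?case by (simp add: power_add algebra_simps)
  qed auto
  show ?thesis using assms(1)
  proof (induction rule: Poly1_induct)
    case (step c k p)
    have "(\<lambda>s. c * (s ^ k * q s) + p s * q s) \<in> Poly1 (m + n)"
      using step * by (intro Poly1_add Poly1_cmult) auto
    then show ?case by (simp add: algebra_simps)
  qed auto
qed

lemma Poly1_power: "p \<in> Poly1 1 \<Longrightarrow> (\<lambda>x. p x ^ k) \<in> Poly1 (int k)"
proof (induction k)
  case (Suc k)
  then show ?case using Poly1_mult[of p 1 "\<lambda>x. p x ^ k" "int k"] by (simp add: algebra_simps)
qed auto

lemma Poly1_line:
  assumes "p \<in> Poly m"
  shows "(\<lambda>s. p (a + s *\<^sub>R d)) \<in> Poly1 m"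
  using assms
proof (induction rule: Poly_induct)
  case (step c i j q)
  have "(\<lambda>s. a $ k + s * d $ k) \<in> Poly1 1" for k
    using Poly1_add[of "\<lambda>s. a $ k" 1 "\<lambda>s. d $ k * s ^ 1"] Poly1_cmult[OF Poly1_monomial[of 1 1], of "d $ k"]
    by (simp add: mult.commute)
  then have "(\<lambda>s. (a $ 1 + s * d $ 1)^i * (a $ 2 + s * d $ 2)^j) \<in> Poly1 (int i + int j)"
    by (intro Poly1_mult Poly1_power)
  then have "(\<lambda>s. (a $ 1 + s * d $ 1)^i * (a $ 2 + s * d $ 2)^j) \<in> Poly1 m"
    using Poly1_mono step(1) by blast
  then show ?case using step by (auto intro!: Poly1_add Poly1_cmult)
qed auto

text \<open>The converse of \<open>Poly1_line\<close>: with an affine coordinate for \<phi>, a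
  polynomial prescribed on an edge is extended to the plane without raising the degree.\<close>

lemma Poly_of_Poly1:
  assumes "g \<in> Poly1 m" "\<phi> \<in> Poly 1"
  shows "(\<lambda>x. g (\<phi> x)) \<in> Poly m"
  using assms(1)
proof (induction rule: Poly1_induct)
  case (step c k q)
  have "(\<lambda>x. \<phi> x ^ k) \<in> Poly m" using Poly_power[OF assms(2), of k] step(1) Poly_mono by blast
  then show ?case using step by (auto intro!: Poly_add Poly_cmult)
qed auto

lemma Poly1_has_derivative:
  assumes "g \<in> Poly1 m"
  shows "(g has_real_derivative deriv g s) (at s)"
proof -
  have "g field_differentiable at s"
    using assms
  proof (induction rule: Poly1_induct)
    case (step c k q)
    then show ?case by (intro derivative_intros)
  qed auto
  then show ?thesis by (simp add: DERIV_deriv_iff_field_differentiable)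
qed

lemma Poly1_deriv: "g \<in> Poly1 m \<Longrightarrow> deriv g \<in> Poly1 m"
proof (induction rule: Poly1_induct)
  case (step c k q)
  have "deriv (\<lambda>s. c * s ^ k + q s) s = c * (of_nat k * s ^ (k - 1)) + deriv q s" for s
    by (rule DERIV_imp_deriv) (auto intro!: derivative_eq_intros Poly1_has_derivative[OF step(2)])
  then have "deriv (\<lambda>s. c * s ^ k + q s) = (\<lambda>s. c * (of_nat k * s ^ (k - 1)) + deriv q s)" by auto
  then show ?case using step by (auto intro!: Poly1_add Poly1_cmult Poly1_monomial)
qed auto

lemma Poly1_continuous_on: "g \<in> Poly1 m \<Longrightarrow> continuous_on S g"
  by (meson Poly1_has_derivative DERIV_isCont continuous_at_imp_continuous_on)

lemma Poly1_poly: "g \<in> Poly1 m \<Longrightarrow> \<exists>q::real poly. g = poly q"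
proof (induction rule: Poly1_induct)
  case zero
  then show ?case by (intro exI[of _ 0]) auto
next
  case (step c k q)
  then obtain r :: "real poly" where "q = poly r" by auto
  then show ?case by (intro exI[of _ "monom c k + r"]) (auto simp: poly_monom)
qed

lemma Poly1_eq_0:
  assumes "g \<in> Poly1 m" "infinite {s. g s = 0}"
  shows "g = (\<lambda>s. 0)"
proof -
  obtain q :: "real poly" where q: "g = poly q" using Poly1_poly[OF assms(1)] by auto
  then have "q = 0" using assms(2) poly_roots_finite[of q] by auto
  then show ?thesis using q by auto
qed

text \<open>On the line from a point z of T through x the polynomial has one variable, and it
  vanishes for all small parameters because T is open around z. Infinitely many zeros make it vanish
  at parameter 1, which is the point x.\<close>

lemma Poly_eq_0:
  assumes "p \<in> Poly m" "open T" "T \<noteq> {}" "\<And>x. x \<in> T \<Longrightarrow> p x = 0"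
  shows "p = (\<lambda>x. 0)"
proof
  fix x
  obtain z where z: "z \<in> T" using assms by auto
  let ?g = "\<lambda>s. p (z + s *\<^sub>R (x - z))"
  have "open ((\<lambda>s::real. z + s *\<^sub>R (x - z)) -` T)"
    using assms(2) by (intro open_vimage continuous_intros) auto
  moreover have "0 \<in> (\<lambda>s::real. z + s *\<^sub>R (x - z)) -` T" using z by simp
  ultimately obtain e where "e > 0" "ball 0 e \<subseteq> (\<lambda>s::real. z + s *\<^sub>R (x - z)) -` T"
    using open_contains_ball by blast
  then have "infinite ((\<lambda>s::real. z + s *\<^sub>R (x - z)) -` T)"
    using infinite_super[of "{0<..<e}" "(\<lambda>s::real. z + s *\<^sub>R (x - z)) -` T"] infinite_Ioo[of 0 e]
    by (force simp: subset_eq dist_real_def)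
  moreover have "((\<lambda>s::real. z + s *\<^sub>R (x - z)) -` T) \<subseteq> {s. ?g s = 0}" using assms(4) by auto
  ultimately have "?g = (\<lambda>s. 0)"
    using Poly1_eq_0[OF Poly1_line[OF assms(1)]] finite_subset by blast
  then have "?g 1 = 0" by metis
  then show "p x = 0" by simp
qed

section \<open>Hessians\<close>

lemma hess_nth: "hess q x $ i $ j = dir_deriv (axis i 1) (dir_deriv (axis j 1) q) x"
  by (simp add: hess_def)

lemma dir_deriv_dir_deriv_add:
  assumes "p \<in> Poly m" "q \<in> Poly n"
  shows "dir_deriv d (dir_deriv e (\<lambda>x. p x + q x)) x = dir_deriv d (dir_deriv e p) x + dir_deriv d (dir_deriv e q) x"
proof -
  have "dir_deriv e (\<lambda>x. p x + q x) = (\<lambda>x. dir_deriv e p x + dir_deriv e q x)"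
    using dir_deriv_add[OF assms] by auto
  then show ?thesis using dir_deriv_add[OF dir_deriv_Poly[OF assms(1)] dir_deriv_Poly[OF assms(2)]] by simp
qed

lemma dir_deriv_dir_deriv_cmult:
  assumes "p \<in> Poly m"
  shows "dir_deriv d (dir_deriv e (\<lambda>x. r * p x)) x = r * dir_deriv d (dir_deriv e p) x"
proof -
  have "dir_deriv e (\<lambda>x. r * p x) = (\<lambda>x. r * dir_deriv e p x)"
    using dir_deriv_cmult[OF assms] by auto
  then show ?thesis using dir_deriv_cmult[OF dir_deriv_Poly[OF assms(1)]] by simp
qed

lemma hess_add:
  "p \<in> Poly m \<Longrightarrow> q \<in> Poly n \<Longrightarrow> hess (\<lambda>x. p x + q x) x = hess p x + hess q x"
  by (simp add: vec_eq_iff hess_nth dir_deriv_dir_deriv_add)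

lemma hess_cmult:
  "p \<in> Poly m \<Longrightarrow> hess (\<lambda>x. r * p x) x = r *\<^sub>R hess p x"
  by (simp add: vec_eq_iff hess_nth dir_deriv_dir_deriv_cmult)

lemma hess_zero [simp]: "hess (\<lambda>x. 0) x = 0"
proof -
  have "dir_deriv e (\<lambda>x. 0) = (\<lambda>x. 0)" for e by auto
  then show ?thesis by (simp add: vec_eq_iff hess_nth)
qed

lemma dir_deriv_commute:
  "p \<in> Poly m \<Longrightarrow> dir_deriv d (dir_deriv e p) x = dir_deriv e (dir_deriv d p) x"
proof (induction rule: Poly_induct)
  case zero
  have "dir_deriv e (\<lambda>x. 0) = (\<lambda>x. 0)" for e by auto
  then show ?case by simp
next
  case (step c i j q)
  let ?m = "\<lambda>i j x::point. (x$1)^i * (x$2)^j"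
  have mP: "?m i j \<in> Poly (int i + int j)" for i j by (rule Poly_monomial) simp
  have 1: "dir_deriv e (?m i j) = (\<lambda>x. (e$1 * of_nat i) * ?m (i-1) j x + (e$2 * of_nat j) * ?m i (j-1) x)" for e
    by (auto simp: fun_eq_iff dir_deriv_monomial)
  have 2: "dir_deriv d (dir_deriv e (?m i j)) x =
     (e$1 * of_nat i) * dir_deriv d (?m (i-1) j) x + (e$2 * of_nat j) * dir_deriv d (?m i (j-1)) x" for d e
    unfolding 1
    by (subst dir_deriv_add[OF Poly_cmult[OF mP] Poly_cmult[OF mP]], subst (1 2) dir_deriv_cmult[OF mP]) simp
  have 3: "dir_deriv d (dir_deriv e (?m i j)) x = dir_deriv e (dir_deriv d (?m i j)) x"
    unfolding 2 dir_deriv_monomial by (simp add: algebra_simps)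
  show ?case
    unfolding dir_deriv_dir_deriv_add[OF Poly_cmult[OF mP] step(2)] dir_deriv_dir_deriv_cmult[OF mP]
    using 3 step by simp
qed

lemma hess_Poly: "q \<in> Poly m \<Longrightarrow> (\<lambda>x. hess q x $ i $ j) \<in> Poly (m - 2)"
  using dir_deriv_Poly[OF dir_deriv_Poly, of q m "axis i 1" "axis j 1"] by (simp add: hess_nth)

lemma hess_Poly_sym: "q \<in> Poly (m + 2) \<Longrightarrow> hess q \<in> Poly_sym m"
  using hess_Poly[of q "m + 2"] dir_deriv_commute[of q "m + 2"]
  by (auto simp: Poly_sym_def sym_tensors_def vec_eq_iff transpose_def hess_nth)

lemma quadratic_form_2: "y \<bullet> (A *v y) = y$1*y$1*A$1$1 + y$1*y$2*(A$1$2 + A$2$1) + y$2*y$2*A$2$2"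
  for y :: point and A :: tensor
  by (simp add: inner_vec_def matrix_vector_mult_def sum_2 algebra_simps)

text \<open>Turns the Hessian into a second derivative along a line, the form required by Taylor's
  formula on rays and by Euler's identity.\<close>

lemma hess_quadratic_form:
  assumes "q \<in> Poly m"
  shows "y \<bullet> (hess q x *v y) = dir_deriv y (dir_deriv y q) x"
proof -
  let ?d = "\<lambda>k. dir_deriv (axis k 1) q"
  have 1: "dir_deriv y q = (\<lambda>x. y$1 * ?d 1 x + y$2 * ?d 2 x)"
    by (rule ext) (rule dir_deriv_coords[OF assms])
  have P: "?d k \<in> Poly (m - 1)" for k using dir_deriv_Poly[OF assms] .
  have "dir_deriv y (dir_deriv y q) x = y$1 * dir_deriv y (?d 1) x + y$2 * dir_deriv y (?d 2) x"
    unfolding 1 by (simp add: dir_deriv_add[OF Poly_cmult[OF P] Poly_cmult[OF P]] dir_deriv_cmult[OF P])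
  then show ?thesis
    unfolding quadratic_form_2 by (simp add: dir_deriv_coords[OF P, of y] hess_nth algebra_simps)
qed

section \<open>Integrals of continuous functions\<close>

text \<open>The operators and norms integrate with respect to \<open>lebesgue\<close>, while scaling
  and Fubini are carried out for \<open>lborel\<close>. For continuous functions on bounded Borel
  sets the two integrals agree.\<close>

lemma set_integrable_continuous:
  fixes f :: "'a::euclidean_space \<Rightarrow> 'b::{banach, second_countable_topology}"
  assumes "bounded T" "T \<in> sets borel" "continuous_on UNIV f"
  shows "set_integrable lborel T f" "set_integrable lebesgue T f"
    "(LINT x:T|lebesgue. f x) = (LINT x:T|lborel. f x)" (is ?A)
proof -
  have "compact (closure T)" using assms(1) by (simp add: compact_closure)
  then have "set_integrable lborel (closure T) f"
    unfolding set_integrable_def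
    using borel_integrable_compact continuous_on_subset[OF assms(3)] by blast
  then show 1: "set_integrable lborel T f"
    using set_integrable_subset closure_subset assms(2) by (metis sets_lborel)
  then have m: "(\<lambda>x. indicator T x *\<^sub>R f x) \<in> borel_measurable lborel"
    by (simp add: set_integrable_def)
  show "set_integrable lebesgue T f"
    using 1 m by (simp add: set_integrable_def integrable_completion)
  show ?A
    unfolding set_lebesgue_integral_def using m by (simp add: integral_completion)
qed

lemma set_integral_ge_0:
  fixes f :: "'a \<Rightarrow> real"
  shows "(\<And>x. x \<in> T \<Longrightarrow> 0 \<le> f x) \<Longrightarrow> 0 \<le> (LINT x:T|M. f x)"
  unfolding set_lebesgue_integral_def by (intro Bochner_Integration.integral_nonneg) (auto simp: indicator_def)

text \<open>The part of U where f is positive is open; if it contained a point it would not be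
  negligible, although f vanishes almost everywhere on T. The set U is separate from T so that T may
  be a closed interval.\<close>

lemma set_integral_nonneg_eq_0:
  fixes f :: "'a::euclidean_space \<Rightarrow> real"
  assumes "open U" "U \<subseteq> T" "T \<in> sets borel" "set_integrable lborel T f" "continuous_on UNIV f"
    "\<And>x. x \<in> T \<Longrightarrow> 0 \<le> f x" "(LINT x:T|lborel. f x) = 0" "x \<in> U"
  shows "f x = 0"
proof (rule ccontr)
  assume "f x \<noteq> 0"
  define S where "S = U \<inter> f -` {0<..}"
  have "open S" unfolding S_def using assms(1,5) by (intro open_Int open_vimage) auto
  moreover have "x \<in> S" using \<open>f x \<noteq> 0\<close> assms(2,6,8) by (force simp: S_def)
  ultimately have "\<not> negligible S" using open_not_negligible by blast
  have "AE x in lborel. indicator T x *\<^sub>R f x = 0"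
    using assms(4,6,7) unfolding set_integrable_def set_lebesgue_integral_def
    by (subst integral_nonneg_eq_0_iff_AE[symmetric]) (auto simp: indicator_def)
  then have "AE x in lborel. x \<notin> S"
    by eventually_elim (use assms(2) in \<open>auto simp: S_def indicator_def\<close>)
  then have "S \<in> null_sets lborel"
    using \<open>open S\<close> by (simp add: AE_iff_null_sets borel_open)
  then show False using \<open>\<not> negligible S\<close> negligible_iff_null_sets null_sets_completionI by blast
qed

text \<open>The weight is there for the factor s (1 - s) on edges, where it measures polynomials
  that vanish at both endpoints.\<close>

lemma semi_inner_integral:
  fixes T :: "'a::euclidean_space set"
  assumes "bounded T" "T \<in> sets borel" "continuous_on UNIV w" "\<And>x. x \<in> T \<Longrightarrow> 0 \<le> w x"
  shows "semi_inner {f :: 'a \<Rightarrow> 'b::euclidean_space. continuous_on UNIV f}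
    (\<lambda>f g. LINT x:T|lborel. w x * (f x \<bullet> g x))"
proof -
  have i: "set_integrable lborel T (\<lambda>x. w x * (f x \<bullet> g x))"
    if "continuous_on UNIV f" "continuous_on UNIV g" for f g :: "'a \<Rightarrow> 'b"
    using that assms by (intro set_integrable_continuous continuous_intros)
  define Q where "Q = (\<lambda>f g. LINT x:T|lborel. w x * ((f :: 'a \<Rightarrow> 'b) x \<bullet> g x))"
  have comm: "Q f g = Q g f" for f g by (simp add: Q_def inner_commute)
  have add: "Q (f + g) k = Q f k + Q g k"
    if "continuous_on UNIV f" "continuous_on UNIV g" "continuous_on UNIV k" for f g k
    using set_integral_add(2)[OF i[OF that(1,3)] i[OF that(2,3)]] by (simp add: Q_def inner_add_left distrib_left)
  have scale: "Q (r *\<^sub>R f) g = r * Q f g" for r f g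
    unfolding Q_def by (subst set_integral_mult_right[symmetric]) (simp add: mult.left_commute)
  have "subspace {f :: 'a \<Rightarrow> 'b. continuous_on UNIV f}"
    by (auto intro!: subspaceI continuous_intros simp: plus_fun_def scaleR_fun_def zero_fun_def)
  moreover have "0 \<le> Q f f" for f
    using assms(4) unfolding Q_def by (intro set_integral_ge_0) auto
  moreover have "Q f (g + k) = Q f g + Q f k"
    if "continuous_on UNIV f" "continuous_on UNIV g" "continuous_on UNIV k" for f g k
    using add[OF that(2,3,1)] by (simp only: comm[of f])
  moreover have "Q f (r *\<^sub>R g) = r * Q f g" for r f g
    using scale[of r g f] by (simp only: comm[of f])
  ultimately show ?thesis
    unfolding semi_inner_def bilinear_on_def Q_def[symmetric] using comm add scale
    by (intro conjI ballI allI) (simp_all only: mem_Collect_eq)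
qed

abbreviation contfuns :: "('a::topological_space \<Rightarrow> 'b::topological_space) set" where
  "contfuns \<equiv> {f. continuous_on UNIV f}"

lemma semi_inner_region:
  assumes "open T" "bounded T"
  shows "semi_inner contfuns (\<lambda>(f :: point \<Rightarrow> 'b::euclidean_space) g. LINT x:T|lebesgue. f x \<bullet> g x)"
proof -
  have eq: "(LINT x:T|lebesgue. f x \<bullet> g x) = (LINT x:T|lborel. 1 * (f x \<bullet> g x))"
    if "f \<in> contfuns" "g \<in> contfuns" for f g :: "point \<Rightarrow> 'b"
    using set_integrable_continuous(3)[of T "\<lambda>x. f x \<bullet> g x"] that assms
    by (auto intro!: continuous_intros)
  have s: "semi_inner contfuns (\<lambda>(f :: point \<Rightarrow> 'b) g. LINT x:T|lborel. 1 * (f x \<bullet> g x))"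
    using assms by (intro semi_inner_integral) auto
  have *: "semi_inner V Q'" if "semi_inner V Q" "\<And>x y. x \<in> V \<Longrightarrow> y \<in> V \<Longrightarrow> Q' x y = Q x y"
    for V :: "(point \<Rightarrow> 'b) set" and Q Q'
    using that subspace_add[of V] subspace_scale[of V] unfolding semi_inner_def bilinear_on_def by simp
  show ?thesis by (rule *[OF s]) (rule eq)
qed

lemma lborel_integral_scale:
  fixes f :: "'a::euclidean_space \<Rightarrow> real"
  assumes "f \<in> borel_measurable borel" "h > 0"
  shows "(\<integral>x. f x \<partial>lborel) = h ^ DIM('a) * (\<integral>x. f (z + h *\<^sub>R x) \<partial>lborel)"
proof -
  have "(\<integral>x. f x \<partial>lborel) = (\<integral>x. f x \<partial>density (distr lborel borel (\<lambda>x. z + h *\<^sub>R x)) (\<lambda>_. ennreal (h ^ DIM('a))))"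
    using lborel_affine[of h z] assms(2) by simp
  also have "\<dots> = (\<integral>x. h ^ DIM('a) * f x \<partial>distr lborel borel (\<lambda>x. z + h *\<^sub>R x))"
    using assms by (subst integral_density) auto
  also have "\<dots> = (\<integral>x. h ^ DIM('a) * f (z + h *\<^sub>R x) \<partial>lborel)"
    using assms by (subst integral_distr) auto
  finally show ?thesis by simp
qed

lemma inner_on_Poly:
  assumes "open T" "bounded T" "T \<noteq> {}"
  shows "inner_on (Poly m) (\<lambda>p q. LINT x:T|lebesgue. p x * q x)"
proof -
  have "semi_inner (Poly m) (\<lambda>p q. LINT x:T|lebesgue. p x * q x)"
    using semi_inner_subset[OF semi_inner_region[OF assms(1,2), where 'b = real] _ subspace_Poly[of m]]
      Poly_continuous_on by (auto simp: subset_eq)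
  moreover have "p = 0" if p: "p \<in> Poly m" "(LINT x:T|lebesgue. p x * p x) = 0" for p
  proof -
    have c: "continuous_on UNIV (\<lambda>x. p x * p x)" using Poly_continuous_on[OF p(1)] by (intro continuous_intros)
    note s = set_integrable_continuous[OF assms(2) borel_open[OF assms(1)] c]
    have "p x * p x = 0" if "x \<in> T" for x
      using set_integral_nonneg_eq_0[OF assms(1) order_refl borel_open[OF assms(1)] s(1) c _ _ that] s(3) p(2)
      by simp
    then show ?thesis using Poly_eq_0[OF p(1) assms(1,3)] by (simp add: zero_fun_def)
  qed
  ultimately show ?thesis by (simp add: inner_on_def)
qed

lemma set_integral_mono_subset:
  fixes f :: "point \<Rightarrow> real"
  assumes "open S" "open T" "bounded T" "S \<subseteq> T" "continuous_on UNIV f" "\<And>x. 0 \<le> f x"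
  shows "(LINT x:S|lebesgue. f x) \<le> (LINT x:T|lebesgue. f x)"
proof -
  have "set_integrable lebesgue S f" "set_integrable lebesgue T f"
    using assms by (auto intro!: set_integrable_continuous bounded_subset[of T S])
  then show ?thesis unfolding set_integrable_def set_lebesgue_integral_def
    using assms by (intro integral_mono) (auto simp: indicator_def)
qed

text \<open>The area of the disk is rounded up from pi to 4 so that the bound is a perfect square
  and disappears under the root of an L2 norm.\<close>

lemma measure_open_le:
  fixes T :: region
  assumes "open T" "T \<subseteq> cball z h" "0 \<le> h"
  shows "measure lebesgue T \<le> (2 * h)\<^sup>2"
proof -
  have "measure lebesgue T \<le> measure lebesgue (cball z h)"
    using assms by (intro measure_mono_fmeasurable) (auto simp: lmeasurable_cball)
  also have "\<dots> = pi * h\<^sup>2" using content_cball[OF assms(3), of z] by (simp add: unit_ball_vol_2)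
  also have "\<dots> \<le> 4 * h\<^sup>2" using pi_less_4 by (intro mult_right_mono) auto
  finally show ?thesis by (simp add: power_mult_distrib)
qed

lemma integral_norm_sq_le:
  fixes f :: "point \<Rightarrow> 'b::euclidean_space"
  assumes "open T" "T \<subseteq> cball z h" "0 \<le> h" "continuous_on UNIV f" "\<And>x. x \<in> T \<Longrightarrow> norm (f x) \<le> c"
  shows "(LINT x:T|lebesgue. (norm (f x))\<^sup>2) \<le> (2 * h * c)\<^sup>2"
proof -
  have b: "bounded T" using assms bounded_subset bounded_cball by blast
  have "(LINT x:T|lebesgue. (norm (f x))\<^sup>2) \<le> (LINT x:T|lebesgue. c\<^sup>2)"
    using assms b by (intro set_integral_mono set_integrable_continuous continuous_intros) (auto intro!: power_mono)
  also have "\<dots> = measure lebesgue T * c\<^sup>2"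
    using assms b by (simp add: set_lebesgue_integral_def)
  also have "\<dots> \<le> (2 * h)\<^sup>2 * c\<^sup>2" using measure_open_le[OF assms(1-3)] by (intro mult_right_mono) auto
  finally show ?thesis by (simp add: power_mult_distrib)
qed

section \<open>Inverse estimates from a disk\<close>

lemma dir_deriv_bound:
  assumes "p \<in> Poly m"
  shows "\<bar>dir_deriv d p x\<bar> \<le> norm d * (\<bar>dir_deriv (axis 1 1) p x\<bar> + \<bar>dir_deriv (axis 2 1) p x\<bar>)"
proof -
  have "\<bar>dir_deriv d p x\<bar> \<le> \<bar>d$1\<bar> * \<bar>dir_deriv (axis 1 1) p x\<bar> + \<bar>d$2\<bar> * \<bar>dir_deriv (axis 2 1) p x\<bar>"
    by (subst dir_deriv_coords[OF assms]) (metis abs_mult abs_triangle_ineq)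
  also have "\<dots> \<le> norm d * \<bar>dir_deriv (axis 1 1) p x\<bar> + norm d * \<bar>dir_deriv (axis 2 1) p x\<bar>"
    by (intro add_mono mult_right_mono component_le_norm_cart) auto
  finally show ?thesis by (simp add: algebra_simps)
qed

text \<open>For each point of a compact disk, the value and the two partial derivatives there give a
  seminorm on the finite-dimensional space \<open>Poly m\<close>; continuity bounds the family on
  each polynomial, so a single constant serves all points. The radius 2 covers points at distance up
  to two diameters from the centre of the inner disk.\<close>

lemma Poly_inverse_ineq_reference:
  assumes "0 < \<kappa>"
  shows "\<exists>C>0. \<forall>p\<in>Poly m. \<forall>x\<in>cball 0 2. \<forall>d.
    \<bar>p x\<bar> \<le> C * sqrt (LINT x:ball 0 \<kappa>|lebesgue. (p x)\<^sup>2) \<and>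
    \<bar>dir_deriv d p x\<bar> \<le> C * norm d * sqrt (LINT x:ball 0 \<kappa>|lebesgue. (p x)\<^sup>2)"
proof -
  let ?N = "\<lambda>x p. \<bar>p x\<bar> + \<bar>dir_deriv (axis 1 1) p x\<bar> + \<bar>dir_deriv (axis 2 1) p x\<bar>"
  let ?Q = "\<lambda>p q. LINT x:ball 0 \<kappa>|lebesgue. p x * (q x :: real)"
  have "\<exists>C>0. \<forall>x\<in>cball 0 2. \<forall>p\<in>Poly m. ?N x p \<le> C * sqrt (?Q p p)"
  proof (rule inner_on_seminorm_bound[OF inner_on_Poly findim_Poly])
    fix x :: point and p q assume "p \<in> Poly m" "q \<in> Poly m"
    then show "?N x (p + q) \<le> ?N x p + ?N x q"
      using dir_deriv_add[of p m q m] by (auto simp: plus_fun_def)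
  next
    fix x :: point and p r assume "p \<in> Poly m"
    then show "?N x (r *\<^sub>R p) \<le> \<bar>r\<bar> * ?N x p"
      using dir_deriv_cmult[of p m] by (auto simp: scaleR_fun_def abs_mult algebra_simps)
  next
    fix p assume p: "p \<in> Poly m"
    have "continuous_on (cball 0 2) (\<lambda>x. ?N x p)"
      using p dir_deriv_Poly by (intro continuous_intros Poly_continuous_on)
    then have "bounded ((\<lambda>x. ?N x p) ` cball 0 2)"
      by (intro compact_imp_bounded compact_continuous_image) auto
    then show "\<exists>K. \<forall>x\<in>cball 0 2. ?N x p \<le> K"
      by (auto simp: bounded_iff intro: order_trans[OF abs_ge_self])
  qed (use assms in auto)
  then obtain C where C: "C > 0" "\<And>x p. x \<in> cball 0 2 \<Longrightarrow> p \<in> Poly m \<Longrightarrow> ?N x p \<le> C * sqrt (?Q p p)"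
    by blast
  show ?thesis
  proof (intro exI[of _ C] conjI ballI allI C(1))
    fix p :: "point \<Rightarrow> real" and x d :: point assume a: "p \<in> Poly m" "x \<in> cball 0 2"
    show "\<bar>p x\<bar> \<le> C * sqrt (LINT x:ball 0 \<kappa>|lebesgue. (p x)\<^sup>2)"
      using C(2)[OF a(2,1)] by (simp add: power2_eq_square)
    have "\<bar>dir_deriv (axis 1 1) p x\<bar> + \<bar>dir_deriv (axis 2 1) p x\<bar> \<le> C * sqrt (?Q p p)"
      using C(2)[OF a(2,1)] by simp
    from mult_left_mono[OF this, of "norm d"] dir_deriv_bound[OF a(1), of d x]
    show "\<bar>dir_deriv d p x\<bar> \<le> C * norm d * sqrt (LINT x:ball 0 \<kappa>|lebesgue. (p x)\<^sup>2)"
      by (simp add: power2_eq_square mult.assoc mult.left_commute[of C])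
  qed
qed

lemma ball_integral_scale:
  fixes z :: point
  assumes "0 < h" "0 < \<kappa>" "continuous_on UNIV f"
  shows "(LINT x:ball z (\<kappa> * h)|lebesgue. f x) = h\<^sup>2 * (LINT x:ball 0 \<kappa>|lebesgue. (f (z + h *\<^sub>R x) :: real))"
proof -
  have m: "f \<in> borel_measurable borel" using assms(3) borel_measurable_continuous_onI by auto
  have ind: "indicator (ball z (\<kappa> * h)) (z + h *\<^sub>R x) = (indicator (ball 0 \<kappa>) x :: real)" for x
    using assms by (auto simp: indicator_def dist_norm mult.commute)
  have "(LINT x:ball z (\<kappa> * h)|lborel. f x) = h ^ DIM(point) * (LINT x:ball 0 \<kappa>|lborel. f (z + h *\<^sub>R x))"
    unfolding set_lebesgue_integral_def
    by (subst lborel_integral_scale[OF _ assms(1), of _ z]) (use m ind in \<open>auto intro!: borel_measurable_times borel_measurable_indicator\<close>)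
  moreover have "continuous_on UNIV (\<lambda>x. f (z + h *\<^sub>R x))"
    using assms(3) by (intro continuous_on_compose2[OF assms(3)] continuous_intros) auto
  ultimately show ?thesis
    using assms by (simp add: set_integrable_continuous(3))
qed

text \<open>Substituting z + h y for x reduces the estimate to the reference disk. The area factor
  \<open>h\<^sup>2\<close> becomes 1/h under the root, and differentiation costs a second 1/h. The
  set T only has to contain the scaled disk, hence its shape does not enter the constant.\<close>

lemma Poly_inverse_ineq:
  assumes "0 < \<kappa>"
  shows "\<exists>C>0. \<forall>z h T p x d. 0 < h \<and> open T \<and> bounded T \<and> ball z (\<kappa> * h) \<subseteq> T \<and> p \<in> Poly m \<and> dist z x \<le> 2 * h \<longrightarrow>
    \<bar>p x\<bar> \<le> C / h * sqrt (LINT x:T|lebesgue. (p x)\<^sup>2) \<and>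
    \<bar>dir_deriv d p x\<bar> \<le> C / h\<^sup>2 * norm d * sqrt (LINT x:T|lebesgue. (p x)\<^sup>2)"
proof -
  obtain C where C: "C > 0" "\<And>p x d. p \<in> Poly m \<Longrightarrow> x \<in> cball 0 2 \<Longrightarrow>
    \<bar>p x\<bar> \<le> C * sqrt (LINT x:ball 0 \<kappa>|lebesgue. (p x)\<^sup>2) \<and>
    \<bar>dir_deriv d p x\<bar> \<le> C * norm d * sqrt (LINT x:ball 0 \<kappa>|lebesgue. (p x)\<^sup>2)"
    using Poly_inverse_ineq_reference[OF assms, of m] by blast
  show ?thesis
  proof (intro exI[of _ C] conjI allI impI C(1); elim conjE)
    fix z x d :: point and h :: real and T p
    assume h: "0 < h" "open T" "bounded T" "ball z (\<kappa> * h) \<subseteq> T" "p \<in> Poly m" "dist z x \<le> 2 * h"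
    let ?p = "\<lambda>x. p (z + h *\<^sub>R x)" and ?y = "(1 / h) *\<^sub>R (x - z)"
    let ?I = "\<lambda>T. LINT x:T|lebesgue. (p x)\<^sup>2"
    have c: "continuous_on UNIV (\<lambda>x. (p x)\<^sup>2)" using Poly_continuous_on[OF h(5)] by (intro continuous_intros)
    have "h\<^sup>2 * (LINT x:ball 0 \<kappa>|lebesgue. (?p x)\<^sup>2) \<le> ?I T"
      using set_integral_mono_subset[OF open_ball h(2,3,4) c] ball_integral_scale[OF h(1) assms c, of z] by simp
    then have "sqrt (h\<^sup>2 * (LINT x:ball 0 \<kappa>|lebesgue. (?p x)\<^sup>2)) \<le> sqrt (?I T)" by simp
    then have r: "sqrt (LINT x:ball 0 \<kappa>|lebesgue. (?p x)\<^sup>2) \<le> sqrt (?I T) / h"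
      using h(1) by (simp add: real_sqrt_mult field_simps)
    have "norm ?y = norm (x - z) / h" using h(1) by (simp del: scaleR_right_diff_distrib)
    also have "\<dots> \<le> 2" using h(1,6) by (simp add: dist_norm norm_minus_commute divide_le_eq)
    finally have y: "?y \<in> cball 0 2" "z + h *\<^sub>R ?y = x"
      using h(1) by (simp_all only: mem_cball_0) (simp add: algebra_simps)
    note b = C(2)[OF Poly_shift[OF h(5)] y(1), of z h d]
    have "\<bar>p x\<bar> \<le> C * sqrt (LINT x:ball 0 \<kappa>|lebesgue. (?p x)\<^sup>2)" using b y(2) by simp
    also have "\<dots> \<le> C * (sqrt (?I T) / h)" using r C(1) by (intro mult_left_mono) auto
    finally show "\<bar>p x\<bar> \<le> C / h * sqrt (?I T)" by simp
    have "h * \<bar>dir_deriv d p x\<bar> \<le> C * norm d * sqrt (LINT x:ball 0 \<kappa>|lebesgue. (?p x)\<^sup>2)"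
      using b y(2) h(1) by (simp add: dir_deriv_shift[OF h(5)] abs_mult)
    also have "\<dots> \<le> C * norm d * (sqrt (?I T) / h)" using r C(1) by (intro mult_left_mono) auto
    finally show "\<bar>dir_deriv d p x\<bar> \<le> C / h\<^sup>2 * norm d * sqrt (?I T)"
      using h(1) by (simp add: field_simps power2_eq_square)
  qed
qed

section \<open>One-dimensional inequalities\<close>

text \<open>The weight may vanish at 0 and 1: positivity inside already makes a polynomial of zero
  weighted norm vanish at infinitely many points. This admits both the weight 1 and the bubble s (1
  - s).\<close>

lemma inner_on_Poly1:
  assumes "continuous_on UNIV w" "\<And>s. 0 < s \<Longrightarrow> s < 1 \<Longrightarrow> 0 < w s" "\<And>s. 0 \<le> s \<Longrightarrow> s \<le> 1 \<Longrightarrow> 0 \<le> w s"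
  shows "inner_on (Poly1 m) (\<lambda>f g. LINT s:{0..1}|lborel. w s * (f s * g s))"
proof -
  have "semi_inner contfuns (\<lambda>f g. LINT s:{0..1}|lborel. w s * (f s \<bullet> (g s :: real)))"
    using assms by (intro semi_inner_integral) auto
  then have "semi_inner (Poly1 m) (\<lambda>f g. LINT s:{0..1}|lborel. w s * (f s * g s))"
    using semi_inner_subset[OF _ _ subspace_Poly1[of m]] Poly1_continuous_on by (force simp: subset_eq)
  moreover have "f = 0" if f: "f \<in> Poly1 m" "(LINT s:{0..1}|lborel. w s * (f s * f s)) = 0" for f
  proof -
    have c: "continuous_on UNIV (\<lambda>s. w s * (f s * f s))" using Poly1_continuous_on[OF f(1)] assms by (intro continuous_intros)
    have "w s * (f s * f s) = 0" if "s \<in> {0<..<1}" for s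
      by (rule set_integral_nonneg_eq_0[of "{0<..<1}" "{0..1}"])
         (use that c f assms in \<open>auto intro!: set_integrable_continuous\<close>)
    then have "{0<..<1} \<subseteq> {s. f s = 0}" using assms(2) by force
    then have "infinite {s. f s = 0}" using infinite_Ioo[of 0 1] infinite_super[of "{0<..<1::real}"] by auto
    then show ?thesis using Poly1_eq_0[OF f(1)] by (simp add: zero_fun_def)
  qed
  ultimately show ?thesis by (simp add: inner_on_def)
qed

lemma Poly1_pointwise_bound:
  assumes "continuous_on UNIV w" "\<And>s. 0 < s \<Longrightarrow> s < 1 \<Longrightarrow> 0 < w s" "\<And>s. 0 \<le> s \<Longrightarrow> s \<le> 1 \<Longrightarrow> 0 \<le> w s"
  shows "\<exists>C>0. \<forall>s\<in>{0..1}. \<forall>g\<in>Poly1 m. \<bar>g s\<bar> + \<bar>deriv g s\<bar> \<le> C * sqrt (LINT s:{0..1}|lborel. w s * (g s * g s))"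
proof (rule inner_on_seminorm_bound[OF inner_on_Poly1[OF assms] findim_Poly1])
  fix s and f g :: "real \<Rightarrow> real" assume "f \<in> Poly1 m" "g \<in> Poly1 m"
  then have "deriv (\<lambda>s. f s + g s) s = deriv f s + deriv g s"
    by (intro DERIV_imp_deriv DERIV_add Poly1_has_derivative)
  then show "\<bar>(f + g) s\<bar> + \<bar>deriv (f + g) s\<bar> \<le> \<bar>f s\<bar> + \<bar>deriv f s\<bar> + (\<bar>g s\<bar> + \<bar>deriv g s\<bar>)"
    by (simp add: plus_fun_def)
next
  fix s r and g :: "real \<Rightarrow> real" assume "g \<in> Poly1 m"
  then have "deriv (\<lambda>s. r * g s) s = r * deriv g s"
    by (intro DERIV_imp_deriv DERIV_cmult Poly1_has_derivative)
  then show "\<bar>(r *\<^sub>R g) s\<bar> + \<bar>deriv (r *\<^sub>R g) s\<bar> \<le> \<bar>r\<bar> * (\<bar>g s\<bar> + \<bar>deriv g s\<bar>)"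
    by (simp add: scaleR_fun_def abs_mult algebra_simps)
next
  fix g :: "real \<Rightarrow> real" assume g: "g \<in> Poly1 m"
  have "continuous_on {0..1} (\<lambda>s. \<bar>g s\<bar> + \<bar>deriv g s\<bar>)"
    using g Poly1_deriv by (intro continuous_intros Poly1_continuous_on)
  then have "bounded ((\<lambda>s. \<bar>g s\<bar> + \<bar>deriv g s\<bar>) ` {0..1})"
    by (intro compact_imp_bounded compact_continuous_image) auto
  then show "\<exists>K. \<forall>s\<in>{0..1}. \<bar>g s\<bar> + \<bar>deriv g s\<bar> \<le> K"
    by (auto simp: bounded_iff intro: order_trans[OF abs_ge_self])
qed

section \<open>Edge integrals\<close>

abbreviation int01 :: "(real \<Rightarrow> real) \<Rightarrow> real" where
  "int01 g \<equiv> LINT s:{0..1}|lborel. g s"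

definition is_edge :: "region \<Rightarrow> bool" where
  "is_edge E \<longleftrightarrow> (\<exists>a b. a \<noteq> b \<and> E = open_segment a b)"

lemma is_edgeE:
  assumes "is_edge E"
  obtains a b where "a \<noteq> b" "E = open_segment a b"
  using assms by (auto simp: is_edge_def)

text \<open>The length is written as an edge integral so that it is a function of the set E alone,
  without named endpoints.\<close>

definition edge_len :: "region \<Rightarrow> real" where
  "edge_len E = edge_integral E (\<lambda>x. 1)"

lemma int01_reflect: "int01 (\<lambda>s. g (1 - s)) = int01 g"
proof -
  have "(\<integral>s. indicator {0..1} s *\<^sub>R g s \<partial>lborel) = (\<integral>s. indicator {0..1} (1 + -1 * s) *\<^sub>R g (1 + -1 * s) \<partial>lborel)"
    using lborel_integral_real_affine[of "-1" "\<lambda>s. indicator {0..1} s *\<^sub>R g s" 1] by simp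
  also have "\<dots> = (\<integral>s. indicator {0..1} s *\<^sub>R g (1 - s) \<partial>lborel)"
    by (intro Bochner_Integration.integral_cong) (auto simp: indicator_def)
  finally show ?thesis by (simp add: set_lebesgue_integral_def)
qed

text \<open>The choice hidden in \<open>edge_integral\<close> can only return the two endpoints in
  one of their two orders, and the reflection of [0,1] exchanges these.\<close>

lemma edge_integral_segment:
  assumes "a \<noteq> b"
  shows "edge_integral (open_segment a b) g = dist a b * int01 (\<lambda>s. g (a + s *\<^sub>R (b - a)))"
proof -
  let ?P = "\<lambda>(c, d). c \<noteq> d \<and> open_segment a b = open_segment c d"
  obtain c d where cd: "(SOME cd. ?P cd) = (c, d)" by (cases "SOME cd. ?P cd")
  have "?P (c, d)" unfolding cd[symmetric] by (rule someI[of ?P "(a, b)"]) (use assms in simp)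
  then have "(c = a \<and> d = b) \<or> (c = b \<and> d = a)"
    by (auto simp: doubleton_eq_iff)
  moreover have "edge_integral (open_segment a b) g = dist c d * int01 (\<lambda>s. g (c + s *\<^sub>R (d - c)))"
    unfolding edge_integral_def cd by simp
  moreover have "int01 (\<lambda>s. g (b + s *\<^sub>R (a - b))) = int01 (\<lambda>s. g (a + s *\<^sub>R (b - a)))"
    by (subst int01_reflect[symmetric]) (simp add: algebra_simps)
  ultimately show ?thesis by (auto simp: dist_commute)
qed

lemma edge_len_segment: "a \<noteq> b \<Longrightarrow> edge_len (open_segment a b) = dist a b"
  by (simp add: edge_len_def edge_integral_segment set_lebesgue_integral_def)

lemma edge_len_pos: "is_edge E \<Longrightarrow> 0 < edge_len E"
  by (auto simp: is_edge_def edge_len_segment)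

lemma edge_verts_segment: "a \<noteq> b \<Longrightarrow> edge_verts (open_segment a b) = {a, b}"
  by (auto simp: edge_verts_def doubleton_eq_iff)

lemma line_in_closure:
  fixes a b :: point
  assumes "a \<noteq> b" "s \<in> {0..1}"
  shows "a + s *\<^sub>R (b - a) \<in> closure (open_segment a b)"
  using assms by (auto simp: in_segment algebra_simps intro!: exI[of _ s])

lemma continuous_on_line:
  fixes a b :: point
  assumes "a \<noteq> b" "continuous_on (closure (open_segment a b)) g"
  shows "continuous_on {0..1} (\<lambda>s. g (a + s *\<^sub>R (b - a)))"
proof -
  have "continuous_on {0..1} (\<lambda>s. a + s *\<^sub>R (b - a))" by (intro continuous_intros)
  then show ?thesis
    by (rule continuous_on_compose2[OF assms(2)]) (use line_in_closure[OF assms(1)] in blast)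
qed

lemma set_integrable_01: "continuous_on {0..1} (g :: real \<Rightarrow> real) \<Longrightarrow> set_integrable lborel {0..1} g"
  unfolding set_integrable_def by (rule borel_integrable_compact) auto

lemma edge_integral_add:
  assumes "is_edge E" "continuous_on (closure E) f" "continuous_on (closure E) g"
  shows "edge_integral E (\<lambda>x. f x + g x) = edge_integral E f + edge_integral E g"
proof -
  obtain a b where ab: "a \<noteq> b" "E = open_segment a b" using assms(1) by (rule is_edgeE)
  show ?thesis
    using set_integral_add(2)[OF set_integrable_01 set_integrable_01, OF continuous_on_line continuous_on_line, OF ab(1) _ ab(1), of f g]
      assms(2,3) ab by (simp add: edge_integral_segment distrib_left)
qed

lemma edge_integral_cmult:
  assumes "is_edge E"
  shows "edge_integral E (\<lambda>x. r * f x) = r * edge_integral E f"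
  using assms by (auto simp: is_edge_def edge_integral_segment)

lemma edge_integral_cong:
  assumes "is_edge E" "\<And>x. x \<in> closure E \<Longrightarrow> f x = g x"
  shows "edge_integral E f = edge_integral E g"
proof -
  obtain a b where ab: "a \<noteq> b" "E = open_segment a b" using assms(1) by (rule is_edgeE)
  have "int01 (\<lambda>s. f (a + s *\<^sub>R (b - a))) = int01 (\<lambda>s. g (a + s *\<^sub>R (b - a)))"
    unfolding set_lebesgue_integral_def
    using line_in_closure[OF ab(1)] assms(2) ab(2)
    by (intro Bochner_Integration.integral_cong) (auto simp: indicator_def)
  then show ?thesis by (simp add: ab edge_integral_segment)
qed

lemma edge_integral_mono:
  assumes "is_edge E" "continuous_on (closure E) f" "continuous_on (closure E) g"
    "\<And>x. x \<in> closure E \<Longrightarrow> f x \<le> g x"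
  shows "edge_integral E f \<le> edge_integral E g"
proof -
  obtain a b where ab: "a \<noteq> b" "E = open_segment a b" using assms(1) by (rule is_edgeE)
  have "int01 (\<lambda>s. f (a + s *\<^sub>R (b - a))) \<le> int01 (\<lambda>s. g (a + s *\<^sub>R (b - a)))"
    using line_in_closure[OF ab(1)] assms ab
    by (intro set_integral_mono set_integrable_01 continuous_on_line) auto
  then show ?thesis by (simp add: ab edge_integral_segment mult_left_mono)
qed

lemma edge_integral_zero [simp]: "is_edge E \<Longrightarrow> edge_integral E (\<lambda>x. 0) = 0"
  using edge_integral_cmult[of E 0 "\<lambda>x. 0"] by simp

lemma edge_integral_nonneg:
  assumes "is_edge E" "\<And>x. x \<in> closure E \<Longrightarrow> 0 \<le> f x"
  shows "0 \<le> edge_integral E f"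
proof -
  obtain a b where ab: "a \<noteq> b" "E = open_segment a b" using assms(1) by (rule is_edgeE)
  have "0 \<le> int01 (\<lambda>s. f (a + s *\<^sub>R (b - a)))"
    using line_in_closure[OF ab(1)] assms ab by (intro set_integral_ge_0) auto
  then show ?thesis by (simp add: ab edge_integral_segment)
qed

lemma edge_integral_sum:
  assumes "is_edge E" "\<And>i. i \<in> I \<Longrightarrow> continuous_on (closure E) (f i)"
  shows "edge_integral E (\<lambda>x. \<Sum>i\<in>I. f i x) = (\<Sum>i\<in>I. edge_integral E (f i))"
  using assms(2)
proof (induction I rule: infinite_finite_induct)
  case (insert i I)
  then show ?case using edge_integral_add[OF assms(1), of "f i" "\<lambda>x. \<Sum>i\<in>I. f i x"]
    by (simp add: continuous_on_sum)
qed (use assms(1) in auto)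

lemma semi_inner_edge:
  assumes "is_edge E"
  shows "semi_inner {g. continuous_on (closure E) g} (\<lambda>f g. edge_integral E (\<lambda>x. f x * g x))"
proof -
  define Q where "Q = (\<lambda>f g. edge_integral E (\<lambda>x. f x * g x))"
  have comm: "Q f g = Q g f" for f g by (simp add: Q_def mult.commute)
  have add: "Q (f + g) k = Q f k + Q g k"
    if "continuous_on (closure E) f" "continuous_on (closure E) g" "continuous_on (closure E) k" for f g k
    using edge_integral_add[OF assms, of "\<lambda>x. f x * k x" "\<lambda>x. g x * k x"] that
    by (simp add: Q_def distrib_right continuous_on_mult)
  have scale: "Q (r *\<^sub>R f) g = r * Q f g" for r f g
    using edge_integral_cmult[OF assms, of r "\<lambda>x. f x * g x"] by (simp add: Q_def mult.assoc)
  have "subspace {g :: point \<Rightarrow> real. continuous_on (closure E) g}"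
    by (auto intro!: subspaceI continuous_intros simp: plus_fun_def scaleR_fun_def zero_fun_def)
  moreover have "0 \<le> Q f f" for f
    unfolding Q_def by (intro edge_integral_nonneg assms) auto
  moreover have "Q f (g + k) = Q f g + Q f k"
    if "continuous_on (closure E) f" "continuous_on (closure E) g" "continuous_on (closure E) k" for f g k
    using add[OF that(2,3,1)] by (simp only: comm[of f])
  moreover have "Q f (r *\<^sub>R g) = r * Q f g" for r f g
    using scale[of r g f] by (simp only: comm[of f])
  ultimately show ?thesis
    unfolding semi_inner_def bilinear_on_def Q_def[symmetric] using comm add scale
    by (intro conjI ballI allI) (simp_all only: mem_Collect_eq)
qed

lemma edge_integral_bound:
  assumes "is_edge E" "continuous_on (closure E) f" "continuous_on (closure E) g"
    "\<And>x. x \<in> closure E \<Longrightarrow> \<bar>f x\<bar> \<le> c" "0 \<le> c"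
  shows "edge_integral E (\<lambda>x. (f x)\<^sup>2) \<le> c\<^sup>2 * edge_len E" (is ?A)
    "\<bar>edge_integral E (\<lambda>x. g x * f x)\<bar> \<le> c * sqrt (edge_len E) * sqrt (edge_integral E (\<lambda>x. (g x)\<^sup>2))" (is ?B)
proof -
  have "edge_integral E (\<lambda>x. (f x)\<^sup>2) \<le> edge_integral E (\<lambda>x. c\<^sup>2 * 1)"
    using assms by (intro edge_integral_mono continuous_intros) (auto simp: abs_le_square_iff[symmetric])
  then show 1: ?A
    using edge_integral_cmult[OF assms(1), of "c\<^sup>2" "\<lambda>x. 1"] by (simp add: edge_len_def)
  have "\<bar>edge_integral E (\<lambda>x. g x * f x)\<bar> \<le> sqrt (edge_integral E (\<lambda>x. g x * g x)) * sqrt (edge_integral E (\<lambda>x. f x * f x))"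
    using semi_inner_CS_abs[OF semi_inner_edge[OF assms(1)], of g f] assms by simp
  also have "\<dots> \<le> sqrt (edge_integral E (\<lambda>x. g x * g x)) * (c * sqrt (edge_len E))"
  proof (rule mult_left_mono)
    have "sqrt (edge_integral E (\<lambda>x. f x * f x)) \<le> sqrt (c\<^sup>2 * edge_len E)"
      using 1 by (simp add: power2_eq_square)
    then show "sqrt (edge_integral E (\<lambda>x. f x * f x)) \<le> c * sqrt (edge_len E)"
      using assms(5) by (simp add: real_sqrt_mult)
  qed (use assms(1) in \<open>auto intro: edge_integral_nonneg\<close>)
  finally show ?B
    by (simp add: power2_eq_square mult.commute mult.left_commute)
qed

section \<open>Polynomials on edges\<close>

definition edge_restrict :: "region \<Rightarrow> (point \<Rightarrow> real) \<Rightarrow> point \<Rightarrow> real" where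
  "edge_restrict E p = (\<lambda>x. if x \<in> closure E then p x else 0)"

lemma Poly_edge_image: "Poly_edge m E = edge_restrict E ` Poly m"
  by (auto simp: Poly_edge_def edge_restrict_def)

lemma edge_restrict_eq [simp]: "x \<in> closure E \<Longrightarrow> edge_restrict E p x = p x"
  by (simp add: edge_restrict_def)

lemma linear_edge_restrict: "linear_on' V (edge_restrict E)"
  by (auto simp: linear_on'_def edge_restrict_def fun_eq_iff)

lemma subspace_Poly_edge: "subspace (Poly_edge m E)"
  unfolding Poly_edge_image
proof (rule subspaceI)
  show "0 \<in> edge_restrict E ` Poly m"
    by (rule image_eqI[of _ _ "\<lambda>x. 0"]) (auto simp: edge_restrict_def)
  fix f g :: "point \<Rightarrow> real" and r assume f: "f \<in> edge_restrict E ` Poly m"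
  then obtain p where p: "p \<in> Poly m" "f = edge_restrict E p" by auto
  then show "r *\<^sub>R f \<in> edge_restrict E ` Poly m"
    using linear_edge_restrict[of UNIV E] subspace_scale[OF subspace_Poly p(1), of r]
    by (intro image_eqI[of _ _ "r *\<^sub>R p"]) (auto simp: linear_on'_def)
  assume "g \<in> edge_restrict E ` Poly m"
  then obtain q where q: "q \<in> Poly m" "g = edge_restrict E q" by auto
  then show "f + g \<in> edge_restrict E ` Poly m"
    using linear_edge_restrict[of UNIV E] subspace_add[OF subspace_Poly p(1) q(1)] p
    by (intro image_eqI[of _ _ "p + q"]) (auto simp: linear_on'_def)
qed

lemma findim_Poly_edge: "findim (Poly_edge m E)"
  unfolding Poly_edge_image by (intro findim_image subspace_Poly findim_Poly linear_edge_restrict)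

lemma Poly_edge_continuous: "g \<in> Poly_edge m E \<Longrightarrow> continuous_on (closure E) g"
proof -
  assume "g \<in> Poly_edge m E"
  then obtain p where p: "p \<in> Poly m" "g = edge_restrict E p" by (auto simp: Poly_edge_image)
  show ?thesis using Poly_continuous_on[OF p(1), of "closure E"]
    by (rule continuous_on_eq) (simp add: p)
qed

lemma Poly_edge_line:
  assumes "g \<in> Poly_edge m (open_segment a b)" "a \<noteq> b"
  obtains f where "f \<in> Poly1 m" "\<And>s. s \<in> {0..1} \<Longrightarrow> g (a + s *\<^sub>R (b - a)) = f s"
proof -
  obtain p where p: "p \<in> Poly m" "g = edge_restrict (open_segment a b) p" using assms by (auto simp: Poly_edge_image)
  show ?thesis
    by (rule that[OF Poly1_line[OF p(1), of a "b - a"]]) (use line_in_closure[OF assms(2)] p in auto)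
qed

text \<open>The parameter of the orthogonal projection of x onto the line through a and b, equal to
  0 at a and 1 at b. As an affine function it carries polynomials on [0,1] to polynomials on the
  edge.\<close>

definition line_coord :: "point \<Rightarrow> point \<Rightarrow> point \<Rightarrow> real" where
  "line_coord a b x = ((x - a) \<bullet> (b - a)) / ((b - a) \<bullet> (b - a))"

lemma line_coord_line: "a \<noteq> b \<Longrightarrow> line_coord a b (a + s *\<^sub>R (b - a)) = s"
  by (simp add: line_coord_def)

lemma line_coord_Poly: "line_coord a b \<in> Poly 1"
proof -
  have n: "(x - a) \<bullet> (b - a) = (b - a)$1 * (x$1 - a$1) + (b - a)$2 * (x$2 - a$2)" for x
    by (simp add: inner_vec_def sum_2)
  have "line_coord a b = (\<lambda>x. (1 / ((b - a) \<bullet> (b - a))) * ((b - a)$1 * (x$1 - a$1) + (b - a)$2 * (x$2 - a$2)))"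
  proof
    fix x show "line_coord a b x = (1 / ((b - a) \<bullet> (b - a))) * ((b - a)$1 * (x$1 - a$1) + (b - a)$2 * (x$2 - a$2))"
      unfolding line_coord_def n[of x] by simp
  qed
  moreover have "\<dots> \<in> Poly 1"
    by (intro Poly_cmult Poly_add Poly_diff Poly_coord Poly_const) auto
  ultimately show ?thesis by (simp only:)
qed

lemma closure_edge_line:
  fixes a b :: point
  assumes "a \<noteq> b" "x \<in> closure (open_segment a b)"
  shows "\<exists>s\<in>{0..1}. x = a + s *\<^sub>R (b - a)"
proof -
  obtain u where "0 \<le> u" "u \<le> 1" "x = (1 - u) *\<^sub>R a + u *\<^sub>R b" using assms by (auto simp: in_segment)
  then show ?thesis by (intro bexI[of _ u]) (auto simp: algebra_simps)
qed

lemma Poly_edge_of_Poly1: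
  assumes "f \<in> Poly1 m"
  shows "edge_restrict (open_segment a b) (\<lambda>x. f (line_coord a b x)) \<in> Poly_edge m (open_segment a b)"
  unfolding Poly_edge_image using Poly_of_Poly1[OF assms line_coord_Poly] by blast

lemma Poly_edge_eqI:
  assumes "g \<in> Poly_edge m (open_segment a b)" "h \<in> Poly_edge n (open_segment a b)" "a \<noteq> b"
    "\<And>s. s \<in> {0..1} \<Longrightarrow> g (a + s *\<^sub>R (b - a)) = h (a + s *\<^sub>R (b - a))"
  shows "g = h"
proof
  fix x
  show "g x = h x"
  proof (cases "x \<in> closure (open_segment a b)")
    case True
    then show ?thesis using closure_edge_line[OF assms(3)] assms(4) by blast
  next
    case False
    then show ?thesis using assms(1,2) by (auto simp: Poly_edge_image edge_restrict_def)
  qed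
qed

lemma inner_on_Poly_edge:
  assumes "is_edge E"
  shows "inner_on (Poly_edge m E) (\<lambda>f g. edge_integral E (\<lambda>x. f x * g x))"
proof -
  obtain a b where ab: "a \<noteq> b" "E = open_segment a b" using assms by (rule is_edgeE)
  have "semi_inner (Poly_edge m E) (\<lambda>f g. edge_integral E (\<lambda>x. f x * g x))"
    using semi_inner_subset[OF semi_inner_edge[OF assms] _ subspace_Poly_edge] Poly_edge_continuous by blast
  moreover have "g = 0" if g: "g \<in> Poly_edge m E" "edge_integral E (\<lambda>x. g x * g x) = 0" for g
  proof -
    obtain f where f: "f \<in> Poly1 m" "\<And>s. s \<in> {0..1} \<Longrightarrow> g (a + s *\<^sub>R (b - a)) = f s"
      using Poly_edge_line[of g m a b] g(1) ab by blast
    have "int01 (\<lambda>s. g (a + s *\<^sub>R (b - a)) * g (a + s *\<^sub>R (b - a))) = int01 (\<lambda>s. f s * f s)"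
      unfolding set_lebesgue_integral_def using f(2)
      by (intro Bochner_Integration.integral_cong) (auto simp: indicator_def)
    then have "int01 (\<lambda>s. 1 * (f s * f s)) = 0"
      using g(2) ab by (simp add: edge_integral_segment)
    then have "f = 0" using inner_on_Poly1[of "\<lambda>s. 1" m] f(1) by (simp add: inner_on_def)
    have "0 \<in> Poly_edge m E" by (rule subspace_0[OF subspace_Poly_edge])
    then show ?thesis
      using Poly_edge_eqI[of g m a b 0 m] f(2) g(1) ab \<open>f = 0\<close> by simp
  qed
  ultimately show ?thesis by (simp add: inner_on_def)
qed

text \<open>By the Riesz representation the projection is the only polynomial with the moments of g.
  Read in this direction, the projection condition in \<open>P_edge\<close> becomes a set of linear
  moment conditions.\<close>

lemma edge_proj_eq_iff:
  assumes "is_edge E" "continuous_on (closure E) g" "t \<in> Poly_edge m E"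
  shows "edge_proj m E g = t \<longleftrightarrow>
    (\<forall>q\<in>Poly_edge m E. edge_integral E (\<lambda>x. g x * q x) = edge_integral E (\<lambda>x. t x * q x))"
proof -
  have "Poly_edge m E \<subseteq> {g. continuous_on (closure E) g}" using Poly_edge_continuous by blast
  from linear_on'_subset[OF bilinear_on_linear(2)[OF semi_innerD(2)[OF semi_inner_edge[OF assms(1)]], of g] this]
  have "linear_on' (Poly_edge m E) (\<lambda>q. edge_integral E (\<lambda>x. g x * q x))" using assms(2) by simp
  from riesz[OF inner_on_Poly_edge[OF assms(1)] findim_Poly_edge this]
  have ex: "\<exists>!p. p \<in> Poly_edge m E \<and>
     (\<forall>q\<in>Poly_edge m E. edge_integral E (\<lambda>x. p x * q x) = edge_integral E (\<lambda>x. g x * q x))" .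
  have P: "edge_proj m E g \<in> Poly_edge m E \<and>
     (\<forall>q\<in>Poly_edge m E. edge_integral E (\<lambda>x. edge_proj m E g x * q x) = edge_integral E (\<lambda>x. g x * q x))"
    unfolding edge_proj_def by (rule theI'[OF ex])
  show ?thesis
  proof
    assume "edge_proj m E g = t"
    with P show "\<forall>q\<in>Poly_edge m E. edge_integral E (\<lambda>x. g x * q x) = edge_integral E (\<lambda>x. t x * q x)" by simp
  next
    assume "\<forall>q\<in>Poly_edge m E. edge_integral E (\<lambda>x. g x * q x) = edge_integral E (\<lambda>x. t x * q x)"
    then show "edge_proj m E g = t"
      unfolding edge_proj_def using assms(3) by (intro the1_equality[OF ex]) simp
  qed
qed

section \<open>Bubble functions and interpolation on an edge\<close>

lemma Poly1_factor_0: "g \<in> Poly1 m \<Longrightarrow> \<exists>r\<in>Poly1 (m - 1). \<forall>s. g s = g 0 + s * r s"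
proof (induction rule: Poly1_induct)
  case (step c k q)
  then obtain r where r: "r \<in> Poly1 (m - 1)" "\<And>s. q s = q 0 + s * r s" by blast
  show ?case
  proof (cases k)
    case 0
    have "c * s ^ k + q s = (c * 0 ^ k + q 0) + s * r s" for s
      using r(2)[of s] 0 by simp
    then show ?thesis using r(1) by blast
  next
    case (Suc k')
    have "(\<lambda>s. c * s ^ k' + r s) \<in> Poly1 (m - 1)"
      using step(1) Suc r by (intro Poly1_add Poly1_cmult Poly1_monomial) auto
    moreover have "c * s ^ k + q s = (c * 0 ^ k + q 0) + s * (c * s ^ k' + r s)" for s
      using r(2)[of s] Suc by (simp add: algebra_simps)
    ultimately show ?thesis by (intro bexI[of _ "\<lambda>s. c * s ^ k' + r s"]) blast+
  qed
qed (auto intro!: bexI[of _ "\<lambda>s. 0"])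

lemma Poly1_factor_1: "g \<in> Poly1 m \<Longrightarrow> \<exists>r\<in>Poly1 (m - 1). \<forall>s. g s = g 1 + (1 - s) * r s"
proof (induction rule: Poly1_induct)
  case (step c k q)
  then obtain r where r: "r \<in> Poly1 (m - 1)" "\<And>s. q s = q 1 + (1 - s) * r s" by blast
  have m: "(\<lambda>s. \<Sum>i<k. s ^ i) \<in> Poly1 (m - 1)"
  proof -
    have "(\<lambda>s. \<Sum>i<j. s ^ i) \<in> Poly1 (m - 1)" if "j \<le> k" for j
      using that
    proof (induction j)
      case (Suc j)
      then show ?case using step(1) by (auto intro!: Poly1_add Poly1_monomial)
    qed auto
    then show ?thesis by blast
  qed
  have "(\<lambda>s. (- c) * (\<Sum>i<k. s ^ i) + r s) \<in> Poly1 (m - 1)"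
    using m r by (intro Poly1_add Poly1_cmult)
  moreover have "c * s ^ k + q s = (c * 1 ^ k + q 1) + (1 - s) * ((- c) * (\<Sum>i<k. s ^ i) + r s)" for s
  proof -
    have "(1 - s) * (\<Sum>i<k. s ^ i) = 1 - s ^ k" by (simp add: one_diff_power_eq)
    then have "c * ((1 - s) * (\<Sum>i<k. s ^ i)) = c * (1 - s ^ k)" by simp
    then show ?thesis using r(2)[of s] by (simp add: algebra_simps)
  qed
  ultimately show ?case by (intro bexI[of _ "\<lambda>s. (- c) * (\<Sum>i<k. s ^ i) + r s"]) blast+
qed (auto intro!: bexI[of _ "\<lambda>s. 0"])

text \<open>Dividing by s and then by 1 - s costs two degrees, so the quotient r lies in the very
  space against which moments on an edge are tested.\<close>

lemma Poly1_factor_bubble: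
  assumes "g \<in> Poly1 m" "g 0 = 0" "g 1 = 0"
  obtains r where "r \<in> Poly1 (m - 2)" "\<And>s. g s = s * (1 - s) * r s"
proof -
  obtain r1 where r1: "r1 \<in> Poly1 (m - 1)" "\<And>s. g s = s * r1 s"
    using Poly1_factor_0[OF assms(1)] assms(2) by auto
  have "r1 1 = 0" using r1(2)[of 1] assms(3) by simp
  then obtain r where r: "r \<in> Poly1 (m - 1 - 1)" "\<And>s. r1 s = (1 - s) * r s"
    using Poly1_factor_1[OF r1(1)] by auto
  show ?thesis using r r1(2) by (intro that[of r]) auto
qed

lemma int01_cong: "(\<And>s. s \<in> {0..1} \<Longrightarrow> f s = g s) \<Longrightarrow> int01 f = int01 g"
  unfolding set_lebesgue_integral_def by (intro Bochner_Integration.integral_cong) (auto simp: indicator_def)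

lemma inner_on_Poly1_bubble:
  "inner_on (Poly1 m) (\<lambda>f g. int01 (\<lambda>s. s * (1 - s) * (f s * g s)))"
  by (rule inner_on_Poly1) (auto intro!: continuous_intros)

text \<open>The polynomial is sought as the linear interpolant of the end values plus s (1 - s) r.
  Its moment conditions determine r by Riesz representation in the inner product with the bubble
  weight. The difference of two solutions has the form s (1 - s) w, and testing it with w
  annihilates the weighted norm of w.\<close>

lemma edge_interpolation:
  assumes "a \<noteq> b" "E = open_segment a b" "t \<in> Poly_edge (m - 2) E" "1 \<le> m"
  shows "\<exists>!p. p \<in> Poly_edge m E \<and> p a = \<alpha> \<and> p b = \<beta> \<and>
    (\<forall>q\<in>Poly_edge (m - 2) E. edge_integral E (\<lambda>x. p x * q x) = edge_integral E (\<lambda>x. t x * q x))"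
proof -
  have E: "is_edge E" using assms by (auto simp: is_edge_def)
  let ?L = "\<lambda>s. a + s *\<^sub>R (b - a)"
  have ei: "edge_integral E g = dist a b * int01 (\<lambda>s. g (?L s))" for g
    using assms by (simp add: edge_integral_segment)
  have d: "dist a b > 0" using assms by simp
  obtain u where u: "u \<in> Poly1 (m - 2)" "\<And>s. s \<in> {0..1} \<Longrightarrow> t (?L s) = u s"
    using Poly_edge_line[of t "m - 2" a b] assms by blast
  define lin where "lin s = \<alpha> * (1 - s) + \<beta> * s" for s :: real
  have lin1: "lin \<in> Poly1 m" unfolding lin_def
    using Poly1_add[of "\<lambda>s. \<alpha>" m "\<lambda>s. (\<beta> - \<alpha>) * s ^ 1"] Poly1_cmult[OF Poly1_monomial[of 1 m], of "\<beta> - \<alpha>"] assms(4)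
    by (simp add: algebra_simps)
  have s: "semi_inner contfuns (\<lambda>f g. int01 (\<lambda>s. 1 * (f s \<bullet> (g s :: real))))"
    by (intro semi_inner_integral) auto
  have uc: "continuous_on UNIV (\<lambda>s. u s - lin s)"
    using u(1) lin1 by (intro continuous_intros Poly1_continuous_on)
  have "Poly1 (m - 2) \<subseteq> contfuns" using Poly1_continuous_on by blast
  from linear_on'_subset[OF bilinear_on_linear(2)[OF semi_innerD(2)[OF s], of "\<lambda>s. u s - lin s"] this]
  have "linear_on' (Poly1 (m - 2)) (\<lambda>q. int01 (\<lambda>s. (u s - lin s) * q s))" using uc by simp
  from riesz[OF inner_on_Poly1_bubble findim_Poly1 this]
  obtain r where r: "r \<in> Poly1 (m - 2)"
    "\<And>q. q \<in> Poly1 (m - 2) \<Longrightarrow> int01 (\<lambda>s. s * (1 - s) * (r s * q s)) = int01 (\<lambda>s. (u s - lin s) * q s)"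
    by blast
  have bub: "(\<lambda>s. s * (1 - s)) \<in> Poly1 2"
    using Poly1_add[OF Poly1_monomial[of 1 2] Poly1_cmult[OF Poly1_monomial[of 2 2], of "-1"]]
    by (simp add: algebra_simps power2_eq_square)
  define f where "f s = lin s + s * (1 - s) * r s" for s
  have f1: "f \<in> Poly1 m" unfolding f_def using lin1 Poly1_mult[OF bub r(1)] by (intro Poly1_add) auto
  define p where "p = edge_restrict E (\<lambda>x. f (line_coord a b x))"
  have pP: "p \<in> Poly_edge m E" unfolding p_def assms(2) by (rule Poly_edge_of_Poly1[OF f1])
  have pL: "p (?L s) = f s" if "s \<in> {0..1}" for s
    using line_in_closure[OF assms(1) that] assms(1,2) by (simp add: p_def line_coord_line)
  have "p a = \<alpha>" "p b = \<beta>" using pL[of 0] pL[of 1] by (auto simp: f_def lin_def)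
  moreover have "edge_integral E (\<lambda>x. p x * q x) = edge_integral E (\<lambda>x. t x * q x)" if q: "q \<in> Poly_edge (m - 2) E" for q
  proof -
    obtain v where v: "v \<in> Poly1 (m - 2)" "\<And>s. s \<in> {0..1} \<Longrightarrow> q (?L s) = v s"
      using Poly_edge_line[of q "m - 2" a b] assms q by blast
    have i: "set_integrable lborel {0..1} (\<lambda>s. lin s * v s)" "set_integrable lborel {0..1} (\<lambda>s. s * (1 - s) * (r s * v s))"
      "set_integrable lborel {0..1} (\<lambda>s. u s * v s)"
      by (intro set_integrable_01 continuous_intros Poly1_continuous_on[OF lin1] Poly1_continuous_on[OF v(1)]
        Poly1_continuous_on[OF r(1)] Poly1_continuous_on[OF u(1)])+
    have "int01 (\<lambda>s. p (?L s) * q (?L s)) = int01 (\<lambda>s. lin s * v s + s * (1 - s) * (r s * v s))"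
      by (rule int01_cong) (simp only: pL v(2), simp add: f_def algebra_simps)
    also have "\<dots> = int01 (\<lambda>s. lin s * v s) + int01 (\<lambda>s. (u s - lin s) * v s)"
      by (subst set_integral_add(2)[OF i(1,2)]) (simp add: r(2)[OF v(1)])
    also have "int01 (\<lambda>s. (u s - lin s) * v s) = int01 (\<lambda>s. u s * v s) - int01 (\<lambda>s. lin s * v s)"
      using set_integral_diff(2)[OF i(3,1)] by (simp add: algebra_simps)
    also have "int01 (\<lambda>s. u s * v s) = int01 (\<lambda>s. t (?L s) * q (?L s))"
      by (rule int01_cong) (simp add: u(2) v(2))
    finally show ?thesis by (simp add: ei)
  qed
  moreover have "p' = p''" if
    p: "p' \<in> Poly_edge m E" "p' a = \<alpha>" "p' b = \<beta>" "p'' \<in> Poly_edge m E" "p'' a = \<alpha>" "p'' b = \<beta>"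
      "\<And>q. q \<in> Poly_edge (m - 2) E \<Longrightarrow> edge_integral E (\<lambda>x. p' x * q x) = edge_integral E (\<lambda>x. t x * q x)"
      "\<And>q. q \<in> Poly_edge (m - 2) E \<Longrightarrow> edge_integral E (\<lambda>x. p'' x * q x) = edge_integral E (\<lambda>x. t x * q x)" for p' p''
  proof -
    obtain f' where f': "f' \<in> Poly1 m" "\<And>s. s \<in> {0..1} \<Longrightarrow> p' (?L s) = f' s"
      using Poly_edge_line[of p' m a b] assms p by blast
    obtain f'' where f'': "f'' \<in> Poly1 m" "\<And>s. s \<in> {0..1} \<Longrightarrow> p'' (?L s) = f'' s"
      using Poly_edge_line[of p'' m a b] assms p by blast
    have "(\<lambda>s. f' s + (-1) * f'' s) \<in> Poly1 m" using f' f'' by (intro Poly1_add Poly1_cmult)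
    moreover have "f' 0 = f'' 0" "f' 1 = f'' 1" using f'(2)[of 0] f'(2)[of 1] f''(2)[of 0] f''(2)[of 1] p by auto
    ultimately obtain w where w: "w \<in> Poly1 (m - 2)" "\<And>s. f' s + (-1) * f'' s = s * (1 - s) * w s"
      using Poly1_factor_bubble[of "\<lambda>s. f' s + (-1) * f'' s" m] by auto
    let ?q = "edge_restrict E (\<lambda>x. w (line_coord a b x))"
    have q: "?q \<in> Poly_edge (m - 2) E" unfolding assms(2) by (rule Poly_edge_of_Poly1[OF w(1)])
    have qL: "?q (?L s) = w s" if "s \<in> {0..1}" for s
      using line_in_closure[OF assms(1) that] assms(1,2) by (simp add: line_coord_line)
    have "int01 (\<lambda>s. p' (?L s) * ?q (?L s)) = int01 (\<lambda>s. p'' (?L s) * ?q (?L s))"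
      using p(7,8)[OF q] d by (simp add: ei)
    moreover have "int01 (\<lambda>s. p' (?L s) * ?q (?L s)) = int01 (\<lambda>s. f' s * w s)"
      "int01 (\<lambda>s. p'' (?L s) * ?q (?L s)) = int01 (\<lambda>s. f'' s * w s)"
      using f' f'' qL by (auto intro!: int01_cong)
    moreover have "set_integrable lborel {0..1} (\<lambda>s. f' s * w s)" "set_integrable lborel {0..1} (\<lambda>s. f'' s * w s)"
      by (intro set_integrable_01 continuous_intros Poly1_continuous_on[OF w(1)]
        Poly1_continuous_on[OF f'(1)] Poly1_continuous_on[OF f''(1)])+
    ultimately have "int01 (\<lambda>s. f' s * w s - f'' s * w s) = 0"
      by (simp add: set_integral_diff(2))
    moreover have "f' s * w s - f'' s * w s = s * (1 - s) * (w s * w s)" for s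
    proof -
      have "f' s * w s - f'' s * w s = (f' s + (-1) * f'' s) * w s" by (simp add: algebra_simps)
      then show ?thesis by (simp only: w(2) mult.assoc)
    qed
    ultimately have "int01 (\<lambda>s. s * (1 - s) * (w s * w s)) = 0" by simp
    then have "w = 0" using inner_on_Poly1_bubble[of "m - 2"] w(1) by (simp add: inner_on_def)
    then have "f' s = f'' s" for s using w(2)[of s] by simp
    then show ?thesis using Poly_edge_eqI[of p' m a b p'' m] p assms f' f'' by simp
  qed
  ultimately show ?thesis using pP by (intro ex1I[of _ p]) blast+
qed

text \<open>Along the edge p equals s (1 - s) r, and testing the moments with r equates the weighted
  square integral B of r, up to the length, with the integral of t r. Norm equivalence bounds the
  maximum of r by a multiple of sqrt B, so Cauchy-Schwarz allows one factor sqrt B to be cancelled.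
  As s (1 - s) is at most 1, B in turn bounds the integral of the square of p. All of this happens
  on [0,1], hence the constant depends on m only.\<close>

lemma edge_bubble_bound:
  "\<exists>C>0. \<forall>E p t. is_edge E \<and> p \<in> Poly_edge m E \<and> t \<in> Poly_edge (m - 2) E \<and> (\<forall>V\<in>edge_verts E. p V = 0) \<and>
    (\<forall>q\<in>Poly_edge (m - 2) E. edge_integral E (\<lambda>x. p x * q x) = edge_integral E (\<lambda>x. t x * q x)) \<longrightarrow>
    edge_integral E (\<lambda>x. (p x)\<^sup>2) \<le> C * edge_integral E (\<lambda>x. (t x)\<^sup>2)"
proof -
  have "\<exists>C>0. \<forall>s\<in>{0..1}. \<forall>g\<in>Poly1 (m - 2).
     \<bar>g s\<bar> + \<bar>deriv g s\<bar> \<le> C * sqrt (int01 (\<lambda>s. s * (1 - s) * (g s * g s)))"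
    by (rule Poly1_pointwise_bound) (auto intro!: continuous_intros)
  then obtain C where C: "C > 0" "\<And>s g. s \<in> {0..1} \<Longrightarrow> g \<in> Poly1 (m - 2) \<Longrightarrow>
     \<bar>g s\<bar> + \<bar>deriv g s\<bar> \<le> C * sqrt (int01 (\<lambda>s. s * (1 - s) * (g s * g s)))"
    by blast
  show ?thesis
  proof (intro exI[of _ "C\<^sup>2"] conjI allI impI; (elim conjE)?)
    show "C\<^sup>2 > 0" using C by simp
    fix E p t
    assume E: "is_edge E" and p: "p \<in> Poly_edge m E" and t: "t \<in> Poly_edge (m - 2) E" and V: "\<forall>V\<in>edge_verts E. p V = 0"
      and m: "\<forall>q\<in>Poly_edge (m - 2) E. edge_integral E (\<lambda>x. p x * q x) = edge_integral E (\<lambda>x. t x * q x)"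
    obtain a b where ab: "a \<noteq> b" "E = open_segment a b" using E by (rule is_edgeE)
    let ?L = "\<lambda>s. a + s *\<^sub>R (b - a)"
    have ei: "edge_integral E g = dist a b * int01 (\<lambda>s. g (?L s))" for g
      using ab by (simp add: edge_integral_segment)
    have d: "dist a b > 0" using ab by simp
    obtain f where f: "f \<in> Poly1 m" "\<And>s. s \<in> {0..1} \<Longrightarrow> p (?L s) = f s"
      using Poly_edge_line[of p m a b] ab p by blast
    have "f 0 = 0" "f 1 = 0" using f(2)[of 0] f(2)[of 1] V ab by (auto simp: edge_verts_segment)
    then obtain r where r: "r \<in> Poly1 (m - 2)" "\<And>s. f s = s * (1 - s) * r s"
      using Poly1_factor_bubble[OF f(1)] by blast
    let ?q = "edge_restrict E (\<lambda>x. r (line_coord a b x))"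
    have q: "?q \<in> Poly_edge (m - 2) E" unfolding ab(2) by (rule Poly_edge_of_Poly1[OF r(1)])
    have qL: "?q (?L s) = r s" if "s \<in> {0..1}" for s
      using line_in_closure[OF ab(1) that] ab(1,2) by (simp add: line_coord_line)
    define B where "B = int01 (\<lambda>s. s * (1 - s) * (r s * r s))"
    have B0: "B \<ge> 0" unfolding B_def by (intro set_integral_ge_0) auto
    have "int01 (\<lambda>s. p (?L s) * ?q (?L s)) = B"
      unfolding B_def by (rule int01_cong) (simp add: f(2) qL r(2))
    then have "edge_integral E (\<lambda>x. p x * ?q x) = dist a b * B"
      using ei[of "\<lambda>x. p x * ?q x"] by simp
    then have BE: "dist a b * B = edge_integral E (\<lambda>x. t x * ?q x)"
      using bspec[OF m q] by simp
    have rb: "\<bar>r s\<bar> \<le> C * sqrt B" if "s \<in> {0..1}" for s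
      using C(2)[OF that r(1)] by (simp add: B_def)
    have qb: "\<bar>?q x\<bar> \<le> C * sqrt B" if "x \<in> closure E" for x
    proof -
      obtain s where "s \<in> {0..1}" "x = ?L s" using closure_edge_line[OF ab(1)] \<open>x \<in> closure E\<close> ab(2) by blast
      then show ?thesis using qL rb by simp
    qed
    have "edge_integral E (\<lambda>x. t x * ?q x) \<le> C * sqrt B * sqrt (edge_len E) * sqrt (edge_integral E (\<lambda>x. (t x)\<^sup>2))"
      using edge_integral_bound(2)[OF E Poly_edge_continuous[OF q] Poly_edge_continuous[OF t] qb] C(1) B0 by simp
    from this[folded BE] have le: "dist a b * B \<le> sqrt (dist a b * B) * (C * sqrt (edge_integral E (\<lambda>x. (t x)\<^sup>2)))"
      using edge_len_segment[OF ab(1), folded ab(2)] by (simp add: real_sqrt_mult mult_ac)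
    define X where "X = sqrt (dist a b * B)"
    have X: "X \<ge> 0" "X * X = dist a b * B" using d B0 by (auto simp: X_def)
    have t0: "0 \<le> edge_integral E (\<lambda>x. (t x)\<^sup>2)" by (rule edge_integral_nonneg[OF E]) simp
    have "X \<le> C * sqrt (edge_integral E (\<lambda>x. (t x)\<^sup>2))"
    proof (cases "X = 0")
      case False
      have "X * X \<le> X * (C * sqrt (edge_integral E (\<lambda>x. (t x)\<^sup>2)))" using le X(2) by (simp add: X_def)
      then show ?thesis using False X(1) by (simp only: mult_le_cancel_left_pos[of X])
    qed (use C(1) t0 in simp)
    from power_mono[OF this X(1), of 2] have Bb: "dist a b * B \<le> C\<^sup>2 * edge_integral E (\<lambda>x. (t x)\<^sup>2)"
      using t0 X(2) by (simp add: power_mult_distrib power2_eq_square[of X])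
    have "int01 (\<lambda>s. (p (?L s))\<^sup>2) = int01 (\<lambda>s. (f s)\<^sup>2)"
      by (rule int01_cong) (simp add: f(2))
    also have "\<dots> \<le> B" unfolding B_def
    proof (intro set_integral_mono set_integrable_01 continuous_intros)
      fix s :: real assume s: "s \<in> {0..1}"
      have "s * (1 - s) \<le> 1 * 1" using s by (intro mult_mono) auto
      then have "(s * (1 - s)) * (s * (1 - s) * (r s * r s)) \<le> 1 * (s * (1 - s) * (r s * r s))"
        using s by (intro mult_right_mono) auto
      then show "(f s)\<^sup>2 \<le> s * (1 - s) * (r s * r s)" by (simp add: r(2) power2_eq_square algebra_simps)
    qed (use f r Poly1_continuous_on in blast)+
    finally have "edge_integral E (\<lambda>x. (p x)\<^sup>2) \<le> dist a b * B" using d by (simp add: ei)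
    with Bb show "edge_integral E (\<lambda>x. (p x)\<^sup>2) \<le> C\<^sup>2 * edge_integral E (\<lambda>x. (t x)\<^sup>2)" by simp
  qed
qed

text \<open>Parametrization turns the tangential derivative into a derivative on [0,1] divided by
  the length, to which norm equivalence on \<open>Poly1 m\<close> applies. Only the values of p on
  the edge enter, so the tangential derivative of a jump is controlled by the jump itself.\<close>

lemma edge_tangential_inverse:
  "\<exists>C>0. \<forall>a b p. a \<noteq> b \<and> p \<in> Poly m \<longrightarrow>
    edge_integral (open_segment a b) (\<lambda>x. (dir_deriv ((b - a) /\<^sub>R norm (b - a)) p x)\<^sup>2)
     \<le> C / (dist a b)\<^sup>2 * edge_integral (open_segment a b) (\<lambda>x. (p x)\<^sup>2)"
proof -
  have "\<exists>C>0. \<forall>s\<in>{0..1}. \<forall>g\<in>Poly1 m.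
     \<bar>g s\<bar> + \<bar>deriv g s\<bar> \<le> C * sqrt (int01 (\<lambda>s. 1 * (g s * g s)))"
    by (rule Poly1_pointwise_bound) auto
  then obtain C where C: "C > 0" "\<And>s g. s \<in> {0..1} \<Longrightarrow> g \<in> Poly1 m \<Longrightarrow>
     \<bar>g s\<bar> + \<bar>deriv g s\<bar> \<le> C * sqrt (int01 (\<lambda>s. 1 * (g s * g s)))"
    by blast
  show ?thesis
  proof (intro exI[of _ "C\<^sup>2"] conjI allI impI; (elim conjE)?)
    show "C\<^sup>2 > 0" using C by simp
    fix a b :: point and p assume ab: "a \<noteq> b" and p: "p \<in> Poly m"
    let ?E = "open_segment a b" let ?L = "\<lambda>s. a + s *\<^sub>R (b - a)" let ?t = "(b - a) /\<^sub>R norm (b - a)"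
    let ?g = "\<lambda>s. p (?L s)"
    have E: "is_edge ?E" using ab by (auto simp: is_edge_def)
    have d: "dist a b > 0" using ab by simp
    define K where "K = int01 (\<lambda>s. ?g s * ?g s)"
    have K0: "K \<ge> 0" unfolding K_def by (intro set_integral_ge_0) auto
    have pt: "\<bar>dir_deriv ?t p x\<bar> \<le> C / dist a b * sqrt K" if x: "x \<in> closure ?E" for x
    proof -
      obtain s where s: "s \<in> {0..1}" "x = ?L s" using closure_edge_line[OF ab x] by blast
      have "deriv ?g s = dir_deriv (b - a) p x"
        using DERIV_imp_deriv[OF Poly_line_deriv[OF p, of a "b - a" s UNIV]] s by simp
      moreover have "dir_deriv ?t p x = dir_deriv (b - a) p x / dist a b"
        by (subst linear_cmul[OF dir_deriv_linear[OF p]]) (simp add: dist_norm norm_minus_commute divide_inverse)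
      moreover have "\<bar>deriv ?g s\<bar> \<le> C * sqrt K"
        using C(2)[OF s(1) Poly1_line[OF p, of a "b - a"]] by (simp add: K_def)
      ultimately show ?thesis using d by (simp add: abs_divide divide_right_mono)
    qed
    have "edge_integral ?E (\<lambda>x. (dir_deriv ?t p x)\<^sup>2) \<le> (C / dist a b * sqrt K)\<^sup>2 * edge_len ?E"
      using Poly_continuous_on[OF dir_deriv_Poly[OF p]] C(1) K0 by (intro edge_integral_bound(1)[OF E _ _ pt]) auto
    also have "\<dots> = C\<^sup>2 / (dist a b)\<^sup>2 * (dist a b * K)"
      using ab K0 by (simp add: edge_len_segment power_mult_distrib power_divide)
    also have "dist a b * K = edge_integral ?E (\<lambda>x. (p x)\<^sup>2)"
      using ab by (simp add: edge_integral_segment K_def power2_eq_square)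
    finally show "edge_integral ?E (\<lambda>x. (dir_deriv ?t p x)\<^sup>2) \<le> C\<^sup>2 / (dist a b)\<^sup>2 * edge_integral ?E (\<lambda>x. (p x)\<^sup>2)" .
  qed
qed

section \<open>Shape regularity\<close>

lemma meshD:
  assumes "polygonal_mesh \<Omega> M"
  shows "finite (elems M)" "finite (edges M)"
    "T \<in> elems M \<Longrightarrow> open T" "T \<in> elems M \<Longrightarrow> bounded T" "T \<in> elems M \<Longrightarrow> T \<noteq> {}"
    "T \<in> elems M \<Longrightarrow> T' \<in> elems M \<Longrightarrow> T \<inter> T' \<noteq> {} \<Longrightarrow> T = T'"
    "E \<in> edges M \<Longrightarrow> E' \<in> edges M \<Longrightarrow> E \<inter> E' \<noteq> {} \<Longrightarrow> E = E'"
    "E \<in> edges M \<Longrightarrow> is_edge E"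
    "closure \<Omega> = (\<Union>T\<in>elems M. closure T)" (is ?A)
    "T \<in> elems M \<Longrightarrow> center M T \<in> T"
proof -
  have a: "finite (elems M)" "\<forall>T\<in>elems M. polygonal T \<and> contractible T" "pairwise disjnt (elems M)"
    ?A "finite (edges M)"
    "\<forall>E\<in>edges M. \<exists>a b. a \<noteq> b \<and> E = open_segment a b" "pairwise disjnt (edges M)"
    "\<forall>T\<in>elems M. center M T \<in> T \<and> (\<exists>r>0. ball (center M T) r \<subseteq> T)"
    using assms unfolding polygonal_mesh_def by - (elim conjE, assumption)+
  show "finite (elems M)" "finite (edges M)" ?A using a by blast+
  show "T \<in> elems M \<Longrightarrow> open T" "T \<in> elems M \<Longrightarrow> bounded T" "T \<in> elems M \<Longrightarrow> T \<noteq> {}"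
    using a(2) unfolding polygonal_def by blast+
  show "T \<in> elems M \<Longrightarrow> T' \<in> elems M \<Longrightarrow> T \<inter> T' \<noteq> {} \<Longrightarrow> T = T'"
    using a(3) unfolding pairwise_def disjnt_def by blast
  show "E \<in> edges M \<Longrightarrow> E' \<in> edges M \<Longrightarrow> E \<inter> E' \<noteq> {} \<Longrightarrow> E = E'"
    using a(7) unfolding pairwise_def disjnt_def by blast
  show "E \<in> edges M \<Longrightarrow> is_edge E" using a(6) unfolding is_edge_def by blast
  show "T \<in> elems M \<Longrightarrow> center M T \<in> T" using a(8) by blast
qed

lemma elem_edgesD: "E \<in> elem_edges M T \<Longrightarrow> E \<in> edges M" "E \<in> elem_edges M T \<Longrightarrow> E \<subseteq> frontier T"
  by (auto simp: elem_edges_def)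

lemma finite_elem_edges: "polygonal_mesh \<Omega> M \<Longrightarrow> finite (elem_edges M T)"
  using meshD(2) by (auto simp: elem_edges_def intro: finite_subset)

lemma closure_elem_edge: "E \<in> elem_edges M T \<Longrightarrow> closure E \<subseteq> closure T"
  using elem_edgesD(2)[of E M T] by (metis closure_closure closure_mono frontier_def Diff_subset subset_trans)

text \<open>Collects the consequences of regularity on which the estimates rest: an inner disk
  comparable to the diameter, boundedly many edges per element, and edges that are not short
  compared with the element.\<close>

definition shape_regular :: "real \<Rightarrow> nat \<Rightarrow> region \<Rightarrow> mesh \<Rightarrow> bool" where
  "shape_regular \<kappa> N \<Omega> M \<longleftrightarrow> polygonal_mesh \<Omega> M \<and>
    (\<forall>T\<in>elems M. 0 < diameter T \<and> (\<exists>z. ball z (\<kappa> * diameter T) \<subseteq> T) \<and>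
      card (elem_edges M T) \<le> N \<and> (\<forall>E\<in>elem_edges M T. \<kappa> * diameter T \<le> edge_len E))"

text \<open>The diameter of the disk parallel to u v has both ends in the triangle. Their difference
  is k (v - u) with k = 2 r / |v - u|, and by affine independence k is the difference of two
  barycentric coordinates for v, which cannot exceed 1.\<close>

lemma triangle_side_ge:
  fixes u v w :: point
  assumes "\<not> affine_dependent {u, v, w}" "u \<noteq> v" "u \<noteq> w" "v \<noteq> w" "cball y r \<subseteq> convex hull {u, v, w}" "0 \<le> r"
  shows "2 * r \<le> dist u v"
proof -
  let ?e = "(v - u) /\<^sub>R norm (v - u)" let ?d = "norm (v - u)"
  have d: "?d > 0" using assms by simp
  have ne: "norm (r *\<^sub>R ?e) = r" using d assms(6) by simp
  have "y + r *\<^sub>R ?e \<in> cball y r" "y - r *\<^sub>R ?e \<in> cball y r"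
    using ne by (auto simp: dist_norm simp del: norm_scaleR)
  then have in1: "y + r *\<^sub>R ?e \<in> convex hull {u, v, w}" and in2: "y - r *\<^sub>R ?e \<in> convex hull {u, v, w}"
    using assms(5) by auto
  obtain a b c where abc: "0 \<le> a" "0 \<le> b" "0 \<le> c" "a + b + c = 1" "y + r *\<^sub>R ?e = a *\<^sub>R u + b *\<^sub>R v + c *\<^sub>R w"
    using in1 unfolding convex_hull_3 by blast
  obtain a' b' c' where abc': "0 \<le> a'" "0 \<le> b'" "0 \<le> c'" "a' + b' + c' = 1" "y - r *\<^sub>R ?e = a' *\<^sub>R u + b' *\<^sub>R v + c' *\<^sub>R w"
    using in2 unfolding convex_hull_3 by blast
  define k where "k = 2 * r / ?d"
  have "k *\<^sub>R (v - u) = (y + r *\<^sub>R ?e) - (y - r *\<^sub>R ?e)"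
    by (simp add: k_def scaleR_2[symmetric] divide_inverse)
  also have "\<dots> = (a - a') *\<^sub>R u + (b - b') *\<^sub>R v + (c - c') *\<^sub>R w"
    unfolding abc(5) abc'(5) by (simp add: algebra_simps)
  finally have e: "(a - a' + k) *\<^sub>R u + (b - b' - k) *\<^sub>R v + (c - c') *\<^sub>R w = 0"
    by (simp add: algebra_simps)
  define U where "U x = (if x = u then a - a' + k else if x = v then b - b' - k else c - c')" for x
  have "\<not> (\<exists>U. sum U {u,v,w} = 0 \<and> (\<exists>x\<in>{u,v,w}. U x \<noteq> 0) \<and> (\<Sum>x\<in>{u,v,w}. U x *\<^sub>R x) = 0)"
    using assms(1) affine_dependent_explicit_finite[of "{u,v,w}"] by blast
  moreover have "sum U {u,v,w} = 0" using assms(2-4) abc(4) abc'(4) by (simp add: U_def)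
  moreover have "(\<Sum>x\<in>{u,v,w}. U x *\<^sub>R x) = 0" using assms(2-4) e by (simp add: U_def add.assoc)
  ultimately have "U v = 0" by blast
  then have "k = b - b'" using assms(2) by (simp add: U_def)
  also have "\<dots> \<le> 1" using abc abc' by linarith
  finally show ?thesis using d by (simp add: k_def dist_norm norm_minus_commute)
qed

context
  fixes \<rho> :: real and \<Omega> :: region and M :: mesh and S :: "region set"
  assumes rho: "0 < \<rho>" "\<rho> < 1" and mesh: "polygonal_mesh \<Omega> M"
    and tri: "triangulation S" "\<forall>t\<in>S. 2 simplex t" "\<Union>S = closure \<Omega>"
      "\<forall>t\<in>S. \<exists>T\<in>elems M. interior t \<subseteq> T"
      "\<forall>t\<in>S. \<forall>F. F face_of t \<and> aff_dim F = 1 \<longrightarrow>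
        (\<exists>E\<in>edges M. rel_interior F \<subseteq> E) \<or> (\<forall>E\<in>edges M. rel_interior F \<inter> E = {})"
      "\<forall>t\<in>S. \<rho> * diameter t \<le> inradius t"
      "\<forall>t\<in>S. \<forall>T\<in>elems M. interior t \<subseteq> T \<longrightarrow> \<rho> * diameter T \<le> diameter t"
begin

definition sub_triangles :: "region \<Rightarrow> region set" where
  "sub_triangles T = {t\<in>S. interior t \<subseteq> T}"

lemma triangle_facts:
  assumes "t \<in> S"
  shows "convex t" "compact t" "interior t \<noteq> {}" "closure (interior t) = t" "aff_dim t = 2"
proof -
  have s: "2 simplex t" using tri(2) assms by blast
  show c: "convex t" "compact t" "aff_dim t = 2"
    using s convex_simplex compact_simplex aff_dim_simplex by blast+
  have "t \<noteq> {}" using c(3) by auto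
  moreover have "interior t = rel_interior t"
    using interior_rel_interior_gen[of t] c(3) by simp
  ultimately show i: "interior t \<noteq> {}" using rel_interior_eq_empty[OF c(1)] by simp
  show "closure (interior t) = t"
    using convex_closure_interior[OF c(1) i] c(2) by (simp add: compact_imp_closed)
qed

lemma triangle_vertices:
  assumes "t \<in> S"
  obtains C where "finite C" "\<not> affine_dependent C" "card C = 3" "t = convex hull C"
  using tri(2) assms that unfolding simplex by (fastforce simp: numeral_eq_Suc)

lemma finite_S: "finite S" using tri(1) by (simp add: triangulation_def)

text \<open>A point of T lies in some closed triangle, whose interior meets the open set T. That
  interior is contained in a single element, which must be T because elements are disjoint. The
  union is finite and therefore closed, so it also contains the closure of T.\<close>

lemma elem_covered:
  assumes "T \<in> elems M"
  shows "closure T \<subseteq> \<Union>(sub_triangles T)"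
proof -
  have "T \<subseteq> \<Union>(sub_triangles T)"
  proof
    fix y assume y: "y \<in> T"
    have "y \<in> closure \<Omega>" using meshD(9)[OF mesh] assms y closure_subset[of T] by blast
    then obtain t where t: "t \<in> S" "y \<in> t" using tri(3) by auto
    have "T \<inter> closure (interior t) \<noteq> {}" using triangle_facts(4)[OF t(1)] t y by auto
    then have ne: "T \<inter> interior t \<noteq> {}"
      using open_Int_closure_eq_empty[OF meshD(3)[OF mesh assms]] by blast
    obtain T' where T': "T' \<in> elems M" "interior t \<subseteq> T'" using tri(4) t by blast
    then have "T = T'" using meshD(6)[OF mesh assms T'(1)] ne by blast
    then show "y \<in> \<Union>(sub_triangles T)" using t T' by (auto simp: sub_triangles_def)
  qed
  moreover have "closed (\<Union>(sub_triangles T))"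
    using finite_S triangle_facts(2) by (intro closed_Union) (auto simp: sub_triangles_def compact_imp_closed)
  ultimately show ?thesis by (rule closure_minimal)
qed

lemma elem_diameter_pos:
  assumes "T \<in> elems M" shows "0 < diameter T"
proof -
  note o = meshD(3-5)[OF mesh assms]
  obtain x e where x: "x \<in> T" "e > 0" "ball x e \<subseteq> T" using o open_contains_ball by blast
  let ?y = "x + (e/2) *\<^sub>R axis 1 1"
  have "dist x ?y = e / 2" using x by (simp add: dist_norm norm_axis_1)
  moreover from this have "?y \<in> T" using x by (intro subsetD[OF x(3)]) (simp add: dist_commute)
  ultimately show ?thesis using diameter_bounded_bound[OF o(2) x(1), of ?y] x by simp
qed

text \<open>One factor \<rho> compares the diameters of triangle and element, the other the inradius
  and the diameter of the triangle. The factor 1/2 pays for the inradius being a supremum: a disk is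
  only guaranteed for radii below it.\<close>

lemma sub_triangle_ball:
  assumes "T \<in> elems M" "t \<in> sub_triangles T"
  obtains x r where "\<rho>\<^sup>2 / 2 * diameter T \<le> r" "cball x r \<subseteq> t" "0 < r"
proof -
  have t: "t \<in> S" "interior t \<subseteq> T" using assms by (auto simp: sub_triangles_def)
  have dT: "diameter T > 0" using elem_diameter_pos assms by blast
  have dt: "\<rho> * diameter T \<le> diameter t" using tri(7) t assms by blast
  then have "diameter t > 0" using dT rho by (meson less_le_trans mult_pos_pos)
  then have in0: "0 < inradius t" using tri(6) t rho by (meson less_le_trans mult_pos_pos)
  let ?R = "{r. 0 \<le> r \<and> (\<exists>x. cball x r \<subseteq> t)}"
  have "r \<le> diameter t" if rR: "r \<in> ?R" for r
  proof -
    obtain x where x: "0 \<le> r" "cball x r \<subseteq> t" using rR by auto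
    have d: "dist x (x + r *\<^sub>R axis 1 1) = r" using x by (simp add: dist_norm norm_axis_1)
    have "x \<in> t" "x + r *\<^sub>R axis 1 1 \<in> t" using x d by auto
    then show ?thesis
      using diameter_bounded_bound[OF compact_imp_bounded[OF triangle_facts(2)[OF t(1)]]] d by metis
  qed
  then have bdd: "bdd_above ?R" by (auto simp: bdd_above_def)
  obtain y where "y \<in> t" using triangle_facts(3)[OF t(1)] interior_subset by blast
  then have "0 \<in> ?R" by auto
  then have "?R \<noteq> {}" by blast
  moreover have "inradius t / 2 < Sup ?R" using in0 by (simp add: inradius_def)
  ultimately obtain r where r: "r \<in> ?R" "inradius t / 2 < r" using less_cSup_iff[OF _ bdd] by blast
  have "\<rho> * (\<rho> * diameter T) \<le> \<rho> * diameter t" using dt rho by (intro mult_left_mono) auto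
  also have "\<dots> \<le> inradius t" using tri(6) t by blast
  finally have "\<rho>\<^sup>2 / 2 * diameter T \<le> r" using r by (simp add: power2_eq_square)
  with r in0 show ?thesis using that by auto
qed

lemma sub_triangles_nonempty:
  assumes "T \<in> elems M" shows "sub_triangles T \<noteq> {}"
  using elem_covered[OF assms] meshD(5)[OF mesh assms] closure_subset[of T] by blast

lemma elem_ball:
  assumes "T \<in> elems M"
  shows "\<exists>z. ball z (\<rho>\<^sup>2 / 2 * diameter T) \<subseteq> T"
proof -
  obtain t where t: "t \<in> sub_triangles T" using sub_triangles_nonempty[OF assms] by blast
  obtain x r where xr: "\<rho>\<^sup>2 / 2 * diameter T \<le> r" "cball x r \<subseteq> t" using sub_triangle_ball[OF assms t] by blast
  have "ball x (\<rho>\<^sup>2 / 2 * diameter T) \<subseteq> ball x r" using xr by auto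
  also have "\<dots> \<subseteq> interior t" using xr(2) ball_subset_cball[of x r] by (intro interior_maximal) auto
  also have "\<dots> \<subseteq> T" using t by (simp add: sub_triangles_def)
  finally show ?thesis by blast
qed

text \<open>In a triangulation the intersection is a face of both triangles, and a face that meets
  the interior is the whole triangle.\<close>

lemma interiors_disjoint:
  assumes "t \<in> S" "t' \<in> S" "t \<noteq> t'" shows "interior t \<inter> interior t' = {}"
proof (rule ccontr)
  assume a: "interior t \<inter> interior t' \<noteq> {}"
  have f: "(t \<inter> t') face_of t" "(t' \<inter> t) face_of t'" using tri(1) assms by (auto simp: triangulation_def)
  have "t \<inter> t' = t" using face_of_disjoint_interior[OF f(1)] a interior_subset by blast
  moreover have "t' \<inter> t = t'" using face_of_disjoint_interior[OF f(2)] a interior_subset by blast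
  ultimately show False using assms by auto
qed

text \<open>A comparison of areas with h the diameter of T: the disjoint interiors each have area at
  least \<open>(\<rho>\<^sup>2 / 2 * h)\<^sup>2\<close>, whereas T has area at most
  \<open>(2 * h)\<^sup>2\<close>. The quotient of the two is the bound.\<close>

lemma card_sub_triangles:
  assumes "T \<in> elems M"
  shows "real (card (sub_triangles T)) \<le> 16 / \<rho> ^ 4"
proof -
  note o = meshD(3-5)[OF mesh assms]
  let ?h = "diameter T" let ?A = "sub_triangles T"
  have fin: "finite ?A" using finite_S by (simp add: sub_triangles_def)
  have h: "?h > 0" using elem_diameter_pos[OF assms] .
  obtain z where z: "z \<in> T" using o by auto
  have sub: "T \<subseteq> cball z ?h" using diameter_bounded_bound[OF o(2) z] by auto
  have lm: "interior t \<in> lmeasurable" if "t \<in> ?A" for t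
    using that triangle_facts(2) by (auto simp: sub_triangles_def intro!: lmeasurable_interior compact_imp_bounded)
  have "(\<rho>\<^sup>2 / 2 * ?h)\<^sup>2 \<le> measure lebesgue (interior t)" if t: "t \<in> ?A" for t
  proof -
    obtain x r where xr: "\<rho>\<^sup>2 / 2 * ?h \<le> r" "cball x r \<subseteq> t" "0 < r" using sub_triangle_ball[OF assms t] by blast
    have "(\<rho>\<^sup>2 / 2 * ?h)\<^sup>2 \<le> r\<^sup>2" using xr h by (intro power_mono) auto
    also have "\<dots> \<le> pi * r\<^sup>2" using pi_gt3 mult_right_mono[of 1 pi "r\<^sup>2"] by simp
    also have "\<dots> = measure lebesgue (ball x r)" using content_ball[of r x] xr by (simp add: unit_ball_vol_2)
    also have "\<dots> \<le> measure lebesgue (interior t)"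
      using xr(2) ball_subset_cball[of x r] lm[OF t]
      by (intro measure_mono_fmeasurable interior_maximal) auto
    finally show ?thesis .
  qed
  then have "(\<Sum>t\<in>?A. (\<rho>\<^sup>2 / 2 * ?h)\<^sup>2) \<le> (\<Sum>t\<in>?A. measure lebesgue (interior t))" by (rule sum_mono)
  also have "\<dots> = measure lebesgue (\<Union>t\<in>?A. interior t)"
  proof (rule measure_UNION'[symmetric, OF fin lm])
    show "pairwise (\<lambda>s t. disjnt (interior s) (interior t)) ?A"
      using interiors_disjoint by (auto simp: pairwise_def disjnt_def sub_triangles_def)
  qed
  also have "\<dots> \<le> measure lebesgue T"
    using o lm fin by (intro measure_mono_fmeasurable) (auto simp: sub_triangles_def lmeasurable_open)
  also have "\<dots> \<le> (2 * ?h)\<^sup>2" using measure_open_le[OF o(1) sub] h by simp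
  finally have "real (card ?A) * (\<rho> ^ 4 / 4 * ?h\<^sup>2) \<le> 4 * ?h\<^sup>2"
    by (simp add: power_mult_distrib power_divide)
  then have "real (card ?A) * (\<rho> ^ 4 / 4) \<le> 4" using h by (simp add: mult.assoc[symmetric])
  then show ?thesis using rho by (simp add: field_simps)
qed

text \<open>The triangulation has finitely many vertices, so E contains a point x that is none of
  them. As a frontier point of T, x lies in a triangle of T but outside its interior, hence on a
  side and not at its ends. Compatibility with the mesh puts the open side into one mesh edge, which
  is E since edges are disjoint. The length of the side is bounded below by the disk in the
  triangle.\<close>

lemma edge_face:
  assumes "T \<in> elems M" "E \<in> elem_edges M T"
  shows "\<exists>t\<in>sub_triangles T. \<exists>F. F face_of t \<and> rel_interior F \<noteq> {} \<and> rel_interior F \<subseteq> E \<and>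
    \<rho>\<^sup>2 / 2 * diameter T \<le> edge_len E"
proof -
  have E: "E \<in> edges M" "E \<subseteq> frontier T" using elem_edgesD[OF assms(2)] by auto
  obtain a b where ab: "a \<noteq> b" "E = open_segment a b" using meshD(8)[OF mesh E(1)] is_edgeE by blast
  define W where "W = (\<Union>t\<in>S. {v. {v} face_of t})"
  have "finite W"
  proof -
    have "finite {v. {v} face_of t}" if "t \<in> S" for t
    proof -
      have "polytope t" using that tri(2) simplex_imp_polytope by blast
      then have "finite ((\<lambda>F. THE v. F = {v}) ` {F. F face_of t})" using finite_polytope_faces by blast
      moreover have "{v. {v} face_of t} \<subseteq> (\<lambda>F. THE v. F = {v}) ` {F. F face_of t}"
        by (auto intro!: image_eqI[of _ _ "{_}"])
      ultimately show ?thesis by (rule finite_subset[rotated])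
    qed
    then show ?thesis unfolding W_def using finite_S by blast
  qed
  moreover have "infinite E" using ab by simp
  ultimately obtain x where x: "x \<in> E" "x \<notin> W" by (meson finite_subset subsetI)
  have o: "open T" using meshD(3)[OF mesh assms(1)] .
  have "x \<in> closure T" "x \<notin> T" using E x o by (auto simp: frontier_def interior_open)
  then obtain t where t: "t \<in> sub_triangles T" "x \<in> t" using elem_covered[OF assms(1)] by blast
  have tS: "t \<in> S" "interior t \<subseteq> T" using t by (auto simp: sub_triangles_def)
  have xi: "x \<notin> interior t" using tS \<open>x \<notin> T\<close> by auto
  have ph: "polyhedron t" using tS tri(2) simplex_imp_polyhedron by blast
  have "interior t = rel_interior t" using interior_rel_interior_gen[of t] triangle_facts(5)[OF tS(1)] by simp
  then have "x \<in> rel_frontier t" using t xi by (simp add: rel_frontier_def closure_subset[THEN subsetD])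
  then obtain F where F: "F facet_of t" "x \<in> F" using rel_frontier_of_polyhedron[OF ph] by auto
  have Ff: "F face_of t" "aff_dim F = 1"
    using F triangle_facts(5)[OF tS(1)] by (auto simp: facet_of_def)
  obtain C where C: "finite C" "\<not> affine_dependent C" "card C = 3" "t = convex hull C"
    using triangle_vertices[OF tS(1)] .
  obtain c where c: "c \<subseteq> C" "F = convex hull c"
    using Ff(1) face_of_convex_hull_affine_independent[OF C(2)] C(4) by auto
  have nc: "\<not> affine_dependent c" using c C affine_independent_subset by blast
  then have "int (card c) = 2" using Ff(2) c aff_dim_affine_independent[OF nc] by (simp add: aff_dim_convex_hull)
  then have "card c = 2" by simp
  then obtain u v where uv: "c = {u, v}" "u \<noteq> v" by (auto simp: card_2_iff)
  have "card (C - {u, v}) = 1" using C c uv by (simp add: card_Diff_subset)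
  then obtain w where "C - {u, v} = {w}" by (auto simp: card_1_singleton_iff)
  then have w: "C = {u, v, w}" "u \<noteq> w" "v \<noteq> w" using c uv by auto
  have Fseg: "F = closed_segment u v" using c uv by (simp add: segment_convex_hull)
  have "{x} face_of t" if "x \<in> C" for x
    unfolding C(4) face_of_convex_hull_affine_independent[OF C(2)] using that by (intro exI[of _ "{x}"]) simp
  from this[of u] this[of v] have "{u} face_of t" "{v} face_of t" using w(1) by auto
  then have "u \<in> W" "v \<in> W" using tS by (auto simp: W_def)
  then have "x \<noteq> u" "x \<noteq> v" using x by auto
  then have xo: "x \<in> open_segment u v" using F Fseg by (auto simp: open_segment_def)
  have rF: "rel_interior F = open_segment u v" using Fseg uv by (simp add: rel_interior_closed_segment)
  have "\<exists>E'\<in>edges M. rel_interior F \<subseteq> E'" using tri(5) tS(1) Ff xo rF E(1) x(1) by blast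
  then obtain E' where E': "E' \<in> edges M" "rel_interior F \<subseteq> E'" by blast
  then have "E = E'" using meshD(7)[OF mesh E(1) E'(1)] x xo rF by blast
  then have sub: "open_segment u v \<subseteq> E" using E' rF by simp
  have "closed_segment u v \<subseteq> closure E" using closure_mono[OF sub] uv by simp
  then have "u \<in> closure (open_segment a b)" "v \<in> closure (open_segment a b)" using ab by auto
  then obtain s s' where s: "s \<in> {0..1}" "u = a + s *\<^sub>R (b - a)" "s' \<in> {0..1}" "v = a + s' *\<^sub>R (b - a)"
    using closure_edge_line[OF ab(1)] by blast
  have "u - v = (s - s') *\<^sub>R (b - a)" unfolding s(2) s(4) by (simp add: algebra_simps)
  then have "dist u v = \<bar>s - s'\<bar> * dist a b" by (simp add: dist_norm norm_minus_commute)
  also have "\<dots> \<le> 1 * dist a b" using s by (intro mult_right_mono) auto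
  finally have len: "dist u v \<le> edge_len E" using ab by (simp add: edge_len_segment)
  obtain y r where yr: "\<rho>\<^sup>2 / 2 * diameter T \<le> r" "cball y r \<subseteq> t" "0 < r"
    using sub_triangle_ball[OF assms(1) t(1)] by blast
  have "2 * r \<le> dist u v"
    using triangle_side_ge[of u v w y r] C(2,4) w uv(2) yr by simp
  then have "\<rho>\<^sup>2 / 2 * diameter T \<le> edge_len E" using len yr by linarith
  then show ?thesis using t(1) Ff(1) rF uv(2) sub by (intro bexI[of _ t] exI[of _ F]) auto
qed

text \<open>Every edge contains the nonempty relative interior of some face of a triangle, and
  distinct edges cannot share such a face because they are disjoint. A triangle has at most 8 faces,
  one for each subset of its three vertices.\<close>

lemma card_elem_edges:
  assumes "T \<in> elems M"
  shows "card (elem_edges M T) \<le> 8 * card (sub_triangles T)"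
proof -
  let ?A = "sub_triangles T"
  have fin: "finite ?A" using finite_S by (simp add: sub_triangles_def)
  obtain F where F: "\<And>E. E \<in> elem_edges M T \<Longrightarrow> \<exists>t\<in>?A. F E face_of t"
    "\<And>E. E \<in> elem_edges M T \<Longrightarrow> rel_interior (F E) \<noteq> {} \<and> rel_interior (F E) \<subseteq> E"
    using edge_face[OF assms] by metis
  have faces: "finite {F. F face_of t} \<and> card {F. F face_of t} \<le> 8" if t: "t \<in> ?A" for t
  proof -
    obtain C where C: "finite C" "\<not> affine_dependent C" "card C = 3" "t = convex hull C"
      using triangle_vertices[of t] t unfolding sub_triangles_def by blast
    have "{F. F face_of t} = (\<lambda>c. convex hull c) ` Pow C"
      using face_of_convex_hull_affine_independent[OF C(2)] C(4) by auto
    moreover have "card ((\<lambda>c. convex hull c) ` Pow C) \<le> 8"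
      using card_image_le[of "Pow C" "\<lambda>c. convex hull c"] C by (simp add: card_Pow)
    ultimately show ?thesis using C(1) by simp
  qed
  have "inj_on F (elem_edges M T)"
  proof (rule inj_onI)
    fix E E' assume E: "E \<in> elem_edges M T" "E' \<in> elem_edges M T" "F E = F E'"
    then have "E \<inter> E' \<noteq> {}" using F(2)[OF E(1)] F(2)[OF E(2)] by auto
    then show "E = E'" using meshD(7)[OF mesh] elem_edgesD E by blast
  qed
  moreover have "F ` elem_edges M T \<subseteq> (\<Union>t\<in>?A. {F. F face_of t})" using F(1) by blast
  moreover have "finite (\<Union>t\<in>?A. {F. F face_of t})" using fin faces by blast
  ultimately have "card (elem_edges M T) \<le> card (\<Union>t\<in>?A. {F. F face_of t})" by (rule card_inj_on_le)
  also have "\<dots> \<le> (\<Sum>t\<in>?A. card {F. F face_of t})" by (rule card_UN_le[OF fin])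
  also have "\<dots> \<le> (\<Sum>t\<in>?A. 8)" using faces by (intro sum_mono) auto
  finally show ?thesis by simp
qed

lemma shape_regular_triangulated: "shape_regular (\<rho>\<^sup>2 / 2) (8 * nat \<lceil>16 / \<rho> ^ 4\<rceil>) \<Omega> M"
  unfolding shape_regular_def
proof (intro conjI ballI mesh elem_diameter_pos elem_ball)
  fix T assume T: "T \<in> elems M"
  have "card (sub_triangles T) \<le> nat \<lceil>16 / \<rho> ^ 4\<rceil>"
    using card_sub_triangles[OF T] by linarith
  then show "card (elem_edges M T) \<le> 8 * nat \<lceil>16 / \<rho> ^ 4\<rceil>" using card_elem_edges[OF T] by linarith
  fix E assume "E \<in> elem_edges M T"
  then show "\<rho>\<^sup>2 / 2 * diameter T \<le> edge_len E" using edge_face[OF T] by blast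
qed

end

lemma regular_mesh_shape_regular:
  assumes "0 < \<rho>" "\<rho> < 1" "polygonal_mesh \<Omega> M" "regular_mesh \<rho> \<Omega> M"
  shows "shape_regular (\<rho>\<^sup>2 / 2) (8 * nat \<lceil>16 / \<rho> ^ 4\<rceil>) \<Omega> M"
proof -
  obtain S where "triangulation S" "\<forall>t\<in>S. 2 simplex t" "\<Union>S = closure \<Omega>"
      "\<forall>t\<in>S. \<exists>T\<in>elems M. interior t \<subseteq> T"
      "\<forall>t\<in>S. \<forall>F. F face_of t \<and> aff_dim F = 1 \<longrightarrow>
        (\<exists>E\<in>edges M. rel_interior F \<subseteq> E) \<or> (\<forall>E\<in>edges M. rel_interior F \<inter> E = {})"
      "\<forall>t\<in>S. \<rho> * diameter t \<le> inradius t"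
      "\<forall>t\<in>S. \<forall>T\<in>elems M. interior t \<subseteq> T \<longrightarrow> \<rho> * diameter T \<le> diameter t"
    using assms(4) unfolding regular_mesh_def by (elim exE conjE) (rule that)
  from shape_regular_triangulated[OF assms(1-3) this] show ?thesis .
qed

section \<open>The divergence theorem on an element\<close>

lemma mesh_edgesD:
  assumes "polygonal_mesh \<Omega> M"
  shows "(\<Union>T\<in>elems M. frontier T) = (\<Union>E\<in>edges M. closure E)" (is ?A)
    "E \<in> edges M \<Longrightarrow> (\<exists>T1\<in>elems M. \<exists>T2\<in>elems M. T1 \<noteq> T2 \<and> E \<subseteq> frontier T1 \<inter> frontier T2) \<or>
        (\<exists>T\<in>elems M. E \<subseteq> frontier T \<inter> frontier \<Omega>)"
    "E \<in> edges M \<Longrightarrow> \<exists>a b. a \<noteq> b \<and> E = open_segment a b \<and> tangent M E = (b - a) /\<^sub>R norm (b - a)"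
    "T \<in> elems M \<Longrightarrow> E \<in> elem_edges M T \<Longrightarrow> sign_TE M T E \<in> {1, -1}"
    "T \<in> elems M \<Longrightarrow> E \<in> elem_edges M T \<Longrightarrow> points_out (sign_TE M T E *\<^sub>R normal M E) E T"
proof -
  have a: ?A
    "\<forall>E\<in>edges M. (\<exists>T1\<in>elems M. \<exists>T2\<in>elems M. T1 \<noteq> T2 \<and> E \<subseteq> frontier T1 \<inter> frontier T2) \<or>
        (\<exists>T\<in>elems M. E \<subseteq> frontier T \<inter> frontier \<Omega>)"
    "\<forall>E\<in>edges M. \<exists>a b. a \<noteq> b \<and> E = open_segment a b \<and> tangent M E = (b - a) /\<^sub>R norm (b - a)"
    "\<forall>T\<in>elems M. \<forall>E\<in>elem_edges M T. sign_TE M T E \<in> {1, -1} \<and>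
        points_out (sign_TE M T E *\<^sub>R normal M E) E T"
    using assms unfolding polygonal_mesh_def by - (elim conjE, assumption)+
  show ?A by (rule a(1))
  show "E \<in> edges M \<Longrightarrow> (\<exists>T1\<in>elems M. \<exists>T2\<in>elems M. T1 \<noteq> T2 \<and> E \<subseteq> frontier T1 \<inter> frontier T2) \<or>
        (\<exists>T\<in>elems M. E \<subseteq> frontier T \<inter> frontier \<Omega>)" by (rule bspec[OF a(2)])
  show "E \<in> edges M \<Longrightarrow> \<exists>a b. a \<noteq> b \<and> E = open_segment a b \<and> tangent M E = (b - a) /\<^sub>R norm (b - a)"
    by (rule bspec[OF a(3)])
  show "T \<in> elems M \<Longrightarrow> E \<in> elem_edges M T \<Longrightarrow> sign_TE M T E \<in> {1, -1}"
    "T \<in> elems M \<Longrightarrow> E \<in> elem_edges M T \<Longrightarrow> points_out (sign_TE M T E *\<^sub>R normal M E) E T"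
    using a(4) by blast+
qed

section \<open>Elements near an interior point of an edge\<close>

lemma open_in_line_empty:
  fixes q n :: point
  assumes "open S" "n \<noteq> 0" "\<And>x. x \<in> S \<Longrightarrow> (x - q) \<bullet> n = 0"
  shows "S = {}"
proof -
  have "S \<subseteq> {x. n \<bullet> x = n \<bullet> q}" using assms(3) by (auto simp: inner_diff_left inner_commute[of n])
  then have "S \<subseteq> interior {x. n \<bullet> x = n \<bullet> q}" using assms(1) by (rule interior_maximal)
  then show ?thesis using interior_hyperplane[OF assms(2)] by simp
qed

lemma edge_normal_line:
  assumes "polygonal_mesh \<Omega> M" "E \<in> edges M"
  shows "normal M E \<noteq> 0" "x \<in> closure E \<Longrightarrow> q \<in> closure E \<Longrightarrow> (x - q) \<bullet> normal M E = 0"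
proof -
  obtain a b where ab: "a \<noteq> b" "E = open_segment a b" "tangent M E = (b - a) /\<^sub>R norm (b - a)"
    using mesh_edgesD(3)[OF assms] by blast
  have c: "(b - a) \<bullet> normal M E = 0"
    by (simp add: normal_def rot90_def ab(3) inner_vec_def sum_2)
  have "norm (tangent M E) = 1" using ab by simp
  then have "tangent M E \<noteq> 0" by auto
  then show "normal M E \<noteq> 0" by (auto simp: normal_def rot90_def vec_eq_iff forall_2)
  assume "x \<in> closure E" "q \<in> closure E"
  then obtain s s' where s: "x = a + s *\<^sub>R (b - a)" "q = a + s' *\<^sub>R (b - a)"
    using closure_edge_line[OF ab(1)] ab(2) by metis
  have "x - q = (s - s') *\<^sub>R (b - a)" unfolding s by (simp add: algebra_simps)
  then show "(x - q) \<bullet> normal M E = 0" using c by simp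
qed

lemma finite_mesh_verts:
  assumes "polygonal_mesh \<Omega> M" shows "finite (mesh_verts M)"
  unfolding mesh_verts_def
proof (rule finite_UN_I[OF meshD(2)[OF assms]])
  fix E assume "E \<in> edges M"
  then obtain a b where "a \<noteq> b" "E = open_segment a b" using meshD(8)[OF assms] is_edgeE by blast
  then show "finite (edge_verts E)" by (simp add: edge_verts_segment)
qed

context
  fixes \<Omega> :: region and M :: mesh
  assumes mesh: "polygonal_mesh \<Omega> M" and Om: "polygonal \<Omega>"
begin

lemma closure_edge_vertex:
  assumes "E \<in> edges M" "q \<in> closure E" "q \<notin> E" shows "q \<in> mesh_verts M"
proof -
  obtain a b where ab: "a \<noteq> b" "E = open_segment a b"
    using meshD(8)[OF mesh assms(1)] is_edgeE by blast
  then have "q = a \<or> q = b" using assms(2,3) closed_segment_eq_open[of a b] by auto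
  then show ?thesis using assms(1) ab edge_verts_segment[OF ab(1)] by (auto simp: mesh_verts_def)
qed

lemma frontier_elem_edges: "T \<in> elems M \<Longrightarrow> frontier T \<subseteq> (\<Union>E\<in>edges M. closure E)"
  using mesh_edgesD(1)[OF mesh] by blast

text \<open>The other closed edges form a closed set. A point of E in that set would lie in a second
  open edge or be an endpoint, and both are excluded. Near q the frontiers of all elements thus lie
  on the one line spanned by E.\<close>

lemma isolating_ball:
  assumes "E \<in> edges M" "q \<in> E" "q \<notin> mesh_verts M"
  obtains d where "d > 0" "\<And>T. T \<in> elems M \<Longrightarrow> ball q d \<inter> frontier T \<subseteq> closure E"
proof -
  let ?K = "\<Union>E'\<in>edges M - {E}. closure E'"
  have "closed ?K" using meshD(2)[OF mesh] by (intro closed_UN) auto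
  moreover have "q \<notin> ?K"
  proof
    assume "q \<in> ?K"
    then obtain E' where E': "E' \<in> edges M" "E' \<noteq> E" "q \<in> closure E'" by blast
    then have "q \<in> E'" using closure_edge_vertex assms(3) by blast
    then show False using meshD(7)[OF mesh assms(1) E'(1)] E'(2) assms(2) by blast
  qed
  ultimately obtain d where d: "d > 0" "ball q d \<subseteq> - ?K"
    using open_contains_ball[of "- ?K"] by blast
  show ?thesis
  proof (rule that[OF d(1)])
    fix T assume "T \<in> elems M"
    then show "ball q d \<inter> frontier T \<subseteq> closure E" using frontier_elem_edges d(2) by blast
  qed
qed

text \<open>The open half disk is connected. If it contained a point of T and a point outside T, it
  would contain a frontier point of T; near q such points lie on the line of E, which the open half
  disk avoids.\<close>

lemma half_disc:
  assumes "T \<in> elems M" "ball q d \<inter> frontier T \<subseteq> closure E" "E \<in> edges M" "q \<in> E" "\<nu> \<noteq> 0"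
    "\<And>x. x \<in> closure E \<Longrightarrow> (x - q) \<bullet> \<nu> = 0"
    "y \<in> ball q d" "(y - q) \<bullet> \<nu> > 0" "x \<in> ball q d" "(x - q) \<bullet> \<nu> > 0" "y \<in> T"
  shows "x \<in> T"
proof (rule ccontr)
  assume "x \<notin> T"
  let ?B = "ball q d \<inter> {x. \<nu> \<bullet> x > \<nu> \<bullet> q}"
  have side: "\<nu> \<bullet> z > \<nu> \<bullet> q \<longleftrightarrow> (z - q) \<bullet> \<nu> > 0" for z
    by (simp add: inner_diff_left inner_commute[of \<nu>])
  have "connected ?B" by (intro convex_connected convex_Int convex_halfspace_gt) auto
  moreover have "?B \<inter> T \<noteq> {}" "?B - T \<noteq> {}"
    using assms(7-11) \<open>x \<notin> T\<close> unfolding side by blast+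
  ultimately obtain w where w: "w \<in> ?B" "w \<in> frontier T" using connected_Int_frontier[of ?B T] by blast
  then have "(w - q) \<bullet> \<nu> = 0" using assms(2,6) by blast
  then show False using w(1) unfolding side by simp
qed

text \<open>The condition \<open>points_out\<close> speaks only of the normal line through q; half
  disks spread this information to the two sides of the whole ball.\<close>

lemma edge_sides:
  assumes "T \<in> elems M" "E \<in> elem_edges M T" "q \<in> E" "d > 0" "ball q d \<inter> frontier T \<subseteq> closure E"
    "\<nu> = sign_TE M T E *\<^sub>R normal M E" "x \<in> ball q d"
  shows "(x - q) \<bullet> \<nu> < 0 \<Longrightarrow> x \<in> T" "(x - q) \<bullet> \<nu> > 0 \<Longrightarrow> x \<notin> T"
proof -
  have E: "E \<in> edges M" using elem_edgesD assms(2) by blast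
  have out: "sign_TE M T E \<in> {1, -1}" "points_out \<nu> E T"
    using mesh_edgesD(4,5)[OF mesh assms(1,2)] assms(6) by simp_all
  have n0: "\<nu> \<noteq> 0" using out(1) edge_normal_line(1)[OF mesh E] assms(6) by auto
  have line: "(x - q) \<bullet> \<nu> = 0" if "x \<in> closure E" for x
    using edge_normal_line(2)[OF mesh E that] assms(3,6) closure_subset[of E] by auto
  obtain e where e: "e > 0" "\<And>s. 0 < s \<Longrightarrow> s < e \<Longrightarrow> q + s *\<^sub>R \<nu> \<notin> T \<and> q - s *\<^sub>R \<nu> \<in> T"
    using out(2) assms(3) unfolding points_out_def by blast
  \<comment> \<open>Small enough both for the range in which \<open>points_out\<close> holds at q
    and for staying inside the ball of radius d.\<close>
  define s where "s = min (e / 2) (d / (2 * norm \<nu>))"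
  have s: "0 < s" "s < e" "s * norm \<nu> < d"
  proof -
    show "0 < s" "s < e" using e(1) assms(4) n0 by (auto simp: s_def)
    have "s * norm \<nu> \<le> d / (2 * norm \<nu>) * norm \<nu>" unfolding s_def by (intro mult_right_mono) auto
    also have "\<dots> < d" using n0 assms(4) by simp
    finally show "s * norm \<nu> < d" .
  qed
  have b: "q + s *\<^sub>R \<nu> \<in> ball q d" "q - s *\<^sub>R \<nu> \<in> ball q d" using s by (auto simp: dist_norm)
  have pos: "\<nu> \<bullet> \<nu> > 0" using n0 by simp
  show "x \<in> T" if "(x - q) \<bullet> \<nu> < 0"
    by (rule half_disc[OF assms(1,5) E assms(3), of "- \<nu>" "q - s *\<^sub>R \<nu>"])
       (use n0 line b s e pos that assms(7) in auto)
  show "x \<notin> T" if "(x - q) \<bullet> \<nu> > 0"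
  proof
    assume "x \<in> T"
    then have "q + s *\<^sub>R \<nu> \<in> T"
      by (intro half_disc[OF assms(1,5) E assms(3) n0 line assms(7) that b(1)]) (use s pos in auto)
    then show False using e s by blast
  qed
qed

text \<open>One frontier point of T on E, away from the vertices, has to force all of E into the
  frontier. Near q the element T reaches into one side of the line of E. If E is shared by two other
  elements, each of them fills a half disk; being disjoint from T, both would fill the opposite one,
  so they would intersect. If E lies on the frontier of \<Omega> next to one other element T1, then
  T and T1 fill a disk around q up to the line; q is then interior to the closure of \<Omega>, which
  is a point of \<Omega> itself by regular openness, in contradiction to lying on its
  frontier.\<close>

lemma frontier_point_elem_edge:
  assumes "T \<in> elems M" "E \<in> edges M" "q \<in> E" "q \<notin> mesh_verts M" "q \<in> frontier T"
  shows "E \<in> elem_edges M T"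
proof (rule ccontr)
  assume nT: "E \<notin> elem_edges M T"
  obtain d where d: "d > 0" "\<And>T. T \<in> elems M \<Longrightarrow> ball q d \<inter> frontier T \<subseteq> closure E"
    by (rule isolating_ball[OF assms(2-4)]) (rule that)
  let ?n = "normal M E"
  have line: "(x - q) \<bullet> ?n = 0" if "x \<in> closure E" for x
    using edge_normal_line(2)[OF mesh assms(2) that] assms(3) closure_subset[of E] by auto
  have n0: "?n \<noteq> 0" using edge_normal_line(1)[OF mesh assms(2)] .
  have oT: "open T" using meshD(3)[OF mesh assms(1)] .
  have "q \<in> closure T" using assms(5) by (simp add: frontier_def)
  then have "T \<inter> ball q d \<noteq> {}"
    using open_Int_closure_eq_empty[of "ball q d" T] d(1) by (metis IntI Int_commute centre_in_ball empty_iff open_ball)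
  moreover have "open (T \<inter> ball q d)" using oT by auto
  ultimately obtain y where y: "y \<in> T" "y \<in> ball q d" "(y - q) \<bullet> ?n \<noteq> 0"
    using open_in_line_empty[OF _ n0, of "T \<inter> ball q d" q] by blast
  have side: "\<exists>\<sigma>\<in>{1,-1}. (\<forall>x\<in>ball q d. (x - q) \<bullet> (\<sigma> *\<^sub>R ?n) < 0 \<longrightarrow> x \<in> T') \<and>
      (\<forall>x\<in>ball q d. (x - q) \<bullet> (\<sigma> *\<^sub>R ?n) > 0 \<longrightarrow> x \<notin> T')"
    if "T' \<in> elems M" "E \<subseteq> frontier T'" for T'
  proof -
    have e: "E \<in> elem_edges M T'" using that assms(2) by (simp add: elem_edges_def)
    have "sign_TE M T' E \<in> {1, -1}" using mesh_edgesD(4)[OF mesh that(1) e] .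
    then show ?thesis using edge_sides[OF that(1) e assms(3) d(1) d(2)[OF that(1)] refl] by blast
  qed
  have disj: "T' \<inter> T = {}" if "T' \<in> elems M" "E \<subseteq> frontier T'" for T'
    using meshD(6)[OF mesh that(1) assms(1)] that(2) nT assms(2) by (auto simp: elem_edges_def)
  have "(\<exists>T1\<in>elems M. \<exists>T2\<in>elems M. T1 \<noteq> T2 \<and> E \<subseteq> frontier T1 \<inter> frontier T2) \<or>
        (\<exists>T\<in>elems M. E \<subseteq> frontier T \<inter> frontier \<Omega>)"
    by (rule mesh_edgesD(2)[OF mesh assms(2)])
  then show False
  proof (elim disjE bexE)
    fix T1 T2 assume T12: "T1 \<in> elems M" "T2 \<in> elems M" "T1 \<noteq> T2 \<and> E \<subseteq> frontier T1 \<inter> frontier T2"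
    obtain \<sigma>1 where s1: "\<sigma>1 \<in> {1,-1::real}" "\<forall>x\<in>ball q d. (x - q) \<bullet> (\<sigma>1 *\<^sub>R ?n) < 0 \<longrightarrow> x \<in> T1"
      "\<forall>x\<in>ball q d. (x - q) \<bullet> (\<sigma>1 *\<^sub>R ?n) > 0 \<longrightarrow> x \<notin> T1"
      using side[OF T12(1)] T12(3) by blast
    obtain \<sigma>2 where s2: "\<sigma>2 \<in> {1,-1::real}" "\<forall>x\<in>ball q d. (x - q) \<bullet> (\<sigma>2 *\<^sub>R ?n) < 0 \<longrightarrow> x \<in> T2"
      using side[OF T12(2)] T12(3) by blast
    have d12: "T1 \<inter> T2 = {}" using meshD(6)[OF mesh T12(1,2)] T12(3) by blast
    have yn: "y \<notin> T1" "y \<notin> T2" using disj T12 y(1) by blast+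
    have a1: "\<not> \<sigma>1 * ((y - q) \<bullet> ?n) < 0" "\<not> \<sigma>2 * ((y - q) \<bullet> ?n) < 0"
      using s1(2) s2(2) yn y(2) by auto
    have "\<sigma>1 = \<sigma>2" using s1(1) s2(1) a1 y(3) by auto
    \<comment> \<open>The mirror image of y in q lies on the other side of the line.\<close>
    define w where "w = 2 *\<^sub>R q - y"
    have wb: "w \<in> ball q d" using y(2) by (simp add: w_def dist_norm scaleR_2 norm_minus_commute)
    have wq: "w - q = - (y - q)" by (simp add: w_def scaleR_2)
    have "\<sigma>1 * ((w - q) \<bullet> ?n) < 0" using a1(1) y(3) s1(1) unfolding wq inner_minus_left by auto
    then have "w \<in> T1" "w \<in> T2" using s1(2) s2(2) wb \<open>\<sigma>1 = \<sigma>2\<close> by auto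
    then show False using d12 by blast
  next
    fix T1 assume T1: "T1 \<in> elems M" "E \<subseteq> frontier T1 \<inter> frontier \<Omega>"
    obtain \<sigma> where s: "\<sigma> \<in> {1,-1::real}" "\<forall>x\<in>ball q d. (x - q) \<bullet> (\<sigma> *\<^sub>R ?n) < 0 \<longrightarrow> x \<in> T1"
      using side[OF T1(1)] T1(2) by blast
    have yn: "y \<notin> T1" using disj T1 y(1) by blast
    have "\<not> \<sigma> * ((y - q) \<bullet> ?n) < 0" using s(2) yn y(2) by auto
    then have ypos: "(y - q) \<bullet> (\<sigma> *\<^sub>R ?n) > 0" using s(1) y(3) by auto
    have sn0: "\<sigma> *\<^sub>R ?n \<noteq> 0" using s(1) n0 by auto
    have lines: "(x - q) \<bullet> (\<sigma> *\<^sub>R ?n) = 0" if "x \<in> closure E" for x using line[OF that] by simp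
    have up: "x \<in> T" if "x \<in> ball q d" "(x - q) \<bullet> (\<sigma> *\<^sub>R ?n) > 0" for x
      by (rule half_disc[OF assms(1) d(2)[OF assms(1)] assms(2,3) sn0 lines y(2) ypos that y(1)])
    have cl: "closure T \<subseteq> closure \<Omega>" "closure T1 \<subseteq> closure \<Omega>"
      using meshD(9)[OF mesh] assms(1) T1(1) by auto
    let ?O = "ball q d - closure \<Omega>"
    have "(x - q) \<bullet> (\<sigma> *\<^sub>R ?n) = 0" if x: "x \<in> ?O" for x
    proof (rule ccontr)
      assume "(x - q) \<bullet> (\<sigma> *\<^sub>R ?n) \<noteq> 0"
      then have "x \<in> T \<or> x \<in> T1" using up s(2) x by (metis DiffD1 linorder_neqE_linordered_idom)
      then show False using cl closure_subset[of T] closure_subset[of T1] x by blast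
    qed
    then have "?O = {}" by (intro open_in_line_empty[OF _ sn0, of _ q]) auto
    then have "q \<in> interior (closure \<Omega>)" using d(1) by (auto simp: mem_interior)
    then have "q \<in> \<Omega>" using Om by (simp add: polygonal_def)
    moreover have "q \<in> frontier \<Omega>" "open \<Omega>" using T1(2) assms(3) Om by (auto simp: polygonal_def)
    ultimately show False by (simp add: frontier_def interior_open)
  qed
qed

end

text \<open>A bounded subset of the line is the signed superposition of the half-lines to the left of
  its boundary points.\<close>

lemma crossing_indicator:
  fixes U :: "real set" and s :: "real \<Rightarrow> real"
  assumes "bounded U" "finite P" "frontier U \<subseteq> P"
    and cross: "\<And>p. p \<in> P \<Longrightarrow> \<exists>e>0. (s p = 1 \<and> {p - e<..<p} \<subseteq> U \<and> {p<..<p + e} \<inter> U = {}) \<or>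
                                    (s p = -1 \<and> {p - e<..<p} \<inter> U = {} \<and> {p<..<p + e} \<subseteq> U)"
  shows "x \<notin> P \<Longrightarrow> indicator U x = (\<Sum>p\<in>{p\<in>P. x < p}. s p)"
\<comment> \<open>Induction on the number of boundary points to the right of x. Beyond the last of
  them U is empty because it is bounded, and passing the leftmost one, p, changes the indicator by
  exactly \<open>s p\<close>.\<close>
proof (induction "card {p\<in>P. x < p}" arbitrary: x rule: less_induct)
  case less
  have same: "a \<in> U \<longleftrightarrow> b \<in> U" if "a \<le> b" "{a..b} \<inter> P = {}" for a b
  proof (rule ccontr)
    assume "\<not> (a \<in> U \<longleftrightarrow> b \<in> U)"
    then have "{a..b} \<inter> U \<noteq> {}" "{a..b} - U \<noteq> {}" using that by auto
    then have "{a..b} \<inter> frontier U \<noteq> {}" by (intro connected_Int_frontier) auto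
    then show False using that(2) assms(3) by blast
  qed
  let ?A = "{p\<in>P. x < p}"
  have finA: "finite ?A" using assms(2) by simp
  show ?case
  proof (cases "?A = {}")
    case True
    obtain B where B: "\<And>u. u \<in> U \<Longrightarrow> \<bar>u\<bar> \<le> B" using assms(1) by (auto simp: bounded_iff)
    define b where "b = max x (B + 1)"
    have "b \<notin> U" using B[of b] by (auto simp: b_def)
    moreover have "{x..b} \<inter> P = {}" using True less.prems by force
    ultimately have "x \<notin> U" using same[of x b] by (simp add: b_def)
    then show ?thesis unfolding True by simp
  next
    case False
    define p where "p = Min ?A"
    have p: "p \<in> P" "x < p" using Min_in[OF finA False] by (auto simp: p_def)
    have pmin: "p \<le> p'" if "p' \<in> P" "x < p'" for p' using that finA by (simp add: p_def)
    define B where "B = {p'\<in>P. p < p'}"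
    have A: "?A = insert p B" using p pmin by (force simp: B_def)
    have finB: "finite B" using assms(2) by (simp add: B_def)
    obtain e where e: "e > 0" "(s p = 1 \<and> {p - e<..<p} \<subseteq> U \<and> {p<..<p + e} \<inter> U = {}) \<or>
                        (s p = -1 \<and> {p - e<..<p} \<inter> U = {} \<and> {p<..<p + e} \<subseteq> U)" using cross[OF p(1)] by blast
    \<comment> \<open>A point to the right of p that precedes every later boundary point and still
      lies in the one-sided neighbourhood of p; the induction hypothesis applies to it. Its
      counterpart to the left of p is z below, which no boundary point separates from x.\<close>
    obtain m where m: "p < m" "m < p + e" "\<And>p'. p' \<in> B \<Longrightarrow> m < p'"
    proof (cases "B = {}")
      case True
      show ?thesis by (rule that[of "p + e/2"]) (use e True in auto)
    next
      case nB: False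
      have "p < Min B" using Min_in[OF finB nB] by (simp add: B_def)
      then show ?thesis
      proof -
        define X where "X = min (p + e) (Min B)"
        have X: "X \<le> Min B" "X \<le> p + e" "p < X" using \<open>p < Min B\<close> e(1) by (auto simp: X_def)
        have "(p + X) / 2 < p'" if "p' \<in> B" for p'
          using Min_le[OF finB that] X by simp
        then show ?thesis using X e(1) by (intro that[of "(p + X) / 2"]) auto
      qed
    qed
    have mP: "m \<notin> P" using m by (force simp: B_def)
    have mA: "{p'\<in>P. m < p'} = B" using m by (force simp: B_def)
    have "p \<notin> B" by (simp add: B_def)
    then have "card {p'\<in>P. m < p'} < card ?A" using finB by (simp add: mA A)
    from less.hyps[OF this mP] have IH: "indicator U m = sum s B" by (simp add: mA)
    define z where "z = max x (p - e/2)"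
    have "{x..z} \<inter> P = {}" using pmin less.prems e p by (force simp: z_def)
    then have xz: "x \<in> U \<longleftrightarrow> z \<in> U" by (intro same) (auto simp: z_def)
    have zi: "z \<in> {p - e<..<p}" using p e by (auto simp: z_def)
    have mi: "m \<in> {p<..<p + e}" using m by simp
    have "sum s ?A = s p + indicator U m" using finB \<open>p \<notin> B\<close> IH by (simp add: A)
    also have "\<dots> = indicator U x" using e(2) zi mi xz by (auto simp: indicator_def)
    finally show ?thesis by simp
  qed
qed

text \<open>Replacing the indicator by its superposition of half-lines leaves integrals over
  intervals with a common left end L outside U. The fundamental theorem evaluates them, and the
  contributions of \<open>F L\<close> cancel because the signs sum to the indicator at L, which is
  zero.\<close>

lemma crossing_integral:
  fixes U :: "real set" and s F f :: "real \<Rightarrow> real"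
  assumes "bounded U" "finite P" "frontier U \<subseteq> P"
    and cross: "\<And>p. p \<in> P \<Longrightarrow> \<exists>e>0. (s p = 1 \<and> {p - e<..<p} \<subseteq> U \<and> {p<..<p + e} \<inter> U = {}) \<or>
                                    (s p = -1 \<and> {p - e<..<p} \<inter> U = {} \<and> {p<..<p + e} \<subseteq> U)"
    and F: "\<And>x. (F has_real_derivative f x) (at x)" "\<And>x. isCont f x"
  shows "(\<integral>x. indicator U x * f x \<partial>lborel) = (\<Sum>p\<in>P. s p * F p)"
proof -
  have ci: "indicator U x = (\<Sum>p\<in>{p\<in>P. x < p}. s p)" if "x \<notin> P" for x
    by (rule crossing_indicator[OF assms(1-3)]) (erule cross, rule that)
  obtain B where B: "\<And>u. u \<in> U \<union> P \<Longrightarrow> \<bar>u\<bar> \<le> B"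
    using assms(1) finite_imp_bounded[OF assms(2)] bounded_Un[of U P] by (auto simp: bounded_iff)
  define L where "L = - B - 1"
  have L: "L < u" if "u \<in> U \<union> P" for u using B[OF that] by (auto simp: L_def)
  have LP: "L \<notin> P" "L \<notin> U" using L by blast+
  have "{p\<in>P. L < p} = P" using L by blast
  with ci[OF LP(1)] LP(2) have s0: "(\<Sum>p\<in>P. s p) = 0" by simp
  let ?g = "\<lambda>p x. f x * indicator {L..p} x"
  have int: "integrable lborel (?g p)" for p
    using borel_integrable_compact[of "{L..p}" f] F(2)
    by (simp add: continuous_at_imp_continuous_on mult.commute)
  have eq: "AE x in lborel. indicator U x * f x = (\<Sum>p\<in>P. s p * ?g p x)"
  proof -
    have "finite (insert L P)" using assms(2) by simp
    then have "AE x in lborel. x \<notin> insert L P"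
      by (intro AE_not_in finite_imp_null_set_lborel)
    then show ?thesis
    proof eventually_elim
      case (elim x)
      have "(\<Sum>p\<in>P. s p * ?g p x) = (\<Sum>p\<in>P. if L < x \<and> x < p then s p * f x else 0)"
        using elim by (intro sum.cong) (auto simp: indicator_def)
      also have "\<dots> = (if L < x then (\<Sum>p\<in>{p\<in>P. x < p}. s p) * f x else 0)"
        by (cases "L < x") (simp_all add: sum_distrib_right sum.inter_filter[OF assms(2), symmetric])
      also have "\<dots> = indicator U x * f x"
        using ci[of x] elim L[of x] by (cases "x \<in> U") (auto simp: indicator_def)
      finally show ?case ..
    qed
  qed
  have m: "(\<lambda>x. \<Sum>p\<in>P. s p * ?g p x) \<in> borel_measurable lborel"
    using int by (intro borel_measurable_integrable Bochner_Integration.integrable_sum integrable_mult_right) auto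
  have "(\<integral>x. indicator U x * f x \<partial>lborel) = (\<integral>x. (\<Sum>p\<in>P. s p * ?g p x) \<partial>lborel)"
  proof (rule integral_cong_AE[OF _ m eq])
    have "U \<in> sets borel"
    proof -
      have "U = interior U \<union> (U \<inter> frontier U)" using interior_subset[of U] closure_subset[of U] by (auto simp: frontier_def)
      moreover have "finite (U \<inter> frontier U)" using assms(2,3) finite_subset by blast
      ultimately show ?thesis by (metis borel_open open_interior sets.Un finite_imp_closed borel_closed)
    qed
    moreover have "f \<in> borel_measurable borel"
      using F(2) by (intro borel_measurable_continuous_onI continuous_at_imp_continuous_on) auto
    ultimately show "(\<lambda>x. indicator U x * f x) \<in> borel_measurable lborel"
      by (auto intro!: borel_measurable_times borel_measurable_indicator)
  qed
  also have "\<dots> = (\<Sum>p\<in>P. s p * (\<integral>x. ?g p x \<partial>lborel))"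
    using int by (subst Bochner_Integration.integral_sum) auto
  also have "\<dots> = (\<Sum>p\<in>P. s p * (F p - F L))"
    using F L by (intro sum.cong refl arg_cong[of _ _ "(*) _"] integral_FTC_Icc_real) (auto simp: less_imp_le)
  also have "\<dots> = (\<Sum>p\<in>P. s p * F p)"
    using s0 by (simp add: right_diff_distrib sum_subtractf sum_distrib_right[symmetric])
  finally show ?thesis .
qed

section \<open>Iterated integrals in the plane\<close>

definition pt :: "real \<Rightarrow> real \<Rightarrow> point" where
  "pt x y = vector [x, y]"

lemma pt_nth [simp]: "pt x y $ 1 = x" "pt x y $ 2 = y"
  by (simp_all add: pt_def)

lemma pt_coords: "pt (z $ 1) (z $ 2) = z"
  by (simp add: vec_eq_iff forall_2)

lemma pt_line: "pt x y = pt 0 y + x *\<^sub>R axis 1 1"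
  by (simp add: vec_eq_iff forall_2 axis_def)

lemma continuous_pt: "continuous_on S (\<lambda>(x, y). pt x y)"
  unfolding continuous_on_componentwise[of S "\<lambda>(x, y). pt x y"]
proof -
  have e: "(\<lambda>(x, y). pt x y) = (\<lambda>z. fst z *\<^sub>R axis 1 1 + snd z *\<^sub>R axis 2 1)"
    by (auto simp: vec_eq_iff forall_2 axis_def)
  show "\<forall>i\<in>Basis. continuous_on S (\<lambda>x. (case x of (x, y) \<Rightarrow> pt x y) \<bullet> i)"
    unfolding e by (intro ballI continuous_intros)
qed

lemma measurable_pt: "(\<lambda>(x, y). pt x y) \<in> borel_measurable borel"
  by (rule borel_measurable_continuous_onI[OF continuous_pt])

text \<open>Identifies the measure on \<open>real^2\<close> with the product measure so that Fubini
  applies; it suffices that both agree on boxes.\<close>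

lemma lborel_point: "lborel = distr (lborel \<Otimes>\<^sub>M lborel) borel (\<lambda>(x, y). pt x y)"
proof (rule lborel_eqI)
  fix l u :: point
  assume le: "\<And>b. b \<in> Basis \<Longrightarrow> l \<bullet> b \<le> u \<bullet> b"
  have B: "(Basis :: point set) = {axis 1 1, axis 2 1}"
    by (auto simp: Basis_vec_def UNIV_2)
  have ne: "axis 1 1 \<noteq> (axis 2 1 :: point)" by (simp add: axis_eq_axis)
  have "(\<lambda>(x, y). pt x y) -` box l u = box (l$1) (u$1) \<times> box (l$2) (u$2)"
    by (auto simp: mem_box B inner_axis)
  moreover have "emeasure (lborel \<Otimes>\<^sub>M lborel) (box (l$1) (u$1) \<times> box (l$2) (u$2)) = ennreal (u$1 - l$1) * ennreal (u$2 - l$2)"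
    using le[of "axis 1 1"] le[of "axis 2 1"]
    by (subst lborel.emeasure_pair_measure_Times) (auto simp: B inner_axis)
  ultimately show "emeasure (distr (lborel \<Otimes>\<^sub>M lborel) borel (\<lambda>(x, y). pt x y)) (box l u) = ennreal (\<Prod>b\<in>Basis. (u - l) \<bullet> b)"
    using measurable_pt le[of "axis 1 1"] le[of "axis 2 1"] ne
    by (subst emeasure_distr) (auto simp: B inner_axis space_pair_measure ennreal_mult lborel_prod)
qed simp

lemma lborel_point_integral:
  fixes f :: "point \<Rightarrow> real"
  assumes "integrable lborel f"
  shows "(\<integral>z. f z \<partial>lborel) = (\<integral>y. (\<integral>x. f (pt x y) \<partial>lborel) \<partial>lborel)"
proof -
  have mp: "(\<lambda>(x, y). pt x y) \<in> measurable (lborel \<Otimes>\<^sub>M lborel) borel"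
    using measurable_pt by (simp add: lborel_prod)
  have mf: "f \<in> borel_measurable borel" using assms by auto
  have i: "integrable (lborel \<Otimes>\<^sub>M lborel) (\<lambda>z. f (case z of (x, y) \<Rightarrow> pt x y))"
    using assms integrable_distr_eq[OF mp mf] lborel_point by simp
  have "(\<integral>z. f z \<partial>lborel) = (\<integral>z. f (case z of (x, y) \<Rightarrow> pt x y) \<partial>(lborel \<Otimes>\<^sub>M lborel))"
    by (subst lborel_point) (rule integral_distr[OF mp mf])
  also have "\<dots> = (\<integral>y. (\<integral>x. f (pt x y) \<partial>lborel) \<partial>lborel)"
    using lborel_pair.integral_snd[of "\<lambda>x y. f (pt x y)"] i by (simp add: case_prod_unfold)
  finally show ?thesis .
qed

lemma pt_diff: "pt (x + r) y - pt x y = r *\<^sub>R axis 1 1"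
  by (simp add: vec_eq_iff forall_2 axis_def)

text \<open>Fubini and the fundamental theorem of calculus on the horizontal lines that contain no vertex:
  such a line crosses the boundary of \<open>T\<close> transversally, once per edge, and the sign of the normal
  tells on which side of the crossing \<open>T\<close> lies.\<close>

lemma elem_divergence_x:
  assumes mesh: "polygonal_mesh \<Omega> M" and Om: "polygonal \<Omega>" and T: "T \<in> elems M" and p: "p \<in> Poly m"
  shows "(LINT z:T|lebesgue. dir_deriv (axis 1 1) p z) =
    (\<Sum>E\<in>elem_edges M T. sign_TE M T E * normal M E $ 1 * edge_integral E p)"
proof -
  let ?g = "dir_deriv (axis 1 1) p"
  note oT = meshD(3,4)[OF mesh T]
  obtain A B where AB: "\<And>E. E \<in> edges M \<Longrightarrow> A E \<noteq> B E \<and> E = open_segment (A E) (B E) \<and>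
      tangent M E = (B E - A E) /\<^sub>R norm (B E - A E)"
    using mesh_edgesD(3)[OF mesh] by metis
  \<comment> \<open>At height y the line through E has parameter \<open>s E y\<close> and passes
    through \<open>q E y\<close>; \<open>I y\<close> collects the edges met there. Horizontal edges
    are left out consistently, since the first component of their normal is zero.\<close>
  define s where "s E y = (y - A E $ 2) / (B E $ 2 - A E $ 2)" for E y
  define I where "I y = {E \<in> elem_edges M T. A E $ 2 \<noteq> B E $ 2 \<and> s E y \<in> {0..1}}" for y
  define q where "q E y = A E + s E y *\<^sub>R (B E - A E)" for E y
  define \<nu> where "\<nu> E = sign_TE M T E * normal M E $ 1" for E
  let ?Y = "(\<lambda>v. v $ 2) ` mesh_verts M"
  have eE: "E \<in> edges M" if "E \<in> elem_edges M T" for E using elem_edgesD that by blast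
  have finI: "finite (I y)" for y using finite_elem_edges[OF mesh] by (simp add: I_def)
  have n1: "normal M E $ 1 = - (B E $ 2 - A E $ 2) / norm (B E - A E)" if "E \<in> edges M" for E
  proof -
    have t: "tangent M E = (B E - A E) /\<^sub>R norm (B E - A E)" using AB[OF that] by blast
    have "normal M E $ 1 = - (tangent M E $ 2)" by (simp add: normal_def rot90_def)
    then show ?thesis unfolding t by (simp add: divide_inverse) (simp add: algebra_simps)
  qed
  have verts: "A E \<in> mesh_verts M" "B E \<in> mesh_verts M" if "E \<in> edges M" for E
    using AB[OF that] that edge_verts_segment[of "A E" "B E"] unfolding mesh_verts_def by auto
  have q2: "q E y $ 2 = y" if "A E $ 2 \<noteq> B E $ 2" for E y
    using that by (simp add: q_def s_def)
  have inner: "(\<integral>x. indicator T (pt x y) * ?g (pt x y) \<partial>lborel) = (\<Sum>E\<in>I y. sgn (\<nu> E) * p (q E y))"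
    if y: "y \<notin> ?Y" for y
  proof -
    have notvert: "z \<notin> mesh_verts M" if "z $ 2 = y" for z using y that by auto
    let ?U = "{x. pt x y \<in> T}"
    have ptc: "continuous_on UNIV (\<lambda>x. pt x y)"
    proof -
      have "(\<lambda>x. pt x y) = (\<lambda>x. pt 0 y + x *\<^sub>R axis 1 1)" by (rule ext) (rule pt_line)
      then show ?thesis by (simp only:) (intro continuous_intros)
    qed
    have qE: "q E y \<in> E" "q E y = pt (q E y $ 1) y" if "E \<in> I y" for E
    proof -
      have E: "E \<in> edges M" "A E $ 2 \<noteq> B E $ 2" "s E y \<in> {0..1}" using that eE by (auto simp: I_def)
      show 2: "q E y = pt (q E y $ 1) y" using q2[OF E(2)] pt_coords[of "q E y"] by simp
      have "q E y \<in> closure (open_segment (A E) (B E))"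
        unfolding q_def using AB[OF E(1)] E(3) by (intro line_in_closure) auto
      then have "q E y \<in> closure E" using AB[OF E(1)] by metis
      then show "q E y \<in> E" using closure_edge_vertex[OF mesh Om E(1)] notvert[OF q2[OF E(2)]] by blast
    qed
    have inj: "inj_on (\<lambda>E. q E y $ 1) (I y)"
    proof (rule inj_onI)
      fix E E' assume E: "E \<in> I y" "E' \<in> I y" "q E y $ 1 = q E' y $ 1"
      then have "q E y = q E' y" using qE(2)[OF E(1)] qE(2)[OF E(2)] by simp
      then have "q E y \<in> E \<inter> E'" using qE(1)[OF E(1)] qE(1)[OF E(2)] by simp
      moreover have "E \<in> edges M" "E' \<in> edges M" using E(1,2) eE by (auto simp: I_def)
      ultimately show "E = E'" using meshD(7)[OF mesh, of E E'] by blast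
    qed
    let ?P = "(\<lambda>E. q E y $ 1) ` I y"
    \<comment> \<open>In \<open>crossing_integral\<close> the signs are indexed by boundary points,
      whereas here they belong to edges; at a height without vertices distinct edges are crossed at
      distinct points, so the index can be changed.\<close>
    define \<sigma> where "\<sigma> x = sgn (\<nu> (inv_into (I y) (\<lambda>E. q E y $ 1) x))" for x
    have sg: "\<sigma> (q E y $ 1) = sgn (\<nu> E)" if "E \<in> I y" for E
      unfolding \<sigma>_def using inv_into_f_f[OF inj that] by simp
    have "(\<integral>x. indicator ?U x * ?g (pt x y) \<partial>lborel) = (\<Sum>x\<in>?P. \<sigma> x * p (pt x y))"
    proof (rule crossing_integral)
      obtain K where K: "\<And>z. z \<in> T \<Longrightarrow> norm z \<le> K" using oT(2) by (auto simp: bounded_iff)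
      have "\<bar>x\<bar> \<le> K" if "x \<in> ?U" for x
        using K[of "pt x y"] that component_le_norm_cart[of "pt x y" 1] by simp
      then show "bounded ?U" by (auto simp: bounded_iff)
      show "finite ?P" using finI by blast
      have oU: "open ?U"
        using open_vimage[OF oT(1) ptc] by (simp add: vimage_def)
      show "frontier ?U \<subseteq> ?P"
      proof
        fix x assume x: "x \<in> frontier ?U"
        have "x \<in> closure ?U" "x \<notin> ?U" using x oU by (auto simp: frontier_def interior_open)
        have "(\<lambda>x. pt x y) ` closure ?U \<subseteq> closure T"
          by (rule image_closure_subset[OF continuous_on_subset[OF ptc]]) (use closure_subset[of T] in auto)
        then have "pt x y \<in> closure T" using \<open>x \<in> closure ?U\<close> by blast
        moreover have "pt x y \<notin> T" using \<open>x \<notin> ?U\<close> by simp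
        ultimately have fr: "pt x y \<in> frontier T" using oT(1) by (simp add: frontier_def interior_open)
        then obtain E where E: "E \<in> edges M" "pt x y \<in> closure E" using frontier_elem_edges[OF mesh Om T] by blast
        have nv: "pt x y \<notin> mesh_verts M" by (rule notvert) simp
        then have "pt x y \<in> E" using closure_edge_vertex[OF mesh Om E] by blast
        then have ET: "E \<in> elem_edges M T" using frontier_point_elem_edge[OF mesh Om T E(1) _ nv fr] by blast
        obtain u where u: "u \<in> {0..1}" "pt x y = A E + u *\<^sub>R (B E - A E)"
          using closure_edge_line[of "A E" "B E" "pt x y"] AB[OF E(1)] E(2) by metis
        have y2: "y = A E $ 2 + u * (B E $ 2 - A E $ 2)"
          using arg_cong[OF u(2), of "\<lambda>z. z $ 2"] by simp
        have ne: "A E $ 2 \<noteq> B E $ 2"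
        proof
          assume "A E $ 2 = B E $ 2"
          then have "A E $ 2 = y" using y2 by simp
          then show False using notvert verts(1)[OF E(1)] by blast
        qed
        have "s E y = u" using ne by (simp add: s_def y2)
        then have "E \<in> I y" "q E y = pt x y" using ET ne u by (auto simp: I_def q_def)
        then show "x \<in> ?P" by (intro image_eqI[of _ _ E]) auto
      qed
      show "((\<lambda>x. p (pt x y)) has_real_derivative ?g (pt x y)) (at x)" for x
        using Poly_line_deriv[OF p, of "pt 0 y" "axis 1 1" x UNIV] by (simp add: pt_line[of _ y, symmetric])
      have "continuous_on UNIV (\<lambda>x. ?g (pt x y))"
        by (rule continuous_on_compose2[OF Poly_continuous_on[OF dir_deriv_Poly[OF p]] ptc, of UNIV]) auto
      then show "isCont (\<lambda>x. ?g (pt x y)) x" for x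
        using continuous_on_eq_continuous_at[of UNIV "\<lambda>x. ?g (pt x y)"] by simp
      fix x assume "x \<in> ?P"
      then obtain E where E: "E \<in> I y" "x = q E y $ 1" by blast
      have ET: "E \<in> elem_edges M T" and EM: "E \<in> edges M" and ne: "A E $ 2 \<noteq> B E $ 2"
        using E(1) eE by (auto simp: I_def)
      have qx: "pt x y \<in> E" using qE[OF E(1)] E(2) by metis
      have nv: "pt x y \<notin> mesh_verts M" by (rule notvert) simp
      obtain d where d: "d > 0" "\<And>T. T \<in> elems M \<Longrightarrow> ball (pt x y) d \<inter> frontier T \<subseteq> closure E"
        by (rule isolating_ball[OF mesh Om EM qx nv]) (rule that)
      have sgn1: "sign_TE M T E \<in> {1, -1}" using mesh_edgesD(4)[OF mesh T ET] .
      have "B E \<noteq> A E" using ne by auto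
      then have "normal M E $ 1 \<noteq> 0" using n1[OF EM] ne by simp
      then have \<nu>0: "\<nu> E \<noteq> 0" using sgn1 by (auto simp: \<nu>_def)
      have ip: "(pt (x + r) y - pt x y) \<bullet> (sign_TE M T E *\<^sub>R normal M E) = r * \<nu> E" for r
        unfolding pt_diff \<nu>_def by (simp add: inner_axis' )
      have bl: "pt (x + r) y \<in> ball (pt x y) d" if "\<bar>r\<bar> < d" for r
        using that by (simp only: mem_ball dist_norm norm_minus_commute[of "pt x y"] pt_diff) (simp add: norm_axis_1)
      note es = edge_sides[OF mesh Om T ET qx d(1) d(2)[OF T] refl bl, unfolded ip]
      have in1: "pt w y \<in> T" if "\<bar>w - x\<bar> < d" "(w - x) * \<nu> E < 0" for w
        using es(1)[OF that] by simp
      have out1: "pt w y \<notin> T" if "\<bar>w - x\<bar> < d" "(w - x) * \<nu> E > 0" for w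
        using es(2)[OF that] by simp
      show "\<exists>e>0. (\<sigma> x = 1 \<and> {x - e<..<x} \<subseteq> ?U \<and> {x<..<x + e} \<inter> ?U = {}) \<or>
                   (\<sigma> x = -1 \<and> {x - e<..<x} \<inter> ?U = {} \<and> {x<..<x + e} \<subseteq> ?U)"
      proof (intro exI[of _ d] conjI d(1))
        show "(\<sigma> x = 1 \<and> {x - d<..<x} \<subseteq> ?U \<and> {x<..<x + d} \<inter> ?U = {}) \<or>
                   (\<sigma> x = -1 \<and> {x - d<..<x} \<inter> ?U = {} \<and> {x<..<x + d} \<subseteq> ?U)"
        proof (cases "\<nu> E > 0")
          case True
          then have "\<sigma> x = 1" using sg[OF E(1)] E(2) by simp
          moreover have "{x - d<..<x} \<subseteq> ?U" using True by (auto intro!: in1 simp: mult_neg_pos)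
          moreover have "{x<..<x + d} \<inter> ?U = {}"
          proof -
            have "pt w y \<notin> T" if "x < w" "w < x + d" for w using True that by (intro out1) auto
            then show ?thesis by auto
          qed
          ultimately show ?thesis by blast
        next
          case False
          then have neg: "\<nu> E < 0" using \<nu>0 by simp
          then have "\<sigma> x = -1" using sg[OF E(1)] E(2) by simp
          moreover have "{x<..<x + d} \<subseteq> ?U" using neg by (auto intro!: in1 simp: mult_pos_neg)
          moreover have "{x - d<..<x} \<inter> ?U = {}"
          proof -
            have "pt w y \<notin> T" if "w < x" "x - d < w" for w using neg that by (intro out1) (auto simp: mult_neg_neg)
            then show ?thesis by auto
          qed
          ultimately show ?thesis by blast
        qed
      qed
    qed
    also have "\<dots> = (\<Sum>E\<in>I y. sgn (\<nu> E) * p (q E y))"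
      by (subst sum.reindex[OF inj]) (use sg qE(2) in \<open>auto intro!: sum.cong\<close>)
    finally show ?thesis by (simp add: indicator_def)
  qed
  let ?h = "\<lambda>E y. if A E $ 2 \<noteq> B E $ 2 \<and> s E y \<in> {0..1} then sgn (\<nu> E) * p (q E y) else 0"
  have hint: "integrable lborel (?h E) \<and> (\<integral>y. ?h E y \<partial>lborel) = \<nu> E * edge_integral E p"
    if "E \<in> elem_edges M T" for E
  proof (cases "A E $ 2 = B E $ 2")
    case True
    then show ?thesis using n1[OF eE[OF that]] by (simp add: \<nu>_def)
  next
    case False
    note E = eE[OF that]
    let ?d = "B E $ 2 - A E $ 2"
    have d0: "?d \<noteq> 0" using False by simp
    define f where "f u = sgn (\<nu> E) * (indicator {0..1} u * p (A E + u *\<^sub>R (B E - A E)))" for u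
    have hf: "?h E y = f (s E y)" for y using False by (simp add: f_def indicator_def q_def)
    have hs: "?h E (A E $ 2 + ?d * u) = f u" for u unfolding hf using d0 by (simp add: s_def)
    have "continuous_on {0..1} (\<lambda>u. p (A E + u *\<^sub>R (B E - A E)))"
      by (rule continuous_on_compose2[OF Poly_continuous_on[OF p]]) (auto intro!: continuous_intros)
    from borel_integrable_compact[OF compact_Icc this] have "integrable lborel f"
      unfolding f_def by (intro integrable_mult_right) simp
    then have i: "integrable lborel (?h E)"
      using lborel_integrable_real_affine_iff[OF d0, of "?h E" "A E $ 2"] unfolding hs by simp
    have "(\<integral>y. ?h E y \<partial>lborel) = \<bar>?d\<bar> *\<^sub>R (\<integral>u. ?h E (A E $ 2 + ?d * u) \<partial>lborel)"
      by (rule lborel_integral_real_affine[OF d0])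
    also have "\<dots> = \<bar>?d\<bar> * sgn (\<nu> E) * int01 (\<lambda>u. p (A E + u *\<^sub>R (B E - A E)))"
      unfolding hs by (simp add: f_def set_lebesgue_integral_def)
    \<comment> \<open>The height difference d along E is, up to sign, the first component of the
      normal times the length. The Jacobian of the substitution of the height by the edge parameter
      thus supplies the arc length and leaves the normal component as coefficient.\<close>
    also have "\<bar>?d\<bar> * sgn (\<nu> E) = \<nu> E * dist (A E) (B E)"
    proof -
      have "B E \<noteq> A E" using False by auto
      then have nz: "norm (B E - A E) > 0" by simp
      have \<nu>: "\<nu> E = - (sign_TE M T E * ?d) / norm (B E - A E)"
        unfolding \<nu>_def n1[OF E] by (simp add: divide_inverse algebra_simps)
      have "sign_TE M T E \<in> {1, -1}" using mesh_edgesD(4)[OF mesh T that] .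
      then have "\<bar>?d\<bar> = \<bar>\<nu> E\<bar> * norm (B E - A E)" using nz unfolding \<nu> by (auto simp: abs_mult)
      then have "\<bar>?d\<bar> * sgn (\<nu> E) = (sgn (\<nu> E) * \<bar>\<nu> E\<bar>) * norm (B E - A E)" by simp
      then show ?thesis by (simp add: sgn_mult_abs dist_norm norm_minus_commute)
    qed
    also have "\<nu> E * dist (A E) (B E) * int01 (\<lambda>u. p (A E + u *\<^sub>R (B E - A E))) = \<nu> E * edge_integral E p"
    proof -
      have "A E \<noteq> B E" "E = open_segment (A E) (B E)" using AB[OF E] by blast+
      from edge_integral_segment[OF this(1), of p, folded this(2)] show ?thesis by simp
    qed
    finally show ?thesis using i by blast
  qed
  have fe: "finite (elem_edges M T)" by (rule finite_elem_edges[OF mesh])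
  have "continuous_on UNIV ?g" by (rule Poly_continuous_on[OF dir_deriv_Poly[OF p]])
  note si = set_integrable_continuous[OF oT(2) borel_open[OF oT(1)] this]
  have "(LINT z:T|lebesgue. ?g z) = (\<integral>z. indicator T z * ?g z \<partial>lborel)"
    using si(3) by (simp add: set_lebesgue_integral_def)
  also have "\<dots> = (\<integral>y. (\<integral>x. indicator T (pt x y) * ?g (pt x y) \<partial>lborel) \<partial>lborel)"
    using si(1) by (intro lborel_point_integral) (simp add: set_integrable_def)
  also have "\<dots> = (\<integral>y. (\<Sum>E\<in>elem_edges M T. ?h E y) \<partial>lborel)"
  proof (rule integral_cong_AE)
    show m: "(\<lambda>y. \<Sum>E\<in>elem_edges M T. ?h E y) \<in> borel_measurable lborel"
      using hint by (intro borel_measurable_integrable Bochner_Integration.integrable_sum) auto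
    have "(\<lambda>z. indicator T z * ?g z) \<in> borel_measurable borel"
      using si(1) by (simp add: set_integrable_def)
    then have "(\<lambda>z. indicator T (pt (fst z) (snd z)) * ?g (pt (fst z) (snd z))) \<in> borel_measurable (lborel \<Otimes>\<^sub>M lborel)"
      using measurable_compose[of "\<lambda>(x, y). pt x y" "lborel \<Otimes>\<^sub>M lborel" borel "\<lambda>z. indicator T z * ?g z"] measurable_pt
      by (simp add: lborel_prod case_prod_unfold)
    then show "(\<lambda>y. \<integral>x. indicator T (pt x y) * ?g (pt x y) \<partial>lborel) \<in> borel_measurable lborel"
      using lborel.borel_measurable_lebesgue_integral[of "\<lambda>y x. indicator T (pt x y) * ?g (pt x y)" lborel]
        measurable_compose[OF measurable_pair_swap', of "\<lambda>z. indicator T (pt (fst z) (snd z)) * ?g (pt (fst z) (snd z))"]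
      by (simp add: case_prod_unfold)
    have "finite ?Y" using finite_mesh_verts[OF mesh] by blast
    then have "AE y in lborel. y \<notin> ?Y" by (intro AE_not_in finite_imp_null_set_lborel)
    then show "AE y in lborel. (\<integral>x. indicator T (pt x y) * ?g (pt x y) \<partial>lborel) = (\<Sum>E\<in>elem_edges M T. ?h E y)"
    proof eventually_elim
      case (elim y)
      show ?case unfolding inner[OF elim] I_def by (rule sum.inter_filter[OF fe])
    qed
  qed
  also have "\<dots> = (\<Sum>E\<in>elem_edges M T. \<integral>y. ?h E y \<partial>lborel)"
    using hint by (intro Bochner_Integration.integral_sum) auto
  also have "\<dots> = (\<Sum>E\<in>elem_edges M T. \<nu> E * edge_integral E p)"
    using hint by (intro sum.cong) auto
  finally show ?thesis by (simp add: \<nu>_def)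
qed

section \<open>Decomposition of symmetric polynomial tensors\<close>

lemma continuous_on_tensor:
  fixes \<tau> :: "point \<Rightarrow> tensor"
  assumes "\<And>i j. continuous_on S (\<lambda>x. \<tau> x $ i $ j)"
  shows "continuous_on S \<tau>"
proof -
  have "continuous_on S (\<lambda>x. \<chi> i j. \<tau> x $ i $ j)"
    by (intro continuous_on_vec_lambda assms)
  then show ?thesis by simp
qed

lemma Poly_symD:
  assumes "\<tau> \<in> Poly_sym m"
  shows "(\<lambda>x. \<tau> x $ i $ j) \<in> Poly m" "\<tau> x $ i $ j = \<tau> x $ j $ i" "\<tau> x \<in> sym_tensors"
proof -
  show "(\<lambda>x. \<tau> x $ i $ j) \<in> Poly m" "\<tau> x \<in> sym_tensors" using assms by (auto simp: Poly_sym_def)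
  have "transpose (\<tau> x) = \<tau> x" using assms by (auto simp: Poly_sym_def sym_tensors_def)
  then have "transpose (\<tau> x) $ j $ i = \<tau> x $ j $ i" by simp
  then show "\<tau> x $ i $ j = \<tau> x $ j $ i" by (simp add: transpose_def)
qed

lemma Poly_symI:
  assumes "\<And>i j. (\<lambda>x. \<tau> x $ i $ j) \<in> Poly m" "\<And>x i j. \<tau> x $ i $ j = \<tau> x $ j $ i"
  shows "\<tau> \<in> Poly_sym m"
  using assms by (auto simp: Poly_sym_def sym_tensors_def transpose_def vec_eq_iff)

lemma Poly_sym_continuous: "\<tau> \<in> Poly_sym m \<Longrightarrow> continuous_on S \<tau>"
  by (intro continuous_on_tensor Poly_continuous_on Poly_symD(1))

lemma subspace_sym_tensors: "subspace sym_tensors"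
  by (rule subspaceI) (auto simp: sym_tensors_def transpose_def vec_eq_iff)

lemma subspace_Poly_sym: "subspace (Poly_sym m)"
proof (rule subspaceI)
  show "0 \<in> Poly_sym m" by (rule Poly_symI) auto
next
  fix \<sigma> \<tau> assume *: "\<sigma> \<in> Poly_sym m" "\<tau> \<in> Poly_sym m"
  show "\<sigma> + \<tau> \<in> Poly_sym m"
    using Poly_symD(2)[OF *(1)] Poly_symD(2)[OF *(2)]
    by (intro Poly_symI) (auto intro!: Poly_add Poly_symD(1)[OF *(1)] Poly_symD(1)[OF *(2)])
next
  fix \<sigma> and r :: real assume *: "\<sigma> \<in> Poly_sym m"
  show "r *\<^sub>R \<sigma> \<in> Poly_sym m"
    using Poly_symD(2)[OF *(1)]
    by (intro Poly_symI) (auto intro!: Poly_cmult Poly_symD(1)[OF *(1)])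
qed

lemma findim_Poly_sym: "findim (Poly_sym m)"
proof -
  let ?V = "Poly m \<times> Poly m \<times> Poly m \<times> Poly m"
  let ?f = "\<lambda>(a, b, c, d) x. (\<chi> i j. if i = 1 then (if j = 1 then a x else b x) else (if j = 1 then c x else d x)) :: tensor"
  have "linear_on' ?V ?f"
    by (auto simp: linear_on'_def fun_eq_iff vec_eq_iff)
  moreover have "subspace ?V" "findim ?V"
    by (intro subspace_Times subspace_Poly findim_Times findim_Poly)+
  ultimately have "findim (?f ` ?V)" by (intro findim_image)
  moreover have "Poly_sym m \<subseteq> ?f ` ?V"
  proof
    fix \<tau> assume t: "\<tau> \<in> Poly_sym m"
    have "\<tau> = ?f (\<lambda>x. \<tau> x $ 1 $ 1, \<lambda>x. \<tau> x $ 1 $ 2, \<lambda>x. \<tau> x $ 2 $ 1, \<lambda>x. \<tau> x $ 2 $ 2)"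
      by (auto simp: fun_eq_iff vec_eq_iff forall_2)
    then show "\<tau> \<in> ?f ` ?V" using Poly_symD(1)[OF t] by blast
  qed
  ultimately show ?thesis by (rule findim_mono)
qed

lemma hess_linear: "linear_on' (Poly m) hess"
  unfolding linear_on'_def
  using hess_add[of _ m _ m] hess_cmult[of _ m] by (auto simp: fun_eq_iff plus_fun_def scaleR_fun_def)

lemma sym_part_rot:
  "sym_part (tensor_prod (rot90 y) v) $ 1 $ 1 = - y$2 * v$1"
  "sym_part (tensor_prod (rot90 y) v) $ 2 $ 2 = y$1 * v$2"
  "sym_part (tensor_prod (rot90 y) v) $ 1 $ 2 = (y$1 * v$1 - y$2 * v$2) / 2"
  "sym_part (tensor_prod (rot90 y) v) $ 2 $ 1 = (y$1 * v$1 - y$2 * v$2) / 2"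
  by (simp_all add: sym_part_def tensor_prod_def rot90_def transpose_def field_simps)

text \<open>The symmetric part has the same quadratic form as the tensor product, and one of the
  factors of that product, \<open>rot90 (x - c)\<close>, is orthogonal to x - c.\<close>

lemma Hess_compl_quadratic:
  assumes "\<upsilon> \<in> Hess_compl l c"
  shows "(x - c) \<bullet> (\<upsilon> x *v (x - c)) = 0"
  using assms unfolding Hess_compl_def quadratic_form_2 by (auto simp: sym_part_rot algebra_simps)

lemma Hess_compl_Poly_sym: "Hess_compl l c \<subseteq> Poly_sym l"
proof
  fix \<upsilon> assume "\<upsilon> \<in> Hess_compl l c"
  then obtain v where v: "v \<in> Poly_vec (l - 1)" "\<upsilon> = (\<lambda>x. sym_part (tensor_prod (rot90 (x - c)) (v x)))"
    by (auto simp: Hess_compl_def)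
  have P: "(\<lambda>x. (x $ k - c $ k) * v x $ i) \<in> Poly l" for k i
  proof -
    have "(\<lambda>x. x $ k - c $ k) \<in> Poly 1" by (intro Poly_diff Poly_coord Poly_const) auto
    then show ?thesis
      using Poly_mult[of "\<lambda>x. x $ k - c $ k" 1 "\<lambda>x. v x $ i" "l - 1"] v(1) by (auto simp: Poly_vec_def)
  qed
  have M1: "(\<lambda>x. (c $ 2 - x $ 2) * v x $ 1) \<in> Poly l"
    using Poly_minus[OF P[of 2 1]] by (simp add: algebra_simps)
  have M2: "(\<lambda>x. ((x $ 1 - c $ 1) * v x $ 1 - (x $ 2 - c $ 2) * v x $ 2) / 2) \<in> Poly l"
    using Poly_cmult[OF Poly_diff[OF P[of 1 1] P[of 2 2]], of "1/2"] by simp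
  note M = M1 M2
  show "\<upsilon> \<in> Poly_sym l"
    unfolding v(2)
  proof (rule Poly_symI)
    fix i j :: 2
    have "i = 1 \<or> i = 2" "j = 1 \<or> j = 2" using exhaust_2 by blast+
    then show "(\<lambda>x. sym_part (tensor_prod (rot90 (x - c)) (v x)) $ i $ j) \<in> Poly l"
      using M P[of 1 2] by (auto simp: sym_part_rot)
    fix x show "sym_part (tensor_prod (rot90 (x - c)) (v x)) $ i $ j = sym_part (tensor_prod (rot90 (x - c)) (v x)) $ j $ i"
      using \<open>i = 1 \<or> i = 2\<close> \<open>j = 1 \<or> j = 2\<close> by (auto simp: sym_part_rot)
  qed
qed

lemma subspace_Hess_compl: "subspace (Hess_compl l c)"
proof -
  let ?f = "\<lambda>v x. sym_part (tensor_prod (rot90 (x - c)) (v x))"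
  have l: "?f (v + w) = ?f v + ?f w" "?f (r *\<^sub>R v) = r *\<^sub>R ?f v" for v w r
    by (auto simp: fun_eq_iff vec_eq_iff sym_part_def tensor_prod_def transpose_def algebra_simps)
  have s: "subspace (Poly_vec (l - 1))"
    by (rule subspaceI) (auto simp: Poly_vec_def intro!: Poly_add Poly_cmult)
  show ?thesis
    unfolding Hess_compl_def
  proof (rule subspaceI)
    show "0 \<in> ?f ` Poly_vec (l - 1)"
      using subspace_0[OF s] l(2)[of 0 0] by (intro image_eqI[of _ _ 0]) auto
  next
    fix x y assume "x \<in> ?f ` Poly_vec (l - 1)" "y \<in> ?f ` Poly_vec (l - 1)"
    then obtain v w where "x = ?f v" "v \<in> Poly_vec (l - 1)" "y = ?f w" "w \<in> Poly_vec (l - 1)" by blast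
    then show "x + y \<in> ?f ` Poly_vec (l - 1)"
      using subspace_add[OF s] by (intro image_eqI[of _ _ "v + w"]) (simp_all only: l)
  next
    fix r x assume "x \<in> ?f ` Poly_vec (l - 1)"
    then obtain v where "x = ?f v" "v \<in> Poly_vec (l - 1)" by blast
    then show "r *\<^sub>R x \<in> ?f ` Poly_vec (l - 1)"
      using subspace_scale[OF s] by (intro image_eqI[of _ _ "r *\<^sub>R v"]) (simp_all only: l)
  qed
qed

lemma quadratic_form_bound: "\<bar>y \<bullet> (A *v y)\<bar> \<le> 4 * (norm y)\<^sup>2 * norm A" for y :: point and A :: tensor
proof -
  have c: "\<bar>A $ i $ j\<bar> \<le> norm A" for i j
    by (rule order_trans[OF component_le_norm_cart Finite_Cartesian_Product.norm_nth_le])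
  have b: "\<bar>y $ i * y $ k * a\<bar> \<le> (norm y)\<^sup>2 * norm A" if "\<bar>a\<bar> \<le> norm A" for i k a
    unfolding abs_mult power2_eq_square using that component_le_norm_cart[of y]
    by (intro mult_mono) auto
  have "y \<bullet> (A *v y) = y$1*y$1*A$1$1 + (y$1*y$2*A$1$2 + y$1*y$2*A$2$1) + y$2*y$2*A$2$2"
    by (simp add: quadratic_form_2 algebra_simps)
  also have "\<bar>\<dots>\<bar> \<le> 4 * ((norm y)\<^sup>2 * norm A)"
    using b[where a = "A$1$1" and i = 1 and k = 1, OF c] b[where a = "A$1$2" and i = 1 and k = 2, OF c] b[where a = "A$2$1" and i = 1 and k = 2, OF c] b[where a = "A$2$2" and i = 2 and k = 2, OF c] by linarith
  finally show ?thesis by simp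
qed

text \<open>The elements \<open>\<upsilon>\<close> of \<open>Hess_compl l c\<close> satisfy \<open>(x - c) \<bullet> \<upsilon> x (x - c) = 0\<close>, so the second
  derivative of \<open>q\<close> along rays from \<open>c\<close> only involves the sum \<open>hess q + \<upsilon>\<close>.\<close>

lemma radial_taylor:
  assumes "q \<in> Poly m" "q c = 0" "\<And>y. dir_deriv y q c = 0"
    "\<upsilon> \<in> Hess_compl l c" "\<And>x. x \<in> cball c h \<Longrightarrow> norm (hess q x + \<upsilon> x) \<le> K" "0 \<le> K" "x \<in> cball c h"
  shows "\<bar>q x\<bar> \<le> 2 * h\<^sup>2 * K"
proof -
  let ?y = "x - c"
  \<comment> \<open>The restriction of q to the ray from c through x and its first two derivatives;
    the terms of order 0 and 1 at c vanish by assumption.\<close>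
  define D where "D k = (if k = 0 then (\<lambda>t. q (c + t *\<^sub>R ?y)) else if k = 1 then (\<lambda>t. dir_deriv ?y q (c + t *\<^sub>R ?y))
     else (\<lambda>t. dir_deriv ?y (dir_deriv ?y q) (c + t *\<^sub>R ?y)))" for k :: nat
  have "\<exists>t>0. t < 1 \<and> D 0 1 = (\<Sum>k<2. D k 0 / fact k * 1 ^ k) + D 2 t / fact 2 * 1 ^ 2"
  proof (rule Maclaurin)
    show "\<forall>k t. k < 2 \<and> 0 \<le> t \<and> t \<le> 1 \<longrightarrow> DERIV (D k) t :> D (Suc k) t"
      using Poly_line_deriv[OF assms(1)] Poly_line_deriv[OF dir_deriv_Poly[OF assms(1)]]
      by (auto simp: D_def less_2_cases_iff)
  qed auto
  then obtain t where t: "0 < t" "t < 1" "D 0 1 = (\<Sum>k<2. D k 0 / fact k * 1 ^ k) + D 2 t / fact 2 * 1 ^ 2" by blast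
  let ?z = "c + t *\<^sub>R ?y"
  have q: "q x = dir_deriv ?y (dir_deriv ?y q) ?z / 2"
    using t(3) assms(2,3) by (simp add: D_def numeral_2_eq_2)
  have nx: "norm ?y \<le> h" using assms(7) by (simp add: dist_norm norm_minus_commute)
  have "norm (t *\<^sub>R ?y) \<le> 1 * norm ?y" unfolding norm_scaleR using t by (intro mult_right_mono) auto
  then have zc: "?z \<in> cball c h" using nx by (simp add: dist_norm)
  have "t\<^sup>2 * (?y \<bullet> (\<upsilon> ?z *v ?y)) = (?z - c) \<bullet> (\<upsilon> ?z *v (?z - c))"
    unfolding quadratic_form_2 by (simp add: power2_eq_square algebra_simps)
  also have "\<dots> = 0" by (rule Hess_compl_quadratic[OF assms(4)])
  \<comment> \<open>The vector from c to the intermediate point is t times the full one, so the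
    vanishing of the quadratic form there transfers to the full vector after division by the square
    of t.\<close>
  finally have "?y \<bullet> (\<upsilon> ?z *v ?y) = 0" using t by simp
  then have "dir_deriv ?y (dir_deriv ?y q) ?z = ?y \<bullet> ((hess q ?z + \<upsilon> ?z) *v ?y)"
    by (simp add: hess_quadratic_form[OF assms(1), symmetric] matrix_vector_mult_add_rdistrib inner_add_right)
  then have "\<bar>dir_deriv ?y (dir_deriv ?y q) ?z\<bar> \<le> 4 * (norm ?y)\<^sup>2 * norm (hess q ?z + \<upsilon> ?z)"
    using quadratic_form_bound by simp
  also have "\<dots> \<le> 4 * h\<^sup>2 * K"
    using nx assms(5)[OF zc] by (intro mult_mono power_mono) auto
  finally show ?thesis using q by simp
qed

lemma hess_Poly_1: "q \<in> Poly 1 \<Longrightarrow> hess q x = 0"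
  using hess_Poly[of q 1] Poly_neg[of _ "-1"] by (fastforce simp: vec_eq_iff fun_eq_iff)

text \<open>r is the first-order Taylor polynomial of q at c. Since the Hessian does not see it, any
  q may be normalized to vanish at c together with its gradient.\<close>

lemma Poly_affine_split:
  assumes "q \<in> Poly m" "1 \<le> m"
  obtains p r where "p \<in> Poly m" "r \<in> Poly 1" "\<And>x. q x = p x + r x" "p c = 0" "\<And>y. dir_deriv y p c = 0"
    "\<And>x. hess q x = hess p x"
proof -
  let ?d = "\<lambda>i. dir_deriv (axis i 1) q c"
  define r where "r x = q c + ((x$1 - c$1) * ?d 1 + (x$2 - c$2) * ?d 2)" for x :: point
  have r1: "r \<in> Poly 1"
  proof -
    have "(\<lambda>x. (x$i - c$i) * k) \<in> Poly 1" for i k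
      using Poly_cmult[OF Poly_diff[OF Poly_coord[of 1 i] Poly_const[of 1 "c$i"]], of k] by (simp add: mult.commute)
    then show ?thesis unfolding r_def by (intro Poly_add Poly_const) auto
  qed
  define p where "p x = q x - r x" for x
  have p: "p \<in> Poly m" unfolding p_def using assms r1 Poly_mono by (intro Poly_diff) blast+
  have "dir_deriv y r c = y$1 * ?d 1 + y$2 * ?d 2" for y
  proof -
    have "(r has_derivative (\<lambda>y. y$1 * ?d 1 + y$2 * ?d 2)) (at c)"
      unfolding r_def
      by (auto intro!: derivative_eq_intros bounded_linear_imp_has_derivative bounded_linear_vec_nth
          has_derivative_mult_left)
    then show ?thesis by (rule dir_deriv_eqI)
  qed
  then have "dir_deriv y p c = 0" for y
    unfolding p_def dir_deriv_diff[OF assms(1) r1] by (simp add: dir_deriv_coords[OF assms(1), of y])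
  moreover have "hess q x = hess p x" for x
  proof -
    have "hess (\<lambda>x. p x + r x) x = hess p x + hess r x" by (rule hess_add[OF p r1])
    then show ?thesis using hess_Poly_1[OF r1] by (simp add: p_def)
  qed
  ultimately show ?thesis using that[OF p r1] by (simp add: p_def r_def)
qed

text \<open>After normalization at c, \<open>radial_taylor\<close> with K = 0 leaves no room for the
  non-affine part. The decomposition is therefore direct, with the affine functions as the only
  ambiguity of the potential q.\<close>

lemma hess_decomposition_unique:
  assumes "q \<in> Poly m" "1 \<le> m" "\<upsilon> \<in> Hess_compl l c" "\<And>x. hess q x + \<upsilon> x = 0"
  shows "q \<in> Poly 1" "\<upsilon> = 0"
proof -
  obtain p r where pr: "p \<in> Poly m" "r \<in> Poly 1" "\<And>x. q x = p x + r x" "p c = 0" "\<And>y. dir_deriv y p c = 0"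
    "\<And>x. hess q x = hess p x" by (rule Poly_affine_split[OF assms(1,2), where c = c]) (rule that)
  have "p x = 0" for x
    using radial_taylor[OF pr(1,4,5) assms(3), of "dist c x" 0 x] assms(4) pr(6) by simp
  then have "q = r" using pr(3) by auto
  then show "q \<in> Poly 1" using pr(2) by simp
  then have "hess q x = 0" for x by (rule hess_Poly_1)
  then show "\<upsilon> = 0" using assms(4) by (auto simp: fun_eq_iff)
qed

section \<open>Solving for the radial part of a tensor field\<close>

lemma euler_monomial:
  "dir_deriv y (\<lambda>x. (x$1)^i * (x$2)^j) y = real (i + j) * ((y$1)^i * (y$2)^j)"
  unfolding dir_deriv_monomial by (cases i; cases j) (auto simp: algebra_simps)

text \<open>Euler's identity applied twice: evaluating the Hessian of q at y on the vector y itself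
  acts diagonally on monomials, with factor n (n - 1) in degree n.\<close>

lemma euler_monomial_2:
  "y \<bullet> (hess (\<lambda>x. (x$1)^i * (x$2)^j) y *v y) = real (i + j) * (real (i + j) - 1) * ((y$1)^i * (y$2)^j)"
proof -
  let ?m = "\<lambda>i j x::point. (x$1)^i * (x$2)^j"
  have mP: "?m i j \<in> Poly (int i + int j)" for i j by (rule Poly_monomial) simp
  have 1: "dir_deriv y (?m i j) = (\<lambda>x. (y$1 * of_nat i) * ?m (i-1) j x + (y$2 * of_nat j) * ?m i (j-1) x)"
    by (auto simp: fun_eq_iff dir_deriv_monomial)
  have "dir_deriv y (dir_deriv y (?m i j)) y =
     (y$1 * of_nat i) * dir_deriv y (?m (i-1) j) y + (y$2 * of_nat j) * dir_deriv y (?m i (j-1)) y"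
    unfolding 1
    by (subst dir_deriv_add[OF Poly_cmult[OF mP] Poly_cmult[OF mP]], subst (1 2) dir_deriv_cmult[OF mP]) simp
  also have "\<dots> = real (i + j) * (real (i + j) - 1) * ?m i j y"
    unfolding euler_monomial by (cases i; cases j) (auto simp: algebra_simps)
  finally show ?thesis using hess_quadratic_form[OF mP] by simp
qed

lemma quadratic_hess_linear:
  assumes "p \<in> Poly m" "q \<in> Poly n"
  shows "y \<bullet> (hess (\<lambda>x. r * p x + q x) z *v y) = r * (y \<bullet> (hess p z *v y)) + y \<bullet> (hess q z *v y)"
  unfolding hess_add[OF Poly_cmult[OF assms(1)] assms(2)] hess_cmult[OF assms(1)]
  by (simp add: quadratic_form_2 algebra_simps)

text \<open>The additional factor of degree 2 raises every monomial to total degree n at least 2,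
  where n (n - 1) is nonzero and can be divided out.\<close>

lemma radial_hess_solve_monomial:
  assumes "p \<in> Poly l" "i0 + j0 = 2"
  shows "\<exists>q\<in>Poly (l + 2). \<forall>y. y \<bullet> (hess q y *v y) = ((y$1)^i0 * (y$2)^j0) * p y"
  using assms(1)
proof (induction rule: Poly_induct)
  case zero
  then show ?case by (intro bexI[of _ "\<lambda>x. 0"]) auto
next
  case (step c i j p)
  then obtain q where q: "q \<in> Poly (l + 2)" "\<And>y. y \<bullet> (hess q y *v y) = ((y$1)^i0 * (y$2)^j0) * p y" by blast
  let ?m = "\<lambda>x::point. (x$1)^(i+i0) * (x$2)^(j+j0)"
  define n where "n = real (i + i0 + (j + j0))"
  have n: "n * (n - 1) \<noteq> 0"
  proof -
    have "n = real (i + j) + 2" using assms(2) by (simp add: n_def)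
    then show ?thesis by simp
  qed
  have m: "?m \<in> Poly (l + 2)" using step(1) assms(2) by (intro Poly_monomial) auto
  let ?q = "\<lambda>x. (c / (n * (n - 1))) * ?m x + q x"
  have "?q \<in> Poly (l + 2)" using m q(1) by (intro Poly_add Poly_cmult)
  moreover have "y \<bullet> (hess ?q y *v y) = ((y$1)^i0 * (y$2)^j0) * (c * ((y$1)^i * (y$2)^j) + p y)" for y
  proof -
    have "y \<bullet> (hess ?q y *v y) = (c / (n * (n - 1))) * (n * (n - 1) * ?m y) + ((y$1)^i0 * (y$2)^j0) * p y"
      unfolding quadratic_hess_linear[OF m q(1)] euler_monomial_2 q(2) by (simp add: n_def)
    also have "(c / (n * (n - 1))) * (n * (n - 1) * ?m y) = c * ?m y" using n by simp
    finally show ?thesis by (simp add: power_add algebra_simps)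
  qed
  ultimately show ?case by (intro bexI[of _ ?q]) blast+
qed

lemma radial_hess_solve:
  assumes "X \<in> Poly_sym l"
  shows "\<exists>q\<in>Poly (l + 2). \<forall>y. y \<bullet> (hess q y *v y) = y \<bullet> (X y *v y)"
proof -
  have P: "(\<lambda>x. X x $ i $ j) \<in> Poly l" for i j by (rule Poly_symD(1)[OF assms])
  obtain q1 where q1: "q1 \<in> Poly (l + 2)" "\<And>y. y \<bullet> (hess q1 y *v y) = ((y$1)^2 * (y$2)^0) * X y $ 1 $ 1"
    using radial_hess_solve_monomial[OF P[of 1 1], of 2 0] by auto
  obtain q2 where q2: "q2 \<in> Poly (l + 2)" "\<And>y. y \<bullet> (hess q2 y *v y) = ((y$1)^1 * (y$2)^1) * X y $ 1 $ 2"
    using radial_hess_solve_monomial[OF P[of 1 2], of 1 1] by auto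
  obtain q3 where q3: "q3 \<in> Poly (l + 2)" "\<And>y. y \<bullet> (hess q3 y *v y) = ((y$1)^0 * (y$2)^2) * X y $ 2 $ 2"
    using radial_hess_solve_monomial[OF P[of 2 2], of 0 2] by auto
  have r: "(\<lambda>x. 1 * q1 x + q3 x) \<in> Poly (l + 2)" using q1 q3 by (intro Poly_add Poly_cmult)
  show ?thesis
  proof (intro bexI[of _ "\<lambda>x. 2 * q2 x + (1 * q1 x + q3 x)"] allI)
    fix y
    show "y \<bullet> (hess (\<lambda>x. 2 * q2 x + (1 * q1 x + q3 x)) y *v y) = y \<bullet> (X y *v y)"
      unfolding quadratic_hess_linear[OF q2(1) r] quadratic_hess_linear[OF q1(1) q3(1)] q1(2) q2(2) q3(2)
      unfolding quadratic_form_2 Poly_symD(2)[OF assms, of _ 2 1] by (simp add: power2_eq_square algebra_simps)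
  qed (rule Poly_add[OF Poly_cmult[OF q2(1)] r])
qed

lemma Poly_factor_coord2:
  "p \<in> Poly m \<Longrightarrow> \<exists>r\<in>Poly (m - 1). \<forall>y. p y = p (axis 1 (y$1)) + y$2 * r y"
proof (induction rule: Poly_induct)
  case zero
  then show ?case by (intro bexI[of _ "\<lambda>x. 0"]) auto
next
  case (step c i j q)
  then obtain r where r: "r \<in> Poly (m - 1)" "\<And>y. q y = q (axis 1 (y$1)) + y$2 * r y" by blast
  show ?case
  proof (cases j)
    case 0
    have "c * ((y$1)^i * (y$2)^j) + q y = c * (((axis 1 (y$1) :: point) $ 1)^i * ((axis 1 (y$1) :: point) $ 2)^j) + q (axis 1 (y$1)) + y$2 * r y" for y
      using r(2)[of y] 0 by (simp add: axis_def)
    then show ?thesis using r(1) by blast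
  next
    case (Suc j')
    have "(\<lambda>y. c * ((y$1)^i * (y$2)^j') + r y) \<in> Poly (m - 1)"
      using step(1) Suc r(1) by (intro Poly_add Poly_cmult Poly_monomial) auto
    moreover have "c * ((y$1)^i * (y$2)^j) + q y = c * (((axis 1 (y$1) :: point) $ 1)^i * ((axis 1 (y$1) :: point) $ 2)^j) + q (axis 1 (y$1)) + y$2 * (c * ((y$1)^i * (y$2)^j') + r y)" for y
      using r(2)[of y] Suc by (simp add: axis_def algebra_simps)
    ultimately show ?thesis by (intro bexI[of _ "\<lambda>y. c * ((y$1)^i * (y$2)^j') + r y"]) blast+
  qed
qed

lemma Poly_factor_coord1:
  "p \<in> Poly m \<Longrightarrow> \<exists>r\<in>Poly (m - 1). \<forall>y. p y = p (axis 2 (y$2)) + y$1 * r y"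
proof (induction rule: Poly_induct)
  case zero
  then show ?case by (intro bexI[of _ "\<lambda>x. 0"]) auto
next
  case (step c i j q)
  then obtain r where r: "r \<in> Poly (m - 1)" "\<And>y. q y = q (axis 2 (y$2)) + y$1 * r y" by blast
  show ?case
  proof (cases i)
    case 0
    have "c * ((y$1)^i * (y$2)^j) + q y = c * (((axis 2 (y$2) :: point) $ 1)^i * ((axis 2 (y$2) :: point) $ 2)^j) + q (axis 2 (y$2)) + y$1 * r y" for y
      using r(2)[of y] 0 by (simp add: axis_def)
    then show ?thesis using r(1) by blast
  next
    case (Suc i')
    have "(\<lambda>y. c * ((y$1)^i' * (y$2)^j) + r y) \<in> Poly (m - 1)"
      using step(1) Suc r(1) by (intro Poly_add Poly_cmult Poly_monomial) auto
    moreover have "c * ((y$1)^i * (y$2)^j) + q y = c * (((axis 2 (y$2) :: point) $ 1)^i * ((axis 2 (y$2) :: point) $ 2)^j) + q (axis 2 (y$2)) + y$1 * (c * ((y$1)^i' * (y$2)^j) + r y)" for y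
      using r(2)[of y] Suc by (simp add: axis_def algebra_simps)
    ultimately show ?thesis by (intro bexI[of _ "\<lambda>y. c * ((y$1)^i' * (y$2)^j) + r y"]) blast+
  qed
qed

lemma Poly_axis_eq_0:
  assumes "p \<in> Poly m" "\<And>s. s \<noteq> 0 \<Longrightarrow> p (axis k s) = 0"
  shows "p (axis k s) = 0"
proof -
  have a: "0 + s *\<^sub>R axis k 1 = (axis k s :: point)" for s
    by (simp add: vec_eq_iff axis_def)
  have "(\<lambda>s. p (axis k s)) \<in> Poly1 m" using Poly1_line[OF assms(1), of 0 "axis k 1"] unfolding a .
  moreover have "infinite {s. p (axis k s) = 0}"
    by (rule infinite_super[of "{0<..<1::real}"]) (auto intro: assms(2))
  ultimately have "(\<lambda>s. p (axis k s)) = (\<lambda>s. 0)" by (rule Poly1_eq_0)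
  then show ?thesis by metis
qed

text \<open>Restricting the quadratic form to the axes shows that \<open>R y $ 1 $ 1\<close>
  vanishes where the second coordinate does, and \<open>R y $ 2 $ 2\<close> where the first does.
  They are thus the second coordinate times some a and the first coordinate times some d. Cancelling
  the product of both coordinates in the remaining identity determines the off-diagonal entry, and
  the vector field with components - a and d reproduces all entries.\<close>

lemma radial_kernel:
  assumes "R \<in> Poly_sym l" "\<And>y. y \<bullet> (R y *v y) = 0"
  shows "\<exists>v\<in>Poly_vec (l - 1). \<forall>y. R y = sym_part (tensor_prod (rot90 y) (v y))"
proof -
  have P: "(\<lambda>x. R x $ i $ j) \<in> Poly l" for i j by (rule Poly_symD(1)[OF assms(1)])
  have q: "y$1*y$1*R y$1$1 + y$1*y$2*(2 * R y$1$2) + y$2*y$2*R y$2$2 = 0" for y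
    using assms(2)[of y] Poly_symD(2)[OF assms(1), of y 2 1] unfolding quadratic_form_2 by simp
  have a0: "R (axis 1 s) $ 1 $ 1 = 0" for s
    by (rule Poly_axis_eq_0[OF P]) (use q[of "axis 1 _"] in \<open>auto simp: axis_def\<close>)
  have d0: "R (axis 2 s) $ 2 $ 2 = 0" for s
    by (rule Poly_axis_eq_0[OF P]) (use q[of "axis 2 _"] in \<open>auto simp: axis_def\<close>)
  obtain a where a: "a \<in> Poly (l - 1)" "\<And>y. R y $ 1 $ 1 = y$2 * a y"
    using Poly_factor_coord2[OF P[of 1 1]] a0 by auto
  obtain d where d: "d \<in> Poly (l - 1)" "\<And>y. R y $ 2 $ 2 = y$1 * d y"
    using Poly_factor_coord1[OF P[of 2 2]] d0 by auto
  let ?w = "\<lambda>y. (y$1 * a y + y$2 * d y) + 2 * R y $ 1 $ 2"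
  have m: "(\<lambda>y. y $ k * b y) \<in> Poly l" if "b \<in> Poly (l - 1)" for b k
    using Poly_mult[OF Poly_coord[of 1 k] that] by simp
  have "?w \<in> Poly l" using m a(1) d(1) P by (intro Poly_add Poly_cmult)
  \<comment> \<open>The coordinates can be cancelled where both are positive; that set is open, so
    the resulting polynomial identity extends to the plane.\<close>
  moreover have "open {y :: point. 0 < y$1 \<and> 0 < y$2}"
    by (intro open_Collect_conj open_Collect_less continuous_intros)
  moreover have "{y :: point. 0 < y$1 \<and> 0 < y$2} \<noteq> {}"
    by (intro ex_in_conv[THEN iffD1] exI[of _ "vector [1, 1]"]) simp
  moreover have "?w y = 0" if "y \<in> {y. 0 < y$1 \<and> 0 < y$2}" for y
  proof -
    have "y$1 * y$2 * ?w y = 0" using q[of y] unfolding a(2) d(2) by (simp add: algebra_simps)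
    then show ?thesis using that by simp
  qed
  ultimately have w: "?w = (\<lambda>y. 0)" by (rule Poly_eq_0)
  define v :: "point \<Rightarrow> point" where "v y = vector [- a y, d y]" for y
  have "v \<in> Poly_vec (l - 1)"
    unfolding Poly_vec_def v_def using a(1) d(1) by (auto simp: forall_2 intro: Poly_minus)
  moreover have "R y = sym_part (tensor_prod (rot90 y) (v y))" for y
    using fun_cong[OF w, of y] a(2)[of y] d(2)[of y] Poly_symD(2)[OF assms(1), of y 2 1]
    by (simp add: vec_eq_iff forall_2 sym_part_rot v_def field_simps)
  ultimately show ?thesis by blast
qed

lemma hess_shift:
  assumes "q \<in> Poly m"
  shows "hess (\<lambda>x. q (x - c)) x = hess q (x - c)"
proof -
  have s: "dir_deriv d (\<lambda>x. p (x - c)) = (\<lambda>x. dir_deriv d p (x - c))" if "p \<in> Poly n" for p n d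
    using dir_deriv_shift[OF that, of d "- c" 1] by auto
  show ?thesis
    by (simp add: vec_eq_iff hess_nth s[OF assms] s[OF dir_deriv_Poly[OF assms]])
qed

lemma Poly_translate: "p \<in> Poly m \<Longrightarrow> (\<lambda>x. p (x - c)) \<in> Poly m"
  using Poly_shift[of p m "- c" 1] by simp

text \<open>With c moved to the origin, a potential q is chosen whose Hessian has the same radial
  quadratic form as the field; the remainder then lies in the radial kernel, which consists of the
  complement space.\<close>

lemma hess_decomposition_exists:
  assumes "X \<in> Poly_sym l"
  shows "\<exists>q\<in>Poly (l + 2). \<exists>\<upsilon>\<in>Hess_compl l c. \<forall>x. X x = hess q x + \<upsilon> x"
proof -
  define Y where "Y y = X (y + c)" for y
  have Y: "Y \<in> Poly_sym l"
    unfolding Y_def using Poly_translate[OF Poly_symD(1)[OF assms], where c = "- c"] Poly_symD(2)[OF assms]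
    by (intro Poly_symI) auto
  obtain q where q: "q \<in> Poly (l + 2)" "\<And>y. y \<bullet> (hess q y *v y) = y \<bullet> (Y y *v y)"
    using radial_hess_solve[OF Y] by blast
  define R where "R y = Y y - hess q y" for y
  have hq: "hess q \<in> Poly_sym l" by (rule hess_Poly_sym[OF q(1)])
  have "R \<in> Poly_sym l"
    unfolding R_def using Poly_symD(2)[OF Y] Poly_symD(2)[OF hq]
    by (intro Poly_symI) (auto intro!: Poly_diff Poly_symD(1)[OF Y] Poly_symD(1)[OF hq])
  moreover have "y \<bullet> (R y *v y) = 0" for y
    using q(2)[of y] by (simp add: R_def matrix_vector_mult_diff_rdistrib inner_diff_right)
  ultimately obtain v where v: "v \<in> Poly_vec (l - 1)" "\<And>y. R y = sym_part (tensor_prod (rot90 y) (v y))"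
    using radial_kernel by blast
  have "(\<lambda>x. R (x - c)) \<in> Hess_compl l c"
  proof -
    have "(\<lambda>x. v (x - c) $ i) \<in> Poly (l - 1)" for i
      using v(1) Poly_translate[of "\<lambda>x. v x $ i" "l - 1" c] by (simp add: Poly_vec_def)
    then show ?thesis
      unfolding Hess_compl_def using v(2)
      by (intro image_eqI[of _ _ "\<lambda>x. v (x - c)"]) (auto simp: Poly_vec_def)
  qed
  moreover have "X x = hess (\<lambda>x. q (x - c)) x + R (x - c)" for x
    using hess_shift[OF q(1), of c x] by (simp add: R_def Y_def)
  ultimately show ?thesis using Poly_translate[OF q(1), of c]
    by (intro bexI[of _ "\<lambda>x. q (x - c)"] bexI[of _ "\<lambda>x. R (x - c)"] allI)
qed

section \<open>The discrete space and the discrete operators\<close>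

lemma linear_on'_diff:
  assumes "linear_on' V f" "subspace V" "x \<in> V" "y \<in> V"
  shows "f (x - y) = f x - f y"
proof -
  have m: "-1 *\<^sub>R y \<in> V" using assms subspace_scale by blast
  have "f (x + -1 *\<^sub>R y) = f x + f (-1 *\<^sub>R y)" using assms(1,3) m unfolding linear_on'_def by blast
  also have "f (-1 *\<^sub>R y) = -1 *\<^sub>R f y" using assms(1,4) unfolding linear_on'_def by blast
  finally show ?thesis by simp
qed

text \<open>Abstract form of the definition of \<open>P_cell\<close>: the data are given on pairs
  (q, u), but the representative only sees the sum j q + u. The hypothesis ker says that the data
  respect this identification; any choice of decomposition then defines a linear functional on V,
  which Riesz represents.\<close>

lemma riesz_decomposed:
  assumes "inner_on V Q" "findim V" "subspace W1" "subspace W2" "linear_on' W1 R" "linear_on' W2 S"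
    "linear_on' W1 j" "W2 \<subseteq> V" "j ` W1 \<subseteq> V"
    and dec: "\<And>x. x \<in> V \<Longrightarrow> \<exists>q\<in>W1. \<exists>u\<in>W2. x = j q + u"
    and ker: "\<And>q u. q \<in> W1 \<Longrightarrow> u \<in> W2 \<Longrightarrow> j q + u = 0 \<Longrightarrow> R q + S u = 0"
  shows "\<exists>!P. P \<in> V \<and> (\<forall>q\<in>W1. \<forall>u\<in>W2. Q P (j q + u) = R q + S u)"
proof -
  obtain f g where fg: "\<And>x. x \<in> V \<Longrightarrow> f x \<in> W1 \<and> g x \<in> W2 \<and> x = j (f x) + g x"
    using dec by metis
  have V: "subspace V" using assms(1) by (simp add: inner_on_def semi_inner_def)
  define L where "L x = R (f x) + S (g x)" for x
  have inV: "j q + u \<in> V" if "q \<in> W1" "u \<in> W2" for q u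
    using that assms(8,9) by (intro subspace_add[OF V]) auto
  have key: "L (j q + u) = R q + S u" if qu: "q \<in> W1" "u \<in> W2" for q u
  proof -
    define x where "x = j q + u"
    have x: "f x \<in> W1" "g x \<in> W2" and xe: "j (f x) + g x = x"
      using fg[OF inV[OF qu]] unfolding x_def by metis+
    have a: "f x - q \<in> W1" "g x - u \<in> W2"
      using x qu assms(3,4) by (simp_all add: subspace_diff)
    have "j (f x - q) + (g x - u) = (j (f x) + g x) - (j q + u)"
      unfolding linear_on'_diff[OF assms(7,3) x(1) qu(1)] by (simp add: algebra_simps)
    also have "\<dots> = 0" unfolding xe by (simp add: x_def)
    finally have "R (f x - q) + S (g x - u) = 0" by (rule ker[OF a])
    moreover have "R (f x - q) = R (f x) - R q" "S (g x - u) = S (g x) - S u"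
      using linear_on'_diff[OF assms(5,3)] linear_on'_diff[OF assms(6,4)] x qu by blast+
    ultimately show ?thesis by (simp add: L_def x_def)
  qed
  have "linear_on' V L"
    unfolding linear_on'_def
  proof (intro conjI ballI allI)
    fix x y assume xy: "x \<in> V" "y \<in> V"
    note x = fg[OF xy(1)] and y = fg[OF xy(2)]
    have s: "f x + f y \<in> W1" "g x + g y \<in> W2" using x y assms(3,4) by (auto intro: subspace_add)
    have jj: "j (f x + f y) = j (f x) + j (f y)" using assms(7) x y by (auto simp: linear_on'_def)
    have "x + y = (j (f x) + g x) + (j (f y) + g y)" using x y by metis
    also have "\<dots> = j (f x + f y) + (g x + g y)" unfolding jj by (simp add: algebra_simps)
    finally show "L (x + y) = L x + L y"
      using key[OF s] assms(5,6) x y by (simp add: L_def linear_on'_def)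
  next
    fix r x assume xV: "x \<in> V"
    note x = fg[OF xV]
    have s: "r *\<^sub>R f x \<in> W1" "r *\<^sub>R g x \<in> W2" using x assms(3,4) by (auto intro: subspace_scale)
    have jj: "j (r *\<^sub>R f x) = r *\<^sub>R j (f x)" using assms(7) x by (auto simp: linear_on'_def)
    have "r *\<^sub>R x = r *\<^sub>R (j (f x) + g x)" using x by metis
    also have "\<dots> = j (r *\<^sub>R f x) + r *\<^sub>R g x" unfolding jj by (simp add: algebra_simps)
    finally show "L (r *\<^sub>R x) = r *\<^sub>R L x"
      using key[OF s] assms(5,6) x by (simp add: L_def linear_on'_def algebra_simps)
  qed
  from riesz[OF assms(1,2) this] obtain P where P: "P \<in> V" "\<And>z. z \<in> V \<Longrightarrow> Q P z = L z"
    "\<And>P'. P' \<in> V \<Longrightarrow> \<forall>z\<in>V. Q P' z = L z \<Longrightarrow> P' = P" by blast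
  show ?thesis
  proof (rule ex1I[of _ P], intro conjI ballI)
    fix q u assume "q \<in> W1" "u \<in> W2"
    then show "Q P (j q + u) = R q + S u" using P(2)[OF inV] key by simp
  next
    fix P' assume P': "P' \<in> V \<and> (\<forall>q\<in>W1. \<forall>u\<in>W2. Q P' (j q + u) = R q + S u)"
    have "Q P' z = L z" if "z \<in> V" for z
    proof -
      have e: "j (f z) + g z = z" using fg[OF that] by metis
      have "Q P' (j (f z) + g z) = L z" using P' fg[OF that] unfolding L_def by blast
      then show ?thesis unfolding e .
    qed
    then show "P' = P" using P(3) P' by blast
  qed (rule P(1))
qed

text \<open>Tuples instead of records, because records are not an instance of \<^class>\<open>real_vector\<close>.\<close>

type_synonym dvec = "(region \<Rightarrow> point \<Rightarrow> tensor) \<times> (region \<Rightarrow> point \<Rightarrow> tensor) \<times> (region \<Rightarrow> point \<Rightarrow> real) \<times>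
  (region \<Rightarrow> point \<Rightarrow> real) \<times> (point \<Rightarrow> tensor)"

definition mkd :: "dvec \<Rightarrow> dofs" where
  "mkd = (\<lambda>(a, b, c, d, e). \<lparr>cell_H = a, cell_Hc = b, edge_nn = c, edge_D = d, vert = e\<rparr>)"

lemma mkd_add [simp]:
  "cell_H (mkd (s + t)) T = (\<lambda>x. cell_H (mkd s) T x + cell_H (mkd t) T x)"
  "cell_Hc (mkd (s + t)) T = (\<lambda>x. cell_Hc (mkd s) T x + cell_Hc (mkd t) T x)"
  "edge_nn (mkd (s + t)) E = (\<lambda>x. edge_nn (mkd s) E x + edge_nn (mkd t) E x)"
  "edge_D (mkd (s + t)) E = (\<lambda>x. edge_D (mkd s) E x + edge_D (mkd t) E x)"
  "vert (mkd (s + t)) V = vert (mkd s) V + vert (mkd t) V"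
  by (cases s; cases t; simp add: mkd_def fun_eq_iff)+

lemma mkd_scale [simp]:
  "cell_H (mkd (r *\<^sub>R t)) T = (\<lambda>x. r *\<^sub>R cell_H (mkd t) T x)"
  "cell_Hc (mkd (r *\<^sub>R t)) T = (\<lambda>x. r *\<^sub>R cell_Hc (mkd t) T x)"
  "edge_nn (mkd (r *\<^sub>R t)) E = (\<lambda>x. r * edge_nn (mkd t) E x)"
  "edge_D (mkd (r *\<^sub>R t)) E = (\<lambda>x. r * edge_D (mkd t) E x)"
  "vert (mkd (r *\<^sub>R t)) V = r *\<^sub>R vert (mkd t) V"
  by (cases t; simp add: mkd_def fun_eq_iff)+

lemma mkd_zero: "mkd 0 = zero_dofs"
  by (simp add: mkd_def zero_dofs_def zero_prod_def zero_fun_def)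

lemma mkd_inject: "mkd s = mkd t \<longleftrightarrow> s = t"
  by (cases s; cases t) (simp add: mkd_def)

lemma mkd_surj: "\<exists>t. \<tau> = mkd t"
  by (rule exI[of _ "(cell_H \<tau>, cell_Hc \<tau>, edge_nn \<tau>, edge_D \<tau>, vert \<tau>)"]) (simp add: mkd_def)

definition Svec :: "int \<Rightarrow> mesh \<Rightarrow> dvec set" where
  "Svec l M = {t. mkd t \<in> Sigma_space l M}"

lemma subspace_Hess_space: "subspace (Hess_space m)"
proof -
  have "subspace (Poly (m + 2))" by (rule subspace_Poly)
  show ?thesis
    unfolding Hess_space_def
  proof (rule subspaceI)
    show "0 \<in> hess ` Poly (m + 2)" by (intro image_eqI[of _ _ "\<lambda>x. 0"]) (auto simp: fun_eq_iff)
  next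
    fix x y assume "x \<in> hess ` Poly (m + 2)" "y \<in> hess ` Poly (m + 2)"
    then obtain p q where "x = hess p" "y = hess q" "p \<in> Poly (m + 2)" "q \<in> Poly (m + 2)" by blast
    then show "x + y \<in> hess ` Poly (m + 2)"
      by (intro image_eqI[of _ _ "p + q"] subspace_add[OF subspace_Poly])
        (use hess_linear[of "m + 2"] in \<open>simp_all add: linear_on'_def\<close>)
  next
    fix r x assume "x \<in> hess ` Poly (m + 2)"
    then obtain p where "x = hess p" "p \<in> Poly (m + 2)" by blast
    then show "r *\<^sub>R x \<in> hess ` Poly (m + 2)"
      by (intro image_eqI[of _ _ "r *\<^sub>R p"] subspace_scale[OF subspace_Poly])
        (use hess_linear[of "m + 2"] in \<open>simp_all add: linear_on'_def\<close>)
  qed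
qed

lemma Hess_space_Poly_sym: "Hess_space m \<subseteq> Poly_sym m"
  unfolding Hess_space_def using hess_Poly_sym by blast

lemma subspace_pointwise:
  "subspace V \<Longrightarrow> f \<in> V \<Longrightarrow> g \<in> V \<Longrightarrow> (\<lambda>x. f x + g x) \<in> V"
  "subspace V \<Longrightarrow> f \<in> V \<Longrightarrow> (\<lambda>x. r *\<^sub>R f x) \<in> V"
  "subspace V \<Longrightarrow> (\<lambda>x. 0) \<in> V"
  using subspace_add[of V f g] subspace_scale[of V f r] subspace_0[of V]
  by (simp_all add: plus_fun_def scaleR_fun_def zero_fun_def)

lemma subspace_Svec: "subspace (Svec l M)"
proof (rule subspaceI)
  note sub = subspace_Hess_space subspace_Hess_compl subspace_Poly_edge subspace_sym_tensors
  have z: "cell_H zero_dofs T = (\<lambda>x. 0)" "cell_Hc zero_dofs T = (\<lambda>x. 0)" "edge_nn zero_dofs E = (\<lambda>x. 0)"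
    "edge_D zero_dofs E = (\<lambda>x. 0)" "vert zero_dofs V = 0" for T E V by (simp_all add: zero_dofs_def)
  show "0 \<in> Svec l M"
    unfolding Svec_def Sigma_space_def mem_Collect_eq mkd_zero z
    by (auto intro: subspace_pointwise(3) sub subspace_0)
  fix s t r assume s: "s \<in> Svec l M"
  have "(\<lambda>x. r * f x) \<in> Poly_edge m E" if "f \<in> Poly_edge m E" for f m E
    using subspace_scale[OF subspace_Poly_edge that, of r] by (simp add: scaleR_fun_def)
  with s show "r *\<^sub>R s \<in> Svec l M"
    unfolding Svec_def Sigma_space_def mem_Collect_eq mkd_scale
    by (auto intro: subspace_pointwise(2) sub subspace_scale)
  assume "t \<in> Svec l M"
  with s show "s + t \<in> Svec l M"
    unfolding Svec_def Sigma_space_def mem_Collect_eq mkd_add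
    by (auto intro: subspace_pointwise(1) sub subspace_add)
qed

lemma findim_sym_tensors: "findim sym_tensors"
proof -
  have "sym_tensors \<subseteq> span (Basis :: tensor set)" by simp
  then show ?thesis unfolding findim_def using finite_Basis by blast
qed

lemma findim_Svec:
  assumes "polygonal_mesh \<Omega> M"
  shows "findim (Svec l M)"
proof -
  let ?A = "{f. (\<forall>T\<in>elems M. f T \<in> Poly_sym (l - 3)) \<and> (\<forall>T. T \<notin> elems M \<longrightarrow> f T = 0)}"
  let ?B = "{f. (\<forall>T\<in>elems M. f T \<in> Poly_sym l) \<and> (\<forall>T. T \<notin> elems M \<longrightarrow> f T = 0)}"
  let ?C = "{f. (\<forall>E\<in>edges M. f E \<in> Poly_edge (l - 2) E) \<and> (\<forall>E. E \<notin> edges M \<longrightarrow> f E = 0)}"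
  let ?D = "{f. (\<forall>E\<in>edges M. f E \<in> Poly_edge (l - 1) E) \<and> (\<forall>E. E \<notin> edges M \<longrightarrow> f E = 0)}"
  let ?E = "{f. (\<forall>V\<in>mesh_verts M. f V \<in> sym_tensors) \<and> (\<forall>V. V \<notin> mesh_verts M \<longrightarrow> f V = 0)}"
  have "findim (?A \<times> ?B \<times> ?C \<times> ?D \<times> ?E)"
    using meshD(1,2)[OF assms] finite_mesh_verts[OF assms]
    by (intro findim_Times findim_fun findim_Poly_sym findim_Poly_edge findim_sym_tensors)
  moreover have "Svec l M \<subseteq> ?A \<times> ?B \<times> ?C \<times> ?D \<times> ?E"
  proof
    fix t assume t: "t \<in> Svec l M"
    obtain a b c d e where abc: "t = (a, b, c, d, e)" by (cases t)
    have "x \<in> Hess_space (l - 3) \<Longrightarrow> x \<in> Poly_sym (l - 3)" "x \<in> Hess_compl l c \<Longrightarrow> x \<in> Poly_sym l" for x c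
      using Hess_space_Poly_sym Hess_compl_Poly_sym by blast+
    with t show "t \<in> ?A \<times> ?B \<times> ?C \<times> ?D \<times> ?E"
      unfolding abc Svec_def Sigma_space_def mkd_def zero_fun_def by auto
  qed
  ultimately show ?thesis by (rule findim_mono)
qed

text \<open>The boundary functional common to \<open>DD\<close> and \<open>P_cell\<close>. The
  parameter N is \<open>edge_nn\<close> in the former, where the functional is subtracted, and
  \<open>P_edge\<close> in the latter, where it is added.\<close>

definition bdry :: "mesh \<Rightarrow> region \<Rightarrow> dofs \<Rightarrow> (region \<Rightarrow> point \<Rightarrow> real) \<Rightarrow> (point \<Rightarrow> real) \<Rightarrow> real" where
  "bdry M T \<tau> N q = vert_terms M T \<tau> q +
     (\<Sum>E\<in>elem_edges M T. sign_TE M T E *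
        (edge_integral E (\<lambda>x. N E x * dir_deriv (normal M E) q x) - edge_integral E (\<lambda>x. edge_D \<tau> E x * q x)))"

locale plate_mesh =
  fixes \<Omega> :: region and M :: mesh and l :: int
  assumes mesh: "polygonal_mesh \<Omega> M" and Om: "polygonal \<Omega>" and l2: "2 \<le> l"
begin

lemma elem: "T \<in> elems M \<Longrightarrow> open T" "T \<in> elems M \<Longrightarrow> bounded T" "T \<in> elems M \<Longrightarrow> T \<noteq> {}"
  using meshD(3-5)[OF mesh] by blast+

lemma elem_edge: "E \<in> elem_edges M T \<Longrightarrow> is_edge E" "E \<in> elem_edges M T \<Longrightarrow> E \<in> edges M"
  using meshD(8)[OF mesh] elem_edgesD by blast+

lemma SigmaD:
  assumes "\<tau> \<in> Sigma_space l M"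
  shows "T \<in> elems M \<Longrightarrow> cell_H \<tau> T \<in> Hess_space (l - 3)"
    "T \<in> elems M \<Longrightarrow> cell_Hc \<tau> T \<in> Hess_compl l (center M T)"
    "E \<in> edges M \<Longrightarrow> edge_nn \<tau> E \<in> Poly_edge (l - 2) E"
    "E \<in> edges M \<Longrightarrow> edge_D \<tau> E \<in> Poly_edge (l - 1) E"
    "T \<in> elems M \<Longrightarrow> continuous_on S (cell_H \<tau> T)"
    "T \<in> elems M \<Longrightarrow> continuous_on S (cell_Hc \<tau> T)"
    "E \<in> edges M \<Longrightarrow> continuous_on (closure E) (edge_nn \<tau> E)"
    "E \<in> edges M \<Longrightarrow> continuous_on (closure E) (edge_D \<tau> E)"
proof -
  show a: "T \<in> elems M \<Longrightarrow> cell_H \<tau> T \<in> Hess_space (l - 3)"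
    "T \<in> elems M \<Longrightarrow> cell_Hc \<tau> T \<in> Hess_compl l (center M T)"
    "E \<in> edges M \<Longrightarrow> edge_nn \<tau> E \<in> Poly_edge (l - 2) E"
    "E \<in> edges M \<Longrightarrow> edge_D \<tau> E \<in> Poly_edge (l - 1) E"
    using assms unfolding Sigma_space_def by blast+
  show "T \<in> elems M \<Longrightarrow> continuous_on S (cell_H \<tau> T)" "T \<in> elems M \<Longrightarrow> continuous_on S (cell_Hc \<tau> T)"
    using a(1,2) Hess_space_Poly_sym Hess_compl_Poly_sym Poly_sym_continuous by blast+
  show "E \<in> edges M \<Longrightarrow> continuous_on (closure E) (edge_nn \<tau> E)"
    "E \<in> edges M \<Longrightarrow> continuous_on (closure E) (edge_D \<tau> E)"
    using a(3,4) Poly_edge_continuous by blast+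
qed

lemma edge_form_linear:
  assumes "E \<in> elem_edges M T" "continuous_on (closure E) f"
  shows "linear_on' (Poly m) (\<lambda>q. edge_integral E (\<lambda>x. f x * q x))" (is ?A)
    "linear_on' (Poly m) (\<lambda>q. edge_integral E (\<lambda>x. f x * dir_deriv d q x))" (is ?B)
proof -
  note e = elem_edge(1)[OF assms(1)]
  have s: "edge_integral E (\<lambda>x. f x * (r * g x)) = r * edge_integral E (\<lambda>x. f x * g x)" for r g
    using edge_integral_cmult[OF e, of r "\<lambda>x. f x * g x"] by (simp add: mult.left_commute)
  have a: "edge_integral E (\<lambda>x. f x * (g x + h x)) = edge_integral E (\<lambda>x. f x * g x) + edge_integral E (\<lambda>x. f x * h x)"
    if "continuous_on (closure E) g" "continuous_on (closure E) h" for g h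
    using edge_integral_add[OF e, of "\<lambda>x. f x * g x" "\<lambda>x. f x * h x"] that assms(2)
    by (simp add: distrib_left continuous_on_mult)
  show ?A
    unfolding linear_on'_def by (auto simp: s intro!: a Poly_continuous_on)
  have d: "dir_deriv d (p + q) = (\<lambda>x. dir_deriv d p x + dir_deriv d q x)" "dir_deriv d (r *\<^sub>R p) = (\<lambda>x. r * dir_deriv d p x)"
    if "p \<in> Poly m" "q \<in> Poly m" for p q r
    using dir_deriv_add[OF that] dir_deriv_cmult[OF that(1)] by (auto simp: plus_fun_def scaleR_fun_def)
  show ?B
    unfolding linear_on'_def by (auto simp: s d intro!: a Poly_continuous_on dir_deriv_Poly)
qed

lemma bdry_linear:
  assumes "\<And>E. E \<in> elem_edges M T \<Longrightarrow> continuous_on (closure E) (N E)"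
    "\<And>E. E \<in> elem_edges M T \<Longrightarrow> continuous_on (closure E) (edge_D \<tau> E)"
  shows "linear_on' (Poly m) (bdry M T \<tau> N)"
proof -
  have e: "edge_integral E (\<lambda>x. N E x * dir_deriv d (p + q) x) = edge_integral E (\<lambda>x. N E x * dir_deriv d p x) + edge_integral E (\<lambda>x. N E x * dir_deriv d q x)"
    "edge_integral E (\<lambda>x. edge_D \<tau> E x * (p + q) x) = edge_integral E (\<lambda>x. edge_D \<tau> E x * p x) + edge_integral E (\<lambda>x. edge_D \<tau> E x * q x)"
    "edge_integral E (\<lambda>x. N E x * dir_deriv d (r *\<^sub>R p) x) = r * edge_integral E (\<lambda>x. N E x * dir_deriv d p x)"
    "edge_integral E (\<lambda>x. edge_D \<tau> E x * (r *\<^sub>R p) x) = r * edge_integral E (\<lambda>x. edge_D \<tau> E x * p x)"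
    if "E \<in> elem_edges M T" "p \<in> Poly m" "q \<in> Poly m" for E p q r d
    using edge_form_linear(1)[OF that(1) assms(2)[OF that(1)], of m] edge_form_linear(2)[OF that(1) assms(1)[OF that(1)], of m d] that(2,3)
    unfolding linear_on'_def by simp_all
  let ?t = "\<lambda>q E. sign_TE M T E * (edge_integral E (\<lambda>x. N E x * dir_deriv (normal M E) q x) - edge_integral E (\<lambda>x. edge_D \<tau> E x * q x))"
  show ?thesis
    unfolding linear_on'_def
  proof (intro conjI ballI allI)
    fix p q assume pq: "p \<in> Poly m" "q \<in> Poly m"
    have "vert_terms M T \<tau> (p + q) = vert_terms M T \<tau> p + vert_terms M T \<tau> q"
      by (simp add: vert_terms_def distrib_left sum.distrib)
    moreover have "?t (p + q) E = ?t p E + ?t q E" if "E \<in> elem_edges M T" for E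
      unfolding e(1,2)[OF that pq] by (simp add: algebra_simps)
    ultimately show "bdry M T \<tau> N (p + q) = bdry M T \<tau> N p + bdry M T \<tau> N q"
      unfolding bdry_def by (simp add: sum.distrib cong: sum.cong)
  next
    fix p r assume p: "p \<in> Poly m"
    have "vert_terms M T \<tau> (r *\<^sub>R p) = r * vert_terms M T \<tau> p"
      by (simp add: vert_terms_def sum_distrib_left mult.left_commute)
    moreover have "?t (r *\<^sub>R p) E = r * ?t p E" if "E \<in> elem_edges M T" for E
      unfolding e(3,4)[OF that p p] by (simp add: algebra_simps)
    then have "(\<Sum>E\<in>elem_edges M T. ?t (r *\<^sub>R p) E) = r * (\<Sum>E\<in>elem_edges M T. ?t p E)"
      unfolding sum_distrib_left by (rule sum.cong[OF refl])
    ultimately show "bdry M T \<tau> N (r *\<^sub>R p) = r *\<^sub>R bdry M T \<tau> N p"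
      unfolding bdry_def by (simp only: distrib_left real_scaleR_def)
  qed
qed

lemma edge_integral_lin:
  assumes "is_edge E" "continuous_on (closure E) f" "continuous_on (closure E) g" "continuous_on (closure E) h"
  shows "edge_integral E (\<lambda>x. (r * f x + g x) * h x) = r * edge_integral E (\<lambda>x. f x * h x) + edge_integral E (\<lambda>x. g x * h x)"
  unfolding edge_integral_cmult[OF assms(1), symmetric] distrib_right mult.assoc
  using assms by (intro edge_integral_add continuous_intros)

lemma tensor_vec_lin: "(r *\<^sub>R A + B) *v n = r *\<^sub>R (A *v n) + B *v n" for A B :: tensor
  by (simp add: vec_eq_iff matrix_vector_mult_def sum_2 algebra_simps)

lemma bdry_lin_dofs:
  assumes N: "\<And>E. E \<in> elem_edges M T \<Longrightarrow> continuous_on (closure E) (N E)" "\<And>E. E \<in> elem_edges M T \<Longrightarrow> continuous_on (closure E) (N' E)"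
    and st: "mkd s \<in> Sigma_space l M" "mkd t \<in> Sigma_space l M" and q: "q \<in> Poly m"
  shows "bdry M T (mkd (r *\<^sub>R s + t)) (\<lambda>E x. r * N E x + N' E x) q = r * bdry M T (mkd s) N q + bdry M T (mkd t) N' q"
proof -
  let ?t = "\<lambda>\<tau> N E. sign_TE M T E * (edge_integral E (\<lambda>x. N E x * dir_deriv (normal M E) q x) - edge_integral E (\<lambda>x. edge_D \<tau> E x * q x))"
  have v: "vert_terms M T (mkd (r *\<^sub>R s + t)) q = r * vert_terms M T (mkd s) q + vert_terms M T (mkd t) q"
    unfolding vert_terms_def mkd_add mkd_scale tensor_vec_lin
    by (simp add: inner_add_left sum_distrib_left sum.distrib[symmetric] algebra_simps)
  have "?t (mkd (r *\<^sub>R s + t)) (\<lambda>E x. r * N E x + N' E x) E = r * ?t (mkd s) N E + ?t (mkd t) N' E" if E: "E \<in> elem_edges M T" for E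
  proof -
    note e = elem_edge[OF E]
    note c = edge_integral_lin[OF e(1) N[OF E] Poly_continuous_on[OF dir_deriv_Poly[OF q]]]
      edge_integral_lin[OF e(1) SigmaD(8)[OF st(1) e(2)] SigmaD(8)[OF st(2) e(2)] Poly_continuous_on[OF q]]
    show ?thesis unfolding mkd_add mkd_scale c by (simp add: algebra_simps)
  qed
  then show ?thesis
    unfolding bdry_def v by (simp add: sum.distrib sum_distrib_left distrib_left cong: sum.cong)
qed

lemma cell_form_linear:
  fixes f :: "point \<Rightarrow> 'b::euclidean_space"
  assumes "T \<in> elems M" "continuous_on UNIV f"
  shows "linear_on' contfuns (\<lambda>g. LINT x:T|lebesgue. f x \<bullet> g x)" "linear_on' contfuns (\<lambda>g. LINT x:T|lebesgue. g x \<bullet> f x)"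
  using bilinear_on_linear[OF semi_innerD(2)[OF semi_inner_region[OF elem(1,2)[OF assms(1)], where 'b = 'b]], of f] assms(2)
  by auto

lemma hess_form_linear:
  assumes "T \<in> elems M" "continuous_on UNIV f"
  shows "linear_on' (Poly m) (\<lambda>q. LINT x:T|lebesgue. f x \<bullet> hess q x)"
proof -
  have "hess q \<in> contfuns" if "q \<in> Poly m" for q
    using Poly_sym_continuous[OF hess_Poly_sym[of q "m - 2"]] that by simp
  then show ?thesis
    using cell_form_linear(1)[OF assms] hess_linear[of m] unfolding linear_on'_def by auto
qed

section \<open>Well-posedness of the discrete operators\<close>

lemma DD_ex1:
  assumes "\<tau> \<in> Sigma_space l M" "T \<in> elems M"
  shows "\<exists>!p. p \<in> Poly (l - 1) \<and> (\<forall>q\<in>Poly (l - 1). (LINT x:T|lebesgue. p x * q x) =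
    (LINT x:T|lebesgue. cell_H \<tau> T x \<bullet> hess q x) - bdry M T \<tau> (edge_nn \<tau>) q)"
proof (rule riesz[OF inner_on_Poly[OF elem[OF assms(2)]] findim_Poly])
  have "linear_on' (Poly (l - 1)) (bdry M T \<tau> (edge_nn \<tau>))"
    using SigmaD(7,8)[OF assms(1)] elem_edge by (intro bdry_linear) blast+
  with hess_form_linear[OF assms(2) SigmaD(5)[OF assms], of "l - 1"]
  show "linear_on' (Poly (l - 1)) (\<lambda>q. (LINT x:T|lebesgue. cell_H \<tau> T x \<bullet> hess q x) - bdry M T \<tau> (edge_nn \<tau>) q)"
    unfolding linear_on'_def by (simp add: algebra_simps)
qed

lemma DD_alt: "DD l M T \<tau> = (THE p. p \<in> Poly (l - 1) \<and> (\<forall>q\<in>Poly (l - 1). (LINT x:T|lebesgue. p x * q x) =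
    (LINT x:T|lebesgue. cell_H \<tau> T x \<bullet> hess q x) - bdry M T \<tau> (edge_nn \<tau>) q))"
  unfolding DD_def bdry_def by (simp only: diff_diff_eq)

lemma DD_props:
  assumes "\<tau> \<in> Sigma_space l M" "T \<in> elems M"
  shows "DD l M T \<tau> \<in> Poly (l - 1)"
    "q \<in> Poly (l - 1) \<Longrightarrow> (LINT x:T|lebesgue. DD l M T \<tau> x * q x) =
      (LINT x:T|lebesgue. cell_H \<tau> T x \<bullet> hess q x) - bdry M T \<tau> (edge_nn \<tau>) q"
  using theI'[OF DD_ex1[OF assms]] unfolding DD_alt by blast+

lemma DD_eqI:
  assumes "\<tau> \<in> Sigma_space l M" "T \<in> elems M" "p \<in> Poly (l - 1)"
    "\<And>q. q \<in> Poly (l - 1) \<Longrightarrow> (LINT x:T|lebesgue. p x * q x) =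
      (LINT x:T|lebesgue. cell_H \<tau> T x \<bullet> hess q x) - bdry M T \<tau> (edge_nn \<tau>) q"
  shows "DD l M T \<tau> = p"
  unfolding DD_alt using assms(3,4) by (intro the1_equality[OF DD_ex1[OF assms(1,2)]]) blast

lemma P_edge_ex1:
  assumes "\<tau> \<in> Sigma_space l M" "E \<in> edges M"
  shows "\<exists>!p. p \<in> Poly_edge l E \<and>
     (\<forall>V\<in>edge_verts E. p V = (vert \<tau> V *v normal M E) \<bullet> normal M E) \<and>
     (\<forall>q\<in>Poly_edge (l - 2) E. edge_integral E (\<lambda>x. p x * q x) = edge_integral E (\<lambda>x. edge_nn \<tau> E x * q x))"
proof -
  obtain a b where ab: "a \<noteq> b" "E = open_segment a b"
    using meshD(8)[OF mesh assms(2)] by (rule is_edgeE)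
  have v: "edge_verts E = {a, b}" using ab by (simp add: edge_verts_segment)
  show ?thesis
    using edge_interpolation[OF ab SigmaD(3)[OF assms], of "(vert \<tau> a *v normal M E) \<bullet> normal M E" "(vert \<tau> b *v normal M E) \<bullet> normal M E"] l2
    unfolding v by simp
qed

lemma P_edge_alt:
  assumes "\<tau> \<in> Sigma_space l M" "E \<in> edges M"
  shows "P_edge l M E \<tau> = (THE p. p \<in> Poly_edge l E \<and>
     (\<forall>V\<in>edge_verts E. p V = (vert \<tau> V *v normal M E) \<bullet> normal M E) \<and>
     (\<forall>q\<in>Poly_edge (l - 2) E. edge_integral E (\<lambda>x. p x * q x) = edge_integral E (\<lambda>x. edge_nn \<tau> E x * q x)))"
proof -
  have "edge_proj (l - 2) E p = edge_nn \<tau> E \<longleftrightarrow>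
     (\<forall>q\<in>Poly_edge (l - 2) E. edge_integral E (\<lambda>x. p x * q x) = edge_integral E (\<lambda>x. edge_nn \<tau> E x * q x))"
    if "p \<in> Poly_edge l E" for p
    using edge_proj_eq_iff[OF meshD(8)[OF mesh assms(2)] Poly_edge_continuous[OF that] SigmaD(3)[OF assms]] .
  then show ?thesis
    unfolding P_edge_def by (intro arg_cong[where f = The] ext conj_cong refl) blast
qed

lemma P_edge_props:
  assumes "\<tau> \<in> Sigma_space l M" "E \<in> edges M"
  shows "P_edge l M E \<tau> \<in> Poly_edge l E"
    "V \<in> edge_verts E \<Longrightarrow> P_edge l M E \<tau> V = (vert \<tau> V *v normal M E) \<bullet> normal M E"
    "q \<in> Poly_edge (l - 2) E \<Longrightarrow> edge_integral E (\<lambda>x. P_edge l M E \<tau> x * q x) = edge_integral E (\<lambda>x. edge_nn \<tau> E x * q x)"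
    "continuous_on (closure E) (P_edge l M E \<tau>)" (is ?A)
proof -
  show "P_edge l M E \<tau> \<in> Poly_edge l E"
    "V \<in> edge_verts E \<Longrightarrow> P_edge l M E \<tau> V = (vert \<tau> V *v normal M E) \<bullet> normal M E"
    "q \<in> Poly_edge (l - 2) E \<Longrightarrow> edge_integral E (\<lambda>x. P_edge l M E \<tau> x * q x) = edge_integral E (\<lambda>x. edge_nn \<tau> E x * q x)"
    using theI'[OF P_edge_ex1[OF assms]] unfolding P_edge_alt[OF assms] by blast+
  then show ?A using Poly_edge_continuous by blast
qed

lemma P_edge_eqI:
  assumes "\<tau> \<in> Sigma_space l M" "E \<in> edges M" "p \<in> Poly_edge l E"
    "\<And>V. V \<in> edge_verts E \<Longrightarrow> p V = (vert \<tau> V *v normal M E) \<bullet> normal M E"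
    "\<And>q. q \<in> Poly_edge (l - 2) E \<Longrightarrow> edge_integral E (\<lambda>x. p x * q x) = edge_integral E (\<lambda>x. edge_nn \<tau> E x * q x)"
  shows "P_edge l M E \<tau> = p"
  unfolding P_edge_alt[OF assms(1,2)] using assms(3-5) by (intro the1_equality[OF P_edge_ex1[OF assms(1,2)]]) blast

text \<open>This is the compatibility condition that makes \<open>P_cell\<close> well defined, since
  affine functions are the kernel of the Hessian. For affine q the Hessian term in \<open>DD\<close>
  drops out. The normal derivative of q is constant, hence of degree at most l - 2, and on such
  polynomials \<open>P_edge\<close> has the same moments as \<open>edge_nn\<close>; both boundary
  functionals agree and cancel.\<close>

lemma consistency_affine:
  assumes "\<tau> \<in> Sigma_space l M" "T \<in> elems M" "q \<in> Poly 1"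
  shows "(LINT x:T|lebesgue. DD l M T \<tau> x * q x) + bdry M T \<tau> (\<lambda>E. P_edge l M E \<tau>) q = 0"
proof -
  have ql: "q \<in> Poly (l - 1)" using assms(3) l2 Poly_mono[of q 1 "l - 1"] by simp
  have "(LINT x:T|lebesgue. DD l M T \<tau> x * q x) = - bdry M T \<tau> (edge_nn \<tau>) q"
    unfolding DD_props(2)[OF assms(1,2) ql] using hess_Poly_1[OF assms(3)] by simp
  moreover have "bdry M T \<tau> (\<lambda>E. P_edge l M E \<tau>) q = bdry M T \<tau> (edge_nn \<tau>) q"
  proof -
    have "edge_integral E (\<lambda>x. P_edge l M E \<tau> x * dir_deriv (normal M E) q x) =
      edge_integral E (\<lambda>x. edge_nn \<tau> E x * dir_deriv (normal M E) q x)" if "E \<in> elem_edges M T" for E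
    proof -
      note e = elem_edge[OF that]
      let ?r = "edge_restrict E (dir_deriv (normal M E) q)"
      have "dir_deriv (normal M E) q \<in> Poly (l - 2)"
        using Poly_mono[OF dir_deriv_Poly[OF assms(3)], of "l - 2"] l2 by simp
      then have "?r \<in> Poly_edge (l - 2) E" unfolding Poly_edge_image by blast
      from P_edge_props(3)[OF assms(1) e(2) this]
      have "edge_integral E (\<lambda>x. P_edge l M E \<tau> x * ?r x) = edge_integral E (\<lambda>x. edge_nn \<tau> E x * ?r x)" .
      moreover have "edge_integral E (\<lambda>x. f x * ?r x) = edge_integral E (\<lambda>x. f x * dir_deriv (normal M E) q x)" for f
        by (rule edge_integral_cong[OF e(1)]) simp
      ultimately show ?thesis by simp
    qed
    then show ?thesis unfolding bdry_def by (simp cong: sum.cong)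
  qed
  ultimately show ?thesis by simp
qed

lemma inner_on_Poly_sym:
  assumes "T \<in> elems M"
  shows "inner_on (Poly_sym m) (\<lambda>\<sigma> \<tau>. LINT x:T|lebesgue. \<sigma> x \<bullet> \<tau> x)"
proof -
  have "semi_inner (Poly_sym m) (\<lambda>\<sigma> \<tau>. LINT x:T|lebesgue. \<sigma> x \<bullet> \<tau> x)"
    using semi_inner_subset[OF semi_inner_region[OF elem(1,2)[OF assms], where 'b = tensor] _ subspace_Poly_sym]
      Poly_sym_continuous by blast
  moreover have "\<tau> = 0" if t: "\<tau> \<in> Poly_sym m" "(LINT x:T|lebesgue. \<tau> x \<bullet> \<tau> x) = 0" for \<tau>
  proof -
    have c: "continuous_on UNIV (\<lambda>x. \<tau> x \<bullet> \<tau> x)" using Poly_sym_continuous[OF t(1)] by (intro continuous_intros)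
    note s = set_integrable_continuous[OF elem(2)[OF assms] borel_open[OF elem(1)[OF assms]] c]
    have "\<tau> x \<bullet> \<tau> x = 0" if "x \<in> T" for x
      using set_integral_nonneg_eq_0[OF elem(1)[OF assms] order_refl borel_open[OF elem(1)[OF assms]] s(1) c _ _ that] s(3) t(2)
      by simp
    then have 0: "\<tau> x = 0" if "x \<in> T" for x using that by simp
    have "(\<lambda>x. \<tau> x $ i $ j) = (\<lambda>x. 0)" for i j
      by (rule Poly_eq_0[OF Poly_symD(1)[OF t(1)] elem(1,3)[OF assms]]) (use 0 in auto)
    then show ?thesis by (simp add: fun_eq_iff vec_eq_iff)
  qed
  ultimately show ?thesis by (simp add: inner_on_def)
qed

definition P_cell_rhs :: "region \<Rightarrow> dofs \<Rightarrow> (point \<Rightarrow> real) \<Rightarrow> (point \<Rightarrow> tensor) \<Rightarrow> real" where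
  "P_cell_rhs T \<tau> q \<upsilon> = (LINT x:T|lebesgue. DD l M T \<tau> x * q x) + bdry M T \<tau> (\<lambda>E. P_edge l M E \<tau>) q
     + (LINT x:T|lebesgue. cell_Hc \<tau> T x \<bullet> \<upsilon> x)"

lemma DD_form_linear:
  assumes "\<tau> \<in> Sigma_space l M" "T \<in> elems M"
  shows "linear_on' (Poly m) (\<lambda>q. (LINT x:T|lebesgue. DD l M T \<tau> x * q x) + bdry M T \<tau> (\<lambda>E. P_edge l M E \<tau>) q)"
proof -
  have "linear_on' (Poly m) (bdry M T \<tau> (\<lambda>E. P_edge l M E \<tau>))"
    using SigmaD(8)[OF assms(1)] P_edge_props(4)[OF assms(1)] elem_edge by (intro bdry_linear) blast+
  moreover have "linear_on' (Poly m) (\<lambda>q. LINT x:T|lebesgue. DD l M T \<tau> x * q x)"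
    using linear_on'_subset[OF cell_form_linear(1)[OF assms(2) Poly_continuous_on[OF DD_props(1)[OF assms]]], of "Poly m"]
      Poly_continuous_on by auto
  ultimately show ?thesis unfolding linear_on'_def by (simp add: algebra_simps)
qed

lemma P_cell_ex1:
  assumes "\<tau> \<in> Sigma_space l M" "T \<in> elems M"
  shows "\<exists>!P. P \<in> Poly_sym l \<and> (\<forall>q\<in>Poly (l + 2). \<forall>\<upsilon>\<in>Hess_compl l (center M T).
    (LINT x:T|lebesgue. P x \<bullet> (hess q x + \<upsilon> x)) = P_cell_rhs T \<tau> q \<upsilon>)"
proof -
  let ?R = "\<lambda>q. (LINT x:T|lebesgue. DD l M T \<tau> x * q x) + bdry M T \<tau> (\<lambda>E. P_edge l M E \<tau>) q"
  let ?S = "\<lambda>\<upsilon>. LINT x:T|lebesgue. cell_Hc \<tau> T x \<bullet> \<upsilon> x"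
  let ?c = "center M T"
  have S: "linear_on' (Hess_compl l ?c) ?S"
    using linear_on'_subset[OF cell_form_linear(1)[OF assms(2) SigmaD(6)[OF assms]], of "Hess_compl l ?c"]
      Hess_compl_Poly_sym Poly_sym_continuous by blast
  have "\<exists>!P. P \<in> Poly_sym l \<and> (\<forall>q\<in>Poly (l + 2). \<forall>\<upsilon>\<in>Hess_compl l ?c.
    (LINT x:T|lebesgue. P x \<bullet> (hess q + \<upsilon>) x) = ?R q + ?S \<upsilon>)"
  proof (rule riesz_decomposed[OF inner_on_Poly_sym[OF assms(2)] findim_Poly_sym subspace_Poly subspace_Hess_compl
        DD_form_linear[OF assms] S hess_linear Hess_compl_Poly_sym])
    show "hess ` Poly (l + 2) \<subseteq> Poly_sym l" using hess_Poly_sym by blast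
    show "\<exists>q\<in>Poly (l + 2). \<exists>u\<in>Hess_compl l ?c. x = hess q + u" if "x \<in> Poly_sym l" for x
      using hess_decomposition_exists[OF that, of ?c] by (simp add: fun_eq_iff)
    show "?R q + ?S u = 0" if "q \<in> Poly (l + 2)" "u \<in> Hess_compl l ?c" "hess q + u = 0" for q u
    proof -
      have "hess q x + u x = 0" for x using that(3) by (metis plus_fun_apply zero_fun_apply)
      then have "q \<in> Poly 1" "u = 0" using hess_decomposition_unique[OF that(1) _ that(2)] l2 by auto
      then show ?thesis using consistency_affine[OF assms] by simp
    qed
  qed
  then show ?thesis unfolding P_cell_rhs_def by simp
qed

lemma P_cell_alt: "P_cell l M T \<tau> = (THE P. P \<in> Poly_sym l \<and> (\<forall>q\<in>Poly (l + 2). \<forall>\<upsilon>\<in>Hess_compl l (center M T).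
    (LINT x:T|lebesgue. P x \<bullet> (hess q x + \<upsilon> x)) = P_cell_rhs T \<tau> q \<upsilon>))"
  unfolding P_cell_def P_cell_rhs_def bdry_def by (simp only: add.assoc)

lemma P_cell_props:
  assumes "\<tau> \<in> Sigma_space l M" "T \<in> elems M"
  shows "P_cell l M T \<tau> \<in> Poly_sym l"
    "q \<in> Poly (l + 2) \<Longrightarrow> \<upsilon> \<in> Hess_compl l (center M T) \<Longrightarrow>
      (LINT x:T|lebesgue. P_cell l M T \<tau> x \<bullet> (hess q x + \<upsilon> x)) = P_cell_rhs T \<tau> q \<upsilon>"
  using theI'[OF P_cell_ex1[OF assms]] unfolding P_cell_alt by blast+

lemma P_cell_eqI:
  assumes "\<tau> \<in> Sigma_space l M" "T \<in> elems M" "P \<in> Poly_sym l"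
    "\<And>q \<upsilon>. q \<in> Poly (l + 2) \<Longrightarrow> \<upsilon> \<in> Hess_compl l (center M T) \<Longrightarrow>
      (LINT x:T|lebesgue. P x \<bullet> (hess q x + \<upsilon> x)) = P_cell_rhs T \<tau> q \<upsilon>"
  shows "P_cell l M T \<tau> = P"
  unfolding P_cell_alt using assms(3,4) by (intro the1_equality[OF P_cell_ex1[OF assms(1,2)]]) blast

lemma SvecD: "t \<in> Svec l M \<Longrightarrow> mkd t \<in> Sigma_space l M"
  by (simp add: Svec_def)

lemma cell_integral_lin:
  fixes f g h :: "point \<Rightarrow> 'b::euclidean_space"
  assumes "T \<in> elems M" "continuous_on UNIV f" "continuous_on UNIV g" "continuous_on UNIV h"
  shows "(LINT x:T|lebesgue. (r *\<^sub>R f x + g x) \<bullet> h x) = r * (LINT x:T|lebesgue. f x \<bullet> h x) + (LINT x:T|lebesgue. g x \<bullet> h x)"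
proof -
  note D = semi_innerD[OF semi_inner_region[OF elem(1,2)[OF assms(1)], where 'b = 'b]]
  have "r *\<^sub>R f \<in> contfuns" using subspace_scale[OF D(1)] assms(2) by blast
  from D(3)[OF this, of g h] D(5)[of f h r] show ?thesis using assms(2-4) by simp
qed

section \<open>Linearity of the discrete operators in the unknowns\<close>

context
  fixes s t :: dvec and r :: real
  assumes s: "mkd s \<in> Sigma_space l M" and t: "mkd t \<in> Sigma_space l M"
begin

lemma comb_Sigma: "mkd (r *\<^sub>R s + t) \<in> Sigma_space l M"
  using subspace_add[OF subspace_Svec subspace_scale[OF subspace_Svec, of s l M r], of t] s t by (simp add: Svec_def)

text \<open>Linearity follows from uniqueness: the combination of the images satisfies the identity
  that characterizes the image of the combination. The same argument serves the edge and cell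
  reconstructions below.\<close>

lemma DD_comb:
  assumes T: "T \<in> elems M"
  shows "DD l M T (mkd (r *\<^sub>R s + t)) = r *\<^sub>R DD l M T (mkd s) + DD l M T (mkd t)"
proof (rule DD_eqI[OF comb_Sigma T subspace_add[OF subspace_Poly subspace_scale[OF subspace_Poly DD_props(1)[OF s T]] DD_props(1)[OF t T]]])
  fix q assume q: "q \<in> Poly (l - 1)"
  note c = DD_props(1)[OF s T, THEN Poly_continuous_on] DD_props(1)[OF t T, THEN Poly_continuous_on] Poly_continuous_on[OF q]
  have "hess q \<in> Poly_sym (l - 3)" using hess_Poly_sym[of q "l - 3"] q by simp
  note lin = cell_integral_lin[OF T SigmaD(5)[OF s T] SigmaD(5)[OF t T] Poly_sym_continuous[OF this]]
  have b: "bdry M T (mkd (r *\<^sub>R s + t)) (edge_nn (mkd (r *\<^sub>R s + t))) q = r * bdry M T (mkd s) (edge_nn (mkd s)) q + bdry M T (mkd t) (edge_nn (mkd t)) q"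
    unfolding mkd_add mkd_scale real_scaleR_def
    by (rule bdry_lin_dofs[OF SigmaD(7)[OF s elem_edge(2)] SigmaD(7)[OF t elem_edge(2)] s t q])
  have i: "(LINT x:T|lebesgue. (r *\<^sub>R DD l M T (mkd s) + DD l M T (mkd t)) x * q x) =
    r * (LINT x:T|lebesgue. DD l M T (mkd s) x * q x) + (LINT x:T|lebesgue. DD l M T (mkd t) x * q x)"
    using cell_integral_lin[OF T c] by simp
  show "(LINT x:T|lebesgue. (r *\<^sub>R DD l M T (mkd s) + DD l M T (mkd t)) x * q x) =
    (LINT x:T|lebesgue. cell_H (mkd (r *\<^sub>R s + t)) T x \<bullet> hess q x) - bdry M T (mkd (r *\<^sub>R s + t)) (edge_nn (mkd (r *\<^sub>R s + t))) q"
    unfolding b i mkd_add mkd_scale lin DD_props(2)[OF s T q] DD_props(2)[OF t T q] by (simp add: right_diff_distrib)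
qed

lemma P_edge_comb:
  assumes E: "E \<in> edges M"
  shows "P_edge l M E (mkd (r *\<^sub>R s + t)) = r *\<^sub>R P_edge l M E (mkd s) + P_edge l M E (mkd t)"
proof (rule P_edge_eqI[OF comb_Sigma E subspace_add[OF subspace_Poly_edge subspace_scale[OF subspace_Poly_edge P_edge_props(1)[OF s E]] P_edge_props(1)[OF t E]]])
  note p = P_edge_props[OF s E] P_edge_props[OF t E]
  note e = edge_integral_lin[OF meshD(8)[OF mesh E]]
  fix q assume q: "q \<in> Poly_edge (l - 2) E"
  show "edge_integral E (\<lambda>x. (r *\<^sub>R P_edge l M E (mkd s) + P_edge l M E (mkd t)) x * q x) = edge_integral E (\<lambda>x. edge_nn (mkd (r *\<^sub>R s + t)) E x * q x)"
    using e[OF p(4,8) Poly_edge_continuous[OF q], of r] e[OF SigmaD(7)[OF s E] SigmaD(7)[OF t E] Poly_edge_continuous[OF q], of r] p(3,7)[OF q] by simp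
qed (use P_edge_props(2)[OF s E] P_edge_props(2)[OF t E] in \<open>simp add: tensor_vec_lin inner_add_left\<close>)

lemma P_cell_comb:
  assumes T: "T \<in> elems M"
  shows "P_cell l M T (mkd (r *\<^sub>R s + t)) = r *\<^sub>R P_cell l M T (mkd s) + P_cell l M T (mkd t)"
proof (rule P_cell_eqI[OF comb_Sigma T subspace_add[OF subspace_Poly_sym subspace_scale[OF subspace_Poly_sym P_cell_props(1)[OF s T]] P_cell_props(1)[OF t T]]])
  note p = P_cell_props[OF s T] P_cell_props[OF t T]
  fix q \<upsilon> assume q: "q \<in> Poly (l + 2)" and v: "\<upsilon> \<in> Hess_compl l (center M T)"
  have cv: "continuous_on UNIV \<upsilon>" using v Hess_compl_Poly_sym Poly_sym_continuous by blast
  have cx: "continuous_on UNIV (\<lambda>x. hess q x + \<upsilon> x)"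
    using Poly_sym_continuous[OF hess_Poly_sym[OF q]] cv by (intro continuous_intros)
  have "bdry M T (mkd (r *\<^sub>R s + t)) (\<lambda>E. P_edge l M E (mkd (r *\<^sub>R s + t))) q =
    bdry M T (mkd (r *\<^sub>R s + t)) (\<lambda>E x. r * P_edge l M E (mkd s) x + P_edge l M E (mkd t) x) q"
    unfolding bdry_def using P_edge_comb elem_edge(2) by (simp cong: sum.cong)
  also have "\<dots> = r * bdry M T (mkd s) (\<lambda>E. P_edge l M E (mkd s)) q + bdry M T (mkd t) (\<lambda>E. P_edge l M E (mkd t)) q"
    by (rule bdry_lin_dofs[OF P_edge_props(4)[OF s elem_edge(2)] P_edge_props(4)[OF t elem_edge(2)] s t q])
  finally have b: "bdry M T (mkd (r *\<^sub>R s + t)) (\<lambda>E. P_edge l M E (mkd (r *\<^sub>R s + t))) q =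
    r * bdry M T (mkd s) (\<lambda>E. P_edge l M E (mkd s)) q + bdry M T (mkd t) (\<lambda>E. P_edge l M E (mkd t)) q" .
  have i1: "(LINT x:T|lebesgue. (r *\<^sub>R DD l M T (mkd s) + DD l M T (mkd t)) x * q x) =
    r * (LINT x:T|lebesgue. DD l M T (mkd s) x * q x) + (LINT x:T|lebesgue. DD l M T (mkd t) x * q x)"
    using cell_integral_lin[OF T DD_props(1)[OF s T, THEN Poly_continuous_on] DD_props(1)[OF t T, THEN Poly_continuous_on] Poly_continuous_on[OF q]] by simp
  show "(LINT x:T|lebesgue. (r *\<^sub>R P_cell l M T (mkd s) + P_cell l M T (mkd t)) x \<bullet> (hess q x + \<upsilon> x)) = P_cell_rhs T (mkd (r *\<^sub>R s + t)) q \<upsilon>"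
    unfolding plus_fun_apply scaleR_fun_apply cell_integral_lin[OF T Poly_sym_continuous[OF p(1)] Poly_sym_continuous[OF p(3)] cx] p(2)[OF q v] p(4)[OF q v]
    unfolding P_cell_rhs_def DD_comb[OF T] i1 b mkd_add mkd_scale cell_integral_lin[OF T SigmaD(6)[OF s T] SigmaD(6)[OF t T] cv]
    by (simp add: algebra_simps)
qed

end

lemma linear_on'I:
  assumes "subspace V" "\<And>r s t. s \<in> V \<Longrightarrow> t \<in> V \<Longrightarrow> f (r *\<^sub>R s + t) = r *\<^sub>R f s + f t"
  shows "linear_on' V f"
proof -
  have "f 0 = 0" using assms(2)[of 0 0 "-1"] subspace_0[OF assms(1)] by simp
  then show ?thesis
    unfolding linear_on'_def using assms(2)[of _ 0] assms(2)[of _ _ 1] subspace_0[OF assms(1)] by simp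
qed

lemmas DD_linear = linear_on'I[OF subspace_Svec DD_comb[OF SvecD SvecD]]

end

section \<open>Local bounds\<close>

definition L2n :: "region \<Rightarrow> (point \<Rightarrow> 'b::euclidean_space) \<Rightarrow> real" where
  "L2n T f = sqrt (LINT x:T|lebesgue. (norm (f x))\<^sup>2)"

definition eL2 :: "region \<Rightarrow> (point \<Rightarrow> real) \<Rightarrow> real" where
  "eL2 E g = sqrt (edge_integral E (\<lambda>x. (g x)\<^sup>2))"

lemma L2n_nonneg: "0 \<le> L2n T f"
  unfolding L2n_def by (intro real_sqrt_ge_zero set_integral_ge_0) simp

lemma L2n_sq: "(L2n T f)\<^sup>2 = (LINT x:T|lebesgue. (norm (f x))\<^sup>2)"
  unfolding L2n_def by (intro real_sqrt_pow2 set_integral_ge_0) simp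

lemma eL2_nonneg: "is_edge E \<Longrightarrow> 0 \<le> eL2 E g"
  unfolding eL2_def by (intro real_sqrt_ge_zero edge_integral_nonneg) auto

lemma eL2_sq: "is_edge E \<Longrightarrow> (eL2 E g)\<^sup>2 = edge_integral E (\<lambda>x. (g x)\<^sup>2)"
  unfolding eL2_def by (intro real_sqrt_pow2 edge_integral_nonneg) auto

text \<open>The conclusion of \<open>Poly_inverse_ineq\<close> as a predicate on its constant. A
  constant chosen before any mesh can then be passed to the estimates as a parameter.\<close>

definition inverse_const :: "real \<Rightarrow> int \<Rightarrow> real \<Rightarrow> bool" where
  "inverse_const \<kappa> m C \<longleftrightarrow> C > 0 \<and>
    (\<forall>z h T p x d. 0 < h \<and> open T \<and> bounded T \<and> ball z (\<kappa> * h) \<subseteq> T \<and> p \<in> Poly m \<and> dist z x \<le> 2 * h \<longrightarrow>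
    \<bar>p x\<bar> \<le> C / h * sqrt (LINT x:T|lebesgue. (p x)\<^sup>2) \<and>
    \<bar>dir_deriv d p x\<bar> \<le> C / h\<^sup>2 * norm d * sqrt (LINT x:T|lebesgue. (p x)\<^sup>2))"

definition bubble_const :: "int \<Rightarrow> real \<Rightarrow> bool" where
  "bubble_const m B \<longleftrightarrow> B > 0 \<and>
    (\<forall>E p t. is_edge E \<and> p \<in> Poly_edge m E \<and> t \<in> Poly_edge (m - 2) E \<and> (\<forall>V\<in>edge_verts E. p V = 0) \<and>
    (\<forall>q\<in>Poly_edge (m - 2) E. edge_integral E (\<lambda>x. p x * q x) = edge_integral E (\<lambda>x. t x * q x)) \<longrightarrow>
    edge_integral E (\<lambda>x. (p x)\<^sup>2) \<le> B * edge_integral E (\<lambda>x. (t x)\<^sup>2))"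

lemma square_le_cancel:
  assumes "x * x \<le> c * x" "0 \<le> (x::real)" "0 \<le> c" shows "x \<le> c"
  using assms by (cases "x = 0") (auto simp: mult_le_cancel_right)

lemma sq_sum_le: "(x + y)\<^sup>2 \<le> 2 * x\<^sup>2 + 2 * (y::real)\<^sup>2"
  using sum_squares_bound[of x y] by (simp add: power2_sum)

lemma tensor_edge_Poly:
  assumes X: "X \<in> Poly_sym l"
  shows "(\<lambda>x. (X x *v n) \<bullet> t) \<in> Poly l" (is ?A) "(\<lambda>x. row_div X x \<bullet> n) \<in> Poly l" (is ?B)
    "(X x *v n) \<bullet> t = n$1 * (t$1 * X x $ 1 $ 1) + n$2 * (t$1 * X x $ 1 $ 2) + n$1 * (t$2 * X x $ 2 $ 1) + n$2 * (t$2 * X x $ 2 $ 2)" (is ?C)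
proof -
  note P = Poly_symD(1)[OF X]
  have e: "(X x *v n) \<bullet> t = n$1 * (t$1 * X x $ 1 $ 1) + n$2 * (t$1 * X x $ 1 $ 2) + n$1 * (t$2 * X x $ 2 $ 1) + n$2 * (t$2 * X x $ 2 $ 2)" for x
    by (simp add: inner_vec_def matrix_vector_mult_def sum_2 algebra_simps)
  then show ?C .
  show ?A unfolding e by (intro Poly_add Poly_cmult P)
  have "(\<lambda>x. row_div X x \<bullet> n) = (\<lambda>x. \<Sum>i\<in>UNIV. n$i * (\<Sum>j\<in>UNIV. dir_deriv (axis j 1) (\<lambda>y. X y $ i $ j) x))"
    by (auto simp: fun_eq_iff row_div_def inner_vec_def mult.commute)
  also have "\<dots> \<in> Poly l"
    using Poly_mono[OF dir_deriv_Poly[OF P], of l] by (intro Poly_sum Poly_cmult) auto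
  finally show ?B .
qed

lemma dir_deriv_sum4:
  assumes "p1 \<in> Poly m" "p2 \<in> Poly m" "p3 \<in> Poly m" "p4 \<in> Poly m"
  shows "dir_deriv d (\<lambda>x. a1 * (b1 * p1 x) + a2 * (b2 * p2 x) + a3 * (b3 * p3 x) + a4 * (b4 * p4 x)) x =
    a1 * (b1 * dir_deriv d p1 x) + a2 * (b2 * dir_deriv d p2 x) + a3 * (b3 * dir_deriv d p3 x) + a4 * (b4 * dir_deriv d p4 x)"
proof -
  note A = assms[THEN Poly_cmult, THEN Poly_cmult]
  show ?thesis
    unfolding dir_deriv_add[OF Poly_add[OF Poly_add[OF A(1) A(2)] A(3)] A(4)] dir_deriv_add[OF Poly_add[OF A(1) A(2)] A(3)]
      dir_deriv_add[OF A(1) A(2)]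
    by (simp only: assms[THEN Poly_cmult, THEN dir_deriv_cmult] assms[THEN dir_deriv_cmult])
qed

text \<open>The constants are locale parameters, and the derived ones are defined from these
  parameters alone; their independence of the mesh is thereby visible in the terms.\<close>

locale plate_estimate = plate_mesh +
  fixes \<kappa> :: real and N :: nat and C B :: real
  assumes shape: "shape_regular \<kappa> N \<Omega> M" and kap: "0 < \<kappa>"
    and invc: "inverse_const \<kappa> (l + 2) C" and bub: "bubble_const l B"
begin

lemma CB_pos: "0 < C" "0 < B"
  using invc bub by (auto simp: inverse_const_def bubble_const_def)

lemma shapeD:
  assumes "T \<in> elems M"
  shows "0 < diameter T" "\<exists>z. ball z (\<kappa> * diameter T) \<subseteq> T" "card (elem_edges M T) \<le> N"
    "E \<in> elem_edges M T \<Longrightarrow> \<kappa> * diameter T \<le> edge_len E"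
  using shape assms unfolding shape_regular_def by blast+

lemma dist_elem:
  assumes "T \<in> elems M" "x \<in> closure T" "y \<in> closure T"
  shows "dist x y \<le> diameter T"
  using diameter_bounded_bound[of "closure T" x y] assms elem(2)[OF assms(1)]
  by (simp add: diameter_closure bounded_closure)

lemma edge_len_le:
  assumes "T \<in> elems M" "E \<in> elem_edges M T"
  shows "edge_len E \<le> diameter T"
proof -
  obtain a b where ab: "a \<noteq> b" "E = open_segment a b" using elem_edge(1)[OF assms(2)] by (rule is_edgeE)
  have "{a, b} \<subseteq> closure T" using closure_elem_edge[OF assms(2)] ab by auto
  then show ?thesis using dist_elem[OF assms(1), of a b] ab by (simp add: edge_len_segment)
qed

lemma norm_tangent_normal:
  assumes "E \<in> edges M"
  shows "norm (tangent M E) = 1" "norm (normal M E) = 1"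
proof -
  obtain a b where "a \<noteq> b" "tangent M E = (b - a) /\<^sub>R norm (b - a)"
    using mesh_edgesD(3)[OF mesh assms] by blast
  then show t: "norm (tangent M E) = 1" by simp
  then show "norm (normal M E) = 1"
    by (simp add: normal_def rot90_def norm_eq_sqrt_inner inner_vec_def sum_2 algebra_simps)
qed

text \<open>The point x may lie up to one diameter outside the element. This is essential for rays
  from the centre of an element, which may leave it when it is not star-shaped.\<close>

lemma Poly_pointwise:
  assumes T: "T \<in> elems M" and p: "p \<in> Poly (l + 2)" and y: "y \<in> closure T" "dist y x \<le> diameter T"
  shows "\<bar>p x\<bar> \<le> C / diameter T * L2n T p" (is ?A) "\<bar>dir_deriv d p x\<bar> \<le> C / (diameter T)\<^sup>2 * norm d * L2n T p" (is ?B)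
proof -
  obtain z where z: "ball z (\<kappa> * diameter T) \<subseteq> T" using shapeD(2)[OF T] by blast
  have "z \<in> T" using z kap shapeD(1)[OF T] by (simp add: subset_iff)
  then have "dist z y \<le> diameter T" using dist_elem[OF T _ y(1)] closure_subset[of T] by blast
  then have "dist z x \<le> 2 * diameter T" using y(2) dist_triangle[of z x y] by simp
  then show ?A ?B
    using invc shapeD(1)[OF T] elem(1,2)[OF T] z p unfolding inverse_const_def L2n_def by simp_all
qed

lemma elem_in_cball: "T \<in> elems M \<Longrightarrow> y \<in> closure T \<Longrightarrow> closure T \<subseteq> cball y (diameter T)"
  using dist_elem by auto

lemma L2n_le_sup:
  fixes f :: "point \<Rightarrow> 'b::euclidean_space"
  assumes "T \<in> elems M" "continuous_on UNIV f" "\<And>x. x \<in> closure T \<Longrightarrow> norm (f x) \<le> c" "0 \<le> c"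
  shows "L2n T f \<le> 2 * diameter T * c"
proof -
  obtain z where z: "z \<in> T" using elem(3)[OF assms(1)] by blast
  have sub: "T \<subseteq> cball z (diameter T)" using elem_in_cball[OF assms(1)] z closure_subset[of T] by blast
  have h: "0 \<le> diameter T" using shapeD(1)[OF assms(1)] by simp
  have "(LINT x:T|lebesgue. (norm (f x))\<^sup>2) \<le> (2 * diameter T * c)\<^sup>2"
    using assms(3) closure_subset[of T] by (intro integral_norm_sq_le[OF elem(1)[OF assms(1)] sub h assms(2)]) blast
  then show ?thesis unfolding L2n_def using h assms(4) by (intro real_le_lsqrt) auto
qed

lemma cell_CS:
  fixes f g :: "point \<Rightarrow> 'b::euclidean_space"
  assumes "T \<in> elems M" "continuous_on UNIV f" "continuous_on UNIV g"
  shows "\<bar>LINT x:T|lebesgue. f x \<bullet> g x\<bar> \<le> L2n T f * L2n T g"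
  using semi_inner_CS_abs[OF semi_inner_region[OF elem(1,2)[OF assms(1)], where 'b = 'b], of f g] assms(2,3)
  by (simp add: L2n_def power2_norm_eq_inner)

text \<open>The inverse estimate is used twice: its pointwise bound for a first derivative is
  integrated over T, at the price of a factor 2 h, and then inserted for the second derivative. Four
  entries with factor 2 each make the 8.\<close>

lemma second_deriv_bound:
  assumes T: "T \<in> elems M" and p: "p \<in> Poly (l + 2)" and x: "x \<in> closure T"
  shows "norm (hess p x) \<le> 8 * C\<^sup>2 / (diameter T)^3 * L2n T p"
proof -
  let ?h = "diameter T"
  note h = shapeD(1)[OF T]
  have c: "\<bar>hess p x $ i $ j\<bar> \<le> 2 * C\<^sup>2 / ?h^3 * L2n T p" for i j
  proof -
    let ?q = "dir_deriv (axis j 1) p"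
    have q: "?q \<in> Poly (l + 2)" using Poly_mono[OF dir_deriv_Poly[OF p]] by simp
    have "L2n T ?q \<le> 2 * ?h * (C / ?h\<^sup>2 * L2n T p)"
      using Poly_pointwise(2)[OF T p _ , where d = "axis j 1"] h CB_pos L2n_nonneg[of T p]
      by (intro L2n_le_sup[OF T Poly_continuous_on[OF q]]) (force simp: norm_axis_1)+
    also have "\<dots> = 2 * C / ?h * L2n T p" using h by (simp add: power2_eq_square)
    finally have q2: "L2n T ?q \<le> 2 * C / ?h * L2n T p" .
    have "\<bar>hess p x $ i $ j\<bar> \<le> C / ?h\<^sup>2 * L2n T ?q"
      using Poly_pointwise(2)[OF T q x, of x "axis i 1"] h by (simp add: hess_nth norm_axis_1)
    also have "\<dots> \<le> C / ?h\<^sup>2 * (2 * C / ?h * L2n T p)" using q2 h CB_pos by (intro mult_left_mono) auto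
    finally show ?thesis by (simp add: power2_eq_square power3_eq_cube mult.commute mult.left_commute)
  qed
  have "norm (hess p x) \<le> (\<Sum>i\<in>UNIV. norm (hess p x $ i))" by (simp add: norm_vec_def L2_set_le_sum)
  also have "\<dots> \<le> (\<Sum>i\<in>(UNIV :: 2 set). \<Sum>j\<in>UNIV. \<bar>hess p x $ i $ j\<bar>)"
    by (intro sum_mono norm_le_l1_cart)
  also have "\<dots> \<le> (\<Sum>i\<in>(UNIV :: 2 set). \<Sum>j\<in>(UNIV :: 2 set). 2 * C\<^sup>2 / ?h^3 * L2n T p)" by (intro sum_mono c)
  finally show ?thesis by (simp add: sum_2)
qed

lemma component_L2n:
  assumes T: "T \<in> elems M" and X: "X \<in> Poly_sym m"
  shows "L2n T (\<lambda>x. X x $ i $ j) \<le> L2n T X"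
proof -
  note Poly_sym_continuous[OF X, continuous_intros]
  have "(LINT x:T|lebesgue. (norm (X x $ i $ j))\<^sup>2) \<le> (LINT x:T|lebesgue. (norm (X x))\<^sup>2)"
  proof (intro set_integral_mono set_integrable_continuous continuous_intros elem[OF T] borel_open)
    show "(norm (X x $ i $ j))\<^sup>2 \<le> (norm (X x))\<^sup>2" for x
      using order_trans[OF component_le_norm_cart Finite_Cartesian_Product.norm_nth_le, of "X x" i j]
      by (intro power_mono) auto
  qed
  then show ?thesis unfolding L2n_def by simp
qed

lemma tensor_pointwise:
  assumes T: "T \<in> elems M" and X: "X \<in> Poly_sym l" and y: "y \<in> closure T" "dist y x \<le> diameter T"
  shows "\<bar>dir_deriv d (\<lambda>x. X x $ i $ j) x\<bar> \<le> C / (diameter T)\<^sup>2 * norm d * L2n T X" (is ?A)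
    "norm (X x) \<le> 4 * C / diameter T * L2n T X" (is ?B)
proof -
  note h = shapeD(1)[OF T]
  have P: "(\<lambda>x. X x $ i $ j) \<in> Poly (l + 2)" for i j using Poly_mono[OF Poly_symD(1)[OF X]] by simp
  have "\<bar>dir_deriv d (\<lambda>x. X x $ i $ j) x\<bar> \<le> C / (diameter T)\<^sup>2 * norm d * L2n T (\<lambda>x. X x $ i $ j)"
    by (rule Poly_pointwise(2)[OF T P y])
  also have "\<dots> \<le> C / (diameter T)\<^sup>2 * norm d * L2n T X"
    using component_L2n[OF T X] CB_pos h by (intro mult_left_mono) auto
  finally show ?A .
  have c: "\<bar>X x $ i $ j\<bar> \<le> C / diameter T * L2n T X" for i j
  proof -
    have "\<bar>X x $ i $ j\<bar> \<le> C / diameter T * L2n T (\<lambda>x. X x $ i $ j)" by (rule Poly_pointwise(1)[OF T P y])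
    also have "\<dots> \<le> C / diameter T * L2n T X"
      using component_L2n[OF T X] CB_pos h by (intro mult_left_mono) auto
    finally show ?thesis .
  qed
  have "norm (X x) \<le> (\<Sum>i\<in>UNIV. norm (X x $ i))" by (simp add: norm_vec_def L2_set_le_sum)
  also have "\<dots> \<le> (\<Sum>i\<in>(UNIV :: 2 set). \<Sum>j\<in>UNIV. \<bar>X x $ i $ j\<bar>)"
    by (intro sum_mono norm_le_l1_cart)
  also have "\<dots> \<le> (\<Sum>i\<in>(UNIV :: 2 set). \<Sum>j\<in>(UNIV :: 2 set). C / diameter T * L2n T X)" by (intro sum_mono c)
  finally show ?B by (simp add: sum_2)
qed

text \<open>The powers of the diameter give all contributions the scaling of an \<open>L\<^sup>2\<close> norm on \<open>T\<close>.\<close>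

definition size_le :: "dofs \<Rightarrow> region \<Rightarrow> real \<Rightarrow> bool" where
  "size_le \<tau> T K \<longleftrightarrow> 0 \<le> K \<and> L2n T (cell_H \<tau> T) \<le> K \<and> cell_Hc \<tau> T = (\<lambda>x. 0) \<and> vert \<tau> = (\<lambda>V. 0) \<and>
    (\<forall>E\<in>elem_edges M T. sqrt (diameter T) * eL2 E (edge_nn \<tau> E) \<le> K \<and>
      diameter T * sqrt (diameter T) * eL2 E (edge_D \<tau> E) \<le> K)"

text \<open>With zero vertex values only edge integrals remain. On an edge, Cauchy-Schwarz costs the
  root of its length, at most the root of the diameter; the bounds a for the derivative and a h for
  the value of q complete precisely the weights of the edge components. Two integrals on each of at
  most N edges give the factor.\<close>

lemma bdry_bound:
  assumes T: "T \<in> elems M" and \<tau>: "\<tau> \<in> Sigma_space l M" and v: "vert \<tau> = (\<lambda>V. 0)" and q: "q \<in> Poly m"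
    and Nc: "\<And>E. E \<in> elem_edges M T \<Longrightarrow> continuous_on (closure E) (F E)"
    and K: "\<And>E. E \<in> elem_edges M T \<Longrightarrow> sqrt (diameter T) * eL2 E (F E) \<le> K"
      "\<And>E. E \<in> elem_edges M T \<Longrightarrow> diameter T * sqrt (diameter T) * eL2 E (edge_D \<tau> E) \<le> K"
    and a: "0 \<le> a" "\<And>x d. x \<in> closure T \<Longrightarrow> norm d = 1 \<Longrightarrow> \<bar>dir_deriv d q x\<bar> \<le> a"
      "\<And>x. x \<in> closure T \<Longrightarrow> \<bar>q x\<bar> \<le> a * diameter T"
    and K0: "0 \<le> K"
  shows "\<bar>bdry M T \<tau> F q\<bar> \<le> real N * (2 * a * K)"
proof -
  let ?h = "diameter T"
  note h = shapeD(1)[OF T]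
  have vt: "vert_terms M T \<tau> q = 0" by (simp add: vert_terms_def v)
  have t: "\<bar>sign_TE M T E * (edge_integral E (\<lambda>x. F E x * dir_deriv (normal M E) q x) - edge_integral E (\<lambda>x. edge_D \<tau> E x * q x))\<bar> \<le> 2 * a * K"
    if E: "E \<in> elem_edges M T" for E
  proof -
    note e = elem_edge[OF E]
    have cl: "x \<in> closure T" if "x \<in> closure E" for x using closure_elem_edge[OF E] that by blast
    have len: "sqrt (edge_len E) \<le> sqrt ?h" using edge_len_le[OF T E] by simp
    have len0: "0 \<le> sqrt (edge_len E)" using edge_len_pos[OF e(1)] by simp
    have "\<bar>edge_integral E (\<lambda>x. F E x * dir_deriv (normal M E) q x)\<bar> \<le> a * sqrt (edge_len E) * eL2 E (F E)"
      unfolding eL2_def using a(2)[OF cl] norm_tangent_normal(2)[OF e(2)] a(1) Nc[OF E]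
      by (intro edge_integral_bound(2)[OF e(1) Poly_continuous_on[OF dir_deriv_Poly[OF q]]]) auto
    also have "\<dots> \<le> a * (sqrt ?h * eL2 E (F E))"
      using len a(1) eL2_nonneg[OF e(1)] by (simp add: mult.assoc mult_left_mono mult_right_mono)
    also have "\<dots> \<le> a * K" using K(1)[OF E] a(1) by (rule mult_left_mono)
    finally have 1: "\<bar>edge_integral E (\<lambda>x. F E x * dir_deriv (normal M E) q x)\<bar> \<le> a * K" .
    have "\<bar>edge_integral E (\<lambda>x. edge_D \<tau> E x * q x)\<bar> \<le> (a * ?h) * sqrt (edge_len E) * eL2 E (edge_D \<tau> E)"
      unfolding eL2_def using a(3)[OF cl] a(1) h
      by (intro edge_integral_bound(2)[OF e(1) Poly_continuous_on[OF q] SigmaD(8)[OF \<tau> e(2)]]) auto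
    also have "\<dots> \<le> (a * ?h) * sqrt ?h * eL2 E (edge_D \<tau> E)"
      using len a(1) h eL2_nonneg[OF e(1)] by (intro mult_right_mono mult_left_mono) auto
    also have "\<dots> = a * (?h * sqrt ?h * eL2 E (edge_D \<tau> E))" by simp
    also have "\<dots> \<le> a * K" using K(2)[OF E] a(1) by (rule mult_left_mono)
    finally have 2: "\<bar>edge_integral E (\<lambda>x. edge_D \<tau> E x * q x)\<bar> \<le> a * K" .
    have "\<bar>sign_TE M T E\<bar> = 1" using mesh_edgesD(4)[OF mesh T E] by auto
    then show ?thesis unfolding abs_mult using 1 2 by simp
  qed
  have "\<bar>bdry M T \<tau> F q\<bar> \<le> (\<Sum>E\<in>elem_edges M T. 2 * a * K)"
    unfolding bdry_def vt add_0 by (rule order_trans[OF sum_abs sum_mono[OF t]])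
  also have "\<dots> \<le> real N * (2 * a * K)"
    using shapeD(3)[OF T] a(1) K0 by (simp add: mult_right_mono)
  finally show ?thesis .
qed

text \<open>The constants reached in turn for \<open>DD\<close>, for \<open>P_edge\<close>, for
  \<open>P_cell\<close> and for the stabilization, each built from the preceding ones. In
  \<open>C3\<close> the first term counts edges and the second vertices, of which there are at most
  2 N.\<close>

definition C1 :: real where "C1 = 16 * C\<^sup>2 + 2 * real N * C"
definition KB :: real where "KB = 1 + sqrt B"
definition C2 :: real where "C2 = 16 * C * C1 + 2 * real N * (16 * C\<^sup>2 + 8 * C) * KB"
definition C3 :: real where
  "C3 = real N * (2 * (16 * C * C2)\<^sup>2 + 2 * KB\<^sup>2 + 2 * (8 * C * C2)\<^sup>2 + 2) + 2 * real N * (4 * C * C2)\<^sup>2"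

lemma C_nonneg: "0 \<le> C1" "0 \<le> KB" "1 \<le> KB" "0 \<le> C2" "0 \<le> C3"
proof -
  show 1: "0 \<le> C1" "0 \<le> KB" "1 \<le> KB" using CB_pos by (auto simp: C1_def KB_def)
  show 2: "0 \<le> C2" unfolding C2_def using 1 CB_pos by (intro add_nonneg_nonneg mult_nonneg_nonneg) auto
  show "0 \<le> C3" unfolding C3_def by (intro add_nonneg_nonneg mult_nonneg_nonneg) auto
qed

text \<open>The defining identity is tested with \<open>DD\<close> itself. Inverse estimates bound
  the Hessian and the boundary values of this test function by its own L2 norm, one factor of which
  cancels.\<close>

lemma DD_bound:
  assumes T: "T \<in> elems M" and \<tau>: "\<tau> \<in> Sigma_space l M" and K: "size_le \<tau> T K"
  shows "L2n T (DD l M T \<tau>) \<le> C1 / (diameter T)\<^sup>2 * K"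
proof -
  let ?h = "diameter T" let ?q = "DD l M T \<tau>"
  note h = shapeD(1)[OF T]
  have q: "?q \<in> Poly (l - 1)" by (rule DD_props(1)[OF \<tau> T])
  have q2: "?q \<in> Poly (l + 2)" using Poly_mono[OF q] by simp
  define m where "m = L2n T ?q"
  have m0: "0 \<le> m" by (simp add: m_def L2n_nonneg)
  have K': "0 \<le> K" "L2n T (cell_H \<tau> T) \<le> K" "vert \<tau> = (\<lambda>V. 0)"
    "\<And>E. E \<in> elem_edges M T \<Longrightarrow> sqrt ?h * eL2 E (edge_nn \<tau> E) \<le> K"
    "\<And>E. E \<in> elem_edges M T \<Longrightarrow> ?h * sqrt ?h * eL2 E (edge_D \<tau> E) \<le> K"
    using K unfolding size_le_def by blast+
  have hc: "continuous_on UNIV (hess ?q)" by (rule Poly_sym_continuous[OF hess_Poly_sym[OF q2]])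
  have "m * m = (LINT x:T|lebesgue. ?q x * ?q x)"
    using L2n_sq[of T ?q] by (simp add: m_def power2_eq_square)
  also have "\<dots> = (LINT x:T|lebesgue. cell_H \<tau> T x \<bullet> hess ?q x) - bdry M T \<tau> (edge_nn \<tau>) ?q"
    by (rule DD_props(2)[OF \<tau> T q])
  also have "\<dots> \<le> 16 * C\<^sup>2 / ?h\<^sup>2 * m * K + real N * (2 * (C / ?h\<^sup>2 * m) * K)"
  proof -
    have "\<bar>LINT x:T|lebesgue. cell_H \<tau> T x \<bullet> hess ?q x\<bar> \<le> L2n T (cell_H \<tau> T) * L2n T (hess ?q)"
      by (rule cell_CS[OF T SigmaD(5)[OF \<tau> T] hc])
    also have "\<dots> \<le> K * (2 * ?h * (8 * C\<^sup>2 / ?h^3 * m))"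
      using second_deriv_bound[OF T q2] K' h m0 L2n_nonneg unfolding m_def
      by (intro mult_mono L2n_le_sup[OF T hc]) auto
    also have "\<dots> = 16 * C\<^sup>2 / ?h\<^sup>2 * m * K" using h by (simp add: power2_eq_square power3_eq_cube)
    finally have 1: "\<bar>LINT x:T|lebesgue. cell_H \<tau> T x \<bullet> hess ?q x\<bar> \<le> 16 * C\<^sup>2 / ?h\<^sup>2 * m * K" .
    have "\<bar>bdry M T \<tau> (edge_nn \<tau>) ?q\<bar> \<le> real N * (2 * (C / ?h\<^sup>2 * m) * K)"
    proof (rule bdry_bound[OF T \<tau> K'(3) q _ K'(4,5) _ _ _ K'(1)])
      show "\<bar>?q x\<bar> \<le> C / ?h\<^sup>2 * m * ?h" if "x \<in> closure T" for x
        using Poly_pointwise(1)[OF T q2 that, of x] h by (simp add: m_def power2_eq_square)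
      show "\<bar>dir_deriv d ?q x\<bar> \<le> C / ?h\<^sup>2 * m" if "x \<in> closure T" "norm d = 1" for x d
        using Poly_pointwise(2)[OF T q2 that(1), of x d] h that(2) by (simp add: m_def)
    qed (use SigmaD(7)[OF \<tau>] elem_edge CB_pos m0 in auto)
    with 1 show ?thesis by linarith
  qed
  also have "\<dots> = (C1 / ?h\<^sup>2 * K) * m" by (simp add: C1_def add_divide_distrib algebra_simps)
  finally have mm: "m * m \<le> (C1 / ?h\<^sup>2 * K) * m" .
  have "m \<le> C1 / ?h\<^sup>2 * K"
    by (rule square_le_cancel[OF mm m0]) (use K'(1) C_nonneg(1) in simp)
  then show ?thesis by (simp add: m_def)
qed

text \<open>Vanishing vertex values make the reconstruction zero at both ends of the edge, so the
  bubble estimate applies with \<open>edge_nn\<close> as the source of the moments.\<close>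

lemma P_edge_bound:
  assumes T: "T \<in> elems M" and \<tau>: "\<tau> \<in> Sigma_space l M" and K: "size_le \<tau> T K" and E: "E \<in> elem_edges M T"
  shows "sqrt (diameter T) * eL2 E (P_edge l M E \<tau>) \<le> KB * K"
proof -
  note e = elem_edge[OF E]
  note p = P_edge_props[OF \<tau> e(2)]
  have K': "0 \<le> K" "vert \<tau> = (\<lambda>V. 0)" "sqrt (diameter T) * eL2 E (edge_nn \<tau> E) \<le> K" using K E unfolding size_le_def by blast+
  have "edge_integral E (\<lambda>x. (P_edge l M E \<tau> x)\<^sup>2) \<le> B * edge_integral E (\<lambda>x. (edge_nn \<tau> E x)\<^sup>2)"
    using bub e(1) p SigmaD(3)[OF \<tau> e(2)] K'(2) unfolding bubble_const_def by simp
  then have "eL2 E (P_edge l M E \<tau>) \<le> sqrt B * eL2 E (edge_nn \<tau> E)"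
    unfolding eL2_def real_sqrt_mult[symmetric] by simp
  then have "sqrt (diameter T) * eL2 E (P_edge l M E \<tau>) \<le> sqrt (diameter T) * (sqrt B * eL2 E (edge_nn \<tau> E))"
    using shapeD(1)[OF T] by (intro mult_left_mono) auto
  also have "\<dots> = sqrt B * (sqrt (diameter T) * eL2 E (edge_nn \<tau> E))" by simp
  also have "\<dots> \<le> sqrt B * K" using K'(3) CB_pos by (intro mult_left_mono) auto
  also have "\<dots> \<le> KB * K" using K'(1) by (simp add: KB_def algebra_simps)
  finally show ?thesis .
qed

text \<open>The reconstruction is decomposed as hess q + \<upsilon> and tested with this pair.
  Bounding the right-hand side requires a bound for q in terms of the sum alone, not of hess q; this
  is what \<open>radial_taylor\<close> provides once q is normalized at the centre of T. The term
  with \<upsilon> disappears because \<open>cell_Hc\<close> is zero, and one factor of the norm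
  cancels as for \<open>DD\<close>.\<close>

lemma P_cell_bound:
  assumes T: "T \<in> elems M" and \<tau>: "\<tau> \<in> Sigma_space l M" and K: "size_le \<tau> T K"
  shows "L2n T (P_cell l M T \<tau>) \<le> C2 * K"
proof -
  let ?h = "diameter T" let ?X = "P_cell l M T \<tau>" let ?c = "center M T"
  note h = shapeD(1)[OF T]
  have X: "?X \<in> Poly_sym l" by (rule P_cell_props(1)[OF \<tau> T])
  obtain q0 \<upsilon> where q0: "q0 \<in> Poly (l + 2)" "\<upsilon> \<in> Hess_compl l ?c" "\<And>x. ?X x = hess q0 x + \<upsilon> x"
    using hess_decomposition_exists[OF X] by blast
  obtain q r where qr: "q \<in> Poly (l + 2)" "q ?c = 0" "\<And>y. dir_deriv y q ?c = 0" "\<And>x. hess q0 x = hess q x"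
    by (rule Poly_affine_split[OF q0(1), of ?c]) (use l2 in \<open>auto intro: that\<close>)
  have Xq: "?X x = hess q x + \<upsilon> x" for x using q0(3) qr(4) by simp
  define n where "n = L2n T ?X"
  have n0: "0 \<le> n" by (simp add: n_def L2n_nonneg)
  have K': "0 \<le> K" "cell_Hc \<tau> T = (\<lambda>x. 0)" "vert \<tau> = (\<lambda>V. 0)"
    "\<And>E. E \<in> elem_edges M T \<Longrightarrow> ?h * sqrt ?h * eL2 E (edge_D \<tau> E) \<le> K"
    using K unfolding size_le_def by blast+
  have cT: "?c \<in> closure T" using meshD(10)[OF mesh T] closure_subset[of T] by blast
  have qsup: "\<bar>q x\<bar> \<le> 8 * C * ?h * n" if "x \<in> closure T" for x
  proof -
    have "\<bar>q x\<bar> \<le> 2 * ?h\<^sup>2 * (4 * C / ?h * n)"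
    proof (rule radial_taylor[OF qr(1-3) q0(2)])
      show "norm (hess q y + \<upsilon> y) \<le> 4 * C / ?h * n" if "y \<in> cball ?c ?h" for y
        using tensor_pointwise(2)[OF T X cT, of y] that Xq[of y] by (simp add: n_def)
      show "x \<in> cball ?c ?h" using elem_in_cball[OF T cT] \<open>x \<in> closure T\<close> by blast
    qed (use CB_pos h n0 in auto)
    also have "\<dots> = 8 * C * ?h * n" using h by (simp add: power2_eq_square)
    finally show ?thesis .
  qed
  have qc: "continuous_on UNIV q" by (rule Poly_continuous_on[OF qr(1)])
  have qL: "L2n T q \<le> 2 * ?h * (8 * C * ?h * n)"
    using qsup h CB_pos n0 by (intro L2n_le_sup[OF T qc]) auto
  \<comment> \<open>The sum of what the gradient of q requires, with 16, and what its value divided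
    by the diameter requires, with 8.\<close>
  define a where "a = (16 * C\<^sup>2 + 8 * C) * n"
  have a0: "0 \<le> a" using CB_pos n0 by (simp add: a_def)
  have "n * n = (LINT x:T|lebesgue. ?X x \<bullet> (hess q x + \<upsilon> x))"
    using L2n_sq[of T ?X] by (simp add: n_def power2_eq_square Xq[symmetric] power2_norm_eq_inner[unfolded power2_eq_square])
  also have "\<dots> = (LINT x:T|lebesgue. DD l M T \<tau> x * q x) + bdry M T \<tau> (\<lambda>E. P_edge l M E \<tau>) q"
    unfolding P_cell_props(2)[OF \<tau> T qr(1) q0(2)] P_cell_rhs_def K'(2) by simp
  also have "\<dots> \<le> 16 * C * C1 * K * n + real N * (2 * a * (KB * K))"
  proof -
    have "\<bar>LINT x:T|lebesgue. DD l M T \<tau> x * q x\<bar> \<le> L2n T (DD l M T \<tau>) * L2n T q"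
      using cell_CS[OF T Poly_continuous_on[OF DD_props(1)[OF \<tau> T]] qc] by simp
    also have "\<dots> \<le> (C1 / ?h\<^sup>2 * K) * (2 * ?h * (8 * C * ?h * n))"
      using DD_bound[OF T \<tau> K] qL L2n_nonneg K'(1) C_nonneg(1) by (intro mult_mono) auto
    also have "\<dots> = 16 * C * C1 * K * n" using h by (simp add: power2_eq_square)
    finally have 1: "\<bar>LINT x:T|lebesgue. DD l M T \<tau> x * q x\<bar> \<le> 16 * C * C1 * K * n" .
    have "\<bar>bdry M T \<tau> (\<lambda>E. P_edge l M E \<tau>) q\<bar> \<le> real N * (2 * a * (KB * K))"
    proof (rule bdry_bound[OF T \<tau> K'(3) qr(1) _ P_edge_bound[OF T \<tau> K] _ a0])
      show "?h * sqrt ?h * eL2 E (edge_D \<tau> E) \<le> KB * K" if "E \<in> elem_edges M T" for E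
        using K'(4)[OF that] mult_right_mono[OF C_nonneg(3) K'(1)] by simp
      show "\<bar>dir_deriv d q x\<bar> \<le> a" if "x \<in> closure T" "norm d = 1" for x d
      proof -
        have "\<bar>dir_deriv d q x\<bar> \<le> C / ?h\<^sup>2 * L2n T q" using Poly_pointwise(2)[OF T qr(1) that(1), of x d] h that(2) by simp
        also have "\<dots> \<le> C / ?h\<^sup>2 * (2 * ?h * (8 * C * ?h * n))" using qL CB_pos by (intro mult_left_mono) auto
        also have "\<dots> = 16 * C\<^sup>2 * n" using h by (simp add: power2_eq_square)
        also have "\<dots> \<le> a" using CB_pos n0 by (simp add: a_def distrib_right)
        finally show ?thesis .
      qed
      show "\<bar>q x\<bar> \<le> a * ?h" if "x \<in> closure T" for x
      proof -
        have "8 * C * n \<le> a" using CB_pos n0 by (simp add: a_def distrib_right)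
        then have "(8 * C * n) * ?h \<le> a * ?h" using h by (intro mult_right_mono) auto
        then show ?thesis using qsup[OF that] by (simp add: mult_ac)
      qed
    qed (use P_edge_props(4)[OF \<tau>] elem_edge C_nonneg K' in auto)
    with 1 show ?thesis by linarith
  qed
  also have "\<dots> = (C2 * K) * n" by (simp add: C2_def a_def algebra_simps)
  finally have nn: "n * n \<le> (C2 * K) * n" .
  have "n \<le> C2 * K"
    by (rule square_le_cancel[OF nn n0]) (use K'(1) C_nonneg(4) in simp)
  then show ?thesis by (simp add: n_def)
qed

lemma finite_card_elem_verts:
  assumes "T \<in> elems M"
  shows "finite (elem_verts M T)" "card (elem_verts M T) \<le> 2 * N"
proof -
  have e: "finite (edge_verts E) \<and> card (edge_verts E) \<le> 2" if E: "E \<in> elem_edges M T" for E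
  proof -
    obtain a b where "a \<noteq> b" "E = open_segment a b" using elem_edge(1)[OF E] by (rule is_edgeE)
    then show ?thesis by (simp add: edge_verts_segment card_insert_if)
  qed
  note f = finite_elem_edges[OF mesh, of T]
  show "finite (elem_verts M T)" unfolding elem_verts_def using f e by blast
  have "card (elem_verts M T) \<le> (\<Sum>E\<in>elem_edges M T. card (edge_verts E))"
    unfolding elem_verts_def by (rule card_UN_le[OF f])
  also have "\<dots> \<le> (\<Sum>E\<in>elem_edges M T. 2)" using e by (intro sum_mono) auto
  also have "\<dots> \<le> 2 * N" using shapeD(3)[OF assms] by simp
  finally show "card (elem_verts M T) \<le> 2 * N" .
qed

text \<open>Treats both kinds of edge terms of the stabilization: k = 1 for the normal-normal
  residual with weight h, and k = 2 for the residual with one derivative and the cube of h. In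
  either case the weight, the squared pointwise bound and the length of the edge multiply to at most
  the square of A.\<close>

lemma scaled_edge_bound:
  assumes T: "T \<in> elems M" and E: "E \<in> elem_edges M T"
    and c: "continuous_on (closure E) f" "continuous_on (closure E) g"
    and f: "\<And>x. x \<in> closure E \<Longrightarrow> \<bar>f x\<bar> \<le> A / diameter T ^ k" "0 \<le> A"
    and g: "diameter T ^ (k - 1) * sqrt (diameter T) * eL2 E g \<le> K" and k: "1 \<le> k"
  shows "edge_integral E (\<lambda>x. diameter T ^ (2 * k - 1) * (f x - g x)\<^sup>2) \<le> 2 * A\<^sup>2 + 2 * K\<^sup>2"
proof -
  let ?h = "diameter T"
  note h = shapeD(1)[OF T]
  note e = elem_edge(1)[OF E]
  have "edge_integral E (\<lambda>x. ?h ^ (2 * k - 1) * (f x - g x)\<^sup>2) = ?h ^ (2 * k - 1) * edge_integral E (\<lambda>x. (f x - g x)\<^sup>2)"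
    by (rule edge_integral_cmult[OF e])
  also have "\<dots> \<le> ?h ^ (2 * k - 1) * (2 * ((A / ?h ^ k)\<^sup>2 * ?h) + 2 * (eL2 E g)\<^sup>2)"
  proof (rule mult_left_mono)
    have "edge_integral E (\<lambda>x. (f x - g x)\<^sup>2) \<le> edge_integral E (\<lambda>x. 2 * (f x)\<^sup>2 + 2 * (g x)\<^sup>2)"
      using c sq_sum_le[of "f x" "- g x" for x] by (intro edge_integral_mono[OF e] continuous_intros) auto
    also have "\<dots> = 2 * edge_integral E (\<lambda>x. (f x)\<^sup>2) + 2 * edge_integral E (\<lambda>x. (g x)\<^sup>2)"
      using edge_integral_add[OF e, of "\<lambda>x. 2 * (f x)\<^sup>2" "\<lambda>x. 2 * (g x)\<^sup>2"] c
      by (simp add: edge_integral_cmult[OF e] continuous_intros)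
    also have "edge_integral E (\<lambda>x. (f x)\<^sup>2) \<le> (A / ?h ^ k)\<^sup>2 * edge_len E"
      using f h by (intro edge_integral_bound(1)[OF e c(1,2)]) auto
    also have "(A / ?h ^ k)\<^sup>2 * edge_len E \<le> (A / ?h ^ k)\<^sup>2 * ?h"
      using edge_len_le[OF T E] by (intro mult_left_mono) auto
    finally show "edge_integral E (\<lambda>x. (f x - g x)\<^sup>2) \<le> 2 * ((A / ?h ^ k)\<^sup>2 * ?h) + 2 * (eL2 E g)\<^sup>2"
      by (simp add: eL2_sq[OF e])
  qed (use h in simp)
  also have "\<dots> = 2 * A\<^sup>2 + 2 * (?h ^ (k - 1) * sqrt ?h * eL2 E g)\<^sup>2"
  proof -
    obtain j where j: "k = Suc j" using k by (cases k) auto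
    have "?h ^ (2 * j + 1) * ((A / ?h ^ Suc j)\<^sup>2 * ?h) = A\<^sup>2"
    proof -
      have "?h ^ (2 * j + 1) * ?h = (?h ^ Suc j)\<^sup>2" by (simp add: power_even_eq power2_eq_square)
      moreover have "X * (Y * ?h) = (X * ?h) * Y" for X Y :: real by simp
      ultimately have "?h ^ (2 * j + 1) * ((A / ?h ^ Suc j)\<^sup>2 * ?h) = (?h ^ Suc j)\<^sup>2 * (A / ?h ^ Suc j)\<^sup>2"
        by simp
      then show ?thesis using h by (simp add: power_divide)
    qed
    moreover have "?h ^ (2 * j + 1) * (eL2 E g)\<^sup>2 = (?h ^ j * sqrt ?h * eL2 E g)\<^sup>2"
      using h by (simp add: power_mult_distrib power_mult[symmetric] mult.commute)
    moreover have "w * (2 * a + 2 * b) = 2 * (w * a) + 2 * (w * b)" for w a b :: real by (simp add: algebra_simps)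
    moreover have "2 * Suc j - 1 = 2 * j + 1" by simp
    ultimately show ?thesis unfolding j diff_Suc_1 by (simp only:)
  qed
  also have "\<dots> \<le> 2 * A\<^sup>2 + 2 * K\<^sup>2"
    using g h eL2_nonneg[OF e] by (intro add_left_mono mult_left_mono power_mono) auto
  finally show ?thesis .
qed

lemma stab_bound:
  assumes T: "T \<in> elems M" and \<tau>: "\<tau> \<in> Sigma_space l M" and K: "size_le \<tau> T K"
  shows "stab l M T \<tau> \<tau> \<le> C3 * K\<^sup>2"
proof -
  let ?h = "diameter T" let ?X = "P_cell l M T \<tau>"
  note h = shapeD(1)[OF T]
  have X: "?X \<in> Poly_sym l" by (rule P_cell_props(1)[OF \<tau> T])
  have K': "0 \<le> K" "vert \<tau> = (\<lambda>V. 0)" "\<And>E. E \<in> elem_edges M T \<Longrightarrow> ?h * sqrt ?h * eL2 E (edge_D \<tau> E) \<le> K"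
    using K unfolding size_le_def by blast+
  define n where "n = L2n T ?X"
  have n0: "0 \<le> n" and nK: "n \<le> C2 * K" using P_cell_bound[OF T \<tau> K] by (simp_all add: n_def L2n_nonneg)
  have edge: "edge_integral E (\<lambda>x. ?h * delta1 l M T E \<tau> x * delta1 l M T E \<tau> x + ?h ^ 3 * delta2 l M T E \<tau> x * delta2 l M T E \<tau> x)
    \<le> (2 * (16 * C * C2)\<^sup>2 + 2 * KB\<^sup>2 + 2 * (8 * C * C2)\<^sup>2 + 2) * K\<^sup>2" if E: "E \<in> elem_edges M T" for E
  proof -
    note e = elem_edge[OF E]
    let ?n = "normal M E" and ?t = "tangent M E"
    note u = norm_tangent_normal[OF e(2)]
    have cl: "x \<in> closure T" if "x \<in> closure E" for x using closure_elem_edge[OF E] that by blast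
    let ?f1 = "\<lambda>x. (?X x *v ?n) \<bullet> ?n" let ?g = "\<lambda>x. (?X x *v ?n) \<bullet> ?t"
    let ?f2 = "\<lambda>x. dir_deriv ?t ?g x + row_div ?X x \<bullet> ?n"
    have f1P: "?f1 \<in> Poly l" "?g \<in> Poly l" by (rule tensor_edge_Poly(1)[OF X])+
    have f2P: "?f2 \<in> Poly l"
      using Poly_mono[OF dir_deriv_Poly[OF f1P(2)], of l] tensor_edge_Poly(2)[OF X] by (intro Poly_add) auto
    have b1: "\<bar>?f1 x\<bar> \<le> (16 * C * n) / ?h ^ 1" if "x \<in> closure E" for x
    proof -
      have "\<bar>?f1 x\<bar> \<le> 4 * norm (?X x)" using quadratic_form_bound[of ?n "?X x"] u by (simp add: inner_commute)
      also have "\<dots> \<le> 4 * (4 * C / ?h * n)" using tensor_pointwise(2)[OF T X cl[OF that], of x] h by (simp add: n_def)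
      finally show ?thesis by simp
    qed
    have comp: "\<bar>?n $ i\<bar> \<le> 1" "\<bar>?t $ i\<bar> \<le> 1" for i
      using component_le_norm_cart[of ?n i] component_le_norm_cart[of ?t i] u by auto
    have dX: "\<bar>dir_deriv d (\<lambda>x. ?X x $ i $ j) x\<bar> \<le> C / ?h\<^sup>2 * n" if "x \<in> closure E" "norm d = 1" for d x i j
      using tensor_pointwise(1)[OF T X cl[OF that(1)], of x d i j] that(2) h by (simp add: n_def)
    have prod1: "\<bar>a * b\<bar> \<le> c" if "\<bar>a\<bar> \<le> 1" "\<bar>b\<bar> \<le> c" for a b c :: real
      unfolding abs_mult using mult_mono[OF that] by simp
    have sum4: "\<bar>a + b + c + d\<bar> \<le> 4 * e" if "\<bar>a\<bar> \<le> e" "\<bar>b\<bar> \<le> e" "\<bar>c\<bar> \<le> e" "\<bar>d\<bar> \<le> e" for a b c d e :: real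
      using that by linarith
    \<comment> \<open>The tangential derivative and the row divergence each contribute four products
      of a derivative of an entry with components of unit vectors, hence the factor 8.\<close>
    have b2: "\<bar>?f2 x\<bar> \<le> (8 * C * n) / ?h ^ 2" if x: "x \<in> closure E" for x
    proof -
      let ?c = "C / ?h\<^sup>2 * n"
      note P = Poly_symD(1)[OF X]
      have "dir_deriv ?t ?g x = ?n$1 * (?t$1 * dir_deriv ?t (\<lambda>x. ?X x $ 1 $ 1) x) + ?n$2 * (?t$1 * dir_deriv ?t (\<lambda>x. ?X x $ 1 $ 2) x)
        + ?n$1 * (?t$2 * dir_deriv ?t (\<lambda>x. ?X x $ 2 $ 1) x) + ?n$2 * (?t$2 * dir_deriv ?t (\<lambda>x. ?X x $ 2 $ 2) x)"
        unfolding tensor_edge_Poly(3)[OF X]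
        by (rule dir_deriv_sum4[OF P P P P])
      moreover have "\<bar>?n$i * (?t$j * dir_deriv ?t (\<lambda>x. ?X x $ j $ i) x)\<bar> \<le> ?c" for i j
        by (intro prod1 comp dX x u)
      ultimately have 1: "\<bar>dir_deriv ?t ?g x\<bar> \<le> 4 * ?c"
        by (simp only: sum4)
      have "row_div ?X x \<bullet> ?n = ?n$1 * dir_deriv (axis 1 1) (\<lambda>x. ?X x $ 1 $ 1) x + ?n$1 * dir_deriv (axis 2 1) (\<lambda>x. ?X x $ 1 $ 2) x
        + ?n$2 * dir_deriv (axis 1 1) (\<lambda>x. ?X x $ 2 $ 1) x + ?n$2 * dir_deriv (axis 2 1) (\<lambda>x. ?X x $ 2 $ 2) x"
        by (simp add: row_div_def inner_vec_def sum_2 algebra_simps)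
      moreover have "\<bar>?n$i * dir_deriv (axis j 1) (\<lambda>x. ?X x $ i $ j) x\<bar> \<le> ?c" for i j
        by (intro prod1 comp dX x norm_axis_1)
      ultimately have 2: "\<bar>row_div ?X x \<bullet> ?n\<bar> \<le> 4 * ?c"
        by (simp only: sum4)
      have "\<bar>?f2 x\<bar> \<le> 4 * ?c + 4 * ?c" using 1 2 abs_triangle_ineq[of "dir_deriv ?t ?g x" "row_div ?X x \<bullet> ?n"] by linarith
      then show ?thesis by simp
    qed
    have c: "continuous_on (closure E) ?f1" "continuous_on (closure E) ?f2" "continuous_on (closure E) (P_edge l M E \<tau>)"
      "continuous_on (closure E) (edge_D \<tau> E)"
      using Poly_continuous_on f1P f2P P_edge_props(4)[OF \<tau> e(2)] SigmaD(8)[OF \<tau> e(2)] by blast+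
    have d1: "edge_integral E (\<lambda>x. ?h ^ (2 * 1 - 1) * (?f1 x - P_edge l M E \<tau> x)\<^sup>2) \<le> 2 * (16 * C * n)\<^sup>2 + 2 * (KB * K)\<^sup>2"
      using P_edge_bound[OF T \<tau> K E] CB_pos n0 by (intro scaled_edge_bound[OF T E c(1,3) b1]) auto
    have d2: "edge_integral E (\<lambda>x. ?h ^ (2 * 2 - 1) * (?f2 x - edge_D \<tau> E x)\<^sup>2) \<le> 2 * (8 * C * n)\<^sup>2 + 2 * K\<^sup>2"
      using K'(3)[OF E] CB_pos n0 by (intro scaled_edge_bound[OF T E c(2,4) b2]) auto
    have "edge_integral E (\<lambda>x. ?h * delta1 l M T E \<tau> x * delta1 l M T E \<tau> x + ?h ^ 3 * delta2 l M T E \<tau> x * delta2 l M T E \<tau> x) =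
      edge_integral E (\<lambda>x. ?h ^ (2 * 1 - 1) * (?f1 x - P_edge l M E \<tau> x)\<^sup>2 + ?h ^ (2 * 2 - 1) * (?f2 x - edge_D \<tau> E x)\<^sup>2)"
      by (simp add: delta1_def delta2_def power2_eq_square mult.assoc)
    also have "\<dots> = edge_integral E (\<lambda>x. ?h ^ (2 * 1 - 1) * (?f1 x - P_edge l M E \<tau> x)\<^sup>2) + edge_integral E (\<lambda>x. ?h ^ (2 * 2 - 1) * (?f2 x - edge_D \<tau> E x)\<^sup>2)"
      by (intro edge_integral_add[OF e(1)] continuous_intros c)
    also have "\<dots> \<le> (2 * (16 * C * n)\<^sup>2 + 2 * (KB * K)\<^sup>2) + (2 * (8 * C * n)\<^sup>2 + 2 * K\<^sup>2)" using d1 d2 by simp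
    also have "\<dots> \<le> (2 * (16 * C * (C2 * K))\<^sup>2 + 2 * (KB * K)\<^sup>2) + (2 * (8 * C * (C2 * K))\<^sup>2 + 2 * K\<^sup>2)"
      using nK n0 CB_pos C_nonneg K'(1) by (intro add_mono mult_left_mono power_mono) simp_all
    also have "\<dots> = (2 * (16 * C * C2)\<^sup>2 + 2 * KB\<^sup>2 + 2 * (8 * C * C2)\<^sup>2 + 2) * K\<^sup>2"
      by (simp add: power_mult_distrib algebra_simps)
    finally show ?thesis .
  qed
  have vert: "?h\<^sup>2 * (deltaV l M T \<tau> V \<bullet> deltaV l M T \<tau> V) \<le> (4 * C * C2)\<^sup>2 * K\<^sup>2" if V: "V \<in> elem_verts M T" for V
  proof -
    obtain E where E: "E \<in> elem_edges M T" "V \<in> edge_verts E" using V by (auto simp: elem_verts_def)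
    obtain a b where ab: "a \<noteq> b" "E = open_segment a b" using elem_edge(1)[OF E(1)] by (rule is_edgeE)
    have "V \<in> closure E" using E(2) ab by (auto simp: edge_verts_segment)
    then have VT: "V \<in> closure T" using closure_elem_edge[OF E(1)] by blast
    have "norm (?X V) \<le> 4 * C / ?h * n" using tensor_pointwise(2)[OF T X VT, of V] h by (simp add: n_def)
    then have "(?h * norm (?X V))\<^sup>2 \<le> (4 * C * n)\<^sup>2" using h by (intro power_mono) (auto simp: field_simps)
    also have "\<dots> \<le> (4 * C * (C2 * K))\<^sup>2" using nK n0 CB_pos by (intro power_mono mult_left_mono) auto
    finally show ?thesis by (simp add: deltaV_def K'(2) power_mult_distrib power2_norm_eq_inner)
  qed
  let ?e = "(2 * (16 * C * C2)\<^sup>2 + 2 * KB\<^sup>2 + 2 * (8 * C * C2)\<^sup>2 + 2) * K\<^sup>2" and ?v = "(4 * C * C2)\<^sup>2 * K\<^sup>2"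
  have e0: "0 \<le> ?e" by (intro mult_nonneg_nonneg add_nonneg_nonneg) auto
  have "stab l M T \<tau> \<tau> \<le> (\<Sum>E\<in>elem_edges M T. ?e) + (\<Sum>V\<in>elem_verts M T. ?v)"
    unfolding stab_def by (intro add_mono sum_mono edge vert)
  also have "\<dots> = real (card (elem_edges M T)) * ?e + real (card (elem_verts M T)) * ?v" by simp
  also have "\<dots> \<le> real N * ?e + real (2 * N) * ?v"
    using shapeD(3)[OF T] finite_card_elem_verts(2)[OF T] e0 by (intro add_mono mult_right_mono) auto
  also have "\<dots> = C3 * K\<^sup>2" by (simp add: C3_def algebra_simps)
  finally show ?thesis .
qed

end

section \<open>The discrete Poincare inequality\<close>

definition tangential_const :: "int \<Rightarrow> real \<Rightarrow> bool" where
  "tangential_const m C \<longleftrightarrow> C > 0 \<and> (\<forall>a b p. a \<noteq> b \<and> p \<in> Poly m \<longrightarrow>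
    edge_integral (open_segment a b) (\<lambda>x. (dir_deriv ((b - a) /\<^sub>R norm (b - a)) p x)\<^sup>2)
     \<le> C / (dist a b)\<^sup>2 * edge_integral (open_segment a b) (\<lambda>x. (p x)\<^sup>2))"

locale plate_poincare = plate_estimate +
  fixes R Ct :: real
  assumes bnd: "closure \<Omega> \<subseteq> cball 0 R" and Rpos: "0 < R" and tang: "tangential_const (l - 1) Ct"
begin

definition adj :: "region \<Rightarrow> region set" where
  "adj E = {T \<in> elems M. E \<subseteq> frontier T}"

lemma adjD: "T \<in> adj E \<Longrightarrow> T \<in> elems M" "E \<in> edges M \<Longrightarrow> T \<in> adj E \<Longrightarrow> E \<in> elem_edges M T"
  by (auto simp: adj_def elem_edges_def)

lemma sum_elem_edges_swap:
  fixes f :: "region \<Rightarrow> region \<Rightarrow> real"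
  shows "(\<Sum>T\<in>elems M. \<Sum>E\<in>elem_edges M T. f T E) = (\<Sum>E\<in>edges M. \<Sum>T\<in>adj E. f T E)"
  unfolding elem_edges_def adj_def
  by (rule sum.swap_restrict[OF meshD(1,2)[OF mesh]])

text \<open>Equal signs would give both elements the same outward normal; the points just behind the
  midpoint of E would then belong to both, although distinct elements are disjoint.\<close>

lemma sign_adj:
  assumes E: "E \<in> edges M" and T: "T1 \<in> adj E" "T2 \<in> adj E" "T1 \<noteq> T2"
  shows "sign_TE M T1 E = - sign_TE M T2 E"
proof (rule ccontr)
  assume ne: "\<not> ?thesis"
  note t = adjD(1)[OF T(1)] adjD(1)[OF T(2)]
  note e = adjD(2)[OF E T(1)] adjD(2)[OF E T(2)]
  have eq: "sign_TE M T1 E = sign_TE M T2 E"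
    using ne mesh_edgesD(4)[OF mesh t(1) e(1)] mesh_edgesD(4)[OF mesh t(2) e(2)] by auto
  define n where "n = sign_TE M T1 E *\<^sub>R normal M E"
  have p: "points_out n E T1" "points_out n E T2"
    using mesh_edgesD(5)[OF mesh t(1) e(1)] mesh_edgesD(5)[OF mesh t(2) e(2)] eq by (simp_all add: n_def)
  obtain a b where ab: "a \<noteq> b" "E = open_segment a b" using elem_edge(1)[OF e(1)] by (rule is_edgeE)
  then have "midpoint a b \<in> E" by simp
  then obtain d1 d2 where d: "0 < d1" "0 < d2"
    "\<forall>s. 0 < s \<and> s < d1 \<longrightarrow> midpoint a b + s *\<^sub>R n \<notin> T1 \<and> midpoint a b - s *\<^sub>R n \<in> T1"
    "\<forall>s. 0 < s \<and> s < d2 \<longrightarrow> midpoint a b + s *\<^sub>R n \<notin> T2 \<and> midpoint a b - s *\<^sub>R n \<in> T2"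
    using p[unfolded points_out_def] by blast
  define s where "s = min d1 d2 / 2"
  have "0 < s" "s < d1" "s < d2" using d(1,2) by (auto simp: s_def min_def)
  then have "midpoint a b - s *\<^sub>R n \<in> T1 \<inter> T2" using d(3,4) by simp
  then show False using meshD(6)[OF mesh t] T(3) by blast
qed

lemma sign_sq:
  assumes "E \<in> edges M" "T \<in> adj E"
  shows "sign_TE M T E = 1 \<or> sign_TE M T E = - 1"
  using mesh_edgesD(4)[OF mesh adjD(1)[OF assms(2)] adjD(2)[OF assms]] by auto

text \<open>Three elements on one edge would need three pairwise opposite signs.\<close>

lemma adj_cases:
  assumes E: "E \<in> edges M"
  obtains "adj E = {}" | T where "adj E = {T}"
  | T1 T2 where "T1 \<noteq> T2" "adj E = {T1, T2}" "sign_TE M T1 E = - sign_TE M T2 E"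
proof -
  have three: "T3 \<in> {T1, T2}" if "T1 \<in> adj E" "T2 \<in> adj E" "T3 \<in> adj E" "T1 \<noteq> T2" for T1 T2 T3
    using sign_adj[OF E that(1,2)] sign_adj[OF E that(1,3)] sign_adj[OF E that(2,3)] sign_sq[OF E that(1)] that(4) by force
  consider "adj E = {}" | T where "adj E = {T}" | T1 T2 where "T1 \<in> adj E" "T2 \<in> adj E" "T1 \<noteq> T2" by blast
  then show ?thesis
  proof cases
    case 3
    then have "adj E = {T1, T2}" using three by blast
    then show ?thesis using 3 sign_adj[OF E 3] that(3) by blast
  qed (use that in blast)+
qed

text \<open>For two elements with opposite signs this is the factorization of a difference of
  squares into the jump and a sum of traces. For a single element the jump is the trace up to
  sign.\<close>

lemma adj_sums:
  fixes w :: "region \<Rightarrow> real"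
  assumes E: "E \<in> edges M"
  shows "\<bar>\<Sum>T\<in>adj E. sign_TE M T E * (w T)\<^sup>2\<bar> \<le> \<bar>\<Sum>T\<in>adj E. sign_TE M T E * w T\<bar> * (\<Sum>T\<in>adj E. \<bar>w T\<bar>)" (is ?A)
    "(\<Sum>T\<in>adj E. \<bar>w T\<bar>)\<^sup>2 \<le> 2 * (\<Sum>T\<in>adj E. (w T)\<^sup>2)" (is ?B)
    "card (adj E) \<le> 2"
proof -
  have two: "\<bar>x\<^sup>2 - y\<^sup>2\<bar> \<le> \<bar>x - y\<bar> * (\<bar>x\<bar> + \<bar>y\<bar>)" for x y :: real
  proof -
    have "\<bar>x - y\<bar> * \<bar>x + y\<bar> \<le> \<bar>x - y\<bar> * (\<bar>x\<bar> + \<bar>y\<bar>)" by (intro mult_left_mono abs_triangle_ineq) simp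
    then show ?thesis by (simp add: power2_eq_square square_diff_square_factored abs_mult mult.commute)
  qed
  have "\<bar>\<Sum>T\<in>adj E. sign_TE M T E * (w T)\<^sup>2\<bar> \<le> \<bar>\<Sum>T\<in>adj E. sign_TE M T E * w T\<bar> * (\<Sum>T\<in>adj E. \<bar>w T\<bar>)
    \<and> (\<Sum>T\<in>adj E. \<bar>w T\<bar>)\<^sup>2 \<le> 2 * (\<Sum>T\<in>adj E. (w T)\<^sup>2) \<and> card (adj E) \<le> 2"
  proof (cases rule: adj_cases[OF E])
    case (2 T)
    have "sign_TE M T E = 1 \<or> sign_TE M T E = - 1" using sign_sq[OF E] 2 by blast
    then show ?thesis unfolding 2 by (auto simp: power2_eq_square abs_mult)
  next
    case (3 T1 T2)
    have s: "sign_TE M T2 E = 1 \<or> sign_TE M T2 E = - 1" using sign_sq[OF E] 3 by blast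
    have "\<bar>sign_TE M T1 E * (w T1)\<^sup>2 + sign_TE M T2 E * (w T2)\<^sup>2\<bar> \<le>
      \<bar>sign_TE M T1 E * w T1 + sign_TE M T2 E * w T2\<bar> * (\<bar>w T1\<bar> + \<bar>w T2\<bar>)"
      using s two[of "w T1" "w T2"] unfolding 3(3) by (auto simp: abs_minus_commute)
    then show ?thesis unfolding 3(2) using 3(1) sq_sum_le[of "\<bar>w T1\<bar>" "\<bar>w T2\<bar>"]
      by (simp add: card_insert_if)
  qed simp
  then show ?A ?B
    "card (adj E) \<le> 2" by blast+
qed

text \<open>The outward signs make this the difference of the two traces when two elements meet at
  E, and plus or minus the trace when only one does. Boundary conditions need no separate treatment
  for this reason.\<close>

definition jump :: "(region \<Rightarrow> point \<Rightarrow> real) \<Rightarrow> region \<Rightarrow> point \<Rightarrow> real" where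
  "jump w E x = (\<Sum>T\<in>adj E. sign_TE M T E * w T x)"

lemma jump_Poly: "(\<And>T. T \<in> elems M \<Longrightarrow> w T \<in> Poly m) \<Longrightarrow> jump w E \<in> Poly m"
  unfolding jump_def[abs_def] using adjD(1) by (intro Poly_sum Poly_cmult) blast

lemma dist_origin:
  assumes "T \<in> elems M" "x \<in> closure T"
  shows "norm x \<le> R"
  using assms meshD(9)[OF mesh] bnd by (auto simp: dist_norm)

text \<open>A discrete trace inequality: the pointwise inverse estimate is squared and integrated
  over E, whose length does not exceed the diameter.\<close>

lemma trace_sq:
  assumes T: "T \<in> elems M" and p: "p \<in> Poly (l + 2)" and E: "E \<in> elem_edges M T"
  shows "edge_len E * edge_integral E (\<lambda>x. (p x)\<^sup>2) \<le> C\<^sup>2 * (L2n T p)\<^sup>2"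
proof -
  let ?h = "diameter T" let ?c = "C / ?h * L2n T p"
  note h = shapeD(1)[OF T]
  note e = elem_edge(1)[OF E]
  note len = edge_len_le[OF T E] edge_len_pos[OF e]
  have c: "continuous_on (closure E) p" by (rule Poly_continuous_on[OF p])
  have "\<bar>p x\<bar> \<le> ?c" if "x \<in> closure E" for x
    using Poly_pointwise(1)[OF T p, of x x] closure_elem_edge[OF E] that h by auto
  then have "edge_integral E (\<lambda>x. (p x)\<^sup>2) \<le> ?c\<^sup>2 * edge_len E"
    using h CB_pos L2n_nonneg[of T p] by (intro edge_integral_bound(1)[OF e c c]) auto
  then have "edge_len E * edge_integral E (\<lambda>x. (p x)\<^sup>2) \<le> edge_len E * (?c\<^sup>2 * edge_len E)"
    using len by (intro mult_left_mono) auto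
  also have "\<dots> = ?c\<^sup>2 * (edge_len E)\<^sup>2" by (simp add: power2_eq_square)
  also have "\<dots> \<le> ?c\<^sup>2 * ?h\<^sup>2" using len by (intro mult_left_mono power_mono) auto
  also have "\<dots> = C\<^sup>2 * (L2n T p)\<^sup>2" using h by (simp add: power_mult_distrib power_divide)
  finally show ?thesis .
qed

text \<open>The divergence theorem for \<open>x\<^sub>1 w\<^sup>2\<close>: the derivative of the factor \<open>x\<^sub>1\<close> produces \<open>\<integral> w\<^sup>2\<close>.\<close>

lemma poincare_cell:
  assumes T: "T \<in> elems M" and w: "w \<in> Poly (l + 2)"
  shows "3 / 4 * (L2n T w)\<^sup>2 \<le> (\<Sum>E\<in>elem_edges M T. sign_TE M T E * normal M E $ 1 * edge_integral E (\<lambda>x. x$1 * (w x * w x)))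
    + 4 * R\<^sup>2 * (L2n T (dir_deriv (axis 1 1) w))\<^sup>2"
proof -
  let ?g = "dir_deriv (axis 1 1) w" let ?p = "\<lambda>x. x$1 * (w x * w x)"
  note ww = Poly_mult[OF w w]
  have x1: "(\<lambda>x. x$1) \<in> Poly 1" by (rule Poly_coord) simp
  have p: "?p \<in> Poly (1 + (l + 2 + (l + 2)))" by (rule Poly_mult[OF x1 ww])
  have d: "dir_deriv (axis 1 1) ?p x = w x * w x + 2 * x$1 * w x * ?g x" for x
  proof -
    have "dir_deriv (axis 1 1) (\<lambda>x :: point. x$1) x = (axis 1 1 :: point) $ 1"
      by (rule dir_deriv_eqI[of _ "\<lambda>d. d $ 1"]) (rule bounded_linear.has_derivative[OF bounded_linear_vec_nth has_derivative_ident])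
    then show ?thesis unfolding dir_deriv_mult[OF x1 ww] dir_deriv_mult[OF w w] by (simp add: algebra_simps)
  qed
  have pt: "3 / 4 * (w x)\<^sup>2 \<le> dir_deriv (axis 1 1) ?p x + 4 * R\<^sup>2 * (?g x)\<^sup>2" if "x \<in> T" for x
  proof -
    have "\<bar>x$1\<bar> \<le> R" using dist_origin[OF T, of x] closure_subset[of T] that component_le_norm_cart[of x 1] by force
    then have "(x$1)\<^sup>2 \<le> R\<^sup>2" using Rpos by (simp add: abs_le_square_iff[symmetric])
    then have "(x$1)\<^sup>2 * (?g x)\<^sup>2 \<le> R\<^sup>2 * (?g x)\<^sup>2" by (rule mult_right_mono) simp
    \<comment> \<open>This square absorbs the mixed term at the expense of a quarter of the square
      of w, which leaves the factor 3/4.\<close>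
    moreover have "0 \<le> (w x / 2 + 2 * (x$1 * ?g x))\<^sup>2" by simp
    then have "0 \<le> (w x)\<^sup>2 / 4 + 2 * x$1 * w x * ?g x + 4 * ((x$1)\<^sup>2 * (?g x)\<^sup>2)"
      by (simp add: power2_eq_square algebra_simps)
    ultimately show ?thesis unfolding d by (simp add: power2_eq_square)
  qed
  note c = Poly_continuous_on[OF w, of UNIV] Poly_continuous_on[OF dir_deriv_Poly[OF w], of UNIV "axis 1 1"]
    Poly_continuous_on[OF dir_deriv_Poly[OF p], of UNIV "axis 1 1"]
  note I = set_integrable_continuous(2)[OF elem(2)[OF T] borel_open[OF elem(1)[OF T]]]
  have "3 / 4 * (L2n T w)\<^sup>2 = (LINT x:T|lebesgue. 3 / 4 * (w x)\<^sup>2)" by (simp add: L2n_sq)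
  also have "\<dots> \<le> (LINT x:T|lebesgue. dir_deriv (axis 1 1) ?p x + 4 * R\<^sup>2 * (?g x)\<^sup>2)"
    by (intro set_integral_mono I continuous_intros c pt)
  also have "\<dots> = (LINT x:T|lebesgue. dir_deriv (axis 1 1) ?p x) + (LINT x:T|lebesgue. 4 * R\<^sup>2 * (?g x)\<^sup>2)"
    by (intro set_integral_add I continuous_intros c)
  also have "(LINT x:T|lebesgue. 4 * R\<^sup>2 * (?g x)\<^sup>2) = 4 * R\<^sup>2 * (L2n T ?g)\<^sup>2" by (simp add: L2n_sq)
  finally show ?thesis unfolding elem_divergence_x[OF mesh Om T p] .
qed

text \<open>The factor x$1 and the normal component are the same for all elements at E, so what
  remains is a signed sum of squared traces, that is, a jump times a sum of traces. Young's
  inequality with parameter \<delta> times the length of E separates the two; the length next to the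
  traces is the one needed by the discrete trace inequality.\<close>

lemma poincare_edge:
  assumes E: "E \<in> edges M" and w: "\<And>T. T \<in> elems M \<Longrightarrow> w T \<in> Poly (l + 2)" and \<delta>: "0 < \<delta>"
  shows "(\<Sum>T\<in>adj E. sign_TE M T E * normal M E $ 1 * edge_integral E (\<lambda>x. x$1 * (w T x * w T x)))
    \<le> \<delta> * C\<^sup>2 * (\<Sum>T\<in>adj E. (L2n T (w T))\<^sup>2) + R\<^sup>2 / (2 * \<delta>) * ((eL2 E (jump w E))\<^sup>2 / edge_len E)"
proof -
  let ?e = "edge_len E" let ?n = "normal M E $ 1"
  have e: "is_edge E" by (rule meshD(8)[OF mesh E])
  have len: "0 < ?e" by (rule edge_len_pos[OF e])
  have W: "w T \<in> Poly (l + 2)" if "T \<in> adj E" for T using w adjD(1)[OF that] .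
  have cw: "continuous_on (closure E) (w T)" if "T \<in> adj E" for T by (rule Poly_continuous_on[OF W[OF that]])
  have cj: "continuous_on (closure E) (jump w E)" by (rule Poly_continuous_on[OF jump_Poly]) (rule w)
  have n1: "\<bar>?n\<bar> \<le> 1" using component_le_norm_cart[of "normal M E" 1] norm_tangent_normal(2)[OF E] by simp
  have eq: "sign_TE M T E * ?n * edge_integral E (\<lambda>x. x$1 * (w T x * w T x)) =
    edge_integral E (\<lambda>x. ?n * x$1 * (sign_TE M T E * (w T x)\<^sup>2))" for T
    by (simp add: edge_integral_cmult[OF e, symmetric] power2_eq_square mult_ac)
  have "(\<Sum>T\<in>adj E. sign_TE M T E * ?n * edge_integral E (\<lambda>x. x$1 * (w T x * w T x)))
    = edge_integral E (\<lambda>x. \<Sum>T\<in>adj E. ?n * x$1 * (sign_TE M T E * (w T x)\<^sup>2))"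
    unfolding eq by (rule edge_integral_sum[OF e, symmetric]) (intro continuous_intros cw)
  also have "\<dots> \<le> edge_integral E (\<lambda>x. \<delta> * ?e * (\<Sum>T\<in>adj E. (w T x)\<^sup>2) + R\<^sup>2 / (2 * \<delta> * ?e) * (jump w E x)\<^sup>2)"
  proof (intro edge_integral_mono[OF e] continuous_intros cw cj)
    fix x assume x: "x \<in> closure E"
    let ?J = "\<bar>jump w E x\<bar>" and ?W = "\<Sum>T\<in>adj E. \<bar>w T x\<bar>" and ?Q = "\<Sum>T\<in>adj E. (w T x)\<^sup>2"
    show "(\<Sum>T\<in>adj E. ?n * x$1 * (sign_TE M T E * (w T x)\<^sup>2)) \<le> \<delta> * ?e * ?Q + R\<^sup>2 / (2 * \<delta> * ?e) * (jump w E x)\<^sup>2"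
    proof (cases "adj E = {}")
      case True
      then show ?thesis using \<delta> len by simp
    next
      case False
      then obtain T where "T \<in> adj E" by blast
      then have "norm x \<le> R" using dist_origin[OF adjD(1)] closure_elem_edge[OF adjD(2)[OF E]] x by blast
      then have x1: "\<bar>x$1\<bar> \<le> R" using component_le_norm_cart[of x 1] by simp
      have W0: "0 \<le> ?W" by (intro sum_nonneg) simp
      have "(\<Sum>T\<in>adj E. ?n * x$1 * (sign_TE M T E * (w T x)\<^sup>2)) \<le> \<bar>?n * x$1\<bar> * \<bar>\<Sum>T\<in>adj E. sign_TE M T E * (w T x)\<^sup>2\<bar>"
        unfolding sum_distrib_left[symmetric] abs_mult[symmetric] by (rule abs_ge_self)
      also have "\<dots> \<le> R * (?J * ?W)"
        using mult_mono[OF n1 x1] adj_sums(1)[OF E, of "\<lambda>T. w T x"] Rpos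
        unfolding jump_def abs_mult by (intro mult_mono) auto
      also have "R * (?J * ?W) \<le> \<delta> * ?e / 2 * ?W\<^sup>2 + R\<^sup>2 / (2 * \<delta> * ?e) * ?J\<^sup>2"
      proof -
        have "2 * (\<delta> * ?e) * (R * (?J * ?W)) \<le> (\<delta> * ?e * ?W)\<^sup>2 + (R * ?J)\<^sup>2"
          using sum_squares_bound[of "\<delta> * ?e * ?W" "R * ?J"] by (simp add: mult_ac)
        then have "R * (?J * ?W) \<le> ((\<delta> * ?e * ?W)\<^sup>2 + (R * ?J)\<^sup>2) / (2 * (\<delta> * ?e))"
          using \<delta> len by (simp add: pos_le_divide_eq mult_ac)
        also have "\<dots> = \<delta> * ?e / 2 * ?W\<^sup>2 + R\<^sup>2 / (2 * \<delta> * ?e) * ?J\<^sup>2"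
        proof -
          have gen: "((d * W)\<^sup>2 + (R * J)\<^sup>2) / (2 * d) = d / 2 * W\<^sup>2 + R\<^sup>2 / (2 * d) * J\<^sup>2" if "0 < d" for d W J :: real
            using that by (simp add: field_simps power2_eq_square)
          show ?thesis using gen[of "\<delta> * ?e" ?W ?J] \<delta> len by (simp only: mult_pos_pos mult.assoc)
        qed
        finally show ?thesis .
      qed
      also have "\<dots> \<le> \<delta> * ?e / 2 * (2 * ?Q) + R\<^sup>2 / (2 * \<delta> * ?e) * (jump w E x)\<^sup>2"
        using adj_sums(2)[OF E, of "\<lambda>T. w T x"] \<delta> len by (intro add_mono mult_left_mono) auto
      finally show ?thesis by simp
    qed
  qed
  also have "\<dots> = edge_integral E (\<lambda>x. \<delta> * ?e * (\<Sum>T\<in>adj E. (w T x)\<^sup>2)) + edge_integral E (\<lambda>x. R\<^sup>2 / (2 * \<delta> * ?e) * (jump w E x)\<^sup>2)"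
    by (intro edge_integral_add[OF e] continuous_intros cw cj)
  also have "edge_integral E (\<lambda>x. \<delta> * ?e * (\<Sum>T\<in>adj E. (w T x)\<^sup>2)) = \<delta> * ?e * (\<Sum>T\<in>adj E. edge_integral E (\<lambda>x. (w T x)\<^sup>2))"
    unfolding edge_integral_cmult[OF e] by (subst edge_integral_sum[OF e]) (intro continuous_intros cw, simp_all)
  also have "edge_integral E (\<lambda>x. R\<^sup>2 / (2 * \<delta> * ?e) * (jump w E x)\<^sup>2) = R\<^sup>2 / (2 * \<delta>) * ((eL2 E (jump w E))\<^sup>2 / ?e)"
    unfolding edge_integral_cmult[OF e] eL2_sq[OF e] by simp
  also have "\<delta> * ?e * (\<Sum>T\<in>adj E. edge_integral E (\<lambda>x. (w T x)\<^sup>2)) = \<delta> * (\<Sum>T\<in>adj E. ?e * edge_integral E (\<lambda>x. (w T x)\<^sup>2))"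
    by (simp add: sum_distrib_left mult.assoc)
  also have "\<dots> \<le> \<delta> * (\<Sum>T\<in>adj E. C\<^sup>2 * (L2n T (w T))\<^sup>2)"
    using \<delta> trace_sq[OF adjD(1) W adjD(2)[OF E]] by (intro mult_left_mono sum_mono) auto
  also have "\<dots> = \<delta> * C\<^sup>2 * (\<Sum>T\<in>adj E. (L2n T (w T))\<^sup>2)" by (simp add: sum_distrib_left mult.assoc)
  finally show ?thesis by simp
qed

definition Cp :: real where "Cp = 8 * R\<^sup>2 * (C\<^sup>2 * real N + 1)"

lemma Cp_pos: "0 < Cp"
  unfolding Cp_def using Rpos by (intro mult_pos_pos add_nonneg_pos) auto

lemma poincare:
  assumes w: "\<And>T. T \<in> elems M \<Longrightarrow> w T \<in> Poly (l + 2)"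
  shows "(\<Sum>T\<in>elems M. (L2n T (w T))\<^sup>2) \<le> Cp * ((\<Sum>T\<in>elems M. (L2n T (dir_deriv (axis 1 1) (w T)))\<^sup>2)
    + (\<Sum>E\<in>edges M. (eL2 E (jump w E))\<^sup>2 / edge_len E))"
proof -
  define S where "S = (\<Sum>T\<in>elems M. (L2n T (w T))\<^sup>2)"
  define D where "D = (\<Sum>T\<in>elems M. (L2n T (dir_deriv (axis 1 1) (w T)))\<^sup>2)"
  define J where "J = (\<Sum>E\<in>edges M. (eL2 E (jump w E))\<^sup>2 / edge_len E)"
  define K where "K = C\<^sup>2 * real N + 1"
  have K: "0 < K" "1 \<le> K" "C\<^sup>2 * real N = K - 1" by (auto simp: K_def add_nonneg_pos)
  \<comment> \<open>With this choice the traces cost at most a quarter of S, after N edges per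
    element have been counted, and half of S remains on the left.\<close>
  define \<delta> where "\<delta> = 1 / (4 * K)"
  have \<delta>: "0 < \<delta>" using K by (simp add: \<delta>_def)
  have nn: "0 \<le> D" "0 \<le> S" unfolding D_def S_def by (intro sum_nonneg, simp)+
  have J0: "0 \<le> J" unfolding J_def using edge_len_pos meshD(8)[OF mesh] by (intro sum_nonneg) (simp add: less_imp_le)
  have "3 / 4 * S \<le> (\<Sum>T\<in>elems M. (\<Sum>E\<in>elem_edges M T. sign_TE M T E * normal M E $ 1 * edge_integral E (\<lambda>x. x$1 * (w T x * w T x)))
      + 4 * R\<^sup>2 * (L2n T (dir_deriv (axis 1 1) (w T)))\<^sup>2)"
    unfolding S_def sum_distrib_left by (intro sum_mono poincare_cell w)
  also have "\<dots> = (\<Sum>E\<in>edges M. \<Sum>T\<in>adj E. sign_TE M T E * normal M E $ 1 * edge_integral E (\<lambda>x. x$1 * (w T x * w T x))) + 4 * R\<^sup>2 * D"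
    unfolding sum.distrib D_def sum_distrib_left[symmetric] sum_elem_edges_swap by simp
  also have "(\<Sum>E\<in>edges M. \<Sum>T\<in>adj E. sign_TE M T E * normal M E $ 1 * edge_integral E (\<lambda>x. x$1 * (w T x * w T x))) \<le>
    (\<Sum>E\<in>edges M. \<delta> * C\<^sup>2 * (\<Sum>T\<in>adj E. (L2n T (w T))\<^sup>2) + R\<^sup>2 / (2 * \<delta>) * ((eL2 E (jump w E))\<^sup>2 / edge_len E))"
    by (intro sum_mono poincare_edge w \<delta>)
  also have "\<dots> = \<delta> * C\<^sup>2 * (\<Sum>T\<in>elems M. \<Sum>E\<in>elem_edges M T. (L2n T (w T))\<^sup>2) + R\<^sup>2 / (2 * \<delta>) * J"
    unfolding sum_elem_edges_swap sum.distrib J_def sum_distrib_left ..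
  also have "(\<Sum>T\<in>elems M. \<Sum>E\<in>elem_edges M T. (L2n T (w T))\<^sup>2) \<le> (\<Sum>T\<in>elems M. real N * (L2n T (w T))\<^sup>2)"
    using shapeD(3) by (intro sum_mono) (simp add: mult_right_mono)
  also have "\<dots> = real N * S" by (simp add: S_def sum_distrib_left)
  finally have "3 / 4 * S \<le> \<delta> * C\<^sup>2 * (real N * S) + R\<^sup>2 / (2 * \<delta>) * J + 4 * R\<^sup>2 * D"
    using \<delta> by (simp add: mult_left_mono)
  moreover have "\<delta> * C\<^sup>2 * (real N * S) \<le> 1 / 4 * S"
  proof -
    have "\<delta> * C\<^sup>2 * (real N * S) = \<delta> * (K - 1) * S" by (simp add: K(3)[symmetric] mult_ac)
    also have "\<dots> \<le> 1 / 4 * S" using K nn(2) by (intro mult_right_mono) (auto simp: \<delta>_def field_simps)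
    finally show ?thesis .
  qed
  moreover have "R\<^sup>2 / (2 * \<delta>) * J = 2 * R\<^sup>2 * K * J" using K by (simp add: \<delta>_def)
  ultimately have "S \<le> 4 * R\<^sup>2 * K * J + 8 * R\<^sup>2 * D" by linarith
  also have "\<dots> \<le> 8 * R\<^sup>2 * K * J + 8 * R\<^sup>2 * K * D"
    using K J0 nn mult_right_mono[OF K(2), of "8 * R\<^sup>2 * D"] by (intro add_mono) (auto simp: mult_ac mult_right_mono)
  also have "\<dots> = Cp * (D + J)" by (simp add: Cp_def K_def algebra_simps)
  finally show ?thesis by (simp add: S_def D_def J_def)
qed

end

section \<open>The test vector\<close>

context plate_poincare
begin

definition jumpn :: "(region \<Rightarrow> point \<Rightarrow> real) \<Rightarrow> region \<Rightarrow> point \<Rightarrow> real" where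
  "jumpn U E = jump (\<lambda>T. dir_deriv (normal M E) (U T)) E"

text \<open>The edge components are such that \<open>form_b\<close> pairs \<open>test_dofs U\<close> with \<open>U\<close> to a sum of squares.\<close>

definition test_dofs :: "(region \<Rightarrow> point \<Rightarrow> real) \<Rightarrow> dofs" where
  "test_dofs U = \<lparr>cell_H = (\<lambda>T. if T \<in> elems M then hess (U T) else (\<lambda>x. 0)), cell_Hc = (\<lambda>T x. 0),
    edge_nn = (\<lambda>E. if E \<in> edges M then edge_restrict E (\<lambda>x. - (1 / edge_len E) * jumpn U E x) else (\<lambda>x. 0)),
    edge_D = (\<lambda>E. if E \<in> edges M then edge_restrict E (\<lambda>x. 1 / (edge_len E)^3 * jump U E x) else (\<lambda>x. 0)),
    vert = (\<lambda>V. 0)\<rparr>"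

text \<open>Under scaling of the mesh both terms behave like the squared L2 norm of a second
  derivative.\<close>

definition edge_energy :: "(region \<Rightarrow> point \<Rightarrow> real) \<Rightarrow> region \<Rightarrow> real" where
  "edge_energy U E = (eL2 E (jumpn U E))\<^sup>2 / edge_len E + (eL2 E (jump U E))\<^sup>2 / (edge_len E)^3"

definition energy :: "(region \<Rightarrow> point \<Rightarrow> real) \<Rightarrow> real" where
  "energy U = (\<Sum>T\<in>elems M. (L2n T (hess (U T)))\<^sup>2) + (\<Sum>E\<in>edges M. edge_energy U E)"

lemma edge_energy_parts:
  assumes "E \<in> edges M"
  shows "0 < edge_len E" "0 \<le> edge_energy U E" "(eL2 E (jumpn U E))\<^sup>2 / edge_len E \<le> edge_energy U E" (is ?A)
    "(eL2 E (jump U E))\<^sup>2 / (edge_len E)^3 \<le> edge_energy U E" (is ?B)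
proof -
  show len: "0 < edge_len E" by (rule edge_len_pos[OF meshD(8)[OF mesh assms]])
  then show "0 \<le> edge_energy U E" ?A ?B
    unfolding edge_energy_def by simp_all
qed

lemma energy_parts:
  "0 \<le> energy U" "(\<Sum>T\<in>elems M. (L2n T (hess (U T)))\<^sup>2) \<le> energy U" "(\<Sum>E\<in>edges M. edge_energy U E) \<le> energy U"
proof -
  have "0 \<le> (\<Sum>T\<in>elems M. (L2n T (hess (U T)))\<^sup>2)" by (intro sum_nonneg) simp
  moreover have "0 \<le> (\<Sum>E\<in>edges M. edge_energy U E)" by (intro sum_nonneg edge_energy_parts)
  ultimately show "0 \<le> energy U" "(\<Sum>T\<in>elems M. (L2n T (hess (U T)))\<^sup>2) \<le> energy U"
    "(\<Sum>E\<in>edges M. edge_energy U E) \<le> energy U" unfolding energy_def by simp_all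
qed

text \<open>Bounds both the ratio of the diameter to an edge length and its cube, the two factors
  that arise when powers of the edge length are exchanged for powers of the diameter.\<close>

definition k\<kappa> :: real where "k\<kappa> = 1 / \<kappa> + 1 / \<kappa>^3"

lemma k\<kappa>_nonneg: "0 \<le> k\<kappa>"
  using kap by (simp add: k\<kappa>_def)

text \<open>The outer \<open>Cp\<close> belongs to the Poincare inequality for u, the inner one to
  that for its first derivative. The term 2 (Ct + 1) comes from the jumps of the derivative and
  \<open>4 * R\<^sup>2\<close> from edge lengths being at most 2 R.\<close>

definition Cu :: real where "Cu = Cp * (Cp * (1 + 2 * (Ct + 1)) + 4 * R\<^sup>2)"

lemma Cu_nonneg: "0 \<le> Cu"
  unfolding Cu_def using Cp_pos tang by (intro mult_nonneg_nonneg add_nonneg_nonneg) (auto simp: tangential_const_def)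

context
  fixes U :: "region \<Rightarrow> point \<Rightarrow> real"
  assumes U: "\<And>T. T \<in> elems M \<Longrightarrow> U T \<in> Poly (l - 1)"
begin

lemma U2: "T \<in> elems M \<Longrightarrow> U T \<in> Poly (l + 2)"
  using Poly_mono[OF U] by simp

lemma jump_U: "jump U E \<in> Poly (l - 1)"
  by (rule jump_Poly[OF U])

lemma jumpn_U: "jumpn U E \<in> Poly (l - 2)"
  unfolding jumpn_def using dir_deriv_Poly[OF U] by (intro jump_Poly) simp

lemma test_dofs_Sigma: "test_dofs U \<in> Sigma_space l M"
proof -
  have z: "(\<lambda>x. 0) \<in> Hess_compl l c" for c
    using subspace_0[OF subspace_Hess_compl[of l c]] by (simp add: zero_fun_def)
  have r: "edge_restrict E (\<lambda>x. r * jumpn U E x) \<in> Poly_edge (l - 2) E"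
    "edge_restrict E (\<lambda>x. r * jump U E x) \<in> Poly_edge (l - 1) E" for E r
    unfolding Poly_edge_image by (intro imageI Poly_cmult jumpn_U jump_U)+
  have "edge_restrict E (\<lambda>x. - (jumpn U E x / edge_len E)) \<in> Poly_edge (l - 2) E"
    "edge_restrict E (\<lambda>x. jump U E x / (edge_len E)^3) \<in> Poly_edge (l - 1) E" for E
    using r(1)[of E "- (1 / edge_len E)"] r(2)[of E "1 / (edge_len E)^3"] by simp_all
  moreover have "hess (U T) \<in> Hess_space (l - 3)" if "T \<in> elems M" for T
    using U[OF that] by (simp add: Hess_space_def)
  moreover have "(0 :: tensor) \<in> sym_tensors"
    using subspace_0[OF subspace_sym_tensors] .
  ultimately show ?thesis unfolding Sigma_space_def test_dofs_def using z by simp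
qed

lemma test_dofs_edge:
  assumes "E \<in> edges M"
  shows "eL2 E (edge_nn (test_dofs U) E) = eL2 E (jumpn U E) / edge_len E" (is ?A)
    "eL2 E (edge_D (test_dofs U) E) = eL2 E (jump U E) / (edge_len E)^3" (is ?B)
    "edge_integral E (\<lambda>x. edge_nn (test_dofs U) E x * f x) = - (1 / edge_len E) * edge_integral E (\<lambda>x. jumpn U E x * f x)" (is ?C)
    "edge_integral E (\<lambda>x. edge_D (test_dofs U) E x * f x) = 1 / (edge_len E)^3 * edge_integral E (\<lambda>x. jump U E x * f x)" (is ?D)
proof -
  note e = meshD(8)[OF mesh assms]
  note len = edge_energy_parts(1)[OF assms]
  have "edge_integral E (\<lambda>x. (edge_nn (test_dofs U) E x)\<^sup>2) = edge_integral E (\<lambda>x. (1 / edge_len E)\<^sup>2 * (jumpn U E x)\<^sup>2)"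
    using assms by (intro edge_integral_cong[OF e]) (simp add: test_dofs_def power_divide)
  then show ?A
    using len unfolding eL2_def by (simp add: edge_integral_cmult[OF e] real_sqrt_mult)
  have "edge_integral E (\<lambda>x. (edge_D (test_dofs U) E x)\<^sup>2) = edge_integral E (\<lambda>x. (1 / (edge_len E)^3)\<^sup>2 * (jump U E x)\<^sup>2)"
    using assms by (intro edge_integral_cong[OF e]) (simp add: test_dofs_def power_divide)
  then show ?B
    using len unfolding eL2_def by (simp add: edge_integral_cmult[OF e] real_sqrt_mult)
  show ?C ?D
    unfolding edge_integral_cmult[OF e, symmetric]
    using assms by (intro edge_integral_cong[OF e]; simp add: test_dofs_def)+
qed

lemma edge_integral_jump:
  assumes E: "E \<in> edges M" and f: "continuous_on (closure E) f" and w: "\<And>T. T \<in> elems M \<Longrightarrow> w T \<in> Poly m"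
  shows "(\<Sum>T\<in>adj E. sign_TE M T E * edge_integral E (\<lambda>x. f x * w T x)) = edge_integral E (\<lambda>x. f x * jump w E x)"
proof -
  note e = meshD(8)[OF mesh E]
  have "(\<Sum>T\<in>adj E. sign_TE M T E * edge_integral E (\<lambda>x. f x * w T x)) =
    (\<Sum>T\<in>adj E. edge_integral E (\<lambda>x. f x * (sign_TE M T E * w T x)))"
    by (simp add: edge_integral_cmult[OF e, symmetric] mult.left_commute)
  also have "\<dots> = edge_integral E (\<lambda>x. \<Sum>T\<in>adj E. f x * (sign_TE M T E * w T x))"
    using adjD(1) Poly_continuous_on[OF w] f
    by (intro edge_integral_sum[OF e, symmetric] continuous_intros) blast+
  finally show ?thesis by (simp add: jump_def sum_distrib_left)
qed

text \<open>On each element the identity for \<open>DD\<close> is tested with u itself. Regrouping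
  the boundary terms by edges turns signed traces into jumps, and the opposite signs of the two edge
  components of \<open>test_dofs\<close> make both contributions positive.\<close>

lemma form_b_test:
  assumes u: "\<And>T x. T \<in> elems M \<Longrightarrow> x \<in> T \<Longrightarrow> u x = U T x"
  shows "form_b l M (test_dofs U) u = energy U"
proof -
  let ?\<tau> = "test_dofs U"
  let ?f = "\<lambda>T E. sign_TE M T E * (edge_integral E (\<lambda>x. edge_nn ?\<tau> E x * dir_deriv (normal M E) (U T) x) - edge_integral E (\<lambda>x. edge_D ?\<tau> E x * U T x))"
  have cell: "(LINT x:T|lebesgue. DD l M T ?\<tau> x * u x) = (L2n T (hess (U T)))\<^sup>2 - (\<Sum>E\<in>elem_edges M T. ?f T E)"
    if T: "T \<in> elems M" for T
  proof -
    have "(LINT x:T|lebesgue. DD l M T ?\<tau> x * u x) = (LINT x:T|lebesgue. DD l M T ?\<tau> x * U T x)"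
      using u[OF T] elem(1)[OF T] by (intro set_lebesgue_integral_cong) auto
    also have "\<dots> = (LINT x:T|lebesgue. cell_H ?\<tau> T x \<bullet> hess (U T) x) - bdry M T ?\<tau> (edge_nn ?\<tau>) (U T)"
      by (rule DD_props(2)[OF test_dofs_Sigma T U[OF T]])
    also have "(LINT x:T|lebesgue. cell_H ?\<tau> T x \<bullet> hess (U T) x) = (L2n T (hess (U T)))\<^sup>2"
      using T by (simp add: test_dofs_def L2n_sq power2_norm_eq_inner)
    also have "bdry M T ?\<tau> (edge_nn ?\<tau>) (U T) = (\<Sum>E\<in>elem_edges M T. ?f T E)"
      by (simp add: bdry_def vert_terms_def test_dofs_def)
    finally show ?thesis .
  qed
  have edge: "(\<Sum>T\<in>adj E. ?f T E) = - edge_energy U E" if E: "E \<in> edges M" for E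
  proof -
    note e = meshD(8)[OF mesh E]
    note s = SigmaD(7,8)[OF test_dofs_Sigma E]
    have "(\<Sum>T\<in>adj E. ?f T E) = edge_integral E (\<lambda>x. edge_nn ?\<tau> E x * jumpn U E x) - edge_integral E (\<lambda>x. edge_D ?\<tau> E x * jump U E x)"
      unfolding right_diff_distrib sum_subtractf jumpn_def
      by (intro arg_cong2[of _ _ _ _ "(-)"] edge_integral_jump[OF E s(1) dir_deriv_Poly[OF U]] edge_integral_jump[OF E s(2) U])
    also have "\<dots> = - edge_energy U E"
      unfolding test_dofs_edge(3,4)[OF E] edge_energy_def eL2_sq[OF e] by (simp add: power2_eq_square)
    finally show ?thesis .
  qed
  have "form_b l M ?\<tau> u = (\<Sum>T\<in>elems M. (L2n T (hess (U T)))\<^sup>2) - (\<Sum>T\<in>elems M. \<Sum>E\<in>elem_edges M T. ?f T E)"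
    unfolding form_b_def by (simp add: cell sum_subtractf cong: sum.cong)
  also have "\<dots> = energy U" unfolding sum_elem_edges_swap energy_def using edge by (simp add: sum_negf)
  finally show ?thesis .
qed

text \<open>The components carry powers of the edge length while \<open>size_le\<close> asks for
  powers of the diameter; the lower bound for edge lengths converts the ratio 1 for the normal
  derivative and its cube for the jump.\<close>

lemma size_le_test:
  assumes T: "T \<in> elems M"
  shows "size_le (test_dofs U) T (sqrt ((L2n T (hess (U T)))\<^sup>2 + (\<Sum>E\<in>elem_edges M T. k\<kappa> * edge_energy U E)))"
    (is "size_le _ _ (sqrt (?a + ?b))")
proof -
  let ?h = "diameter T"
  note h = shapeD(1)[OF T]
  have nn: "0 \<le> ?a" "0 \<le> ?b" using edge_energy_parts(2)[OF elem_edge(2)] k\<kappa>_nonneg by (auto intro!: sum_nonneg)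
  have single: "k\<kappa> * edge_energy U E \<le> ?b" if "E \<in> elem_edges M T" for E
    using that edge_energy_parts(2)[OF elem_edge(2)] k\<kappa>_nonneg finite_elem_edges[OF mesh] by (intro member_le_sum) auto
  have "L2n T (cell_H (test_dofs U) T) \<le> sqrt (?a + ?b)"
    using T nn by (intro real_le_rsqrt) (simp add: test_dofs_def)
  moreover have "sqrt ?h * eL2 E (edge_nn (test_dofs U) E) \<le> sqrt (?a + ?b)"
    "?h * sqrt ?h * eL2 E (edge_D (test_dofs U) E) \<le> sqrt (?a + ?b)" if E: "E \<in> elem_edges M T" for E
  proof -
    note e = elem_edge[OF E]
    note p = edge_energy_parts[OF e(2)]
    let ?e = "edge_len E"
    have he: "?h / ?e \<le> 1 / \<kappa>" using shapeD(4)[OF T E] kap p(1) by (simp add: field_simps)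
    have he0: "0 \<le> ?h / ?e" using h p(1) by simp
    have "(sqrt ?h * eL2 E (edge_nn (test_dofs U) E))\<^sup>2 = ?h / ?e * ((eL2 E (jumpn U E))\<^sup>2 / ?e)"
      using h p(1) unfolding test_dofs_edge(1)[OF e(2)] by (simp add: power_mult_distrib power_divide power2_eq_square[of ?e])
    also have "\<dots> \<le> k\<kappa> * edge_energy U E"
    proof (intro mult_mono)
      have "1 / \<kappa> \<le> k\<kappa>" using kap by (simp add: k\<kappa>_def)
      then show "?h / ?e \<le> k\<kappa>" using he by (rule order_trans[rotated])
    qed (use p k\<kappa>_nonneg in auto)
    also have "\<dots> \<le> ?a + ?b" using single[OF E] nn(1) by (rule add_increasing[rotated])
    finally show "sqrt ?h * eL2 E (edge_nn (test_dofs U) E) \<le> sqrt (?a + ?b)" by (rule real_le_rsqrt)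
    have "(?h * sqrt ?h * eL2 E (edge_D (test_dofs U) E))\<^sup>2 = (?h / ?e)^3 * ((eL2 E (jump U E))\<^sup>2 / ?e^3)"
      using h p(1) unfolding test_dofs_edge(2)[OF e(2)]
      by (simp add: power_mult_distrib power_divide power2_eq_square[of "?e^3"] power2_eq_square[of ?h] power3_eq_cube[of ?h])
    also have "\<dots> \<le> k\<kappa> * edge_energy U E"
    proof (intro mult_mono)
      have "(?h / ?e)^3 \<le> (1 / \<kappa>)^3" using he he0 by (rule power_mono)
      also have "\<dots> \<le> k\<kappa>" using kap by (simp add: k\<kappa>_def power_divide)
      finally show "(?h / ?e)^3 \<le> k\<kappa>" .
    qed (use p k\<kappa>_nonneg in auto)
    also have "\<dots> \<le> ?a + ?b" using single[OF E] nn(1) by (rule add_increasing[rotated])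
    finally show "?h * sqrt ?h * eL2 E (edge_D (test_dofs U) E) \<le> sqrt (?a + ?b)" by (rule real_le_rsqrt)
  qed
  ultimately show ?thesis using nn by (simp add: size_le_def test_dofs_def)
qed

text \<open>The local bounds are summed over the elements. Each edge is counted for at most two of
  them, which explains the factor 1 + 2 \<open>k\<kappa>\<close>.\<close>

lemma test_local_norm:
  "(\<Sum>T\<in>elems M. (LINT x:T|lebesgue. (norm (P_cell l M T (test_dofs U) x))\<^sup>2) + stab l M T (test_dofs U) (test_dofs U))
    \<le> (C2\<^sup>2 + C3) * (1 + 2 * k\<kappa>) * energy U"
proof -
  let ?k = "\<lambda>T. (L2n T (hess (U T)))\<^sup>2 + (\<Sum>E\<in>elem_edges M T. k\<kappa> * edge_energy U E)"
  have "(LINT x:T|lebesgue. (norm (P_cell l M T (test_dofs U) x))\<^sup>2) + stab l M T (test_dofs U) (test_dofs U) \<le> (C2\<^sup>2 + C3) * ?k T"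
    if T: "T \<in> elems M" for T
  proof -
    note s = size_le_test[OF T]
    have k0: "0 \<le> ?k T" using s by (simp add: size_le_def)
    have "(L2n T (P_cell l M T (test_dofs U)))\<^sup>2 \<le> (C2 * sqrt (?k T))\<^sup>2"
      by (rule power_mono[OF P_cell_bound[OF T test_dofs_Sigma s] L2n_nonneg])
    also have "\<dots> = C2\<^sup>2 * ?k T" using k0 by (simp add: power_mult_distrib)
    finally show ?thesis
      using stab_bound[OF T test_dofs_Sigma s] k0 by (simp add: L2n_sq distrib_right)
  qed
  then have "(\<Sum>T\<in>elems M. (LINT x:T|lebesgue. (norm (P_cell l M T (test_dofs U) x))\<^sup>2) + stab l M T (test_dofs U) (test_dofs U))
    \<le> (\<Sum>T\<in>elems M. (C2\<^sup>2 + C3) * ?k T)" by (rule sum_mono)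
  also have "\<dots> = (C2\<^sup>2 + C3) * ((\<Sum>T\<in>elems M. (L2n T (hess (U T)))\<^sup>2) + (\<Sum>E\<in>edges M. \<Sum>T\<in>adj E. k\<kappa> * edge_energy U E))"
    unfolding sum_elem_edges_swap[symmetric] sum.distrib[symmetric] sum_distrib_left ..
  also have "\<dots> \<le> (C2\<^sup>2 + C3) * (energy U + 2 * k\<kappa> * energy U)"
  proof (intro mult_left_mono add_mono)
    have "(\<Sum>E\<in>edges M. \<Sum>T\<in>adj E. k\<kappa> * edge_energy U E) \<le> (\<Sum>E\<in>edges M. 2 * k\<kappa> * edge_energy U E)"
    proof (rule sum_mono)
      fix E assume E: "E \<in> edges M"
      have "real (card (adj E)) * (k\<kappa> * edge_energy U E) \<le> 2 * (k\<kappa> * edge_energy U E)"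
        using adj_sums(3)[OF E] k\<kappa>_nonneg edge_energy_parts(2)[OF E] by (intro mult_right_mono) auto
      then show "(\<Sum>T\<in>adj E. k\<kappa> * edge_energy U E) \<le> 2 * k\<kappa> * edge_energy U E" by simp
    qed
    also have "\<dots> \<le> 2 * k\<kappa> * energy U"
      unfolding sum_distrib_left[symmetric] using energy_parts(3) k\<kappa>_nonneg by (intro mult_left_mono) auto
    finally show "(\<Sum>E\<in>edges M. \<Sum>T\<in>adj E. k\<kappa> * edge_energy U E) \<le> 2 * k\<kappa> * energy U" .
  qed (use energy_parts C_nonneg in auto)
  finally show ?thesis by (simp add: algebra_simps)
qed

text \<open>The energy contains jumps of normal derivatives only. The first partial derivative is
  split into normal and tangential parts, and the jump of the tangential derivative is the
  tangential derivative of the jump, so the inverse estimate along the edge reduces it to the jump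
  of U.\<close>

lemma jump_gradient_bound:
  assumes E: "E \<in> edges M"
  shows "(eL2 E (jump (\<lambda>T. dir_deriv (axis 1 1) (U T)) E))\<^sup>2 / edge_len E \<le> 2 * (Ct + 1) * edge_energy U E"
proof -
  let ?t = "tangent M E" and ?n = "normal M E" and ?e = "edge_len E" and ?J = "jump U E"
  note e = meshD(8)[OF mesh E]
  note p = edge_energy_parts[OF E]
  note u = norm_tangent_normal[OF E]
  have Ct: "0 < Ct" using tang by (simp add: tangential_const_def)
  have comp: "\<bar>?t$1\<bar> \<le> 1" "\<bar>?n$1\<bar> \<le> 1"
    using component_le_norm_cart[of ?t 1] component_le_norm_cart[of ?n 1] u by auto
  have un: "(?t$1)\<^sup>2 + (?t$2)\<^sup>2 = 1"
    using u(1) by (simp add: norm_eq_1 inner_vec_def sum_2 power2_eq_square)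
  have J: "jump (\<lambda>T. dir_deriv (axis 1 1) (U T)) E x = ?t$1 * dir_deriv ?t ?J x + ?n$1 * jumpn U E x" for x
  proof -
    have d1: "dir_deriv (axis 1 1) (U T) x = ?t$1 * dir_deriv ?t (U T) x + ?n$1 * dir_deriv ?n (U T) x" if T: "T \<in> adj E" for T
    proof -
      note c = dir_deriv_coords[OF U[OF adjD(1)[OF T]], where x = x]
      have n: "?n$1 = - ?t$2" "?n$2 = ?t$1" by (simp_all add: normal_def rot90_def)
      have gen: "a = t1 * (t1 * a + t2 * b) + (- t2) * (- t2 * a + t1 * b)" if "t1\<^sup>2 + t2\<^sup>2 = 1" for a b t1 t2 :: real
      proof -
        have "t1 * (t1 * a + t2 * b) + (- t2) * (- t2 * a + t1 * b) = (t1\<^sup>2 + t2\<^sup>2) * a" by (simp add: power2_eq_square algebra_simps)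
        then show ?thesis using that by simp
      qed
      show ?thesis unfolding c[of ?t] c[of ?n] n by (rule gen[OF un])
    qed
    have dJ: "dir_deriv ?t ?J x = (\<Sum>T\<in>adj E. sign_TE M T E * dir_deriv ?t (U T) x)"
    proof -
      have "dir_deriv ?t ?J x = (\<Sum>T\<in>adj E. dir_deriv ?t (\<lambda>x. sign_TE M T E * U T x) x)"
        unfolding jump_def[abs_def] using adjD(1) by (intro dir_deriv_sum[of _ _ "l - 1"] Poly_cmult U)
      also have "\<dots> = (\<Sum>T\<in>adj E. sign_TE M T E * dir_deriv ?t (U T) x)"
        by (rule sum.cong[OF refl]) (rule dir_deriv_cmult[OF U[OF adjD(1)]])
      finally show ?thesis .
    qed
    show ?thesis unfolding dJ jumpn_def jump_def sum_distrib_left sum.distrib[symmetric]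
      by (intro sum.cong refl) (simp add: d1 algebra_simps)
  qed
  have c: "continuous_on (closure E) (dir_deriv ?t ?J)" "continuous_on (closure E) (jumpn U E)"
    "continuous_on (closure E) (jump (\<lambda>T. dir_deriv (axis 1 1) (U T)) E)"
    by (rule Poly_continuous_on[OF dir_deriv_Poly[OF jump_U]], rule Poly_continuous_on[OF jumpn_U],
      rule Poly_continuous_on[OF jump_Poly[OF dir_deriv_Poly[OF U]]])
  have "(eL2 E (jump (\<lambda>T. dir_deriv (axis 1 1) (U T)) E))\<^sup>2 \<le> edge_integral E (\<lambda>x. 2 * (dir_deriv ?t ?J x)\<^sup>2 + 2 * (jumpn U E x)\<^sup>2)"
    unfolding eL2_sq[OF e]
  proof (intro edge_integral_mono[OF e] continuous_intros c)
    fix x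
    have sq: "(a * x)\<^sup>2 \<le> x\<^sup>2" if "\<bar>a\<bar> \<le> 1" for a x :: real
      using that by (simp add: power_mult_distrib abs_square_le_1 mult_left_le_one_le)
    show "(jump (\<lambda>T. dir_deriv (axis 1 1) (U T)) E x)\<^sup>2 \<le> 2 * (dir_deriv ?t ?J x)\<^sup>2 + 2 * (jumpn U E x)\<^sup>2"
      unfolding J using sq_sum_le[of "?t$1 * dir_deriv ?t ?J x" "?n$1 * jumpn U E x"]
        sq[OF comp(1), of "dir_deriv ?t ?J x"] sq[OF comp(2), of "jumpn U E x"] by linarith
  qed
  also have "\<dots> = 2 * edge_integral E (\<lambda>x. (dir_deriv ?t ?J x)\<^sup>2) + 2 * (eL2 E (jumpn U E))\<^sup>2"
    unfolding eL2_sq[OF e] edge_integral_cmult[OF e, symmetric] by (intro edge_integral_add[OF e] continuous_intros c)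
  also have "edge_integral E (\<lambda>x. (dir_deriv ?t ?J x)\<^sup>2) \<le> Ct / ?e\<^sup>2 * (eL2 E ?J)\<^sup>2"
  proof -
    obtain a b where ab: "a \<noteq> b" "E = open_segment a b" "?t = (b - a) /\<^sub>R norm (b - a)"
      using mesh_edgesD(3)[OF mesh E] by blast
    have len: "?e = dist a b" using ab by (simp add: edge_len_segment)
    have "edge_integral (open_segment a b) (\<lambda>x. (dir_deriv ((b - a) /\<^sub>R norm (b - a)) p x)\<^sup>2)
     \<le> Ct / (dist a b)\<^sup>2 * edge_integral (open_segment a b) (\<lambda>x. (p x)\<^sup>2)" if "p \<in> Poly (l - 1)" for p
      using tang ab(1) that unfolding tangential_const_def by blast
    from this[OF jump_U[of E]] show ?thesis
      by (simp only: eL2_sq[OF e] ab(3)[symmetric] ab(2)[symmetric] len[symmetric])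
  qed
  finally have "(eL2 E (jump (\<lambda>T. dir_deriv (axis 1 1) (U T)) E))\<^sup>2 / ?e \<le> (2 * (Ct / ?e\<^sup>2 * (eL2 E ?J)\<^sup>2) + 2 * (eL2 E (jumpn U E))\<^sup>2) / ?e"
    using p(1) by (intro divide_right_mono) auto
  also have "\<dots> = 2 * Ct * ((eL2 E ?J)\<^sup>2 / ?e^3) + 2 * ((eL2 E (jumpn U E))\<^sup>2 / ?e)"
    using p(1) by (simp add: add_divide_distrib power2_eq_square power3_eq_cube)
  also have "\<dots> \<le> 2 * Ct * edge_energy U E + 2 * edge_energy U E"
    using p Ct by (intro add_mono mult_left_mono) auto
  finally show ?thesis by (simp add: algebra_simps)
qed

text \<open>Since \<open>poincare\<close> involves only the first partial derivative, no full
  gradient is needed. Applied to that derivative it requires an entry of the Hessian and the jumps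
  of the derivative; applied to U it requires the bound just obtained and the jumps of U, whose
  weight is lowered from the inverse cube of the edge length to its inverse because edges are at
  most 2 R long.\<close>

lemma test_L2_bound: "(\<Sum>T\<in>elems M. (L2n T (U T))\<^sup>2) \<le> Cu * energy U"
proof -
  let ?d = "\<lambda>T. dir_deriv (axis 1 1) (U T)"
  have Ct: "0 < Ct" using tang by (simp add: tangential_const_def)
  have dU: "?d T \<in> Poly (l + 2)" if "T \<in> elems M" for T
    using Poly_mono[OF dir_deriv_Poly[OF U[OF that]]] by simp
  have "(\<Sum>T\<in>elems M. (L2n T (dir_deriv (axis 1 1) (?d T)))\<^sup>2) \<le> (\<Sum>T\<in>elems M. (L2n T (hess (U T)))\<^sup>2)"
  proof (intro sum_mono power_mono L2n_nonneg)
    fix T assume T: "T \<in> elems M"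
    show "L2n T (dir_deriv (axis 1 1) (?d T)) \<le> L2n T (hess (U T))"
      using component_L2n[OF T hess_Poly_sym[OF U[OF T, THEN Poly_mono[of _ _ "l + 2"]]], of 1 1] by (simp add: hess_nth)
  qed
  then have 2: "(\<Sum>T\<in>elems M. (L2n T (dir_deriv (axis 1 1) (?d T)))\<^sup>2) \<le> energy U" using energy_parts(2) by (rule order_trans)
  have "(\<Sum>E\<in>edges M. (eL2 E (jump ?d E))\<^sup>2 / edge_len E) \<le> 2 * (Ct + 1) * (\<Sum>E\<in>edges M. edge_energy U E)"
    unfolding sum_distrib_left by (intro sum_mono jump_gradient_bound)
  also have "\<dots> \<le> 2 * (Ct + 1) * energy U" using energy_parts(3) Ct by (intro mult_left_mono) auto
  finally have "(\<Sum>T\<in>elems M. (L2n T (?d T))\<^sup>2) \<le> Cp * (energy U + 2 * (Ct + 1) * energy U)"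
    using 2 Cp_pos by (intro order_trans[OF poincare[OF dU]] mult_left_mono add_mono) auto
  then have 1: "(\<Sum>T\<in>elems M. (L2n T (?d T))\<^sup>2) \<le> Cp * (1 + 2 * (Ct + 1)) * energy U" by (simp add: algebra_simps)
  have "(eL2 E (jump U E))\<^sup>2 / edge_len E \<le> 4 * R\<^sup>2 * edge_energy U E" if E: "E \<in> edges M" for E
  proof (cases "adj E = {}")
    case True
    then have "jump U E = (\<lambda>x. 0)" by (simp add: jump_def fun_eq_iff)
    then show ?thesis using edge_energy_parts(2)[OF E, of U] meshD(8)[OF mesh E] by (simp add: eL2_def)
  next
    case False
    then obtain T where T: "T \<in> adj E" by blast
    note p = edge_energy_parts[OF E]
    obtain a b where ab: "a \<noteq> b" "E = open_segment a b" using meshD(8)[OF mesh E] by (rule is_edgeE)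
    have "{a, b} \<subseteq> closure T" using closure_elem_edge[OF adjD(2)[OF E T]] ab by auto
    then have "norm a \<le> R" "norm b \<le> R" using dist_origin[OF adjD(1)[OF T]] by auto
    then have "edge_len E \<le> 2 * R" using ab norm_triangle_ineq4[of a b] by (simp add: edge_len_segment dist_norm)
    then have "(edge_len E)\<^sup>2 \<le> (2 * R)\<^sup>2" using p(1) by (intro power_mono) auto
    then have "(edge_len E)\<^sup>2 * ((eL2 E (jump U E))\<^sup>2 / (edge_len E)^3) \<le> (2 * R)\<^sup>2 * edge_energy U E"
      using p by (intro mult_mono) auto
    then show ?thesis using p(1) by (simp add: power2_eq_square power3_eq_cube power_mult_distrib)
  qed
  then have "(\<Sum>E\<in>edges M. (eL2 E (jump U E))\<^sup>2 / edge_len E) \<le> 4 * R\<^sup>2 * (\<Sum>E\<in>edges M. edge_energy U E)"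
    unfolding sum_distrib_left by (rule sum_mono)
  also have "\<dots> \<le> 4 * R\<^sup>2 * energy U" using energy_parts(3) by (intro mult_left_mono) auto
  finally have "(\<Sum>T\<in>elems M. (L2n T (U T))\<^sup>2) \<le> Cp * (Cp * (1 + 2 * (Ct + 1)) * energy U + 4 * R\<^sup>2 * energy U)"
    using 1 Cp_pos by (intro order_trans[OF poincare[OF U2]] mult_left_mono add_mono) auto
  also have "\<dots> = Cu * energy U" by (simp add: Cu_def algebra_simps)
  finally show ?thesis .
qed

end

end

section \<open>The compliance tensor\<close>

lemma stiffness_inverse:
  assumes "0 < D" "0 < \<nu>" "\<nu> < 1"
  shows "stiffness D \<nu> ((1 / (D * (1 - \<nu>))) *\<^sub>R (\<sigma> - (\<nu> / (1 + \<nu>) * trace \<sigma>) *\<^sub>R mat 1)) = \<sigma>"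
    "(1 / (D * (1 - \<nu>))) *\<^sub>R (stiffness D \<nu> \<sigma> - (\<nu> / (1 + \<nu>) * trace (stiffness D \<nu> \<sigma>)) *\<^sub>R mat 1) = \<sigma>"
proof -
  have nz: "D \<noteq> 0" "1 - \<nu> \<noteq> 0" "1 + \<nu> \<noteq> 0" using assms by auto
  let ?m = "mat 1 :: tensor"
  have lin: "trace (A - r *\<^sub>R B) = trace A - r * trace B" "trace (A + r *\<^sub>R B) = trace A + r * trace B"
    "trace (r *\<^sub>R A) = r * trace A" for A B :: tensor and r
    by (simp_all add: trace_def sum_2 algebra_simps)
  have m: "trace ?m = 2" by (simp add: trace_def mat_def)
  have tr1: "trace ((1 / (D * (1 - \<nu>))) *\<^sub>R (\<sigma> - (\<nu> / (1 + \<nu>) * trace \<sigma>) *\<^sub>R ?m)) = trace \<sigma> / (D * (1 + \<nu>))"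
    unfolding lin m using nz by (simp add: divide_simps) (simp add: algebra_simps)
  have tr2: "trace (stiffness D \<nu> \<sigma>) = D * (1 + \<nu>) * trace \<sigma>"
    unfolding stiffness_def lin m by (simp add: algebra_simps)
  show "stiffness D \<nu> ((1 / (D * (1 - \<nu>))) *\<^sub>R (\<sigma> - (\<nu> / (1 + \<nu>) * trace \<sigma>) *\<^sub>R ?m)) = \<sigma>"
    unfolding stiffness_def tr1 using nz
    by (simp add: scaleR_add_right scaleR_diff_right)
  show "(1 / (D * (1 - \<nu>))) *\<^sub>R (stiffness D \<nu> \<sigma> - (\<nu> / (1 + \<nu>) * trace (stiffness D \<nu> \<sigma>)) *\<^sub>R ?m) = \<sigma>"
    unfolding tr2 unfolding stiffness_def using nz
    by (simp add: scaleR_add_right scaleR_diff_right)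
qed

lemma sym_tensors_iff: "A \<in> sym_tensors \<longleftrightarrow> A $ 1 $ 2 = A $ 2 $ 1"
  by (auto simp: sym_tensors_def transpose_def vec_eq_iff forall_2)

lemma compliance_eq:
  assumes "0 < D" "0 < \<nu>" "\<nu> < 1" "\<sigma> \<in> sym_tensors"
  shows "compliance D \<nu> \<sigma> = (1 / (D * (1 - \<nu>))) *\<^sub>R (\<sigma> - (\<nu> / (1 + \<nu>) * trace \<sigma>) *\<^sub>R mat 1)"
proof -
  have "inj_on (stiffness D \<nu>) sym_tensors"
    by (rule inj_on_inverseI) (rule stiffness_inverse(2)[OF assms(1-3)])
  then show ?thesis
    unfolding compliance_def
    by (rule inv_into_f_eq) (use assms(4) in \<open>simp add: sym_tensors_iff mat_def\<close>, rule stiffness_inverse(1)[OF assms(1-3)])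
qed

text \<open>The deviatoric part. Stiffness and compliance act as scalars on trace-free tensors and
  on multiples of the identity, so splitting into \<open>dev\<close> and \<open>trace\<close>
  diagonalizes them.\<close>

definition dev :: "tensor \<Rightarrow> tensor" where
  "dev A = A - (trace A / 2) *\<^sub>R mat 1"

lemma inner_dev: "A \<bullet> B = dev A \<bullet> dev B + 1 / 2 * (trace A * trace B)"
  by (simp add: dev_def trace_def inner_vec_def sum_2 mat_def field_simps)

text \<open>The eigenvalues are 1/(D (1 - \<nu>)) on trace-free tensors and 1/(D (1 + \<nu>)) on
  multiples of the identity. The additional 2 in the trace term is the squared Frobenius norm of the
  identity.\<close>

lemma compliance_inner:
  assumes "0 < D" "0 < \<nu>" "\<nu> < 1" "\<sigma> \<in> sym_tensors"
  shows "compliance D \<nu> \<sigma> \<bullet> \<tau> = 1 / (D * (1 - \<nu>)) * (dev \<sigma> \<bullet> dev \<tau>) + 1 / (2 * D * (1 + \<nu>)) * (trace \<sigma> * trace \<tau>)"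
proof -
  have nz: "D \<noteq> 0" "1 - \<nu> \<noteq> 0" "1 + \<nu> \<noteq> 0" using assms by auto
  have m: "mat 1 \<bullet> \<tau> = trace \<tau>" by (simp add: trace_def inner_vec_def sum_2 mat_def)
  have "compliance D \<nu> \<sigma> \<bullet> \<tau> = 1 / (D * (1 - \<nu>)) * (\<sigma> \<bullet> \<tau> - \<nu> / (1 + \<nu>) * trace \<sigma> * trace \<tau>)"
    unfolding compliance_eq[OF assms] by (simp add: inner_diff_left m)
  also have "\<dots> = 1 / (D * (1 - \<nu>)) * (dev \<sigma> \<bullet> dev \<tau>) + 1 / (D * (1 - \<nu>)) * (1 / 2 - \<nu> / (1 + \<nu>)) * (trace \<sigma> * trace \<tau>)"
    unfolding inner_dev[of \<sigma> \<tau>] by (simp add: algebra_simps)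
  also have "1 / (D * (1 - \<nu>)) * (1 / 2 - \<nu> / (1 + \<nu>)) = 1 / (2 * D * (1 + \<nu>))"
    using nz by (simp add: divide_simps)
  finally show ?thesis .
qed

lemma dev_lin: "dev (r *\<^sub>R A + B) = r *\<^sub>R dev A + dev B" "trace (r *\<^sub>R A + B) = r * trace A + trace B" for A B :: tensor
  by (simp_all add: dev_def trace_def sum_2 vec_eq_iff mat_def forall_2 algebra_simps add_divide_distrib)

section \<open>The bilinear forms\<close>

text \<open>After the splitting of the compliance, every part of \<open>form_a\<close> is an inner
  product of quantities linear in the unknowns. Assembling the form from pullbacks, sums and
  nonnegative multiples yields Cauchy-Schwarz for it as a whole.\<close>

lemma semi_inner_pull:
  assumes "semi_inner W Q" "subspace V" "linear_on' V f" "\<And>s. s \<in> V \<Longrightarrow> f s \<in> W"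
  shows "semi_inner V (\<lambda>s t. Q (f s) (f t))"
  using assms(2-4) semi_innerD[OF assms(1)]
  unfolding semi_inner_def bilinear_on_def linear_on'_def by simp

lemma semi_inner_add:
  "semi_inner V Q1 \<Longrightarrow> semi_inner V Q2 \<Longrightarrow> semi_inner V (\<lambda>s t. Q1 s t + Q2 s t)"
  unfolding semi_inner_def bilinear_on_def by (simp add: algebra_simps)

lemma semi_inner_cmult:
  "semi_inner V Q \<Longrightarrow> 0 \<le> c \<Longrightarrow> semi_inner V (\<lambda>s t. c * Q s t)"
  unfolding semi_inner_def bilinear_on_def by (simp add: algebra_simps)

lemma semi_inner_sum:
  assumes "subspace V" "\<And>i. i \<in> I \<Longrightarrow> semi_inner V (Q i)"
  shows "semi_inner V (\<lambda>s t. \<Sum>i\<in>I. Q i s t)"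
proof -
  have z: "semi_inner V (\<lambda>s t. 0)" using assms(1) by (simp add: semi_inner_def bilinear_on_def)
  show ?thesis using assms(2)
  proof (induction I rule: infinite_finite_induct)
    case (insert i I)
    then show ?case using semi_inner_add[of V "Q i" "\<lambda>s t. \<Sum>i\<in>I. Q i s t"] by simp
  qed (simp_all add: z)
qed

lemma semi_inner_cong:
  assumes "semi_inner V Q" "\<And>s t. s \<in> V \<Longrightarrow> t \<in> V \<Longrightarrow> Q' s t = Q s t"
  shows "semi_inner V Q'"
  using assms semi_innerD(1)[OF assms(1)] unfolding semi_inner_def bilinear_on_def
  by (simp add: subspace_add subspace_scale)

context plate_mesh
begin

abbreviation "PC T t \<equiv> P_cell l M T (mkd t)"

lemma PC:
  assumes "T \<in> elems M" "t \<in> Svec l M"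
  shows "PC T t \<in> Poly_sym l" "continuous_on UNIV (PC T t)" "PC T t x \<in> sym_tensors"
    "continuous_on UNIV (\<lambda>x. dev (PC T t x))" (is ?A) "continuous_on UNIV (\<lambda>x. trace (PC T t x))" (is ?B)
proof -
  show p: "PC T t \<in> Poly_sym l" by (rule P_cell_props(1)[OF SvecD[OF assms(2)] assms(1)])
  then show c: "continuous_on UNIV (PC T t)" "PC T t x \<in> sym_tensors" by (auto simp: Poly_sym_continuous Poly_sym_def)
  show ?B unfolding trace_def by (intro continuous_intros c)
  then show ?A unfolding dev_def by (intro continuous_intros c) auto
qed

lemma PC_lin:
  assumes "T \<in> elems M" "s \<in> Svec l M" "t \<in> Svec l M"
  shows "PC T (r *\<^sub>R s + t) x = r *\<^sub>R PC T s x + PC T t x"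
  using P_cell_comb[OF SvecD[OF assms(2)] SvecD[OF assms(3)] assms(1)] by simp

lemma cell_semi_inner:
  assumes T: "T \<in> elems M"
  shows "semi_inner (Svec l M) (\<lambda>s t. LINT x:T|lebesgue. dev (PC T s x) \<bullet> dev (PC T t x))" (is ?A)
    "semi_inner (Svec l M) (\<lambda>s t. LINT x:T|lebesgue. trace (PC T s x) * trace (PC T t x))" (is ?B)
proof -
  have l1: "linear_on' (Svec l M) (\<lambda>t x. dev (PC T t x))" "linear_on' (Svec l M) (\<lambda>t x. trace (PC T t x))"
    by (rule linear_on'I[OF subspace_Svec], simp add: fun_eq_iff PC_lin[OF T] dev_lin)+
  show ?A
    by (rule semi_inner_pull[OF semi_inner_region[OF elem(1,2)[OF T]] subspace_Svec l1(1)]) (simp add: PC[OF T])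
  show ?B
    using semi_inner_pull[OF semi_inner_region[OF elem(1,2)[OF T]] subspace_Svec l1(2)] PC[OF T] by simp
qed

lemma cell_split:
  assumes T: "T \<in> elems M" and st: "s \<in> Svec l M" "t \<in> Svec l M"
  shows "(LINT x:T|lebesgue. PC T s x \<bullet> PC T t x) = (LINT x:T|lebesgue. dev (PC T s x) \<bullet> dev (PC T t x)) +
      1 / 2 * (LINT x:T|lebesgue. trace (PC T s x) * trace (PC T t x))" (is ?A)
    "0 < D \<Longrightarrow> 0 < \<nu> \<Longrightarrow> \<nu> < 1 \<Longrightarrow> (LINT x:T|lebesgue. compliance D \<nu> (PC T s x) \<bullet> PC T t x) =
      1 / (D * (1 - \<nu>)) * (LINT x:T|lebesgue. dev (PC T s x) \<bullet> dev (PC T t x)) +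
      1 / (2 * D * (1 + \<nu>)) * (LINT x:T|lebesgue. trace (PC T s x) * trace (PC T t x))"
proof -
  note c = PC(4,5)[OF T st(1)] PC(4,5)[OF T st(2)]
  note I = set_integrable_continuous(2)[OF elem(2)[OF T] borel_open[OF elem(1)[OF T]]]
  have split: "(LINT x:T|lebesgue. a * (dev (PC T s x) \<bullet> dev (PC T t x)) + b * (trace (PC T s x) * trace (PC T t x))) =
    a * (LINT x:T|lebesgue. dev (PC T s x) \<bullet> dev (PC T t x)) + b * (LINT x:T|lebesgue. trace (PC T s x) * trace (PC T t x))" for a b
    by (subst set_integral_add(2)) (auto intro!: I continuous_intros c)
  show ?A unfolding inner_dev[of "PC T s _"] using split[of 1 "1 / 2"] by simp
  show "(LINT x:T|lebesgue. compliance D \<nu> (PC T s x) \<bullet> PC T t x) =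
      1 / (D * (1 - \<nu>)) * (LINT x:T|lebesgue. dev (PC T s x) \<bullet> dev (PC T t x)) +
      1 / (2 * D * (1 + \<nu>)) * (LINT x:T|lebesgue. trace (PC T s x) * trace (PC T t x))" if "0 < D" "0 < \<nu>" "\<nu> < 1"
    unfolding compliance_inner[OF that PC(3)[OF T st(1)]] by (rule split)
qed

lemma P_cell_edge:
  assumes T: "T \<in> elems M" and s: "s \<in> Svec l M" "t \<in> Svec l M"
  shows "dir_deriv d (\<lambda>y. (PC T (r *\<^sub>R s + t) y *v n) \<bullet> e) x = r * dir_deriv d (\<lambda>y. (PC T s y *v n) \<bullet> e) x + dir_deriv d (\<lambda>y. (PC T t y *v n) \<bullet> e) x" (is ?A)
    "row_div (PC T (r *\<^sub>R s + t)) x = r *\<^sub>R row_div (PC T s) x + row_div (PC T t) x" (is ?B)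
proof -
  note P = PC(1)[OF T s(1)] PC(1)[OF T s(2)]
  note cp = P(1)[THEN Poly_symD(1)] P(2)[THEN Poly_symD(1)]
  note p = tensor_edge_Poly(1)[OF P(1)] tensor_edge_Poly(1)[OF P(2)]
  show ?A
    unfolding PC_lin[OF T s] tensor_vec_lin inner_add_left inner_scaleR_left dir_deriv_add[OF Poly_cmult[OF p(1)] p(2)] dir_deriv_cmult[OF p(1)] ..
  show ?B
    unfolding row_div_def PC_lin[OF T s] vector_add_component vector_scaleR_component real_scaleR_def
      dir_deriv_add[OF Poly_cmult[OF cp(1)] cp(2)] dir_deriv_cmult[OF cp(1)]
    by (simp add: vec_eq_iff sum.distrib sum_distrib_left)
qed

lemma delta_linear:
  assumes T: "T \<in> elems M" and E: "E \<in> elem_edges M T"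
  shows "linear_on' (Svec l M) (\<lambda>t. delta1 l M T E (mkd t))" (is ?A) "linear_on' (Svec l M) (\<lambda>t. delta2 l M T E (mkd t))" (is ?B)
    "linear_on' (Svec l M) (\<lambda>t. deltaV l M T (mkd t) V)" (is ?C)
    "t \<in> Svec l M \<Longrightarrow> continuous_on (closure E) (delta1 l M T E (mkd t))"
    "t \<in> Svec l M \<Longrightarrow> continuous_on (closure E) (delta2 l M T E (mkd t))"
proof -
  note e = elem_edge[OF E]
  note lin = linear_on'I[OF subspace_Svec]
  show ?A
    by (rule lin) (simp add: fun_eq_iff delta1_def P_edge_comb[OF SvecD SvecD e(2)] PC_lin[OF T] tensor_vec_lin inner_add_left right_diff_distrib)
  show ?B
    by (rule lin) (simp add: fun_eq_iff delta2_def P_cell_edge[OF T] inner_add_left right_diff_distrib distrib_left)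
  show ?C
    by (rule lin) (simp add: deltaV_def PC_lin[OF T] scaleR_diff_right)
  assume t: "t \<in> Svec l M"
  note p = tensor_edge_Poly[OF PC(1)[OF T t]]
  show "continuous_on (closure E) (delta1 l M T E (mkd t))" "continuous_on (closure E) (delta2 l M T E (mkd t))"
    unfolding delta1_def[abs_def] delta2_def[abs_def]
    by (intro continuous_intros Poly_continuous_on[OF p(1)] P_edge_props(4)[OF SvecD[OF t] e(2)],
      intro continuous_intros Poly_continuous_on[OF dir_deriv_Poly[OF p(1)]]
        Poly_continuous_on[OF p(2)] SigmaD(8)[OF SvecD[OF t] e(2)])
qed

lemma stab_split:
  assumes T: "T \<in> elems M" and st: "s \<in> Svec l M" "t \<in> Svec l M"
  shows "stab l M T (mkd s) (mkd t) = (\<Sum>E\<in>elem_edges M T.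
        diameter T * edge_integral E (\<lambda>x. delta1 l M T E (mkd s) x * delta1 l M T E (mkd t) x)
        + diameter T ^ 3 * edge_integral E (\<lambda>x. delta2 l M T E (mkd s) x * delta2 l M T E (mkd t) x))
     + (\<Sum>V\<in>elem_verts M T. (diameter T)\<^sup>2 * (deltaV l M T (mkd s) V \<bullet> deltaV l M T (mkd t) V))"
  unfolding stab_def mult.assoc
proof (intro arg_cong2[of _ _ _ _ "(+)"] sum.cong refl)
  fix E assume E: "E \<in> elem_edges M T"
  note c = delta_linear(4,5)[OF T E st(1)] delta_linear(4,5)[OF T E st(2)]
  note e = elem_edge(1)[OF E]
  show "edge_integral E (\<lambda>x. diameter T * (delta1 l M T E (mkd s) x * delta1 l M T E (mkd t) x)
        + diameter T ^ 3 * (delta2 l M T E (mkd s) x * delta2 l M T E (mkd t) x)) =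
    diameter T * edge_integral E (\<lambda>x. delta1 l M T E (mkd s) x * delta1 l M T E (mkd t) x)
        + diameter T ^ 3 * edge_integral E (\<lambda>x. delta2 l M T E (mkd s) x * delta2 l M T E (mkd t) x)"
    unfolding edge_integral_cmult[OF e, symmetric] by (intro edge_integral_add[OF e] continuous_intros c)
qed

lemma stab_semi_inner:
  assumes T: "T \<in> elems M"
  shows "semi_inner (Svec l M) (\<lambda>s t. stab l M T (mkd s) (mkd t))"
proof -
  have h: "0 \<le> diameter T" using elem(2)[OF T] by (rule diameter_ge_0)
  have UI: "semi_inner UNIV ((\<bullet>) :: tensor \<Rightarrow> tensor \<Rightarrow> real)"
    by (simp add: semi_inner_def bilinear_on_def inner_add_left inner_add_right inner_commute)
  have "semi_inner (Svec l M) (\<lambda>s t. (\<Sum>E\<in>elem_edges M T.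
        diameter T * edge_integral E (\<lambda>x. delta1 l M T E (mkd s) x * delta1 l M T E (mkd t) x)
        + diameter T ^ 3 * edge_integral E (\<lambda>x. delta2 l M T E (mkd s) x * delta2 l M T E (mkd t) x))
     + (\<Sum>V\<in>elem_verts M T. (diameter T)\<^sup>2 * (deltaV l M T (mkd s) V \<bullet> deltaV l M T (mkd t) V)))"
  proof (intro semi_inner_add semi_inner_sum semi_inner_cmult subspace_Svec)
    fix E assume E: "E \<in> elem_edges M T"
    note e = semi_inner_edge[OF elem_edge(1)[OF E]]
    show "semi_inner (Svec l M) (\<lambda>s t. edge_integral E (\<lambda>x. delta1 l M T E (mkd s) x * delta1 l M T E (mkd t) x))"
      by (rule semi_inner_pull[OF e subspace_Svec delta_linear(1)[OF T E]]) (simp add: delta_linear(4)[OF T E])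
    show "semi_inner (Svec l M) (\<lambda>s t. edge_integral E (\<lambda>x. delta2 l M T E (mkd s) x * delta2 l M T E (mkd t) x))"
      by (rule semi_inner_pull[OF e subspace_Svec delta_linear(2)[OF T E]]) (simp add: delta_linear(5)[OF T E])
  next
    fix V assume "V \<in> elem_verts M T"
    then obtain E where E: "E \<in> elem_edges M T" by (auto simp: elem_verts_def)
    show "semi_inner (Svec l M) (\<lambda>s t. deltaV l M T (mkd s) V \<bullet> deltaV l M T (mkd t) V)"
      by (rule semi_inner_pull[OF UI subspace_Svec delta_linear(3)[OF T E]]) simp
  qed (use h in auto)
  then show ?thesis by (rule semi_inner_cong) (rule stab_split[OF T])
qed

definition normsq :: "dvec \<Rightarrow> real" where
  "normsq t = (\<Sum>T\<in>elems M. (LINT x:T|lebesgue. PC T t x \<bullet> PC T t x) + stab l M T (mkd t) (mkd t))"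

lemma stab_nonneg: "T \<in> elems M \<Longrightarrow> t \<in> Svec l M \<Longrightarrow> 0 \<le> stab l M T (mkd t) (mkd t)"
  by (rule semi_innerD(8)[OF stab_semi_inner])

lemma norm_Sigma_sq:
  assumes "t \<in> Svec l M"
  shows "(norm_Sigma l M (mkd t))\<^sup>2 = normsq t" "0 \<le> normsq t"
proof -
  show 0: "0 \<le> normsq t"
    unfolding normsq_def using stab_nonneg[OF _ assms] by (intro sum_nonneg add_nonneg_nonneg set_integral_ge_0) auto
  then show "(norm_Sigma l M (mkd t))\<^sup>2 = normsq t"
    by (simp add: norm_Sigma_def normsq_def power2_norm_eq_inner)
qed

lemma form_a_semi_inner:
  assumes "0 < D" "0 < \<nu>" "\<nu> < 1"
  shows "semi_inner (Svec l M) (\<lambda>s t. form_a l M D \<nu> (mkd s) (mkd t))"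
proof -
  have "semi_inner (Svec l M) (\<lambda>s t. \<Sum>T\<in>elems M.
      (1 / (D * (1 - \<nu>)) * (LINT x:T|lebesgue. dev (PC T s x) \<bullet> dev (PC T t x)) +
      1 / (2 * D * (1 + \<nu>)) * (LINT x:T|lebesgue. trace (PC T s x) * trace (PC T t x)))
      + 1 / (D * (1 + \<nu>)) * stab l M T (mkd s) (mkd t))"
    using assms by (intro semi_inner_sum semi_inner_add semi_inner_cmult subspace_Svec cell_semi_inner stab_semi_inner) auto
  then show ?thesis
    by (rule semi_inner_cong) (simp add: form_a_def cell_split(2)[OF _ _ _ assms] cong: sum.cong)
qed

text \<open>The trace-free part has the larger of the two eigenvalues, the trace part and the
  stabilization have the smaller one; the squared norm has the same three parts with weights 1, 1/2
  and 1.\<close>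

lemma form_a_bounds:
  assumes "0 < D" "0 < \<nu>" "\<nu> < 1" and t: "t \<in> Svec l M"
  shows "1 / (D * (1 + \<nu>)) * normsq t \<le> form_a l M D \<nu> (mkd t) (mkd t)"
    "form_a l M D \<nu> (mkd t) (mkd t) \<le> 1 / (D * (1 - \<nu>)) * normsq t"
proof -
  let ?a = "1 / (D * (1 - \<nu>))" and ?b = "1 / (2 * D * (1 + \<nu>))" and ?c = "1 / (D * (1 + \<nu>))"
  have c: "?c \<le> ?a" "?b = ?c / 2" "0 \<le> ?c" using assms by (auto simp: frac_le)
  have X: "0 \<le> (LINT x:T|lebesgue. dev (PC T t x) \<bullet> dev (PC T t x))" "0 \<le> (LINT x:T|lebesgue. trace (PC T t x) * trace (PC T t x))"
    for T by (intro set_integral_ge_0; simp)+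
  have lo: "c * (X + 1 / 2 * Y + S) \<le> a * X + c / 2 * Y + c * S" and hi: "a * X + c / 2 * Y + c * S \<le> a * (X + 1 / 2 * Y + S)"
    if "0 \<le> X" "0 \<le> Y" "0 \<le> S" "c \<le> a" for a c X Y S :: real
    using mult_right_mono[OF that(4,1)] mult_right_mono[OF that(4,2)] mult_right_mono[OF that(4,3)] by (simp_all add: algebra_simps)
  show "?c * normsq t \<le> form_a l M D \<nu> (mkd t) (mkd t)" "form_a l M D \<nu> (mkd t) (mkd t) \<le> ?a * normsq t"
    unfolding form_a_def normsq_def sum_distrib_left
    using lo[OF X stab_nonneg[OF _ t] c(1)] hi[OF X stab_nonneg[OF _ t] c(1)]
    by (intro sum_mono; simp only: cell_split[OF _ t t] cell_split(2)[OF _ t t assms(1-3)] c(2))+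
qed

lemma form_a_CS:
  assumes "0 < D" "0 < \<nu>" "\<nu> < 1" and st: "s \<in> Svec l M" "t \<in> Svec l M"
  shows "\<bar>form_a l M D \<nu> (mkd s) (mkd t)\<bar> \<le> 1 / (D * (1 - \<nu>)) * (norm_Sigma l M (mkd s) * norm_Sigma l M (mkd t))"
proof -
  let ?a = "1 / (D * (1 - \<nu>))"
  have a: "0 \<le> ?a" using assms by simp
  have n: "0 \<le> norm_Sigma l M (mkd t)" "norm_Sigma l M (mkd t) = sqrt (normsq t)" if "t \<in> Svec l M" for t
    using norm_Sigma_sq[OF that] by (simp_all add: norm_Sigma_def normsq_def power2_norm_eq_inner)
  have b: "sqrt (form_a l M D \<nu> (mkd t) (mkd t)) \<le> sqrt ?a * norm_Sigma l M (mkd t)" if "t \<in> Svec l M" for t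
    unfolding n(2)[OF that] real_sqrt_mult[symmetric] using form_a_bounds(2)[OF assms(1-3) that] by simp
  have "\<bar>form_a l M D \<nu> (mkd s) (mkd t)\<bar> \<le> (sqrt ?a * norm_Sigma l M (mkd s)) * (sqrt ?a * norm_Sigma l M (mkd t))"
    by (rule order_trans[OF semi_inner_CS_abs[OF form_a_semi_inner[OF assms(1-3)] st] mult_mono[OF b[OF st(1)] b[OF st(2)]]])
      (use a n st form_a_bounds(1)[OF assms(1-3)] norm_Sigma_sq(2) semi_innerD(8)[OF form_a_semi_inner[OF assms(1-3)]] in auto)
  also have "\<dots> = (sqrt ?a * sqrt ?a) * (norm_Sigma l M (mkd s) * norm_Sigma l M (mkd t))" by (simp only: mult_ac)
  finally show ?thesis using a by simp
qed

end

section \<open>Square-integrable functions and broken polynomials\<close>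

text \<open>Serves the load term: f is merely square integrable, so the integral of f v is outside
  the setting of continuous functions used for the discrete quantities.\<close>

lemma semi_inner_square_integrable:
  assumes "S \<in> sets lebesgue"
  shows "semi_inner {f. square_integrable S f} (\<lambda>f g. LINT x:S|lebesgue. f x * g x)"
proof -
  let ?N = "lebesgue_on S"
  have I: "(LINT x:S|lebesgue. h x) = integral\<^sup>L ?N h" for h :: "point \<Rightarrow> real"
    using assms by (simp add: set_lebesgue_integral_def integral_restrict_space)
  have prod: "integrable ?N (\<lambda>x. f x * g x)" if "square_integrable S f" "square_integrable S g" for f g
  proof (rule Bochner_Integration.integrable_bound[of ?N "\<lambda>x. (f x)\<^sup>2 + (g x)\<^sup>2"])
    show "AE x in ?N. norm (f x * g x) \<le> norm ((f x)\<^sup>2 + (g x)\<^sup>2)"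
    proof (rule AE_I2)
      fix x
      have "2 * (\<bar>f x\<bar> * \<bar>g x\<bar>) \<le> (f x)\<^sup>2 + (g x)\<^sup>2" using sum_squares_bound[of "\<bar>f x\<bar>" "\<bar>g x\<bar>"] by simp
      moreover have "0 \<le> \<bar>f x\<bar> * \<bar>g x\<bar>" by simp
      ultimately have "\<bar>f x\<bar> * \<bar>g x\<bar> \<le> (f x)\<^sup>2 + (g x)\<^sup>2" by linarith
      then show "norm (f x * g x) \<le> norm ((f x)\<^sup>2 + (g x)\<^sup>2)" by (simp add: abs_mult)
    qed
  qed (use that in \<open>auto simp: square_integrable_def\<close>)
  have add: "square_integrable S (f + g)" if "square_integrable S f" "square_integrable S g" for f g
    unfolding square_integrable_def
  proof
    show m: "f + g \<in> borel_measurable ?N"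
      unfolding plus_fun_def using that by (auto simp: square_integrable_def)
    have "integrable ?N (\<lambda>x. (f x)\<^sup>2 + 2 * (f x * g x) + (g x)\<^sup>2)"
      using that prod[OF that] by (auto simp: square_integrable_def)
    then show "integrable ?N (\<lambda>x. ((f + g) x)\<^sup>2)" by (simp add: power2_sum algebra_simps)
  qed
  have scale: "square_integrable S (r *\<^sub>R f)" if "square_integrable S f" for f r
    using that unfolding square_integrable_def scaleR_fun_def by (auto simp: power_mult_distrib)
  have zero: "square_integrable S 0" by (simp add: square_integrable_def zero_fun_def)
  show ?thesis
    unfolding semi_inner_def bilinear_on_def subspace_def I
    using prod add scale zero by (auto simp: distrib_left distrib_right mult.commute mult.left_commute)
qed

context plate_mesh
begin

lemma elem_subset: "T \<in> elems M \<Longrightarrow> T \<subseteq> \<Omega>"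
proof -
  assume T: "T \<in> elems M"
  then have "T \<subseteq> closure \<Omega>" using meshD(9)[OF mesh] closure_subset[of T] by blast
  then have "T \<subseteq> interior (closure \<Omega>)" by (rule interior_maximal[OF _ elem(1)[OF T]])
  then show ?thesis using Om by (simp add: polygonal_def)
qed

lemma Omega_lebesgue: "\<Omega> \<in> sets lebesgue"
  using Om by (simp add: polygonal_def)

text \<open>A broken polynomial carries information only on the open elements. Its traces,
  derivatives and jumps on edges are those of this polynomial.\<close>

definition rep :: "(point \<Rightarrow> real) \<Rightarrow> region \<Rightarrow> point \<Rightarrow> real" where
  "rep v T = (SOME p. p \<in> Poly (l - 1) \<and> (\<forall>x\<in>T. v x = p x))"

lemma rep:
  assumes "v \<in> Poly_broken (l - 1) M" "T \<in> elems M"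
  shows "rep v T \<in> Poly (l - 1)" "x \<in> T \<Longrightarrow> v x = rep v T x"
proof -
  have "\<exists>p. p \<in> Poly (l - 1) \<and> (\<forall>x\<in>T. v x = p x)" using assms unfolding Poly_broken_def by blast
  from someI_ex[OF this] show "rep v T \<in> Poly (l - 1)" "x \<in> T \<Longrightarrow> v x = rep v T x"
    unfolding rep_def by blast+
qed

lemma broken_off: "v \<in> Poly_broken (l - 1) M \<Longrightarrow> x \<notin> \<Union>(elems M) \<Longrightarrow> v x = 0"
  by (simp add: Poly_broken_def)

text \<open>The elements cover \<Omega> only up to edges and vertices. Because broken polynomials
  are zero there, the decomposition over elements holds at every point and not just almost
  everywhere.\<close>

lemma sum_indicator:
  fixes g :: "point \<Rightarrow> real"
  assumes "\<And>x. x \<notin> \<Union>(elems M) \<Longrightarrow> g x = 0"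
  shows "(\<Sum>T\<in>elems M. indicator T x * g x) = indicator \<Omega> x * g x" (is ?A) "(\<Sum>T\<in>elems M. indicator T x * g x) = g x" (is ?B)
proof -
  have "(\<Sum>T\<in>elems M. indicator T x * g x) = g x \<and> (g x = 0 \<or> x \<in> \<Omega>)"
  proof (cases "x \<in> \<Union>(elems M)")
    case True
    then obtain T where T: "T \<in> elems M" "x \<in> T" by blast
    have z: "(\<Sum>S\<in>elems M - {T}. indicator S x * g x) = 0"
    proof (intro sum.neutral ballI)
      fix S assume "S \<in> elems M - {T}"
      then have "x \<notin> S" using meshD(6)[OF mesh T(1), of S] T(2) by blast
      then show "indicator S x * g x = 0" by simp
    qed
    show ?thesis unfolding sum.remove[OF meshD(1)[OF mesh] T(1)] z
      using T(2) elem_subset[OF T(1)] by auto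
  qed (use assms in auto)
  then show ?A ?B
    by (auto simp: indicator_def)
qed

lemma broken_cell_integrable:
  assumes v: "v \<in> Poly_broken (l - 1) M" and T: "T \<in> elems M" and f: "continuous_on UNIV f"
  shows "set_integrable lebesgue T (\<lambda>x. f x * v x)" (is ?A) "(LINT x:T|lebesgue. f x * v x) = (LINT x:T|lebesgue. f x * rep v T x)" (is ?B)
    "set_integrable lebesgue T (\<lambda>x. (v x)\<^sup>2)" (is ?C) "(LINT x:T|lebesgue. (v x)\<^sup>2) = (L2n T (rep v T))\<^sup>2" (is ?D)
proof -
  note c = Poly_continuous_on[OF rep(1)[OF v T], of UNIV]
  note I = set_integrable_continuous(2)[OF elem(2)[OF T] borel_open[OF elem(1)[OF T]]]
  have Ts: "T \<in> sets lebesgue" using elem(1)[OF T] by simp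
  have cong: "set_integrable lebesgue T (\<lambda>x. G (v x) x) \<longleftrightarrow> set_integrable lebesgue T (\<lambda>x. G (rep v T x) x)"
    for G :: "real \<Rightarrow> point \<Rightarrow> real"
    using rep(2)[OF v T] by (intro set_integrable_cong) auto
  have cong2: "(LINT x:T|lebesgue. G (v x) x) = (LINT x:T|lebesgue. G (rep v T x) x)"
    for G :: "real \<Rightarrow> point \<Rightarrow> real"
    using rep(2)[OF v T] Ts by (intro set_lebesgue_integral_cong) auto
  show ?A
    unfolding cong[of "\<lambda>v x. f x * v"] by (intro I continuous_intros c f)
  show ?C
    unfolding cong[of "\<lambda>v x. v\<^sup>2"] by (intro I continuous_intros c)
  show ?B by (rule cong2[of "\<lambda>v x. f x * v"])
  show ?D using cong2[of "\<lambda>v x. v\<^sup>2"] by (simp add: L2n_sq)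
qed

lemma broken_L2:
  assumes v: "v \<in> Poly_broken (l - 1) M"
  shows "square_integrable \<Omega> v" "(L2_norm_on \<Omega> v)\<^sup>2 = (\<Sum>T\<in>elems M. (L2n T (rep v T))\<^sup>2)" (is ?A)
proof -
  have off: "(v x)\<^sup>2 = 0" if "x \<notin> \<Union>(elems M)" for x using broken_off[OF v that] by simp
  have s: "(\<Sum>T\<in>elems M. indicator T x * (v x)\<^sup>2) = indicator \<Omega> x * (v x)\<^sup>2" for x
    by (rule sum_indicator(1)) (rule off)
  note i = broken_cell_integrable(3,4)[OF v _ continuous_on_const[of UNIV "0 :: real"]]
  have int: "integrable lebesgue (\<lambda>x. indicator \<Omega> x * (v x)\<^sup>2)"
  proof -
    have "integrable lebesgue (\<lambda>x. \<Sum>T\<in>elems M. indicator T x * (v x)\<^sup>2)"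
      using i(1) by (intro Bochner_Integration.integrable_sum) (simp add: set_integrable_def)
    then show ?thesis by (simp only: s)
  qed
  have "(LINT x:\<Omega>|lebesgue. (v x)\<^sup>2) = (\<Sum>T\<in>elems M. (L2n T (rep v T))\<^sup>2)"
  proof -
    have "(LINT x:\<Omega>|lebesgue. (v x)\<^sup>2) = (LINT x|lebesgue. (\<Sum>T\<in>elems M. indicator T x * (v x)\<^sup>2))"
      unfolding s by (simp add: set_lebesgue_integral_def)
    also have "\<dots> = (\<Sum>T\<in>elems M. LINT x:T|lebesgue. (v x)\<^sup>2)"
    proof -
      have "(LINT x|lebesgue. (\<Sum>T\<in>elems M. indicator T x * (v x)\<^sup>2)) = (\<Sum>T\<in>elems M. LINT x|lebesgue. indicator T x * (v x)\<^sup>2)"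
        using i(1) by (intro Bochner_Integration.integral_sum) (simp add: set_integrable_def)
      then show ?thesis by (simp add: set_lebesgue_integral_def)
    qed
    finally show ?thesis using i(2) by simp
  qed
  then show ?A
    unfolding L2_norm_on_def by (subst real_sqrt_pow2) (auto intro: sum_nonneg)
  have "v = (\<lambda>x. \<Sum>T\<in>elems M. indicator T x * rep v T x)"
  proof
    fix x
    have "v x = (\<Sum>T\<in>elems M. indicator T x * v x)" using sum_indicator(2)[of v, OF broken_off[OF v]] by simp
    also have "\<dots> = (\<Sum>T\<in>elems M. indicator T x * rep v T x)"
      using rep(2)[OF v] by (intro sum.cong refl) (auto simp: indicator_def)
    finally show "v x = (\<Sum>T\<in>elems M. indicator T x * rep v T x)" .
  qed
  moreover have "(\<lambda>x. \<Sum>T\<in>elems M. indicator T x * rep v T x) \<in> borel_measurable borel"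
    using elem(1) Poly_continuous_on[OF rep(1)[OF v]]
    by (intro borel_measurable_sum borel_measurable_times borel_measurable_indicator borel_measurable_continuous_onI) auto
  ultimately have "v \<in> borel_measurable borel" by metis
  then have "v \<in> borel_measurable lebesgue" by (simp add: measurable_completion)
  then show "square_integrable \<Omega> v"
    unfolding square_integrable_def using int Omega_lebesgue
    by (auto simp: integrable_restrict_space intro: measurable_restrict_space1)
qed

lemma subspace_Poly_broken: "subspace (Poly_broken (l - 1) M)"
proof (rule subspaceI)
  show "0 \<in> Poly_broken (l - 1) M"
    using subspace_0[OF subspace_Poly[of "l - 1"]] by (auto simp: Poly_broken_def intro!: bexI[of _ 0])
  fix u v and r :: real assume u: "u \<in> Poly_broken (l - 1) M"
  show "r *\<^sub>R u \<in> Poly_broken (l - 1) M"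
    unfolding Poly_broken_def
  proof (intro CollectI conjI ballI allI impI)
    fix T assume T: "T \<in> elems M"
    show "\<exists>p\<in>Poly (l - 1). \<forall>x\<in>T. (r *\<^sub>R u) x = p x"
      using rep[OF u T] by (intro bexI[of _ "\<lambda>x. r * rep u T x"] Poly_cmult) auto
  qed (simp add: broken_off[OF u])
  assume v: "v \<in> Poly_broken (l - 1) M"
  show "u + v \<in> Poly_broken (l - 1) M"
    unfolding Poly_broken_def
  proof (intro CollectI conjI ballI allI impI)
    fix T assume T: "T \<in> elems M"
    show "\<exists>p\<in>Poly (l - 1). \<forall>x\<in>T. (u + v) x = p x"
      using rep[OF u T] rep[OF v T] by (intro bexI[of _ "\<lambda>x. rep u T x + rep v T x"] Poly_add) auto
  qed (simp add: broken_off[OF u] broken_off[OF v])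
qed

lemma findim_Poly_broken: "findim (Poly_broken (l - 1) M)"
proof -
  let ?S = "{f. (\<forall>T\<in>elems M. f T \<in> Poly (l - 1)) \<and> (\<forall>T. T \<notin> elems M \<longrightarrow> f T = 0)}"
  let ?j = "\<lambda>(f :: region \<Rightarrow> point \<Rightarrow> real) x. \<Sum>T\<in>elems M. indicator T x * f T x"
  have "subspace ?S"
    by (rule subspaceI) (auto intro: subspace_0[OF subspace_Poly] subspace_add[OF subspace_Poly] subspace_scale[OF subspace_Poly])
  moreover have "findim ?S" by (rule findim_fun[OF meshD(1)[OF mesh] findim_Poly])
  moreover have "linear_on' ?S ?j"
    by (auto simp: linear_on'_def fun_eq_iff distrib_left sum.distrib sum_distrib_left mult.left_commute)
  ultimately have "findim (?j ` ?S)" by (rule findim_image)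
  moreover have "Poly_broken (l - 1) M \<subseteq> ?j ` ?S"
  proof
    fix v assume v: "v \<in> Poly_broken (l - 1) M"
    let ?f = "\<lambda>T. if T \<in> elems M then rep v T else 0"
    have e: "?j ?f = v"
    proof
      fix x
      have "?j ?f x = (\<Sum>T\<in>elems M. indicator T x * v x)"
        using rep(2)[OF v] by (intro sum.cong refl) (auto simp: indicator_def)
      also have "\<dots> = v x" by (rule sum_indicator(2)[OF broken_off[OF v]])
      finally show "?j ?f x = v x" .
    qed
    have m: "?f \<in> ?S" using rep(1)[OF v] by auto
    show "v \<in> ?j ` ?S" by (rule image_eqI[of _ ?j ?f, OF e[symmetric] m])
  qed
  ultimately show ?thesis by (rule findim_mono)
qed

lemma form_b_bilinear: "bilinear_on (Svec l M) (Poly_broken (l - 1) M) (\<lambda>t v. form_b l M (mkd t) v)"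
proof -
  have c: "continuous_on UNIV (DD l M T (mkd t))" if "T \<in> elems M" "t \<in> Svec l M" for T t
    by (rule Poly_continuous_on[OF DD_props(1)[OF SvecD[OF that(2)] that(1)]])
  note I = broken_cell_integrable(1)[OF _ _ c]
  have D: "DD l M T (mkd (s + t)) x = DD l M T (mkd s) x + DD l M T (mkd t) x"
    "DD l M T (mkd (r *\<^sub>R s)) x = r * DD l M T (mkd s) x"
    if "T \<in> elems M" "s \<in> Svec l M" "t \<in> Svec l M" for s t T r x
    using DD_linear[where T = T] that unfolding linear_on'_def by simp_all
  show ?thesis
    unfolding bilinear_on_def form_b_def
  proof (intro conjI ballI allI)
    fix s t v assume st: "s \<in> Svec l M" "t \<in> Svec l M" and v: "v \<in> Poly_broken (l - 1) M"
    show "(\<Sum>T\<in>elems M. LINT x:T|lebesgue. DD l M T (mkd (s + t)) x * v x) =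
      (\<Sum>T\<in>elems M. LINT x:T|lebesgue. DD l M T (mkd s) x * v x) + (\<Sum>T\<in>elems M. LINT x:T|lebesgue. DD l M T (mkd t) x * v x)"
      unfolding sum.distrib[symmetric]
      by (intro sum.cong refl) (simp add: D(1)[OF _ st] distrib_right set_integral_add(2)[OF I[OF v _ _ st(1)] I[OF v _ _ st(2)]])
  next
    fix t u v assume t: "t \<in> Svec l M" and uv: "u \<in> Poly_broken (l - 1) M" "v \<in> Poly_broken (l - 1) M"
    show "(\<Sum>T\<in>elems M. LINT x:T|lebesgue. DD l M T (mkd t) x * (u + v) x) =
      (\<Sum>T\<in>elems M. LINT x:T|lebesgue. DD l M T (mkd t) x * u x) + (\<Sum>T\<in>elems M. LINT x:T|lebesgue. DD l M T (mkd t) x * v x)"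
      unfolding sum.distrib[symmetric]
      by (intro sum.cong refl) (simp add: distrib_left set_integral_add(2)[OF I[OF uv(1) _ _ t] I[OF uv(2) _ _ t]])
  next
    fix r t v assume t: "t \<in> Svec l M"
    show "(\<Sum>T\<in>elems M. LINT x:T|lebesgue. DD l M T (mkd (r *\<^sub>R t)) x * v x) =
      r * (\<Sum>T\<in>elems M. LINT x:T|lebesgue. DD l M T (mkd t) x * v x)"
      unfolding sum_distrib_left by (intro sum.cong refl) (simp add: D(2)[OF _ t t] mult.assoc)
  next
    fix r t and v :: "point \<Rightarrow> real"
    show "(\<Sum>T\<in>elems M. LINT x:T|lebesgue. DD l M T (mkd t) x * (r *\<^sub>R v) x) =
      r * (\<Sum>T\<in>elems M. LINT x:T|lebesgue. DD l M T (mkd t) x * v x)"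
      unfolding sum_distrib_left by (intro sum.cong refl) (simp add: mult.left_commute)
  qed
qed

end

section \<open>Definiteness of the norm\<close>

context plate_estimate
begin

lemma edge_in_elem:
  assumes "E \<in> edges M"
  obtains T where "T \<in> elems M" "E \<in> elem_edges M T"
  using mesh_edgesD(2)[OF mesh assms] assms by (auto simp: elem_edges_def)

lemma Poly_edge_sq_zero:
  assumes "E \<in> edges M" "g \<in> Poly_edge m E" "edge_integral E (\<lambda>x. g x * g x) = 0"
  shows "g = (\<lambda>x. 0)"
proof -
  have "g = 0" using inner_on_Poly_edge[OF meshD(8)[OF mesh assms(1)], of m] assms(2,3) by (simp add: inner_on_def)
  then show ?thesis by (simp add: zero_fun_def)
qed

lemma Poly_sym_sq_zero:
  assumes "T \<in> elems M" "X \<in> Poly_sym m" "(LINT x:T|lebesgue. X x \<bullet> X x) = 0"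
  shows "X = (\<lambda>x. 0)"
proof -
  have "X = 0" using inner_on_Poly_sym[OF assms(1), of m] assms(2,3) by (simp add: inner_on_def)
  then show ?thesis by (simp add: zero_fun_def)
qed

text \<open>If the norm is zero, all cell reconstructions vanish, and the stabilization then
  annihilates \<open>P_edge\<close>, \<open>edge_D\<close> and the vertex values;
  \<open>edge_nn\<close> has the moments of \<open>P_edge\<close> and vanishes as well. In the
  identity for \<open>P_cell\<close> the choice q = 0 with \<open>cell_Hc\<close> as \<upsilon>
  removes \<open>cell_Hc\<close>. Finally \<open>cell_H\<close> is the Hessian of some q of degree l
  - 1; the identity for \<open>P_cell\<close> makes \<open>DD\<close> orthogonal to q, and the
  identity for \<open>DD\<close> says that this pairing is the squared norm of
  \<open>cell_H\<close>.\<close>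

lemma normsq_definite:
  assumes t: "t \<in> Svec l M" and 0: "normsq t = 0"
  shows "t = 0"
proof -
  let ?\<tau> = "mkd t"
  note S = SvecD[OF t]
  have loc: "(LINT x:T|lebesgue. PC T t x \<bullet> PC T t x) = 0" "stab l M T ?\<tau> ?\<tau> = 0" if T: "T \<in> elems M" for T
  proof -
    have nn: "0 \<le> (LINT x:T|lebesgue. PC T t x \<bullet> PC T t x)" "0 \<le> stab l M T ?\<tau> ?\<tau>" if "T \<in> elems M" for T
      using stab_nonneg[OF that t] by (auto intro!: set_integral_ge_0)
    have "(LINT x:T|lebesgue. PC T t x \<bullet> PC T t x) + stab l M T ?\<tau> ?\<tau> = 0"
      using 0 nn T unfolding normsq_def by (subst (asm) sum_nonneg_eq_0_iff[OF meshD(1)[OF mesh]]) auto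
    then show "(LINT x:T|lebesgue. PC T t x \<bullet> PC T t x) = 0" "stab l M T ?\<tau> ?\<tau> = 0" using nn[OF T] by linarith+
  qed
  have P0: "PC T t = (\<lambda>x. 0)" if T: "T \<in> elems M" for T
    by (rule Poly_sym_sq_zero[OF T PC(1)[OF T t] loc(1)[OF T]])
  have st: "edge_integral E (\<lambda>x. delta1 l M T E ?\<tau> x * delta1 l M T E ?\<tau> x) = 0"
    "edge_integral E (\<lambda>x. delta2 l M T E ?\<tau> x * delta2 l M T E ?\<tau> x) = 0"
    "V \<in> elem_verts M T \<Longrightarrow> vert ?\<tau> V = 0"
    if T: "T \<in> elems M" and E: "E \<in> elem_edges M T" for T E V
  proof -
    let ?h = "diameter T"
    let ?a = "\<lambda>E. edge_integral E (\<lambda>x. delta1 l M T E ?\<tau> x * delta1 l M T E ?\<tau> x)"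
    let ?b = "\<lambda>E. edge_integral E (\<lambda>x. delta2 l M T E ?\<tau> x * delta2 l M T E ?\<tau> x)"
    let ?c = "\<lambda>V. ?h\<^sup>2 * (deltaV l M T ?\<tau> V \<bullet> deltaV l M T ?\<tau> V)"
    note h = shapeD(1)[OF T]
    have nn: "0 \<le> ?a E" "0 \<le> ?b E" if "E \<in> elem_edges M T" for E
      using elem_edge(1)[OF that] by (auto intro!: edge_integral_nonneg)
    have e: "0 \<le> ?h * ?a E + ?h ^ 3 * ?b E" if "E \<in> elem_edges M T" for E using nn[OF that] h by simp
    have s: "(\<Sum>E\<in>elem_edges M T. ?h * ?a E + ?h ^ 3 * ?b E) + (\<Sum>V\<in>elem_verts M T. ?c V) = 0"
      using loc(2)[OF T] unfolding stab_split[OF T t t] .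
    have "0 \<le> (\<Sum>E\<in>elem_edges M T. ?h * ?a E + ?h ^ 3 * ?b E)" "0 \<le> (\<Sum>V\<in>elem_verts M T. ?c V)"
      using e by (auto intro!: sum_nonneg)
    with s have s': "(\<Sum>E\<in>elem_edges M T. ?h * ?a E + ?h ^ 3 * ?b E) = 0" "(\<Sum>V\<in>elem_verts M T. ?c V) = 0" by linarith+
    have "?h * ?a E + ?h ^ 3 * ?b E = 0"
      using s'(1) e E by (subst (asm) sum_nonneg_eq_0_iff[OF finite_elem_edges[OF mesh]]) auto
    moreover have "0 \<le> ?h * ?a E" "0 \<le> ?h ^ 3 * ?b E" using nn[OF E] h by auto
    ultimately have "?h * ?a E = 0" "?h ^ 3 * ?b E = 0" by linarith+
    then show "?a E = 0" "?b E = 0" using h by simp_all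
    show "vert ?\<tau> V = 0" if V: "V \<in> elem_verts M T"
    proof -
      have "?c V = 0" using s'(2) V by (subst (asm) sum_nonneg_eq_0_iff[OF finite_card_elem_verts(1)[OF T]]) auto
      then show ?thesis using h by (simp add: deltaV_def P0[OF T])
    qed
  qed
  have edge: "P_edge l M E ?\<tau> = (\<lambda>x. 0)" "edge_D ?\<tau> E = (\<lambda>x. 0)" "edge_nn ?\<tau> E = (\<lambda>x. 0)" if E: "E \<in> edges M" for E
  proof -
    obtain T where T: "T \<in> elems M" "E \<in> elem_edges M T" using E by (rule edge_in_elem)
    show pe: "P_edge l M E ?\<tau> = (\<lambda>x. 0)"
      using st(1)[OF T] by (intro Poly_edge_sq_zero[OF E P_edge_props(1)[OF S E]]) (simp add: delta1_def P0[OF T(1)])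
    show "edge_D ?\<tau> E = (\<lambda>x. 0)"
      using st(2)[OF T] by (intro Poly_edge_sq_zero[OF E SigmaD(4)[OF S E]]) (simp add: delta2_def P0[OF T(1)] row_div_def inner_vec_def)
    show "edge_nn ?\<tau> E = (\<lambda>x. 0)"
      using P_edge_props(3)[OF S E SigmaD(3)[OF S E]] meshD(8)[OF mesh E]
      by (intro Poly_edge_sq_zero[OF E SigmaD(3)[OF S E]]) (simp add: pe)
  qed
  have vert: "vert ?\<tau> V = 0" for V
  proof (cases "V \<in> mesh_verts M")
    case True
    then obtain E where E: "E \<in> edges M" "V \<in> edge_verts E" by (auto simp: mesh_verts_def)
    obtain T where T: "T \<in> elems M" "E \<in> elem_edges M T" using E(1) by (rule edge_in_elem)
    show ?thesis using st(3)[OF T, of V] T(2) E(2) by (auto simp: elem_verts_def)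
  next
    case False
    then show ?thesis using S by (simp add: Sigma_space_def)
  qed
  have b0: "bdry M T ?\<tau> F q = 0" if "\<And>E. E \<in> elem_edges M T \<Longrightarrow> F E = (\<lambda>x. 0)" for T F q
    unfolding bdry_def vert_terms_def using that edge(2)[OF elem_edge(2)] elem_edge(1) by (simp add: vert)
  have cell: "cell_Hc ?\<tau> T = (\<lambda>x. 0)" "cell_H ?\<tau> T = (\<lambda>x. 0)" if T: "T \<in> elems M" for T
  proof -
    have rhs: "(LINT x:T|lebesgue. DD l M T ?\<tau> x * q x) + (LINT x:T|lebesgue. cell_Hc ?\<tau> T x \<bullet> \<upsilon> x) = 0"
      if "q \<in> Poly (l + 2)" "\<upsilon> \<in> Hess_compl l (center M T)" for q \<upsilon>
      using P_cell_props(2)[OF S T that] b0[of T "\<lambda>E. P_edge l M E ?\<tau>" q] edge(1)[OF elem_edge(2)]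
      by (simp add: P_cell_rhs_def P0[OF T])
    have "(LINT x:T|lebesgue. cell_Hc ?\<tau> T x \<bullet> cell_Hc ?\<tau> T x) = 0"
      using rhs[of "\<lambda>x. 0", OF _ SigmaD(2)[OF S T]] l2 by simp
    moreover have "cell_Hc ?\<tau> T \<in> Poly_sym l" using SigmaD(2)[OF S T] Hess_compl_Poly_sym by blast
    ultimately show Hc: "cell_Hc ?\<tau> T = (\<lambda>x. 0)" using Poly_sym_sq_zero[OF T] by blast
    obtain q where q: "q \<in> Poly (l - 1)" "cell_H ?\<tau> T = hess q"
      using SigmaD(1)[OF S T] by (auto simp: Hess_space_def)
    have "q \<in> Poly (l + 2)" using Poly_mono[OF q(1)] by simp
    then have "(LINT x:T|lebesgue. DD l M T ?\<tau> x * q x) = 0"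
      using rhs[OF _ SigmaD(2)[OF S T], of q] by (simp add: Hc)
    then have "(LINT x:T|lebesgue. cell_H ?\<tau> T x \<bullet> cell_H ?\<tau> T x) = 0"
      using DD_props(2)[OF S T q(1)] b0[of T "edge_nn ?\<tau>" q] edge(3)[OF elem_edge(2)] by (simp add: q(2))
    moreover have "cell_H ?\<tau> T \<in> Poly_sym (l + 2 - 2)" unfolding q(2) by (rule hess_Poly_sym) (use Poly_mono[OF q(1)] in simp)
    ultimately show "cell_H ?\<tau> T = (\<lambda>x. 0)" using Poly_sym_sq_zero[OF T] by blast
  qed
  have "cell_H ?\<tau> T = (\<lambda>x. 0)" "cell_Hc ?\<tau> T = (\<lambda>x. 0)" for T
    using cell[of T] S by (cases "T \<in> elems M"; simp add: Sigma_space_def)+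
  moreover have "edge_nn ?\<tau> E = (\<lambda>x. 0)" "edge_D ?\<tau> E = (\<lambda>x. 0)" for E
    using edge[of E] S by (cases "E \<in> edges M"; simp add: Sigma_space_def)+
  ultimately have "?\<tau> = zero_dofs"
    using vert unfolding zero_dofs_def by (intro dofs.equality) (simp_all add: fun_eq_iff)
  then have "mkd t = mkd 0" by (simp add: mkd_zero)
  then show ?thesis by (simp only: mkd_inject)
qed

end

section \<open>The inf-sup condition\<close>

text \<open>The arithmetic behind \<open>gamma_const\<close>. S and U are the norms of the tensor
  and the scalar component, K stands for the supremum, Q is the energy of the scalar component and t
  the norm of the test vector. The bounds in b give Q at most c1 times the square of K + k S, which
  controls U by K and k S. Coercivity, with 1 + \<nu> below 2, controls the square of S by 2 D K W.
  What results is a quadratic inequality for W in which D and k appear through m, and 1 over the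
  root of the square of m plus 1 is \<open>gamma_const\<close>.\<close>

lemma inf_sup_algebra:
  fixes S U K Q t D \<nu> c1 c2 :: real
  assumes D: "0 < D" "0 < \<nu>" "\<nu> < 1" and nn: "0 \<le> S" "0 \<le> U" "0 \<le> K" "0 \<le> Q" "0 \<le> t" "0 \<le> c1" "0 \<le> c2"
    and a: "1 / (D * (1 + \<nu>)) * S\<^sup>2 \<le> K * sqrt (S\<^sup>2 + U\<^sup>2)"
    and b: "Q \<le> (K + 1 / (D * (1 - \<nu>)) * S) * t" "t\<^sup>2 \<le> c1 * Q" "U\<^sup>2 \<le> c2 * Q"
  shows "gamma_const D \<nu> * sqrt (S\<^sup>2 + U\<^sup>2) \<le> 2 * (1 + 2 * (c1 * c2)) * K"
proof -
  define k where "k = 1 / (D * (1 - \<nu>))"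
  define g where "g = K + k * S"
  define W where "W = sqrt (S\<^sup>2 + U\<^sup>2)"
  define c where "c = 1 + 2 * (c1 * c2)"
  define m where "m = D * (1 + k\<^sup>2)"
  have k0: "0 \<le> k" using D by (simp add: k_def)
  have g0: "0 \<le> g" using k0 nn by (simp add: g_def)
  have W0: "0 \<le> W" "W\<^sup>2 = S\<^sup>2 + U\<^sup>2" by (simp_all add: W_def)
  have c: "1 \<le> c" using nn by (simp add: c_def)
  have m0: "0 \<le> m" using D by (simp add: m_def)
  have Qg: "Q \<le> c1 * g\<^sup>2"
  proof -
    have "Q\<^sup>2 \<le> (g * t)\<^sup>2" using b(1) nn by (intro power_mono) (simp_all add: g_def k_def)
    also have "\<dots> \<le> g\<^sup>2 * (c1 * Q)" unfolding power_mult_distrib using b(2) by (rule mult_left_mono) simp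
    finally have "Q * Q \<le> (c1 * g\<^sup>2) * Q" by (simp add: power2_eq_square mult_ac)
    then show ?thesis by (rule square_le_cancel) (use nn in auto)
  qed
  have gsq: "g\<^sup>2 \<le> 2 * K\<^sup>2 + 2 * k\<^sup>2 * S\<^sup>2"
    using sq_sum_le[of K "k * S"] by (simp add: g_def power_mult_distrib)
  have "U\<^sup>2 \<le> c2 * (c1 * (2 * K\<^sup>2 + 2 * k\<^sup>2 * S\<^sup>2))"
    using b(3) Qg gsq nn by (meson mult_left_mono order_trans)
  also have "\<dots> = (c - 1) * K\<^sup>2 + (c - 1) * k\<^sup>2 * S\<^sup>2" by (simp add: c_def algebra_simps)
  finally have "W\<^sup>2 \<le> S\<^sup>2 + ((c - 1) * K\<^sup>2 + (c - 1) * k\<^sup>2 * S\<^sup>2)" using W0 by simp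
  also have "\<dots> \<le> c * (1 + k\<^sup>2) * S\<^sup>2 + c * K\<^sup>2"
  proof -
    have "S\<^sup>2 \<le> c * S\<^sup>2" using mult_right_mono[OF c, of "S\<^sup>2"] by simp
    moreover have "c * (1 + k\<^sup>2) * S\<^sup>2 + c * K\<^sup>2 - (S\<^sup>2 + ((c - 1) * K\<^sup>2 + (c - 1) * k\<^sup>2 * S\<^sup>2)) = (c * S\<^sup>2 - S\<^sup>2) + k\<^sup>2 * S\<^sup>2 + K\<^sup>2"
      by (simp add: algebra_simps)
    moreover have "0 \<le> k\<^sup>2 * S\<^sup>2" "0 \<le> K\<^sup>2" by simp_all
    ultimately show ?thesis by linarith
  qed
  also have "\<dots> \<le> 2 * (c * m * K) * W + c * K\<^sup>2"
  proof -
    have "1 / (2 * D) * S\<^sup>2 \<le> 1 / (D * (1 + \<nu>)) * S\<^sup>2" using D by (intro mult_right_mono frac_le) auto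
    also have "\<dots> \<le> K * W" using a by (simp add: W_def)
    finally have "S\<^sup>2 \<le> 2 * D * (K * W)" using D by (simp add: field_simps)
    then have "c * (1 + k\<^sup>2) * S\<^sup>2 \<le> c * (1 + k\<^sup>2) * (2 * D * (K * W))" using c by (intro mult_left_mono) auto
    then show ?thesis by (simp add: m_def mult_ac)
  qed
  \<comment> \<open>Half of the square of W is split off so that it can be absorbed on the
    left.\<close>
  also have "\<dots> \<le> (2 * (c * m * K)\<^sup>2 + W\<^sup>2 / 2) + c * K\<^sup>2"
  proof -
    have "0 \<le> (2 * (c * m * K) - W)\<^sup>2" by simp
    then show ?thesis by (simp add: power2_diff power_mult_distrib mult_ac)
  qed
  finally have "W\<^sup>2 \<le> 4 * (c * m * K)\<^sup>2 + 2 * c * K\<^sup>2" by simp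
  also have "\<dots> \<le> 4 * (c * m * K)\<^sup>2 + 4 * c\<^sup>2 * K\<^sup>2"
  proof -
    have "c \<le> c\<^sup>2" using c by (simp add: power2_eq_square)
    then have "2 * c \<le> 4 * c\<^sup>2" using c by linarith
    then have "2 * c * K\<^sup>2 \<le> 4 * c\<^sup>2 * K\<^sup>2" by (rule mult_right_mono) simp
    then show ?thesis by simp
  qed
  also have "\<dots> = (2 * c * K * sqrt (m\<^sup>2 + 1))\<^sup>2" by (simp add: power_mult_distrib algebra_simps)
  finally have "W \<le> 2 * c * K * sqrt (m\<^sup>2 + 1)" by (rule power2_le_imp_le) (use c nn in auto)
  moreover have "gamma_const D \<nu> = 1 / sqrt (m\<^sup>2 + 1)"
  proof -
    have "D\<^sup>2 * (1 + 1 / (D\<^sup>2 * (1 - \<nu>)\<^sup>2))\<^sup>2 + 1 = m\<^sup>2 + 1"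
      by (simp add: m_def k_def power_mult_distrib power_divide)
    moreover have "(m\<^sup>2 + 1) powr (- 1 / 2) = 1 / sqrt (m\<^sup>2 + 1)"
      using powr_half_sqrt[of "m\<^sup>2 + 1"] powr_minus_divide[of "m\<^sup>2 + 1" "1 / 2"] by simp
    ultimately show ?thesis by (simp add: gamma_const_def)
  qed
  moreover have "0 < sqrt (m\<^sup>2 + 1)" by (simp add: add_nonneg_pos)
  ultimately have "gamma_const D \<nu> * W \<le> 2 * c * K" by (simp add: pos_divide_le_eq)
  then show ?thesis by (simp only: W_def c_def)
qed

lemma gamma_const_pos: "0 < gamma_const D \<nu>"
proof -
  have "0 \<le> D\<^sup>2 * (1 + 1 / (D\<^sup>2 * (1 - \<nu>)\<^sup>2))\<^sup>2" by simp
  then have "D\<^sup>2 * (1 + 1 / (D\<^sup>2 * (1 - \<nu>)\<^sup>2))\<^sup>2 + 1 \<noteq> 0" by linarith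
  then show ?thesis by (simp add: gamma_const_def)
qed

context plate_poincare
begin

definition Cfin :: real where "Cfin = 2 * (1 + 2 * (((C2\<^sup>2 + C3) * (1 + 2 * k\<kappa>)) * Cu))"

lemma Cfin_parts: "0 \<le> (C2\<^sup>2 + C3) * (1 + 2 * k\<kappa>)" "0 < Cfin"
proof -
  show 1: "0 \<le> (C2\<^sup>2 + C3) * (1 + 2 * k\<kappa>)" using C_nonneg k\<kappa>_nonneg by simp
  from mult_nonneg_nonneg[OF this Cu_nonneg] show "0 < Cfin" by (simp add: Cfin_def)
qed

abbreviation VV :: "(dvec \<times> (point \<Rightarrow> real)) set" where
  "VV \<equiv> Svec l M \<times> Poly_broken (l - 1) M"

definition mkp :: "dvec \<times> (point \<Rightarrow> real) \<Rightarrow> dofs \<times> (point \<Rightarrow> real)" where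
  "mkp p = (mkd (fst p), snd p)"

definition np :: "dvec \<times> (point \<Rightarrow> real) \<Rightarrow> real" where
  "np p = norm_pair l \<Omega> M (mkp p)"

lemma pair_space_eq: "pair_space l M = mkp ` VV"
proof
  show "mkp ` VV \<subseteq> pair_space l M" using SvecD by (auto simp: mkp_def pair_space_def)
  show "pair_space l M \<subseteq> mkp ` VV"
  proof
    fix z assume z: "z \<in> pair_space l M"
    obtain t where t: "fst z = mkd t" using mkd_surj by blast
    have "z = mkp (t, snd z)" using t by (simp add: mkp_def prod_eq_iff)
    moreover have "(t, snd z) \<in> VV" using z t by (auto simp: pair_space_def Svec_def)
    ultimately show "z \<in> mkp ` VV" by blast
  qed
qed

lemma subspace_VV: "subspace VV"
  using subspace_Times[OF subspace_Svec subspace_Poly_broken] .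

lemma findim_VV: "findim VV"
  by (rule findim_Times[OF findim_Svec[OF mesh] findim_Poly_broken])

lemma mkp_zero: "mkp 0 = (zero_dofs, \<lambda>x. 0)"
  by (simp add: mkp_def mkd_zero zero_fun_def)

lemma mkp_inject: "mkp p = mkp q \<longleftrightarrow> p = q"
  by (auto simp: mkp_def mkd_inject prod_eq_iff)

lemma np_sq:
  assumes "p \<in> VV"
  shows "np p = sqrt ((norm_Sigma l M (mkd (fst p)))\<^sup>2 + (L2_norm_on \<Omega> (snd p))\<^sup>2)" (is ?A) "0 \<le> np p"
    "L2_norm_on \<Omega> (snd p) \<le> np p" "0 \<le> L2_norm_on \<Omega> (snd p)" "0 \<le> norm_Sigma l M (mkd (fst p))"
proof -
  show e: ?A
    by (simp add: np_def norm_pair_def mkp_def)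
  show "0 \<le> np p" unfolding e by simp
  show "L2_norm_on \<Omega> (snd p) \<le> np p" unfolding e by (rule real_le_rsqrt) simp
  show "0 \<le> L2_norm_on \<Omega> (snd p)" unfolding L2_norm_on_def by (intro real_sqrt_ge_zero set_integral_ge_0) simp
  have "fst p \<in> Svec l M" using assms by auto
  from norm_Sigma_sq(2)[OF this] show "0 \<le> norm_Sigma l M (mkd (fst p))"
    by (simp add: norm_Sigma_def normsq_def power2_norm_eq_inner)
qed

lemma np_definite:
  assumes p: "p \<in> VV" and 0: "np p = 0"
  shows "p = 0"
proof -
  have s: "fst p \<in> Svec l M" and v: "snd p \<in> Poly_broken (l - 1) M" using p by auto
  have z: "(norm_Sigma l M (mkd (fst p)))\<^sup>2 = 0" "(L2_norm_on \<Omega> (snd p))\<^sup>2 = 0"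
    using 0 unfolding np_sq(1)[OF p] by (simp_all add: sum_power2_eq_zero_iff)
  have "fst p = 0" using normsq_definite[OF s] z(1) norm_Sigma_sq(1)[OF s] by simp
  moreover have "snd p = 0"
  proof
    fix x
    have sz: "(\<Sum>T\<in>elems M. (L2n T (rep (snd p) T))\<^sup>2) = 0" using z(2) unfolding broken_L2(2)[OF v] .
    show "snd p x = 0 x"
    proof (cases "x \<in> \<Union>(elems M)")
      case True
      then obtain T where T: "T \<in> elems M" "x \<in> T" by blast
      have "(L2n T (rep (snd p) T))\<^sup>2 = 0"
        using sz T(1) by (subst (asm) sum_nonneg_eq_0_iff[OF meshD(1)[OF mesh]]) auto
      then have "(LINT x:T|lebesgue. rep (snd p) T x * rep (snd p) T x) = 0" by (simp only: L2n_sq) (simp add: power2_eq_square)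
      then have "rep (snd p) T = 0"
        using inner_on_Poly[OF elem[OF T(1)], of "l - 1"] rep(1)[OF v T(1)] by (simp add: inner_on_def)
      then show ?thesis using rep(2)[OF v T(1) T(2)] by simp
    next
      case False
      then show ?thesis using broken_off[OF v] by simp
    qed
  qed
  ultimately show ?thesis by (simp add: prod_eq_iff)
qed

context
  fixes D \<nu> :: real
  assumes D: "0 < D" "0 < \<nu>" "\<nu> < 1"
begin

definition AA :: "dvec \<times> (point \<Rightarrow> real) \<Rightarrow> dvec \<times> (point \<Rightarrow> real) \<Rightarrow> real" where
  "AA p q = form_A l M D \<nu> (mkp p) (mkp q)"

lemma AA_eq: "AA p q = form_a l M D \<nu> (mkd (fst p)) (mkd (fst q)) + form_b l M (mkd (fst q)) (snd p) - form_b l M (mkd (fst p)) (snd q)"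
  by (simp add: AA_def form_A_def mkp_def)

lemmas fa = semi_innerD(3-8)[OF form_a_semi_inner[OF D]]

lemma fb:
  assumes "s \<in> Svec l M" "t \<in> Svec l M" "u \<in> Poly_broken (l - 1) M" "v \<in> Poly_broken (l - 1) M"
  shows "form_b l M (mkd (s + t)) v = form_b l M (mkd s) v + form_b l M (mkd t) v" (is ?A)
    "form_b l M (mkd (r *\<^sub>R t)) v = r * form_b l M (mkd t) v"
    "form_b l M (mkd t) (u + v) = form_b l M (mkd t) u + form_b l M (mkd t) v" (is ?C)
    "form_b l M (mkd t) (r *\<^sub>R v) = r * form_b l M (mkd t) v"
    "form_b l M (mkd t) 0 = 0" "form_b l M (mkd 0) v = 0"
proof -
  note b = form_b_bilinear[unfolded bilinear_on_def]
  show ?A ?C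
    using b assms by simp_all
  show r: "form_b l M (mkd (r *\<^sub>R t)) v = r * form_b l M (mkd t) v" "form_b l M (mkd t) (r *\<^sub>R v) = r * form_b l M (mkd t) v" for r
    using b assms by simp_all
  show "form_b l M (mkd t) 0 = 0" "form_b l M (mkd 0) v = 0" using r[of 0] by simp_all
qed

lemma fa_zero:
  assumes "s \<in> Svec l M"
  shows "form_a l M D \<nu> (mkd s) (mkd 0) = 0" "form_a l M D \<nu> (mkd 0) (mkd s) = 0"
  using fa(3)[OF assms assms, of 0] fa(4)[OF assms assms, of 0] by simp_all

lemma AA_bilinear: "bilinear_on VV VV AA"
  unfolding bilinear_on_def
proof (intro conjI ballI allI)
  fix p q z assume "p \<in> VV" "q \<in> VV" "z \<in> VV"
  then have m: "fst p \<in> Svec l M" "fst q \<in> Svec l M" "fst z \<in> Svec l M"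
    "snd p \<in> Poly_broken (l - 1) M" "snd q \<in> Poly_broken (l - 1) M" "snd z \<in> Poly_broken (l - 1) M" by auto
  show "AA (p + q) z = AA p z + AA q z"
    unfolding AA_eq fst_add snd_add fa(1)[OF m(1-3)] fb(1)[OF m(1,2,4,6)] fb(3)[OF m(1,3,4,5)] by simp
  show "AA p (q + z) = AA p q + AA p z"
    unfolding AA_eq fst_add snd_add fa(2)[OF m(1-3)] fb(1)[OF m(2,3,5,4)] fb(3)[OF m(2,1,5,6)] by simp
next
  fix r p q assume "p \<in> VV" "q \<in> VV"
  then have m: "fst p \<in> Svec l M" "fst q \<in> Svec l M" "snd p \<in> Poly_broken (l - 1) M" "snd q \<in> Poly_broken (l - 1) M" by auto
  show "AA (r *\<^sub>R p) q = r * AA p q"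
    unfolding AA_eq fst_scaleR snd_scaleR fa(3)[OF m(1,2)] fb(2)[OF m(1,1,3,4)] fb(4)[OF m(1,2,4,3)] by (simp add: algebra_simps)
  show "AA p (r *\<^sub>R q) = r * AA p q"
    unfolding AA_eq fst_scaleR snd_scaleR fa(4)[OF m(1,2)] fb(2)[OF m(1,2,4,3)] fb(4)[OF m(2,1,3,4)] by (simp add: algebra_simps)
qed

text \<open>Two test pairs suffice: w itself, for which the terms with \<open>form_b\<close> cancel,
  and the special vector built from the scalar part of w, completed by zero. A general bound K in
  place of a supremum makes the lemma usable for injectivity with K = 0 and for the a priori
  estimate with the norm of f.\<close>

lemma inf_sup_bound:
  assumes w: "w \<in> VV" and K: "0 \<le> K" "\<And>z. z \<in> VV \<Longrightarrow> AA w z \<le> K * np z"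
  shows "gamma_const D \<nu> * np w \<le> Cfin * K"
proof -
  let ?s = "fst w" and ?u = "snd w"
  have s: "?s \<in> Svec l M" and u: "?u \<in> Poly_broken (l - 1) M" using w by auto
  let ?U = "rep ?u"
  have U: "\<And>T. T \<in> elems M \<Longrightarrow> ?U T \<in> Poly (l - 1)" by (rule rep(1)[OF u])
  obtain t where t: "test_dofs ?U = mkd t" using mkd_surj by blast
  have tS: "t \<in> Svec l M" using test_dofs_Sigma[where U = ?U, OF U] t by (simp add: Svec_def)
  have t0: "(t, 0) \<in> VV" using tS subspace_0[OF subspace_Poly_broken] by simp
  have B: "form_b l M (mkd t) ?u = energy ?U"
    unfolding t[symmetric] by (rule form_b_test[where U = ?U, OF U rep(2)[OF u]])
  have nt: "(norm_Sigma l M (mkd t))\<^sup>2 \<le> (C2\<^sup>2 + C3) * (1 + 2 * k\<kappa>) * energy ?U"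
    using test_local_norm[where U = ?U, OF U] unfolding norm_Sigma_sq(1)[OF tS] normsq_def t by (simp add: power2_norm_eq_inner)
  have nu: "(L2_norm_on \<Omega> ?u)\<^sup>2 \<le> Cu * energy ?U"
    unfolding broken_L2(2)[OF u] by (rule test_L2_bound[where U = ?U, OF U])
  have nt0: "np (t, 0) = norm_Sigma l M (mkd t)"
    using np_sq(1,5)[OF t0] by (simp add: L2_norm_on_def)
  have "AA w (t, 0) \<le> K * norm_Sigma l M (mkd t)" using K(2)[OF t0] by (simp add: nt0)
  then have "form_a l M D \<nu> (mkd ?s) (mkd t) + energy ?U \<le> K * norm_Sigma l M (mkd t)"
    by (simp add: AA_eq B fb(5)[OF s s u u])
  moreover have "\<bar>form_a l M D \<nu> (mkd ?s) (mkd t)\<bar> \<le> 1 / (D * (1 - \<nu>)) * (norm_Sigma l M (mkd ?s) * norm_Sigma l M (mkd t))"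
    by (rule form_a_CS[OF D s tS])
  ultimately have Q: "energy ?U \<le> (K + 1 / (D * (1 - \<nu>)) * norm_Sigma l M (mkd ?s)) * norm_Sigma l M (mkd t)"
    by (simp add: distrib_right)
  have "1 / (D * (1 + \<nu>)) * (norm_Sigma l M (mkd ?s))\<^sup>2 \<le> K * np w"
    using form_a_bounds(1)[OF D s] K(2)[OF w] unfolding norm_Sigma_sq(1)[OF s] AA_eq by simp
  then show ?thesis
    unfolding Cfin_def np_sq(1)[OF w]
    by (intro inf_sup_algebra[OF D np_sq(5)[OF w] np_sq(4)[OF w] K(1) energy_parts(1) _ Cfin_parts(1) Cu_nonneg _ Q nt nu])
      (use np_sq(5)[OF t0] in auto)
qed

text \<open>The supremum is taken in the extended reals. Testing with w shows that it is
  nonnegative, so it is either a real number, to which \<open>inf_sup_bound\<close> applies, or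
  infinite, and then the claim holds since \<open>Cfin\<close> is positive.\<close>

lemma inf_sup:
  assumes w: "w \<in> VV"
  shows "ereal (gamma_const D \<nu> * np w) \<le> ereal Cfin * (SUP z\<in>VV - {0}. ereal (AA w z / np z))"
proof -
  let ?S = "SUP z\<in>VV - {0}. ereal (AA w z / np z)"
  have pos: "0 < np z" if "z \<in> VV - {0}" for z using np_definite np_sq(2) that by (metis DiffE insertI1 order_le_less)
  have AA0: "AA 0 z = 0" "AA z 0 = 0" if "z \<in> VV" for z
    using bilinear_on_linear[OF AA_bilinear] that linear_on'_0[OF _ subspace_VV] by blast+
  \<comment> \<open>For w = 0 some other test pair is required, as the supremum over an empty set
    would be minus infinity. The function equal to 1 on the elements is a nonzero broken polynomial
    because l - 1 is nonnegative.\<close>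
  have ne: "\<exists>z. z \<in> VV - {0}"
  proof -
    let ?v = "indicator (\<Union>(elems M)) :: point \<Rightarrow> real"
    have "?v \<in> Poly_broken (l - 1) M"
      unfolding Poly_broken_def using l2 by (auto intro!: bexI[of _ "\<lambda>x. 1"] simp: indicator_def)
    moreover have "elems M \<noteq> {}" using meshD(9)[OF mesh] Om by (auto simp: polygonal_def)
    then obtain T x where "T \<in> elems M" "x \<in> T" using elem(3) by blast
    then have "?v x \<noteq> 0 x" by (auto simp: indicator_def)
    then have "?v \<noteq> 0" by metis
    ultimately show ?thesis using subspace_0[OF subspace_Svec] by (intro exI[of _ "(0, ?v)"]) (auto simp: prod_eq_iff)
  qed
  then obtain z0 where z0: "z0 \<in> VV - {0}" by blast
  have up: "ereal (AA w z / np z) \<le> ?S" if "z \<in> VV - {0}" for z using that by (rule SUP_upper)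
  have S0: "0 \<le> ?S"
  proof (cases "w = 0")
    case True
    then show ?thesis using up[OF z0] AA0(1) z0 by (simp add: zero_ereal_def)
  next
    case False
    have "AA w w = form_a l M D \<nu> (mkd (fst w)) (mkd (fst w))" by (simp add: AA_eq)
    then have "0 \<le> AA w w" using fa(6)[of "fst w"] w by auto
    then have "0 \<le> ereal (AA w w / np w)" using np_sq(2)[OF w] by simp
    also have "\<dots> \<le> ?S" by (rule up) (use w False in auto)
    finally show ?thesis .
  qed
  show ?thesis
  proof (cases ?S)
    case (real K)
    have "AA w z \<le> K * np z" if "z \<in> VV" for z
    proof (cases "z = 0")
      case True
      then show ?thesis using AA0(2)[OF w] S0 real np_sq(2)[OF that] by simp
    next
      case False
      then have z: "z \<in> VV - {0}" using that by simp
      show ?thesis using up[OF z] pos[OF z] unfolding real by (simp add: pos_divide_le_eq)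
    qed
    then have "gamma_const D \<nu> * np w \<le> Cfin * K" using S0 real by (intro inf_sup_bound[OF w]) auto
    then show ?thesis unfolding real by simp
  next
    case PInf
    then show ?thesis using Cfin_parts(2) by simp
  next
    case MInf
    then show ?thesis using S0 by simp
  qed
qed

text \<open>Nondegeneracy in the first argument is the inf-sup bound with K = 0. Nondegeneracy in
  the second follows from it because the form is symmetric up to the sign of the scalar
  components.\<close>

lemma solution_exists:
  assumes L: "linear_on' VV L"
  shows "\<exists>!w. w \<in> VV \<and> (\<forall>z\<in>VV. AA w z = L z)"
proof (rule nondegenerate_solvable[OF subspace_VV findim_VV AA_bilinear _ _ L])
  show left: "w = 0" if w: "w \<in> VV" "\<And>z. z \<in> VV \<Longrightarrow> AA w z = 0" for w
  proof -
    have "gamma_const D \<nu> * np w \<le> Cfin * 0" using w(2) by (intro inf_sup_bound[OF w(1)]) auto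
    then have "np w \<le> 0" using gamma_const_pos[of D \<nu>] by (auto simp: mult_le_0_iff)
    then show ?thesis using np_definite[OF w(1)] np_sq(2)[OF w(1)] by simp
  qed
  show "z = 0" if z: "z \<in> VV" "\<And>w. w \<in> VV \<Longrightarrow> AA w z = 0" for z
  proof -
    have mz: "fst z \<in> Svec l M" "snd z \<in> Poly_broken (l - 1) M" using z(1) by auto
    have neg: "(-1) *\<^sub>R v \<in> Poly_broken (l - 1) M" if "v \<in> Poly_broken (l - 1) M" for v
      by (rule subspace_scale[OF subspace_Poly_broken that])
    \<comment> \<open>Changing the sign of the second components transposes the form.\<close>
    have "(fst z, (-1) *\<^sub>R snd z) = 0"
    proof (rule left)
      show "(fst z, (-1) *\<^sub>R snd z) \<in> VV" using mz neg by auto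
      fix y assume "y \<in> VV"
      then have my: "fst y \<in> Svec l M" "snd y \<in> Poly_broken (l - 1) M" by auto
      have "AA (fst z, (-1) *\<^sub>R snd z) y = AA (fst y, (-1) *\<^sub>R snd y) z"
        unfolding AA_eq fst_conv snd_conv fb(4)[OF mz(1) my(1) mz(2) mz(2)] fb(4)[OF my(1) mz(1) mz(2) my(2)]
        using fa(5)[OF mz(1) my(1)] by simp
      also have "\<dots> = 0" by (rule z(2)) (use my neg in auto)
      finally show "AA (fst z, (-1) *\<^sub>R snd z) y = 0" .
    qed
    then show ?thesis by (auto simp: prod_eq_iff)
  qed
qed

context
  fixes f :: "point \<Rightarrow> real"
  assumes f: "square_integrable \<Omega> f"
begin

definition LL :: "dvec \<times> (point \<Rightarrow> real) \<Rightarrow> real" where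
  "LL p = (LINT x:\<Omega>|lebesgue. f x * snd p x)"

lemma LL_linear: "linear_on' VV LL"
proof -
  have "linear_on' {f. square_integrable \<Omega> f} (\<lambda>v. LINT x:\<Omega>|lebesgue. f x * v x)"
    using bilinear_on_linear(2)[OF semi_innerD(2)[OF semi_inner_square_integrable[OF Omega_lebesgue]]] f by simp
  then have "linear_on' (Poly_broken (l - 1) M) (\<lambda>v. LINT x:\<Omega>|lebesgue. f x * v x)"
    by (rule linear_on'_subset) (use broken_L2(1) in blast)
  then show ?thesis unfolding linear_on'_def LL_def by auto
qed

lemma LL_bound:
  assumes "z \<in> VV"
  shows "LL z \<le> L2_norm_on \<Omega> f * np z"
proof -
  have v: "snd z \<in> Poly_broken (l - 1) M" using assms by auto
  have "\<bar>LL z\<bar> \<le> L2_norm_on \<Omega> f * L2_norm_on \<Omega> (snd z)"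
    using semi_inner_CS_abs[OF semi_inner_square_integrable[OF Omega_lebesgue], of f "snd z"] f broken_L2(1)[OF v]
    unfolding LL_def L2_norm_on_def power2_eq_square by simp
  also have "\<dots> \<le> L2_norm_on \<Omega> f * np z"
    using np_sq(3)[OF assms] by (intro mult_left_mono) (simp add: L2_norm_on_def set_integral_ge_0, simp add: L2_norm_on_def set_integral_ge_0)
  finally show ?thesis by simp
qed

lemma discrete_solution_iff:
  assumes w: "w \<in> VV"
  shows "discrete_solution l \<Omega> M D \<nu> f (mkp w) \<longleftrightarrow> (\<forall>z\<in>VV. AA w z = LL z)"
proof
  have m: "fst w \<in> Svec l M" "snd w \<in> Poly_broken (l - 1) M" using w by auto
  assume d: "discrete_solution l \<Omega> M D \<nu> f (mkp w)"
  show "\<forall>z\<in>VV. AA w z = LL z"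
  proof
    fix z assume "z \<in> VV"
    then have "mkd (fst z) \<in> Sigma_space l M" "snd z \<in> Poly_broken (l - 1) M" using SvecD by auto
    then show "AA w z = LL z" using d by (auto simp: discrete_solution_def mkp_def AA_eq LL_def)
  qed
next
  have m: "fst w \<in> Svec l M" "snd w \<in> Poly_broken (l - 1) M" using w by auto
  assume a: "\<forall>z\<in>VV. AA w z = LL z"
  have 1: "form_a l M D \<nu> (mkd (fst w)) \<tau> + form_b l M \<tau> (snd w) = 0" if \<tau>: "\<tau> \<in> Sigma_space l M" for \<tau>
  proof -
    obtain t where t: "\<tau> = mkd t" using mkd_surj by blast
    then have tS: "t \<in> Svec l M" using \<tau> by (simp add: Svec_def)
    have "(t, 0) \<in> VV" using tS subspace_0[OF subspace_Poly_broken] by simp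
    then have "AA w (t, 0) = LL (t, 0)" using a by blast
    then show ?thesis by (simp add: AA_eq LL_def t fb(5)[OF m(1) m(1) m(2) m(2)])
  qed
  have 2: "- form_b l M (mkd (fst w)) v = (LINT x:\<Omega>|lebesgue. f x * v x)" if v: "v \<in> Poly_broken (l - 1) M" for v
  proof -
    have "(0, v) \<in> VV" using v subspace_0[OF subspace_Svec] by simp
    then have "AA w (0, v) = LL (0, v)" using a by blast
    then show ?thesis by (simp add: AA_eq LL_def fb(6)[OF m(1) m(1) m(2) m(2)] fa_zero(1)[OF m(1)])
  qed
  show "discrete_solution l \<Omega> M D \<nu> f (mkp w)"
    using 1 2 by (simp add: discrete_solution_def mkp_def)
qed

lemma solution_bound:
  assumes w: "w \<in> VV" and d: "\<forall>z\<in>VV. AA w z = LL z"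
  shows "np w \<le> Cfin * (inverse (gamma_const D \<nu>) * L2_norm_on \<Omega> f)"
proof -
  have "0 \<le> L2_norm_on \<Omega> f" unfolding L2_norm_on_def by (intro real_sqrt_ge_zero set_integral_ge_0) simp
  then have "gamma_const D \<nu> * np w \<le> Cfin * L2_norm_on \<Omega> f"
    using d LL_bound by (intro inf_sup_bound[OF w]) auto
  then show ?thesis using gamma_const_pos[of D \<nu>] by (simp add: field_simps)
qed

end

end

lemma plate_main:
  assumes D: "0 < D" "0 < \<nu>" "\<nu> < 1"
  shows "(\<forall>w\<in>pair_space l M.
         ereal (gamma_const D \<nu> * norm_pair l \<Omega> M w) \<le>
         ereal Cfin * (SUP z\<in>pair_space l M - {(zero_dofs, \<lambda>x. 0)}.
                      ereal (form_A l M D \<nu> w z / norm_pair l \<Omega> M z))) \<and>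
      (\<forall>f. square_integrable \<Omega> f \<longrightarrow>
         (\<exists>!w. w \<in> pair_space l M \<and> discrete_solution l \<Omega> M D \<nu> f w) \<and>
         (\<forall>w\<in>pair_space l M. discrete_solution l \<Omega> M D \<nu> f w \<longleftrightarrow>
            (\<forall>(\<tau>, v)\<in>pair_space l M.
               form_A l M D \<nu> w (\<tau>, v) = (LINT x:\<Omega>|lebesgue. f x * v x))) \<and>
         (\<forall>w\<in>pair_space l M. discrete_solution l \<Omega> M D \<nu> f w \<longrightarrow>
            norm_pair l \<Omega> M w \<le> Cfin * (inverse (gamma_const D \<nu>) * L2_norm_on \<Omega> f)))"
proof (intro conjI allI impI)
  have inj: "inj mkp" by (rule injI) (simp only: mkp_inject)
  have im: "pair_space l M - {(zero_dofs, \<lambda>x. 0)} = mkp ` (VV - {0})"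
    unfolding pair_space_eq mkp_zero[symmetric] image_set_diff[OF inj] by simp
  have all: "(\<forall>w\<in>pair_space l M. P w) \<longleftrightarrow> (\<forall>w\<in>VV. P (mkp w))" for P
    unfolding pair_space_eq by (rule ball_simps(9))
  show "\<forall>w\<in>pair_space l M. ereal (gamma_const D \<nu> * norm_pair l \<Omega> M w) \<le>
         ereal Cfin * (SUP z\<in>pair_space l M - {(zero_dofs, \<lambda>x. 0)}.
                      ereal (form_A l M D \<nu> w z / norm_pair l \<Omega> M z))"
    unfolding all im image_image by (rule ballI) (rule inf_sup[OF D, unfolded np_def AA_def[OF D]])
next
  fix f assume f: "square_integrable \<Omega> f"
  have all: "(\<forall>w\<in>pair_space l M. P w) \<longleftrightarrow> (\<forall>w\<in>VV. P (mkp w))" for P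
    unfolding pair_space_eq by (rule ball_simps(9))
  note iff = discrete_solution_iff[OF D f]
  have LL: "AA D \<nu> w z = LL f z \<longleftrightarrow> (case mkp z of (\<tau>, v) \<Rightarrow> form_A l M D \<nu> (mkp w) (\<tau>, v) = (LINT x:\<Omega>|lebesgue. f x * v x))" for w z
    by (simp add: AA_def[OF D] LL_def[OF D f] mkp_def)
  have ex: "\<exists>!w. w \<in> VV \<and> (\<forall>z\<in>VV. AA D \<nu> w z = LL f z)"
    by (rule solution_exists[OF D LL_linear[OF D f]])
  then obtain w where w: "w \<in> VV" "\<forall>z\<in>VV. AA D \<nu> w z = LL f z" by blast
  show "\<exists>!w. w \<in> pair_space l M \<and> discrete_solution l \<Omega> M D \<nu> f w"
  proof (rule ex1I[of _ "mkp w"])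
    show "mkp w \<in> pair_space l M \<and> discrete_solution l \<Omega> M D \<nu> f (mkp w)"
      unfolding pair_space_eq iff[OF w(1)] using w by simp
    fix y assume "y \<in> pair_space l M \<and> discrete_solution l \<Omega> M D \<nu> f y"
    then obtain z where z: "z \<in> VV" "y = mkp z" "discrete_solution l \<Omega> M D \<nu> f (mkp z)"
      unfolding pair_space_eq by blast
    then have "z = w" using ex w unfolding iff[OF z(1)] by blast
    then show "y = mkp w" using z(2) by simp
  qed
  show "\<forall>w\<in>pair_space l M. discrete_solution l \<Omega> M D \<nu> f w \<longleftrightarrow>
      (\<forall>(\<tau>, v)\<in>pair_space l M. form_A l M D \<nu> w (\<tau>, v) = (LINT x:\<Omega>|lebesgue. f x * v x))"
    unfolding all by (rule ballI) (simp only: iff LL)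
  show "\<forall>w\<in>pair_space l M. discrete_solution l \<Omega> M D \<nu> f w \<longrightarrow>
      norm_pair l \<Omega> M w \<le> Cfin * (inverse (gamma_const D \<nu>) * L2_norm_on \<Omega> f)"
    unfolding all by (intro ballI impI) (simp only: iff solution_bound[OF D f, unfolded np_def])
qed

end

section \<open>Choice of the constant before the mesh\<close>

theorem lemma5:
  fixes \<Omega> :: "(real^2) set" and \<rho> :: real and l :: int
  assumes "polygonal \<Omega>" and "contractible \<Omega>"
    and "0 < \<rho>" and "\<rho> < 1"
    and "2 \<le> l"
  shows "\<exists>C>0. \<forall>M D \<nu>.
    polygonal_mesh \<Omega> M \<and> regular_mesh \<rho> \<Omega> M \<and> 0 < D \<and> 0 < \<nu> \<and> \<nu> < 1 \<longrightarrow>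
      (\<forall>w\<in>pair_space l M.
         ereal (gamma_const D \<nu> * norm_pair l \<Omega> M w) \<le>
         ereal C * (SUP z\<in>pair_space l M - {(zero_dofs, \<lambda>x. 0)}.
                      ereal (form_A l M D \<nu> w z / norm_pair l \<Omega> M z))) \<and>
      (\<forall>f. square_integrable \<Omega> f \<longrightarrow>
         (\<exists>!w. w \<in> pair_space l M \<and> discrete_solution l \<Omega> M D \<nu> f w) \<and>
         (\<forall>w\<in>pair_space l M. discrete_solution l \<Omega> M D \<nu> f w \<longleftrightarrow>
            (\<forall>(\<tau>, v)\<in>pair_space l M.
               form_A l M D \<nu> w (\<tau>, v) = (LINT x:\<Omega>|lebesgue. f x * v x))) \<and>
         (\<forall>w\<in>pair_space l M. discrete_solution l \<Omega> M D \<nu> f w \<longrightarrow>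
            norm_pair l \<Omega> M w \<le> C * (inverse (gamma_const D \<nu>) * L2_norm_on \<Omega> f)))"
proof (cases "\<exists>M. polygonal_mesh \<Omega> M \<and> regular_mesh \<rho> \<Omega> M")
  case False
  then have none: "\<not> (polygonal_mesh \<Omega> M \<and> regular_mesh \<rho> \<Omega> M \<and> X)" for M X by blast
  show ?thesis by (rule exI[of _ 1]) (simp only: none simp_thms zero_less_one)
next
  case True
  \<comment> \<open>Some regular mesh is needed to enter the locale in which \<open>Cfin\<close> is
    proved positive. The constant itself takes neither the mesh nor D and \<nu> as arguments, so it
    is the same for all meshes.\<close>
  then obtain M0 where M0: "polygonal_mesh \<Omega> M0" "regular_mesh \<rho> \<Omega> M0" by blast
  let ?\<kappa> = "\<rho>\<^sup>2 / 2" and ?N = "8 * nat \<lceil>16 / \<rho> ^ 4\<rceil>"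
  have \<kappa>: "0 < ?\<kappa>" using assms(3) by simp
  obtain C where C: "inverse_const ?\<kappa> (l + 2) C"
    using Poly_inverse_ineq[OF \<kappa>, of "l + 2"] unfolding inverse_const_def[symmetric] ..
  obtain B where B: "bubble_const l B"
    using edge_bubble_bound[of l] unfolding bubble_const_def[symmetric] ..
  obtain Ct where Ct: "tangential_const (l - 1) Ct"
    using edge_tangential_inverse[of "l - 1"] unfolding tangential_const_def[symmetric] ..
  have "bounded (closure \<Omega>)" using assms(1) by (simp add: polygonal_def bounded_closure)
  then obtain R where R: "0 < R" "\<And>x. x \<in> closure \<Omega> \<Longrightarrow> norm x \<le> R" unfolding bounded_pos by blast
  then have R': "closure \<Omega> \<subseteq> cball 0 R" by auto
  have P: "plate_poincare \<Omega> M l ?\<kappa> ?N C B R Ct" if "polygonal_mesh \<Omega> M" "regular_mesh \<rho> \<Omega> M" for M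
    by unfold_locales (use that assms \<kappa> C B R(1) R' Ct regular_mesh_shape_regular[OF assms(3,4) that] in auto)
  show ?thesis
  proof (rule exI[of _ "plate_poincare.Cfin ?\<kappa> ?N C B R Ct"], rule conjI)
    show "0 < plate_poincare.Cfin ?\<kappa> ?N C B R Ct" by (rule plate_poincare.Cfin_parts(2)[OF P[OF M0]])
  qed (intro allI, rule impI, elim conjE, rule plate_poincare.plate_main[OF P])
qed

end
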